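(* For every $n\ge1$ there exists a constant $c_n$ such that the following holds. Let $\Gamma<\mathrm{PSL}_2\mathbb{R}$ be a discrete finitely generated free group such that $S=\Gamma\backslash\mathbb{H}^2$ is a noncompact convex cocompact hyperbolic surface. Let $\underline a=(a_i)$ be disjoint transversely oriented properly embedded geodesic arcs cutting $S$ into a topological disk, and let $K$ be a fundamental domain for the action of $\Gamma$ on $\widetilde{\mathrm{Core}(S)}\subset\mathbb{H}^2$ bounded by lifts $\tilde a_i^{\pm}$ of the arcs $a_i$ and by subarcs of lifts $\beta_k$ of $\partial\,\mathrm{Core}(S)$, the $\beta_k$ being cyclically ordered, so that each lift $\tilde a_i^\pm$ intersects two consecutive geodesics $\beta_k,\beta_{k+1}$. For each $a_i$ choose a waist $p_i\in a_i$ inside $\mathrm{Core}(S)$ and an angle $\theta_i$ such that the geodesic through $p_i$ at transverse angle $\theta_i$ (the axis of $\eta_i$) stays in $\mathrm{Core}(S)$. If $\mathrm{Core}(S)$ is at least $c_n$-thin (with respect to $K$), then the higher strip deformation determined by the strip data $(\underline a,\underline p,\underline\theta)$ is a proper affine deformation of $\sigma_{4n-1}(\Gamma)$.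
   Context: Convex core. $\mathrm{Core}(S)=\Gamma\backslash C(\Lambda_\Gamma)$, where $C(\Lambda_\Gamma)=\widetilde{\mathrm{Core}(S)}$ is the convex hull in $\mathbb{H}^2$ of the limit set of $\Gamma$; $S$ is convex cocompact if $\mathrm{Core}(S)$ is compact. Thinness. Denote the endpoints of $\beta_k$ in $\partial\mathbb{H}^2\cong\mathbb{RP}^1$ by $\beta_k^-,\beta_k^+$, oriented so that $\beta_k^-<\beta_k^+<\beta_{k+1}^-$ in the cyclic order. The cross-ratio is $[z_1,z_2;z_3,z_4]:=\frac{z_3-z_1}{z_3-z_2}\cdot\frac{z_4-z_2}{z_4-z_1}$. $\mathrm{Core}(S)$ is $c$-thin if $[\beta_{k+1}^-,\beta_{k+1}^+;\beta_k^-,\beta_k^+]>c$ for all $k$ (indices taken cyclically). Representation and neutral vectors. Fix the oriented basis $(e_1,e_2)$ of $\mathbb{R}^2$ and the area form $\omega$ with $\omega(e_1,e_2)=-\omega(e_2,e_1)=1$. $\mathrm{Sym}^{4n-2}(\mathbb{R}^2)\cong\mathbb{R}^{4n-1}$ is the space of symmetric tensors in $(\mathbb{R}^2)^{\otimes(4n-2)}$; for $v_1,v_2\in\mathbb{R}^2$, $v_1^iv_2^{4n-2-i}$ is the sum of all tensors $v_{k_1}\otimes\cdots\otimes v_{k_{4n-2}}$ with exactly $i$ of the $k_j$ equal to $1$ and the rest equal to $2$. $\sigma_{4n-1}$ is the irreducible representation of $\mathrm{PSL}_2\mathbb{R}$ on this space induced by $\gamma\cdot e_1^ie_2^{4n-2-i}=(\gamma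 e_1)^i(\gamma e_2)^{4n-2-i}$. It preserves the symmetric form $B$ of signature $(2n,2n-1)$ obtained by restricting $B(v_1\otimes\cdots\otimes v_{4n-2},w_1\otimes\cdots\otimes w_{4n-2})=-\prod_i\omega(v_i,w_i)$; $\mathbb{R}^{2n,2n-1}$ is $\mathbb{R}^{4n-1}$ with this form. For $\eta\in\mathrm{PSL}_2\mathbb{R}$ loxodromic (two distinct real eigenvalues) with eigenvectors $v_1,v_2$ for the eigenvalues of larger and smaller modulus, chosen so that $(v_1,v_2)$ is positively oriented, the neutral vector is $x^0(\sigma_{4n-1}(\eta))=B(v_1^{2n-1}v_2^{2n-1},v_1^{2n-1}v_2^{2n-1})^{-1/2}\,v_1^{2n-1}v_2^{2n-1}$. Higher strip deformations. Angles $\theta_i\in[-\pi,\pi)$ are based at $p_i$ and measured from the normal to $a_i$ in the positive transverse direction. Let $a_i^j$ be the lifts of $a_i$ to $\mathbb{H}^2$, $p_i^j\in a_i^j$ the corresponding lift of $p_i$, and $\tilde{\underline a}$ the union of all lifts. Let $\eta_i^j\in\mathrm{PSL}_2\mathbb{R}$ be a loxodromic element whose axis passes through $p_i^j$, its translation direction there making angle $\theta_i$ with the positive transverse normal to $a_i^j$ (the neutral vector does not depend on the translation length); $\eta_i$ refers to any of these. Choose a basepoint $x_0\in\mathbb{H}^2\setminus\tilde{\underline a}$. For $\gamma\in\Gamma$ let $c_\gamma$ be a path from $x_0$ to $\gamma\cdot x_0$ transverse to $\tilde{\underline a}$, and for $y\in\tilde{\underline a}\cap c_\gamma$ let $y\in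 a_{i(y)}^{j(y)}$ and let $\iota_y=\pm1$ be the sign of the crossing ($+1$ if $c_\gamma$ crosses in the positive transverse direction, $-1$ otherwise). The higher strip deformation determined by $(\underline a,\underline p,\underline\theta)$ (all weights $1$) is the cocycle $$u_{(\underline a,\underline p,\underline\theta)}(\gamma)=\sum_{y\in\tilde{\underline a}\cap c_\gamma}\iota_y\,x^0\big(\sigma_{4n-1}(\eta_{i(y)}^{j(y)})\big).$$ It does not depend on $c_\gamma$, and depends on $x_0$ only up to conjugation of the affine action by a translation. It is a proper affine deformation of $\sigma_{4n-1}(\Gamma)$ if the affine action $\gamma\cdot x=\sigma_{4n-1}(\gamma)x+u_{(\underline a,\underline p,\underline\theta)}(\gamma)$ of $\Gamma$ on $\mathbb{R}^{2n,2n-1}$ is properly discontinuous.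
   Formalization: Added assumption: the axes of the η_i all cross their arcs in the positive, or all in the negative, transverse direction (all cos θ_i of one sign). With mixed signs the claim fails: generators dual to the arcs have Margulis invariants of opposite signs. *)

theory Defs
  imports "HOL-Analysis.Analysis" "HOL-Algebra.Generated_Groups"
begin

section \<open>The group $\mathrm{PSL}_2\mathbb{R}$ and its action on the hyperbolic plane\<close>

definition SL2R :: "(real^2^2) monoid" where
  "SL2R = \<lparr>carrier = {A. det A = 1}, mult = (**), one = mat 1\<rparr>"

text \<open>An element of \<open>PSL2R\<close> is a coset \<open>{A, -A}\<close>; in particular, for a set \<open>\<Gamma>\<close> of elements
  of \<open>PSL2R\<close> the preimage of \<open>\<Gamma>\<close> in \<open>SL2R\<close> is \<open>\<Union>\<Gamma>\<close>.\<close>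

definition PSL2R :: "(real^2^2) set monoid" where
  "PSL2R = SL2R Mod {mat 1, - mat 1}"

type_synonym psl = "(real^2^2) set"

definition rep :: "psl \<Rightarrow> real^2^2" where
  "rep g = (SOME A. A \<in> g)"

definition HP :: "complex set" where
  "HP = {z. Im z > 0}"

definition moebius :: "real^2^2 \<Rightarrow> complex \<Rightarrow> complex" where
  "moebius A z = (of_real (A$1$1) * z + of_real (A$1$2)) / (of_real (A$2$1) * z + of_real (A$2$2))"

definition act :: "psl \<Rightarrow> complex \<Rightarrow> complex" where
  "act g z = moebius (rep g) z"

text \<open>A discrete subgroup of \<open>PSL2R\<close> is one whose preimage in \<open>SL2R\<close> is a discrete set of
  matrices; this is discreteness for the quotient topology, since the kernel is finite.\<close>

definition discrete_subgroup :: "psl set \<Rightarrow> bool" where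
  "discrete_subgroup \<Gamma> \<longleftrightarrow> subgroup \<Gamma> PSL2R \<and> discrete (\<Union>\<Gamma>)"

text \<open>Words in the letters \<open>x\<close> (paired with \<open>True\<close>) and \<open>x\<inverse>\<close> (paired with \<open>False\<close>).\<close>

definition word_val :: "('a, 'b) monoid_scheme \<Rightarrow> ('a \<times> bool) list \<Rightarrow> 'a" where
  "word_val G w = foldr (\<lambda>(x, b) y. (if b then x else inv\<^bsub>G\<^esub> x) \<otimes>\<^bsub>G\<^esub> y) w \<one>\<^bsub>G\<^esub>"

definition reduced :: "('a \<times> bool) list \<Rightarrow> bool" where
  "reduced w \<longleftrightarrow> (\<forall>j. Suc j < length w \<longrightarrow>
     \<not> (fst (w!j) = fst (w!Suc j) \<and> snd (w!j) \<noteq> snd (w!Suc j)))"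

definition free_basis :: "('a, 'b) monoid_scheme \<Rightarrow> 'a set \<Rightarrow> bool" where
  "free_basis G X \<longleftrightarrow> X \<subseteq> carrier G \<and> generate G X = carrier G \<and>
     (\<forall>w \<in> lists (X \<times> UNIV). reduced w \<and> w \<noteq> [] \<longrightarrow> word_val G w \<noteq> \<one>\<^bsub>G\<^esub>)"

definition fg_free :: "psl set \<Rightarrow> bool" where
  "fg_free \<Gamma> \<longleftrightarrow> (\<exists>X. finite X \<and> free_basis (PSL2R\<lparr>carrier := \<Gamma>\<rparr>) X)"


section \<open>Geodesics and the boundary at infinity\<close>

text \<open>The unit speed geodesics are the images under \<open>SL2R\<close> of the upward imaginary axis.\<close>

definition geod :: "real^2^2 \<Rightarrow> real \<Rightarrow> complex" where
  "geod A t = moebius A (\<i> * of_real (exp t))"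

text \<open>$\mathbb{RP}^1 = \mathbb{R} \cup \{\infty\}$, the boundary of the upper half plane.\<close>

datatype rp1 = Fin real | Infty

fun tends_rp1 :: "('a \<Rightarrow> complex) \<Rightarrow> rp1 \<Rightarrow> 'a filter \<Rightarrow> bool" where
  "tends_rp1 f (Fin x) F = (f \<longlongrightarrow> of_real x) F"
| "tends_rp1 f Infty F = filterlim f at_infinity F"

definition geod_line :: "rp1 \<Rightarrow> rp1 \<Rightarrow> complex set" where
  "geod_line \<xi> \<eta> = (\<Union>A \<in> {A. det A = 1 \<and> tends_rp1 (geod A) \<xi> at_bot \<and> tends_rp1 (geod A) \<eta> at_top}.
     range (geod A))"

definition area :: "real^2 \<Rightarrow> real^2 \<Rightarrow> real" where
  "area v w = v$1 * w$2 - v$2 * w$1"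

fun hom_coord :: "rp1 \<Rightarrow> real^2" where
  "hom_coord (Fin x) = vector [x, 1]"
| "hom_coord Infty = vector [1, 0]"

text \<open>The cyclic order is that of increasing real numbers. For real points \<open>x\<close>, \<open>y\<close>, \<open>z\<close> the
  product below is \<open>(x - y) * (y - z) * (z - x)\<close>. Likewise
  \<open>area (hom_coord (Fin x)) (hom_coord (Fin y)) = x - y\<close>, so that \<open>cross_ratio\<close> is the usual
  formula in affine coordinates, extended to \<open>Infty\<close> by homogeneity.\<close>

definition cyc :: "rp1 \<Rightarrow> rp1 \<Rightarrow> rp1 \<Rightarrow> bool" where
  "cyc \<xi> \<eta> \<zeta> \<longleftrightarrow> area (hom_coord \<xi>) (hom_coord \<eta>) * area (hom_coord \<eta>) (hom_coord \<zeta>)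
                 * area (hom_coord \<zeta>) (hom_coord \<xi>) > 0"

definition cross_ratio :: "rp1 \<Rightarrow> rp1 \<Rightarrow> rp1 \<Rightarrow> rp1 \<Rightarrow> real" where
  "cross_ratio z1 z2 z3 z4 =
     area (hom_coord z3) (hom_coord z1) / area (hom_coord z3) (hom_coord z2) *
     (area (hom_coord z4) (hom_coord z2) / area (hom_coord z4) (hom_coord z1))"

definition hyp_convex :: "complex set \<Rightarrow> bool" where
  "hyp_convex X \<longleftrightarrow> X \<subseteq> HP \<and>
     (\<forall>A r s t. det A = 1 \<and> r \<le> s \<and> s \<le> t \<and> geod A r \<in> X \<and> geod A t \<in> X \<longrightarrow> geod A s \<in> X)"


section \<open>The surface and its convex core\<close>

definition proj :: "psl set \<Rightarrow> complex \<Rightarrow> complex set" where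
  "proj \<Gamma> z = (\<lambda>g. act g z) ` \<Gamma>"

text \<open>The surface $\Gamma\backslash\mathbb{H}^2$, as the set of orbits with the quotient topology.\<close>

definition surface :: "psl set \<Rightarrow> complex set topology" where
  "surface \<Gamma> = topology (\<lambda>U. U \<subseteq> proj \<Gamma> ` HP \<and> open {z \<in> HP. proj \<Gamma> z \<in> U})"

lemma openin_surface:
  "openin (surface \<Gamma>) U \<longleftrightarrow> U \<subseteq> proj \<Gamma> ` HP \<and> open {z \<in> HP. proj \<Gamma> z \<in> U}"
proof -
  have "istopology (\<lambda>U. U \<subseteq> proj \<Gamma> ` HP \<and> open {z \<in> HP. proj \<Gamma> z \<in> U})" (is "istopology ?P")
    unfolding istopology_def
  proof (intro conjI allI impI)
    fix S T assume P: "?P S" "?P T"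
    have "open ({z \<in> HP. proj \<Gamma> z \<in> S} \<inter> {z \<in> HP. proj \<Gamma> z \<in> T})"
      by (rule open_Int) (use P in auto)
    also have "{z \<in> HP. proj \<Gamma> z \<in> S} \<inter> {z \<in> HP. proj \<Gamma> z \<in> T} = {z \<in> HP. proj \<Gamma> z \<in> S \<inter> T}"
      by auto
    finally show "open {z \<in> HP. proj \<Gamma> z \<in> S \<inter> T}" .
    show "S \<inter> T \<subseteq> proj \<Gamma> ` HP"
      using P(1) by auto
  next
    fix \<K> assume P: "\<forall>K\<in>\<K>. ?P K"
    have "open (\<Union>K\<in>\<K>. {z \<in> HP. proj \<Gamma> z \<in> K})"
      by (rule open_UN) (use P in auto)
    also have "(\<Union>K\<in>\<K>. {z \<in> HP. proj \<Gamma> z \<in> K}) = {z \<in> HP. proj \<Gamma> z \<in> \<Union>\<K>}"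
      by auto
    finally show "open {z \<in> HP. proj \<Gamma> z \<in> \<Union>\<K>}" .
    show "\<Union>\<K> \<subseteq> proj \<Gamma> ` HP"
      using P by auto
  qed
  then show ?thesis
    unfolding surface_def by (simp add: topology_inverse')
qed

definition limit_set :: "psl set \<Rightarrow> rp1 set" where
  "limit_set \<Gamma> = {\<xi>. \<exists>z\<in>HP. \<exists>g :: nat \<Rightarrow> psl. range g \<subseteq> \<Gamma> \<and> tends_rp1 (\<lambda>k. act (g k) z) \<xi> sequentially}"

definition core_cover :: "psl set \<Rightarrow> complex set" where
  "core_cover \<Gamma> = hyp_convex hull (\<Union>\<xi>\<in>limit_set \<Gamma>. \<Union>\<eta>\<in>limit_set \<Gamma>. geod_line \<xi> \<eta>)"

definition Core :: "psl set \<Rightarrow> complex set set" where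
  "Core \<Gamma> = proj \<Gamma> ` core_cover \<Gamma>"

definition convex_cocompact :: "psl set \<Rightarrow> bool" where
  "convex_cocompact \<Gamma> \<longleftrightarrow> compactin (surface \<Gamma>) (Core \<Gamma>)"


section \<open>Arc systems\<close>

text \<open>An arc \<open>a i\<close> is given by a unit speed parametrization \<open>proj \<Gamma> \<circ> geod (a i)\<close>. As the surface
  is oriented, the direction in which the arc is traversed amounts to a transverse orientation;
  the positive transverse direction is taken to be on the right of the arc.\<close>

definition pos_normal :: "(real \<Rightarrow> complex) \<Rightarrow> real \<Rightarrow> complex" where
  "pos_normal \<alpha> t = - \<i> * vector_derivative \<alpha> (at t)"

definition lift_curve :: "(nat \<Rightarrow> real^2^2) \<Rightarrow> nat \<Rightarrow> psl \<Rightarrow> real \<Rightarrow> complex" where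
  "lift_curve a i g t = act g (geod (a i) t)"

definition all_lifts :: "psl set \<Rightarrow> nat \<Rightarrow> (nat \<Rightarrow> real^2^2) \<Rightarrow> complex set" where
  "all_lifts \<Gamma> m a = (\<Union>i<m. \<Union>g\<in>\<Gamma>. range (lift_curve a i g))"

definition arc_image :: "psl set \<Rightarrow> (nat \<Rightarrow> real^2^2) \<Rightarrow> nat \<Rightarrow> complex set set" where
  "arc_image \<Gamma> a i = proj \<Gamma> ` range (geod (a i))"

definition cutting_arcs :: "psl set \<Rightarrow> nat \<Rightarrow> (nat \<Rightarrow> real^2^2) \<Rightarrow> bool" where
  "cutting_arcs \<Gamma> m a \<longleftrightarrow>
     (\<forall>i<m. det (a i) = 1 \<and>
        embedding_map euclideanreal (surface \<Gamma>) (\<lambda>t. proj \<Gamma> (geod (a i) t)) \<and>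
        proper_map euclideanreal (surface \<Gamma>) (\<lambda>t. proj \<Gamma> (geod (a i) t))) \<and>
     (\<forall>i<m. \<forall>j<m. i \<noteq> j \<longrightarrow> arc_image \<Gamma> a i \<inter> arc_image \<Gamma> a j = {}) \<and>
     subtopology (surface \<Gamma>) (topspace (surface \<Gamma>) - (\<Union>i<m. arc_image \<Gamma> a i))
       homeomorphic_space top_of_set (ball (0::complex) 1)"


section \<open>Fundamental domains and thinness\<close>

definition fundamental_domain :: "psl set \<Rightarrow> complex set \<Rightarrow> complex set \<Rightarrow> bool" where
  "fundamental_domain \<Gamma> X K \<longleftrightarrow> K \<subseteq> X \<and> closedin (top_of_set HP) K \<and> (\<Union>g\<in>\<Gamma>. act g ` K) = X \<and>
     (\<forall>g\<in>\<Gamma>. g \<noteq> \<one>\<^bsub>PSL2R\<^esub> \<longrightarrow> interior K \<inter> act g ` interior K = {})"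

text \<open>The endpoints of \<open>\<beta>\<^sub>0, \<beta>\<^sub>1, \<dots>\<close> enumerated as
  $\beta_0^-, \beta_0^+, \beta_1^-, \beta_1^+, \dots$\<close>

definition endpoint :: "(nat \<Rightarrow> rp1) \<Rightarrow> (nat \<Rightarrow> rp1) \<Rightarrow> nat \<Rightarrow> rp1" where
  "endpoint bm bp j = (if even j then bm (j div 2) else bp (j div 2))"

definition cyclically_ordered :: "nat \<Rightarrow> (nat \<Rightarrow> rp1) \<Rightarrow> (nat \<Rightarrow> rp1) \<Rightarrow> bool" where
  "cyclically_ordered N bm bp \<longleftrightarrow>
     (\<forall>i j k. i < j \<and> j < k \<and> k < 2 * N \<longrightarrow>
        cyc (endpoint bm bp i) (endpoint bm bp j) (endpoint bm bp k))"

text \<open>\<open>K\<close> is bounded by lifts \<open>L i True\<close>, \<open>L i False\<close> of the arcs \<open>a i\<close> and by subarcs of the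
  geodesics \<open>\<beta>\<^sub>k\<close> from \<open>bm k\<close> to \<open>bp k\<close>, for \<open>k < N\<close>. The lifts of the boundary components of the
  core are the connected components of the boundary of \<open>core_cover \<Gamma>\<close> in the hyperbolic plane.\<close>

definition core_domain ::
  "psl set \<Rightarrow> nat \<Rightarrow> (nat \<Rightarrow> real^2^2) \<Rightarrow> complex set \<Rightarrow> nat \<Rightarrow> (nat \<Rightarrow> rp1) \<Rightarrow> (nat \<Rightarrow> rp1) \<Rightarrow> bool"
where
  "core_domain \<Gamma> m a K N bm bp \<longleftrightarrow>
     fundamental_domain \<Gamma> (core_cover \<Gamma>) K \<and>
     (\<forall>k<N. geod_line (bm k) (bp k) \<in> components (HP \<inter> frontier (core_cover \<Gamma>)) \<and>
        (\<exists>B s t. det B = 1 \<and> s < t \<and> geod_line (bm k) (bp k) \<inter> K = geod B ` {s..t})) \<and>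
     cyclically_ordered N bm bp \<and>
     (\<exists>L :: nat \<Rightarrow> bool \<Rightarrow> complex set.
        (\<forall>i<m. L i True \<noteq> L i False \<and>
           (\<forall>e. (\<exists>g\<in>\<Gamma>. L i e = range (lift_curve a i g)) \<and>
              (\<exists>k<N. L i e \<inter> geod_line (bm k) (bp k) \<noteq> {} \<and>
                 L i e \<inter> geod_line (bm (Suc k mod N)) (bp (Suc k mod N)) \<noteq> {}))) \<and>
        frontier K = (\<Union>i<m. \<Union>e. L i e \<inter> K) \<union> (\<Union>k<N. geod_line (bm k) (bp k) \<inter> K))"

definition thin :: "real \<Rightarrow> nat \<Rightarrow> (nat \<Rightarrow> rp1) \<Rightarrow> (nat \<Rightarrow> rp1) \<Rightarrow> bool" where
  "thin c N bm bp \<longleftrightarrow>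
     (\<forall>k<N. cross_ratio (bm (Suc k mod N)) (bp (Suc k mod N)) (bm k) (bp k) > c)"


section \<open>Symmetric tensors and neutral vectors\<close>

text \<open>A tensor of degree \<open>d\<close> over $\mathbb{R}^2$ is given by its coordinates in the basis
  $e_{k_1} \otimes \cdots \otimes e_{k_d}$, indexed by the words \<open>[k\<^sub>1, \<dots>, k\<^sub>d]\<close>. It is represented
  by a function on all lists that vanishes outside \<open>idx d\<close>; the product topology on such
  functions is the usual one. The indices are the elements \<open>1\<close> and \<open>2\<close> of the type \<open>2\<close>.\<close>

type_synonym tensor = "2 list \<Rightarrow> real"

definition idx :: "nat \<Rightarrow> 2 list set" where
  "idx d = {k. length k = d}"

definition sym_tensors :: "nat \<Rightarrow> tensor set" where
  "sym_tensors d = {T. (\<forall>k. length k \<noteq> d \<longrightarrow> T k = 0) \<and> (\<forall>k l. mset k = mset l \<longrightarrow> T k = T l)}"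

definition pure_tensor :: "(real^2) list \<Rightarrow> tensor" where
  "pure_tensor vs k = (if length k = length vs then \<Prod>j<length vs. (vs!j) $ (k!j) else 0)"

text \<open>\<open>sym_mono d v\<^sub>1 v\<^sub>2 i\<close> is $v_1^i v_2^{d-i}$, without normalizing factor.\<close>

definition sym_mono :: "nat \<Rightarrow> real^2 \<Rightarrow> real^2 \<Rightarrow> nat \<Rightarrow> tensor" where
  "sym_mono d v1 v2 i l =
     (\<Sum>k \<in> {k \<in> idx d. count_list k 1 = i}. pure_tensor (map (\<lambda>j. if j = 1 then v1 else v2) k) l)"

definition sigma_mat :: "nat \<Rightarrow> real^2^2 \<Rightarrow> tensor \<Rightarrow> tensor" where
  "sigma_mat d A T k =
     (if length k = d then \<Sum>l\<in>idx d. (\<Prod>j<d. A $ (k!j) $ (l!j)) * T l else 0)"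

text \<open>The action of \<open>PSL2R\<close> on tensors of even degree \<open>d\<close>; the representation
  $\sigma_{4n-1}$ is its restriction to \<open>sym_tensors d\<close> for \<open>d = 4 * n - 2\<close>.\<close>

definition sigma :: "nat \<Rightarrow> psl \<Rightarrow> tensor \<Rightarrow> tensor" where
  "sigma d g T = sigma_mat d (rep g) T"

definition Bform :: "nat \<Rightarrow> tensor \<Rightarrow> tensor \<Rightarrow> real" where
  "Bform d T U =
     - (\<Sum>k\<in>idx d. \<Sum>l\<in>idx d. (\<Prod>j<d. area (axis (k!j) 1) (axis (l!j) 1)) * T k * U l)"

definition loxodromic :: "psl \<Rightarrow> bool" where
  "loxodromic g \<longleftrightarrow> (\<exists>\<kappa> \<mu> v w. \<kappa> \<noteq> \<mu> \<and> v \<noteq> 0 \<and> w \<noteq> 0 \<and>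
     rep g *v v = \<kappa> *\<^sub>R v \<and> rep g *v w = \<mu> *\<^sub>R w)"

definition eigen_frame :: "psl \<Rightarrow> real^2 \<Rightarrow> real^2 \<Rightarrow> bool" where
  "eigen_frame g v1 v2 \<longleftrightarrow> (\<exists>\<kappa> \<mu>. \<bar>\<kappa>\<bar> > \<bar>\<mu>\<bar> \<and>
     rep g *v v1 = \<kappa> *\<^sub>R v1 \<and> rep g *v v2 = \<mu> *\<^sub>R v2) \<and> area v1 v2 > 0"

definition neutral :: "nat \<Rightarrow> psl \<Rightarrow> tensor" where
  "neutral n g = (let (v1, v2) = (SOME (v1, v2). eigen_frame g v1 v2);
                      w = sym_mono (4*n - 2) v1 v2 (2*n - 1)
                  in (\<lambda>k. Bform (4*n - 2) w w powr (- 1/2) * w k))"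


section \<open>Higher strip deformations\<close>

text \<open>The geodesic \<open>geod B\<close> passes at time \<open>t\<close> through the point \<open>\<alpha> s\<close> of the curve \<open>\<alpha>\<close>, its
  direction there making angle \<open>\<theta>\<close> with the positive transverse normal to \<open>\<alpha>\<close>.\<close>

definition at_angle :: "(real \<Rightarrow> complex) \<Rightarrow> real \<Rightarrow> real \<Rightarrow> real^2^2 \<Rightarrow> real \<Rightarrow> bool" where
  "at_angle \<alpha> s \<theta> B t \<longleftrightarrow> det B = 1 \<and> geod B t = \<alpha> s \<and>
     (\<exists>r>0. vector_derivative (geod B) (at t) = of_real r * cis \<theta> * pos_normal \<alpha> s)"

definition translates_along :: "psl \<Rightarrow> real^2^2 \<Rightarrow> bool" where
  "translates_along g B \<longleftrightarrow> (\<exists>l>0. \<forall>t. act g (geod B t) = geod B (t + l))"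

definition strip_element :: "(real \<Rightarrow> complex) \<Rightarrow> real \<Rightarrow> real \<Rightarrow> psl \<Rightarrow> bool" where
  "strip_element \<alpha> s \<theta> \<eta> \<longleftrightarrow> \<eta> \<in> carrier PSL2R \<and> loxodromic \<eta> \<and>
     (\<exists>B t. at_angle \<alpha> s \<theta> B t \<and> translates_along \<eta> B)"

text \<open>Strip data on the arcs \<open>a i\<close>: the waist \<open>p\<^sub>i\<close> is the point of parameter \<open>s i\<close> on \<open>a i\<close>, so
  that its lifts are the points \<open>lift_curve a i g (s i)\<close>.\<close>

definition strip_data ::
  "psl set \<Rightarrow> nat \<Rightarrow> (nat \<Rightarrow> real^2^2) \<Rightarrow> (nat \<Rightarrow> real) \<Rightarrow> (nat \<Rightarrow> real) \<Rightarrow> bool"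
where
  "strip_data \<Gamma> m a s \<theta> \<longleftrightarrow>
     (\<forall>i<m. \<theta> i \<in> {-pi..<pi} \<and> proj \<Gamma> (geod (a i) (s i)) \<in> Core \<Gamma> \<and>
        (\<forall>B t. at_angle (geod (a i)) (s i) (\<theta> i) B t \<longrightarrow> proj \<Gamma> ` range (geod B) \<subseteq> Core \<Gamma>))"

text \<open>The axes of the \<open>\<eta>\<^sub>i\<close> all cross their arcs in the positive, or all in the negative, transverse
  direction. Turning one axis around (\<open>\<theta>\<^sub>i + \<pi>\<close> in place of \<open>\<theta>\<^sub>i\<close>) changes the sign of its neutral
  vector; with mixed signs some strips are inserted and others removed, and the deformation has
  Margulis invariants of both signs.\<close>

definition coherent_angles :: "nat \<Rightarrow> (nat \<Rightarrow> real) \<Rightarrow> bool" where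
  "coherent_angles m \<theta> \<longleftrightarrow> (\<forall>i<m. cos (\<theta> i) > 0) \<or> (\<forall>i<m. cos (\<theta> i) < 0)"

text \<open>A crossing is recorded by the time \<open>t\<close> along the path \<open>c\<close>, the arc \<open>a i\<close>, the element \<open>g\<close>
  describing the lift and the parameter \<open>r\<close> of the crossing point on it. For arcs as above \<open>i\<close>,
  \<open>g\<close> and \<open>r\<close> are determined by \<open>t\<close>.\<close>

definition crossings ::
  "psl set \<Rightarrow> nat \<Rightarrow> (nat \<Rightarrow> real^2^2) \<Rightarrow> (real \<Rightarrow> complex) \<Rightarrow> (real \<times> nat \<times> psl \<times> real) set"
where
  "crossings \<Gamma> m a c =
     {(t, i, g, r). t \<in> {0..1} \<and> i < m \<and> g \<in> \<Gamma> \<and> c t = lift_curve a i g r}"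

definition transverse_path ::
  "psl set \<Rightarrow> nat \<Rightarrow> (nat \<Rightarrow> real^2^2) \<Rightarrow> complex \<Rightarrow> complex \<Rightarrow> (real \<Rightarrow> complex) \<Rightarrow> bool"
where
  "transverse_path \<Gamma> m a x y c \<longleftrightarrow>
     path c \<and> path_image c \<subseteq> HP \<and> pathstart c = x \<and> pathfinish c = y \<and>
     (\<forall>(t, i, g, r) \<in> crossings \<Gamma> m a c. c differentiable (at t) \<and>
        pos_normal (lift_curve a i g) r \<bullet> vector_derivative c (at t) \<noteq> 0)"

definition crossing_sign :: "(real \<Rightarrow> complex) \<Rightarrow> (real \<Rightarrow> complex) \<Rightarrow> real \<Rightarrow> real \<Rightarrow> real" where
  "crossing_sign c \<alpha> t r = sgn (pos_normal \<alpha> r \<bullet> vector_derivative c (at t))"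

definition strip_sum ::
  "nat \<Rightarrow> psl set \<Rightarrow> nat \<Rightarrow> (nat \<Rightarrow> real^2^2) \<Rightarrow> (nat \<Rightarrow> real) \<Rightarrow> (nat \<Rightarrow> real) \<Rightarrow> (real \<Rightarrow> complex) \<Rightarrow> tensor"
where
  "strip_sum n \<Gamma> m a s \<theta> c = (\<lambda>k. \<Sum>(t, i, g, r) \<in> crossings \<Gamma> m a c.
     crossing_sign c (lift_curve a i g) t r *
     neutral n (SOME \<eta>. strip_element (lift_curve a i g) (s i) (\<theta> i) \<eta>) k)"

text \<open>\<open>u\<close> is the higher strip deformation for some choice of the basepoint \<open>x\<close> and of the paths.\<close>

definition higher_strip_deformation ::
  "nat \<Rightarrow> psl set \<Rightarrow> nat \<Rightarrow> (nat \<Rightarrow> real^2^2) \<Rightarrow> (nat \<Rightarrow> real) \<Rightarrow> (nat \<Rightarrow> real) \<Rightarrow> (psl \<Rightarrow> tensor) \<Rightarrow> bool"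
where
  "higher_strip_deformation n \<Gamma> m a s \<theta> u \<longleftrightarrow>
     (\<exists>x \<in> HP - all_lifts \<Gamma> m a. \<exists>c.
        \<forall>g\<in>\<Gamma>. transverse_path \<Gamma> m a x (act g x) (c g) \<and> u g = strip_sum n \<Gamma> m a s \<theta> (c g))"

definition affine_act :: "nat \<Rightarrow> (psl \<Rightarrow> tensor) \<Rightarrow> psl \<Rightarrow> tensor \<Rightarrow> tensor" where
  "affine_act n u g x = (\<lambda>k. sigma (4*n - 2) g x k + u g k)"

definition proper_affine_deformation :: "nat \<Rightarrow> psl set \<Rightarrow> (psl \<Rightarrow> tensor) \<Rightarrow> bool" where
  "proper_affine_deformation n \<Gamma> u \<longleftrightarrow>
     (\<forall>g\<in>\<Gamma>. u g \<in> sym_tensors (4*n - 2)) \<and>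
     (\<forall>g\<in>\<Gamma>. \<forall>h\<in>\<Gamma>. u (g \<otimes>\<^bsub>PSL2R\<^esub> h) = affine_act n u g (u h)) \<and>
     (\<forall>C. compact C \<and> C \<subseteq> sym_tensors (4*n - 2) \<longrightarrow> finite {g\<in>\<Gamma>. affine_act n u g ` C \<inter> C \<noteq> {}})"

end

theory Submission
  imports Defs
begin

text \<open>Let \<open>L\<close> run through the lifts separating the basepoint \<open>x\<close> from \<open>\<gamma> x\<close>. Along a path every other lift is
  crossed with total sign zero, so \<open>u(\<gamma>)\<close> is the signed sum of the neutral vectors of the axes
  \<open>\<eta>\<^sub>L\<close>. Take a suitable endpoint \<open>v\<close> of the axis at the first and \<open>w\<close> of the axis at the last of these lifts:
  every \<open>L\<close> then separates \<open>v\<close> from \<open>w\<close>. Pair tensors via \<open>\<omega>\<close> with the one that has \<open>2n - 1\<close> factors \<open>v\<close> and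
  \<open>2n - 1\<close> factors \<open>w\<close>, and divide by \<open>\<bar>\<omega>(v, w)\<bar>\<close> to the power \<open>2n - 1\<close>. If \<open>y\<close> and \<open>z\<close> are the endpoints
  of \<open>\<eta>\<^sub>L\<close> on the sides of \<open>v\<close> and \<open>w\<close>, this functional is a polynomial in \<open>p = \<omega>(v, y) \<omega>(w, z)\<close> and
  \<open>q = \<omega>(v, z) \<omega>(w, y)\<close> at the neutral vector of \<open>\<eta>\<^sub>L\<close>, with \<open>p\<close> and \<open>q\<close> interchanged for the opposite labelling
  of the endpoints. All four points are endpoints of geodesics of the convex core crossing \<open>L\<close>, so
  \<open>c\<close>-thinness makes one of \<open>p\<close>, \<open>q\<close> at least \<open>c - 1\<close> times the other; its power \<open>2n - 1\<close> dominates, and as the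
  angles are coherent every summand contributes at least a fixed amount with the same sign.

  The functional and its translate by \<open>\<gamma>\<close> are bounded on compact sets, because the first and the last
  lift, the latter moved back by \<open>\<gamma>\<^sup>-\<^sup>1\<close>, lie in a finite set independent of \<open>\<gamma>\<close>. So a \<open>\<gamma>\<close> that moves a
  compact set onto a set meeting it has a bounded number of separating lifts. Only finitely many \<open>\<gamma>\<close>
  do: as the cut surface is a disk, \<open>\<Gamma>\<close> acts freely and transitively on the complementary regions,
  and each region has finitely many neighbours up to translation.\<close>

section \<open>Two by two matrices and the group $\mathrm{PSL}_2\mathbb{R}$\<close>

text \<open>The functional has to vary with \<gamma>: a summand has a controlled sign only on pairs
  of points lying on opposite sides of its lift, and \<open>v\<close>, \<open>w\<close> are placed
  so that this holds for all summands at once. Dividing by a power of \<bar>\<omega>(v, w)\<bar>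
  removes the scale of both vectors, and it is the right size: for an axis with \<bar>\<omega>(y,
  z)\<bar> = 1 the identity \<open>p - q = \<omega>(v, w) \<omega>(y, z)\<close> shows that the
  dominant one of \<open>p\<close>, \<open>q\<close> is at least half of \<bar>\<omega>(v, w)\<bar>.
  The constant is 1 + 2 * 4^(2n - 1). There are 4^(2n - 1) words of length 4n - 2; every
  contributing word but one contains a factor of the smaller product, and the ratio 2 * 4^(2n - 1)
  keeps their sum at most half of the dominant power. The summand 1 is the difference between a
  cross ratio and the ratio of the two products. As the exponent 2n - 1 is odd, the dominant power
  keeps the sign of its base. The position of a point or of an end relative to a geodesic is always
  the sign of a quadratic polynomial, so convexity, crossings and thinness reduce to real
  algebra.\<close>

lemma mat2_eq_iff:
  "(A :: 'a^2^2) = B \<longleftrightarrow> A$1$1 = B$1$1 \<and> A$1$2 = B$1$2 \<and> A$2$1 = B$2$1 \<and> A$2$2 = B$2$2"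
  by (auto simp: vec_eq_iff forall_2)

lemma vec2_eq_iff: "(v :: 'a^2) = w \<longleftrightarrow> v$1 = w$1 \<and> v$2 = w$2"
  by (auto simp: vec_eq_iff forall_2)

lemma mat2_mult_nth [simp]:
  fixes A B :: "real^2^2"
  shows "(A ** B) $ i $ j = A$i$1 * B$1$j + A$i$2 * B$2$j"
  by (simp add: matrix_matrix_mult_def sum_2)

lemma mat2_vec_nth [simp]:
  fixes A :: "real^2^2"
  shows "(A *v v) $ i = A$i$1 * v$1 + A$i$2 * v$2"
  by (simp add: matrix_vector_mult_def sum_2)

lemma mat2_one_nth [simp]:
  "(mat 1 :: real^2^2)$1$1 = 1" "(mat 1 :: real^2^2)$1$2 = 0"
  "(mat 1 :: real^2^2)$2$1 = 0" "(mat 1 :: real^2^2)$2$2 = 1"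
  by (simp_all add: mat_def)

lemma mat2_uminus_mult [simp]:
  fixes A B :: "real^2^2"
  shows "(- A) ** B = - (A ** B)" "A ** (- B) = - (A ** B)"
  by (simp_all add: mat2_eq_iff algebra_simps)

lemma det_2_uminus [simp]: "det (- A :: real^2^2) = det A"
  by (simp add: det_2)

definition mk2 :: "real \<Rightarrow> real \<Rightarrow> real \<Rightarrow> real \<Rightarrow> real^2^2" where
  "mk2 a b c d = vector [vector [a, b], vector [c, d]]"

lemma mk2_nth [simp]:
  "mk2 a b c d $ 1 $ 1 = a" "mk2 a b c d $ 1 $ 2 = b"
  "mk2 a b c d $ 2 $ 1 = c" "mk2 a b c d $ 2 $ 2 = d"
  by (simp_all add: mk2_def)

lemma det_mk2 [simp]: "det (mk2 a b c d) = a * d - b * c"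
  by (simp add: det_2)

definition inv2 :: "real^2^2 \<Rightarrow> real^2^2" where
  "inv2 A = mk2 (A$2$2) (- A$1$2) (- A$2$1) (A$1$1)"

lemma inv2_nth [simp]:
  "inv2 A $ 1 $ 1 = A$2$2" "inv2 A $ 1 $ 2 = - A$1$2"
  "inv2 A $ 2 $ 1 = - A$2$1" "inv2 A $ 2 $ 2 = A$1$1"
  by (simp_all add: inv2_def)

lemma det_inv2 [simp]: "det (inv2 A) = det A"
  by (simp add: det_2 algebra_simps)

lemma inv2_mult: "det A = 1 \<Longrightarrow> inv2 A ** A = mat 1" "det A = 1 \<Longrightarrow> A ** inv2 A = mat 1"
  by (simp_all add: mat2_eq_iff det_2 algebra_simps)

lemma mat2_mult_assoc: "(A ** B) ** C = A ** (B ** (C :: real^2^2))"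
  by (simp add: matrix_mul_assoc)

lemma inv2_cancel_left [simp]: "det A = 1 \<Longrightarrow> inv2 A ** (A ** B) = B" "det A = 1 \<Longrightarrow> A ** (inv2 A ** B) = B"
  by (simp_all add: matrix_mul_assoc inv2_mult)

lemma inv2_vec_cancel [simp]:
  "det A = 1 \<Longrightarrow> inv2 A *v (A *v v) = v" "det A = 1 \<Longrightarrow> A *v (inv2 A *v v) = v"
  by (simp_all add: matrix_vector_mul_assoc inv2_mult)

lemma inv2_mult_distrib: "inv2 (A ** B) = inv2 B ** inv2 A"
  by (simp add: mat2_eq_iff algebra_simps)

lemma det_mult_one [simp]: "det A = 1 \<Longrightarrow> det B = 1 \<Longrightarrow> det (A ** B :: real^2^2) = 1"
  by (simp add: det_mul)

lemma SL2R_simps [simp]: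
  "carrier SL2R = {A. det A = 1}" "mult SL2R = (**)" "one SL2R = mat 1"
  by (simp_all add: SL2R_def)

lemma group_SL2R: "group SL2R"
proof (rule groupI)
  show "\<And>x. x \<in> carrier SL2R \<Longrightarrow> \<exists>y\<in>carrier SL2R. y \<otimes>\<^bsub>SL2R\<^esub> x = \<one>\<^bsub>SL2R\<^esub>"
    using inv2_mult(1) by (auto intro!: exI[of _ "inv2 _"])
qed (auto simp: matrix_mul_assoc)

lemma normal_pm_one: "{mat 1, - mat 1} \<lhd> SL2R"
proof -
  interpret group SL2R by (rule group_SL2R)
  have sub: "subgroup {mat 1, - mat 1} SL2R"
  proof (rule subgroupI)
    fix a assume "a \<in> {mat 1, - mat 1 :: real^2^2}"
    then show "inv\<^bsub>SL2R\<^esub> a \<in> {mat 1, - mat 1}"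
      using inv_equality[of a a] by auto
  qed auto
  show ?thesis
    by (rule normal_invI[OF sub])
      (auto simp: r_inv[simplified] inv_closed[simplified])
qed

lemma group_PSL2R: "group PSL2R"
  unfolding PSL2R_def using normal.factorgroup_is_group[OF normal_pm_one] .

lemma PSL2R_one [simp]: "\<one>\<^bsub>PSL2R\<^esub> = {mat 1, - mat 1}"
  by (simp add: PSL2R_def FactGroup_def)

lemma in_PSL2R_iff: "g \<in> carrier PSL2R \<longleftrightarrow> (\<exists>A. det A = 1 \<and> g = {A, - A})"
  unfolding PSL2R_def FactGroup_def RCOSETS_def r_coset_def by auto

lemma PSL2R_mult: "{A, - A} \<otimes>\<^bsub>PSL2R\<^esub> {B, - B} = {A ** B, - (A ** B)}"
  unfolding PSL2R_def FactGroup_def set_mult_def by auto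

section \<open>Matrix representatives, determined up to sign\<close>

lemma rep_in: "g \<in> carrier PSL2R \<Longrightarrow> rep g \<in> g"
  unfolding rep_def in_PSL2R_iff by (rule someI_ex) auto

lemma rep_eq: "g \<in> carrier PSL2R \<Longrightarrow> g = {rep g, - rep g}"
  using rep_in[of g] unfolding in_PSL2R_iff by auto

lemma rep_pair: "det A = 1 \<Longrightarrow> rep {A, - A} = A \<or> rep {A, - A} = - A"
  using rep_in[of "{A, - A}"] in_PSL2R_iff by auto

lemma det_rep [simp]: "g \<in> carrier PSL2R \<Longrightarrow> det (rep g) = 1"
  using rep_in[of g] unfolding in_PSL2R_iff by auto

text \<open>\<open>rep\<close> rests on a choice and is multiplicative only up to sign. The sign is
  harmless, because \<open>moebius\<close>, \<open>side\<close>, \<open>bside\<close> and the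
  neutral vectors are even in the matrix.\<close>

lemma rep_mult:
  assumes "g \<in> carrier PSL2R" "h \<in> carrier PSL2R"
  shows "rep (g \<otimes>\<^bsub>PSL2R\<^esub> h) = rep g ** rep h \<or> rep (g \<otimes>\<^bsub>PSL2R\<^esub> h) = - (rep g ** rep h)"
  using rep_pair[of "rep g ** rep h"] PSL2R_mult[of "rep g" "rep h"]
    rep_eq[OF assms(1)] rep_eq[OF assms(2)] assms by simp

lemma rep_inv:
  assumes "g \<in> carrier PSL2R"
  shows "rep (inv\<^bsub>PSL2R\<^esub> g) = inv2 (rep g) \<or> rep (inv\<^bsub>PSL2R\<^esub> g) = - inv2 (rep g)"
proof -
  interpret group PSL2R by (rule group_PSL2R)
  have "{inv2 (rep g), - inv2 (rep g)} \<otimes>\<^bsub>PSL2R\<^esub> {rep g, - rep g} = {mat 1, - mat 1}"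
    unfolding PSL2R_mult using assms by (simp add: inv2_mult)
  moreover have "{inv2 (rep g), - inv2 (rep g)} \<in> carrier PSL2R"
    unfolding in_PSL2R_iff using assms by (intro exI[of _ "inv2 (rep g)"]) simp
  ultimately have "inv\<^bsub>PSL2R\<^esub> g = {inv2 (rep g), - inv2 (rep g)}"
    using assms inv_equality[of _ g] unfolding rep_eq[OF assms, symmetric] by simp
  then show ?thesis using rep_pair[of "inv2 (rep g)"] assms by simp
qed

section \<open>The action on the upper half plane\<close>

lemma moebius_uminus [simp]: "moebius (- A) z = moebius A z"
proof -
  have "moebius (- A) z = (- (of_real (A$1$1) * z + of_real (A$1$2))) / (- (of_real (A$2$1) * z + of_real (A$2$2)))"
    by (simp add: moebius_def)
  also have "\<dots> = moebius A z"
    unfolding minus_divide_divide by (simp add: moebius_def)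
  finally show ?thesis .
qed

lemma moebius_one [simp]: "moebius (mat 1) z = z"
  by (simp add: moebius_def)

lemma moebius_denom_nz:
  fixes A :: "real^2^2"
  assumes "det A = 1" "z \<in> HP"
  shows "of_real (A$2$1) * z + of_real (A$2$2) \<noteq> (0 :: complex)"
proof
  assume *: "of_real (A$2$1) * z + of_real (A$2$2) = (0 :: complex)"
  then have "Im (of_real (A$2$1) * z + of_real (A$2$2)) = 0" by simp
  then have "A$2$1 = 0" using assms(2) by (auto simp: HP_def)
  with * have "A$2$2 = 0" by simp
  with \<open>A$2$1 = 0\<close> assms(1) show False by (simp add: det_2)
qed

text \<open>The reciprocal of the conformal factor of \<open>moebius A\<close> at \<open>z\<close>.
  Multiplying by it clears the denominators from the real part, the imaginary part and the squared
  modulus of the image.\<close>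

definition jac :: "real^2^2 \<Rightarrow> complex \<Rightarrow> real" where
  "jac A z = (cmod (of_real (A$2$1) * z + of_real (A$2$2)))\<^sup>2"

lemma jac_alt: "jac A z = (A$2$1 * Re z + A$2$2)\<^sup>2 + (A$2$1 * Im z)\<^sup>2"
  by (simp add: jac_def cmod_power2)

lemma jac_pos: "det A = 1 \<Longrightarrow> z \<in> HP \<Longrightarrow> jac A z > 0"
  using moebius_denom_nz by (simp add: jac_def)

lemma moebius_jac:
  "moebius A z = ((of_real (A$1$1) * z + of_real (A$1$2)) * cnj (of_real (A$2$1) * z + of_real (A$2$2))) /
     of_real (jac A z)"
  unfolding moebius_def jac_def by (rule complex_div_cnj)

text \<open>Together with \<open>cmod_moebius_jac\<close>: up to the positive factor
  \<open>jac\<close>, the triple (|z|^2, Re z, 1) transforms by the symmetric square of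
  \<open>A\<close>, so signs of linear forms in this triple behave equivariantly.\<close>

lemma Re_moebius_jac:
  assumes "det A = 1" "z \<in> HP"
  shows "Re (moebius A z) * jac A z =
    A$1$1 * A$2$1 * (cmod z)\<^sup>2 + (A$1$1 * A$2$2 + A$1$2 * A$2$1) * Re z + A$1$2 * A$2$2"
proof -
  have "Re (moebius A z) * jac A z =
      Re ((of_real (A$1$1) * z + of_real (A$1$2)) * cnj (of_real (A$2$1) * z + of_real (A$2$2)))"
    using jac_pos[OF assms] unfolding moebius_jac by simp
  also have "\<dots> = A$1$1 * A$2$1 * (cmod z)\<^sup>2 + (A$1$1 * A$2$2 + A$1$2 * A$2$1) * Re z + A$1$2 * A$2$2"
    unfolding cmod_power2 by (simp add: algebra_simps power2_eq_square)
  finally show ?thesis .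
qed

lemma Im_moebius_jac:
  assumes "det A = 1" "z \<in> HP"
  shows "Im (moebius A z) * jac A z = Im z"
proof -
  have "Im (moebius A z) * jac A z =
      Im ((of_real (A$1$1) * z + of_real (A$1$2)) * cnj (of_real (A$2$1) * z + of_real (A$2$2)))"
    using jac_pos[OF assms] unfolding moebius_jac by simp
  also have "\<dots> = (A$1$1 * A$2$2 - A$1$2 * A$2$1) * Im z"
    by (simp add: algebra_simps)
  finally show ?thesis using assms(1) by (simp add: det_2)
qed

lemma cmod_moebius_jac:
  assumes "det A = 1" "z \<in> HP"
  shows "(cmod (moebius A z))\<^sup>2 * jac A z =
    (A$1$1)\<^sup>2 * (cmod z)\<^sup>2 + 2 * A$1$1 * A$1$2 * Re z + (A$1$2)\<^sup>2"
proof -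
  have "(cmod (moebius A z))\<^sup>2 * jac A z = (cmod (of_real (A$1$1) * z + of_real (A$1$2)))\<^sup>2"
    using jac_pos[OF assms] unfolding moebius_def jac_def
    by (simp add: norm_divide power_divide)
  also have "\<dots> = (A$1$1)\<^sup>2 * (cmod z)\<^sup>2 + 2 * A$1$1 * A$1$2 * Re z + (A$1$2)\<^sup>2"
    unfolding cmod_power2 by (simp add: algebra_simps power2_eq_square)
  finally show ?thesis .
qed

lemma moebius_in_HP:
  assumes "det A = 1" "z \<in> HP"
  shows "moebius A z \<in> HP"
proof -
  have "Im (moebius A z) * jac A z > 0"
    using Im_moebius_jac[OF assms] assms(2) by (simp add: HP_def)
  then show ?thesis using jac_pos[OF assms] by (simp add: HP_def zero_less_mult_iff)
qed

lemma moebius_mult: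
  assumes "det A = 1" "det B = 1" "z \<in> HP"
  shows "moebius (A ** B) z = moebius A (moebius B z)"
proof -
  define p where "p = of_real (B$1$1) * z + of_real (B$1$2)"
  define q where "q = of_real (B$2$1) * z + of_real (B$2$2)"
  have q: "q \<noteq> 0" unfolding q_def by (rule moebius_denom_nz[OF assms(2,3)])
  have 1: "moebius B z = p / q" by (simp add: moebius_def p_def q_def)
  have "moebius (A ** B) z = (of_real (A$1$1) * p + of_real (A$1$2) * q) / (of_real (A$2$1) * p + of_real (A$2$2) * q)"
    by (simp add: moebius_def p_def q_def algebra_simps)
  also have "\<dots> = ((of_real (A$1$1) * p + of_real (A$1$2) * q) / q) / ((of_real (A$2$1) * p + of_real (A$2$2) * q) / q)"
    using q by simp
  also have "\<dots> = moebius A (p / q)"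
    using q by (simp add: moebius_def add_divide_distrib)
  finally show ?thesis by (simp add: 1)
qed

lemma moebius_inv2 [simp]:
  assumes "det A = 1" "z \<in> HP"
  shows "moebius (inv2 A) (moebius A z) = z" "moebius A (moebius (inv2 A) z) = z"
  using moebius_mult[of "inv2 A" A z] moebius_mult[of A "inv2 A" z] assms by (simp_all add: inv2_mult)

lemma act_in_HP [simp]: "g \<in> carrier PSL2R \<Longrightarrow> z \<in> HP \<Longrightarrow> act g z \<in> HP"
  unfolding act_def by (rule moebius_in_HP) auto

lemma act_one [simp]: "act {mat 1, - mat 1} z = z"
  unfolding act_def using rep_pair[of "mat 1"] by auto

lemma act_mult:
  assumes "g \<in> carrier PSL2R" "h \<in> carrier PSL2R" "z \<in> HP"
  shows "act (g \<otimes>\<^bsub>PSL2R\<^esub> h) z = act g (act h z)"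
  unfolding act_def using rep_mult[OF assms(1,2)] moebius_mult[of "rep g" "rep h" z] assms by auto

lemma act_inv:
  assumes "g \<in> carrier PSL2R" "z \<in> HP"
  shows "act (inv\<^bsub>PSL2R\<^esub> g) (act g z) = z" "act g (act (inv\<^bsub>PSL2R\<^esub> g) z) = z"
proof -
  interpret group PSL2R by (rule group_PSL2R)
  show "act (inv\<^bsub>PSL2R\<^esub> g) (act g z) = z" "act g (act (inv\<^bsub>PSL2R\<^esub> g) z) = z"
    using act_mult[of "inv\<^bsub>PSL2R\<^esub> g" g z] act_mult[of g "inv\<^bsub>PSL2R\<^esub> g" z] assms by (auto simp: l_inv r_inv)
qed

lemma open_HP: "open HP"
  unfolding HP_def using open_halfspace_Im_gt by blast

lemma continuous_on_moebius: "det A = 1 \<Longrightarrow> continuous_on HP (moebius A)"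
  unfolding moebius_def by (intro continuous_intros) (use moebius_denom_nz in auto)

lemma continuous_on_act: "g \<in> carrier PSL2R \<Longrightarrow> continuous_on HP (act g)"
  unfolding act_def[abs_def] by (rule continuous_on_moebius) auto

lemma open_act_image:
  assumes "g \<in> carrier PSL2R" "open U" "U \<subseteq> HP"
  shows "open (act g ` U)"
proof -
  interpret group PSL2R by (rule group_PSL2R)
  have "act g ` U = HP \<inter> act (inv\<^bsub>PSL2R\<^esub> g) -` U"
  proof (intro subset_antisym subsetI)
    fix z assume "z \<in> HP \<inter> act (inv\<^bsub>PSL2R\<^esub> g) -` U"
    then show "z \<in> act g ` U" using act_inv(2)[OF assms(1), of z] by (metis Int_iff image_eqI vimageD)
  next
    fix z assume "z \<in> act g ` U"
    then obtain w where w: "w \<in> U" "z = act g w" by blast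
    then show "z \<in> HP \<inter> act (inv\<^bsub>PSL2R\<^esub> g) -` U"
      using assms(3) act_inv(1)[OF assms(1), of w] act_in_HP[OF assms(1), of w] by force
  qed
  moreover have "open (HP \<inter> act (inv\<^bsub>PSL2R\<^esub> g) -` U)"
    using continuous_on_act[of "inv\<^bsub>PSL2R\<^esub> g"] assms open_HP
    by (intro continuous_open_preimage) auto
  ultimately show ?thesis by simp
qed

section \<open>Geodesics as images of the imaginary axis\<close>

lemma iexp_in_HP [simp]: "\<i> * of_real (exp t) \<in> HP"
  by (simp add: HP_def)

lemma geod_in_HP [simp]: "det A = 1 \<Longrightarrow> geod A t \<in> HP"
  unfolding geod_def by (rule moebius_in_HP) auto

lemma moebius_geod: "det A = 1 \<Longrightarrow> det B = 1 \<Longrightarrow> moebius A (geod B t) = geod (A ** B) t"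
  unfolding geod_def by (rule moebius_mult[symmetric]) auto

lemma geod_uminus [simp]: "geod (- A) t = geod A t"
  by (simp add: geod_def)

lemma act_geod: "g \<in> carrier PSL2R \<Longrightarrow> det B = 1 \<Longrightarrow> act g (geod B t) = geod (rep g ** B) t"
  unfolding act_def by (rule moebius_geod) auto

lemma moebius_inj:
  assumes "det A = 1" "z \<in> HP" "w \<in> HP" "moebius A z = moebius A w"
  shows "z = w"
  using moebius_inv2(1)[OF assms(1,2)] moebius_inv2(1)[OF assms(1,3)] assms(4) by metis

lemma geod_inj: "det A = 1 \<Longrightarrow> geod A s = geod A t \<Longrightarrow> s = t"
  unfolding geod_def using moebius_inj[of A "\<i> * of_real (exp s)" "\<i> * of_real (exp t)"]
  by (auto simp: complex_eq_iff)

section \<open>Sides of a geodesic\<close>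

text \<open>Both functions are the value at \<open>(|z|\<^sup>2, Re z, 1)\<close>, respectively \<open>(v\<^sub>1\<^sup>2, v\<^sub>1 v\<^sub>2, v\<^sub>2\<^sup>2)\<close>, of one linear
  form on the symmetric square of the plane. Points of the plane or of its boundary lie on the
  right of \<open>geod A\<close>, which runs from \<open>A e\<^sub>2\<close> to \<open>A e\<^sub>1\<close>, when the value is positive.\<close>

definition side :: "real^2^2 \<Rightarrow> complex \<Rightarrow> real" where
  "side A z = - (A$2$1 * A$2$2) * (cmod z)\<^sup>2 + (A$1$1 * A$2$2 + A$1$2 * A$2$1) * Re z - A$1$1 * A$1$2"

definition bside :: "real^2^2 \<Rightarrow> real^2 \<Rightarrow> real" where
  "bside A v = area v (column 2 A) * area (column 1 A) v"

lemma column_nth [simp]: "column j A $ i = A $ i $ j"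
  by (simp add: column_def)

lemma column_mult:
  fixes A B :: "real^2^2"
  shows "column j (A ** B) = A *v column j B"
  by (simp add: vec2_eq_iff)

lemma side_uminus [simp]: "side (- A) z = side A z"
  by (simp add: side_def)

lemma bside_uminus [simp]: "bside (- A) z = bside A z"
  by (simp add: bside_def area_def algebra_simps)

lemma bside_scaleR: "bside A (c *\<^sub>R v) = c\<^sup>2 * bside A v"
  by (simp add: bside_def area_def algebra_simps power2_eq_square)

lemma area_mult: "area (A *v v) (A *v w) = det A * area v w"
  by (simp add: area_def det_2 algebra_simps)

lemma bside_mult: "det B = 1 \<Longrightarrow> bside (B ** A) (B *v v) = bside A v"
  by (simp add: bside_def column_mult area_mult)

text \<open>Moving \<open>geod A\<close> to the imaginary axis turns its right side into the part
  with positive real part.\<close>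

lemma side_eq_Re:
  assumes "det A = 1" "z \<in> HP"
  shows "side A z = Re (moebius (inv2 A) z) * jac (inv2 A) z"
  using assms by (subst Re_moebius_jac) (auto simp: side_def algebra_simps)

lemma jac_mult:
  assumes "det A = 1" "det B = 1" "z \<in> HP"
  shows "jac (A ** B) z = jac A (moebius B z) * jac B z"
proof -
  define p where "p = of_real (B$1$1) * z + of_real (B$1$2)"
  define q where "q = of_real (B$2$1) * z + of_real (B$2$2)"
  have q: "q \<noteq> 0" unfolding q_def by (rule moebius_denom_nz[OF assms(2,3)])
  have 1: "moebius B z = p / q" by (simp add: moebius_def p_def q_def)
  have "of_real ((A ** B)$2$1) * z + of_real ((A ** B)$2$2) = (of_real (A$2$1) * (p/q) + of_real (A$2$2)) * q"
  proof -
    have "of_real ((A ** B)$2$1) * z + of_real ((A ** B)$2$2) = of_real (A$2$1) * p + of_real (A$2$2) * q"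
      by (simp add: p_def q_def algebra_simps)
    also have "\<dots> = (of_real (A$2$1) * (p/q) + of_real (A$2$2)) * q"
      using q by (simp add: distrib_right)
    finally show ?thesis .
  qed
  then show ?thesis unfolding jac_def 1 by (simp add: norm_mult power_mult_distrib q_def)
qed

lemma side_mult:
  assumes "det A = 1" "det B = 1" "z \<in> HP"
  shows "side (B ** A) (moebius B z) * jac B z = side A z"
proof -
  have z: "moebius B z \<in> HP" using assms moebius_in_HP by blast
  have 1: "moebius (inv2 (B ** A)) (moebius B z) = moebius (inv2 A) z"
    using assms z by (simp add: inv2_mult_distrib moebius_mult)
  have "jac (inv2 (B ** A)) (moebius B z) * jac B z = jac (inv2 A) z"
    using assms z jac_mult[of "inv2 (B ** A)" B z]
    by (simp add: inv2_mult_distrib mat2_mult_assoc inv2_mult)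
  then show ?thesis
    using side_eq_Re[of "B ** A" "moebius B z"] side_eq_Re[of A z] assms z 1
    by (simp add: mult.assoc)
qed

lemma sgn_side_act:
  assumes "g \<in> carrier PSL2R" "det A = 1" "z \<in> HP"
  shows "sgn (side (rep g ** A) (act g z)) = sgn (side A z)"
proof -
  have "sgn (side A z) = sgn (side (rep g ** A) (act g z)) * sgn (jac (rep g) z)"
    using side_mult[of A "rep g" z] assms by (simp add: act_def flip: sgn_mult)
  then show ?thesis using jac_pos[of "rep g" z] assms by simp
qed

text \<open>On \<open>geod B\<close> the triple (|z|^2, Re z, 1) is, up to a positive factor, e^(2t)
  times the square of the first column plus the square of the second. So a side function that does
  not vanish at both ends has at most one zero along the geodesic, and its signs are governed by
  those at the ends.\<close>

lemma side_geod:
  assumes "det B = 1"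
  shows "side A (geod B t) * ((B$2$1)\<^sup>2 * exp (2*t) + (B$2$2)\<^sup>2) =
    exp (2*t) * bside A (column 1 B) + bside A (column 2 B)"
proof -
  let ?z = "\<i> * complex_of_real (exp t)"
  have j: "jac B ?z = (B$2$1)\<^sup>2 * exp (2*t) + (B$2$2)\<^sup>2"
    by (simp add: jac_alt power_mult_distrib exp_double)
  have e: "(cmod ?z)\<^sup>2 = exp (2*t)" by (simp add: norm_mult exp_double)
  have "side A (geod B t) * jac B ?z = - (A$2$1 * A$2$2) * ((cmod (moebius B ?z))\<^sup>2 * jac B ?z)
     + (A$1$1 * A$2$2 + A$1$2 * A$2$1) * (Re (moebius B ?z) * jac B ?z) - A$1$1 * A$1$2 * jac B ?z"
    by (simp add: side_def geod_def algebra_simps)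
  also have "\<dots> = exp (2*t) * bside A (column 1 B) + bside A (column 2 B)"
    unfolding cmod_moebius_jac[OF assms iexp_in_HP] Re_moebius_jac[OF assms iexp_in_HP]
    unfolding j e
    by (simp add: bside_def area_def algebra_simps power2_eq_square)
  finally show ?thesis by (simp add: j)
qed

lemma side_geod_pos:
  assumes "det B = 1"
  obtains r where "r > 0" "side A (geod B t) = r * (exp (2*t) * bside A (column 1 B) + bside A (column 2 B))"
proof -
  define j where "j = (B$2$1)\<^sup>2 * exp (2*t) + (B$2$2)\<^sup>2"
  have "j = jac B (\<i> * complex_of_real (exp t))"
    by (simp add: j_def jac_alt power_mult_distrib exp_double)
  then have "j > 0" using jac_pos[OF assms] by simp
  then show ?thesis using that[of "1/j"] side_geod[OF assms, of A t]
    by (simp add: j_def field_simps)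
qed

lemma side_eq_0_iff:
  assumes "det A = 1" "z \<in> HP"
  shows "side A z = 0 \<longleftrightarrow> z \<in> range (geod A)"
proof
  assume "side A z = 0"
  moreover have w: "moebius (inv2 A) z \<in> HP" using assms by (simp add: moebius_in_HP)
  ultimately have "Re (moebius (inv2 A) z) = 0"
    using side_eq_Re[OF assms] jac_pos[of "inv2 A" z] assms by auto
  then have "moebius (inv2 A) z = \<i> * of_real (exp (ln (Im (moebius (inv2 A) z))))"
    using w by (simp add: complex_eq_iff HP_def)
  then have "z = geod A (ln (Im (moebius (inv2 A) z)))"
    unfolding geod_def using assms moebius_inv2(2) by metis
  then show "z \<in> range (geod A)" by blast
next
  assume "z \<in> range (geod A)"
  then obtain t where "z = geod A t" by blast
  moreover obtain r where "side A (geod A t) = r * (exp (2*t) * bside A (column 1 A) + bside A (column 2 A))"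
    using side_geod_pos[OF assms(1)] by metis
  ultimately show "side A z = 0" by (simp add: bside_def area_def)
qed

lemma side_geod_self [simp]: "det A = 1 \<Longrightarrow> side A (geod A t) = 0"
  using side_eq_0_iff[of A "geod A t"] by auto

lemma continuous_on_side [continuous_intros]:
  "continuous_on S f \<Longrightarrow> continuous_on S (\<lambda>x. side A (f x))"
  unfolding side_def by (intro continuous_intros)

section \<open>Free groups are torsion free\<close>

context group
begin

lemma word_val_Nil [simp]: "word_val G [] = \<one>"
  by (simp add: word_val_def)

lemma word_val_Cons: "word_val G (p # w) = (if snd p then fst p else inv (fst p)) \<otimes> word_val G w"
  by (simp add: word_val_def case_prod_beta)

lemma word_val_closed [simp]:
  "X \<subseteq> carrier G \<Longrightarrow> w \<in> lists (X \<times> UNIV) \<Longrightarrow> word_val G w \<in> carrier G"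
  by (induction w) (auto simp: word_val_Cons)

lemma word_val_append:
  assumes "X \<subseteq> carrier G" "u \<in> lists (X \<times> UNIV)" "w \<in> lists (X \<times> UNIV)"
  shows "word_val G (u @ w) = word_val G u \<otimes> word_val G w"
  using assms(2)
proof (induction u)
  case Nil
  then show ?case using assms by simp
next
  case (Cons p u)
  moreover have "fst p \<in> carrier G" using Cons assms(1) by auto
  ultimately show ?case using assms by (auto simp: word_val_Cons m_assoc)
qed

lemma generate_word:
  assumes "X \<subseteq> carrier G" "x \<in> generate G X"
  shows "\<exists>w \<in> lists (X \<times> UNIV). word_val G w = x"
  using assms(2)
proof induction
  case one
  show ?case by (rule bexI[of _ "[]"]) auto
next
  case (incl h)
  then show ?case using assms(1) by (intro bexI[of _ "[(h, True)]"]) (auto simp: word_val_Cons)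
next
  case (inv h)
  then show ?case using assms(1) by (intro bexI[of _ "[(h, False)]"]) (auto simp: word_val_Cons)
next
  case (eng h1 h2)
  then obtain w1 w2 where "w1 \<in> lists (X \<times> UNIV)" "word_val G w1 = h1"
    "w2 \<in> lists (X \<times> UNIV)" "word_val G w2 = h2" by blast
  then show ?case using assms(1) by (intro bexI[of _ "w1 @ w2"]) (auto simp: word_val_append)
qed

lemma letter_cancel:
  assumes "fst p \<in> carrier G" "fst p = fst q" "snd p \<noteq> snd q"
  shows "(if snd p then fst p else inv (fst p)) \<otimes> (if snd q then fst q else inv (fst q)) = \<one>"
  using assms by auto

end

lemma reduced_iff_successively:
  "reduced w \<longleftrightarrow> successively (\<lambda>p q. \<not> (fst p = fst q \<and> snd p \<noteq> snd q)) w"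
  by (auto simp: reduced_def successively_conv_nth)

lemma reduced_concat_replicate:
  assumes "reduced w" "w \<noteq> []" "\<not> (fst (last w) = fst (hd w) \<and> snd (last w) \<noteq> snd (hd w))"
  shows "reduced (concat (replicate k w)) \<and> (k > 0 \<longrightarrow> hd (concat (replicate k w)) = hd w)"
  using assms by (induction k) (auto simp: reduced_iff_successively successively_append_iff)

text \<open>A shortest word among those representing a conjugate of \<open>x\<close> is cyclically reduced, so its
  powers are reduced.\<close>

lemma free_basis_torsion_free:
  assumes "group G" and X: "free_basis G X" and x: "x \<in> carrier G" "x \<noteq> \<one>\<^bsub>G\<^esub>" and k: "k > (0::nat)"
  shows "x [^]\<^bsub>G\<^esub> k \<noteq> \<one>\<^bsub>G\<^esub>"
proof -
  interpret group G by fact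
  have XG: "X \<subseteq> carrier G" and gen: "generate G X = carrier G"
    and free: "\<And>w. w \<in> lists (X \<times> UNIV) \<Longrightarrow> reduced w \<Longrightarrow> w \<noteq> [] \<Longrightarrow> word_val G w \<noteq> \<one>\<^bsub>G\<^esub>"
    using X unfolding free_basis_def by auto
  define P where "P w \<longleftrightarrow> w \<in> lists (X \<times> UNIV) \<and> (\<exists>y\<in>carrier G. word_val G w = y \<otimes>\<^bsub>G\<^esub> x \<otimes>\<^bsub>G\<^esub> inv\<^bsub>G\<^esub> y)" for w
  obtain w0 where "w0 \<in> lists (X \<times> UNIV)" "word_val G w0 = x"
    using generate_word[OF XG, of x] gen x by auto
  then have "P w0" unfolding P_def using x by (intro conjI bexI[of _ "\<one>\<^bsub>G\<^esub>"]) auto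
  then obtain w where w: "P w" and least: "\<And>u. P u \<Longrightarrow> length w \<le> length u"
    using ex_has_least_nat[of P w0 length] by auto
  then obtain y where wX: "w \<in> lists (X \<times> UNIV)" and y: "y \<in> carrier G" "word_val G w = y \<otimes>\<^bsub>G\<^esub> x \<otimes>\<^bsub>G\<^esub> inv\<^bsub>G\<^esub> y"
    unfolding P_def by auto
  have nz: "word_val G w \<noteq> \<one>\<^bsub>G\<^esub>"
  proof
    assume "word_val G w = \<one>\<^bsub>G\<^esub>"
    then have "y \<otimes>\<^bsub>G\<^esub> x = y" using y x by (metis inv_equality inv_inv m_closed inv_closed)
    then show False using y x by simp
  qed
  then have ne: "w \<noteq> []" by auto
  \<comment> \<open>Deleting a cancelling pair would give a shorter word with the same
    value.\<close>
  have red: "reduced w"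
  proof (rule ccontr)
    assume "\<not> reduced w"
    then obtain j where j: "Suc j < length w" "fst (w!j) = fst (w!Suc j)" "snd (w!j) \<noteq> snd (w!Suc j)"
      unfolding reduced_def by auto
    let ?u = "take j w" and ?v = "drop (Suc (Suc j)) w"
    have "w = ?u @ (w!j) # (w!Suc j) # ?v"
      using j(1) by (simp add: Cons_nth_drop_Suc)
    moreover have uv: "?u \<in> lists (X \<times> UNIV)" "?v \<in> lists (X \<times> UNIV)"
      using wX by (auto dest: in_set_takeD in_set_dropD)
    moreover have c: "fst (w!j) \<in> carrier G" "fst (w!Suc j) \<in> carrier G"
      "w!j \<in> X \<times> UNIV" "w!Suc j \<in> X \<times> UNIV"
    proof -
      show "w!j \<in> X \<times> UNIV" "w!Suc j \<in> X \<times> UNIV"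
        using wX j(1) nth_mem[of j w] nth_mem[of "Suc j" w] unfolding in_lists_conv_set by (meson Suc_lessD)+
      then show "fst (w!j) \<in> carrier G" "fst (w!Suc j) \<in> carrier G" using XG by auto
    qed
    ultimately have "word_val G w = word_val G ?u \<otimes>\<^bsub>G\<^esub> word_val G ((w!j) # (w!Suc j) # ?v)"
      using word_val_append[OF XG, of ?u "(w!j) # (w!Suc j) # ?v"] by simp
    also have "word_val G ((w!j) # (w!Suc j) # ?v) = word_val G ?v"
      unfolding word_val_Cons using letter_cancel[OF c(1) j(2,3)] c word_val_closed[OF XG uv(2)]
      by (subst m_assoc[symmetric]) auto
    finally have "word_val G (?u @ ?v) = word_val G w"
      using word_val_append[OF XG uv] by simp
    then have "P (?u @ ?v)" using w uv unfolding P_def by auto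
    from least[OF this] j(1) show False by simp
  qed
  \<comment> \<open>If the last letter inverted the first, conjugating by the last letter would
    remove both and give a shorter word for a conjugate of \<open>x\<close>.\<close>
  have cyc: "\<not> (fst (last w) = fst (hd w) \<and> snd (last w) \<noteq> snd (hd w))"
  proof
    assume *: "fst (last w) = fst (hd w) \<and> snd (last w) \<noteq> snd (hd w)"
    define p q where "p = hd w" and "q = last w"
    have "tl w \<noteq> []" using * ne by (cases w) auto
    then have wu: "w = p # butlast (tl w) @ [q]"
      using ne unfolding p_def q_def by (cases w) auto
    define u where "u = butlast (tl w)"
    have uX: "u \<in> lists (X \<times> UNIV)" and pq: "p \<in> X \<times> UNIV" "q \<in> X \<times> UNIV"
      using wX wu unfolding u_def by (metis append_in_lists_conv Cons_in_lists_iff)+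
    define a b where "a = (if snd p then fst p else inv\<^bsub>G\<^esub> (fst p))" and "b = (if snd q then fst q else inv\<^bsub>G\<^esub> (fst q))"
    have ab: "a \<in> carrier G" "b \<in> carrier G" "b \<otimes>\<^bsub>G\<^esub> a = \<one>\<^bsub>G\<^esub>"
      using pq XG letter_cancel[of q p] * unfolding a_def b_def p_def q_def by auto
    then have a: "a = inv\<^bsub>G\<^esub> b" by (metis inv_equality inv_inv)
    have "word_val G w = a \<otimes>\<^bsub>G\<^esub> (word_val G u \<otimes>\<^bsub>G\<^esub> b)"
    proof -
      have "word_val G w = word_val G (p # u @ [q])" using wu u_def by metis
      also have "\<dots> = a \<otimes>\<^bsub>G\<^esub> (word_val G u \<otimes>\<^bsub>G\<^esub> word_val G [q])"
        using word_val_append[OF XG uX, of "[q]"] pq by (simp add: word_val_Cons a_def)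
      also have "word_val G [q] = b" using ab by (simp add: word_val_Cons b_def)
      finally show ?thesis .
    qed
    then have "b \<otimes>\<^bsub>G\<^esub> word_val G w \<otimes>\<^bsub>G\<^esub> inv\<^bsub>G\<^esub> b = word_val G u"
      using ab uX word_val_closed[OF XG uX] unfolding a by (simp add: m_assoc r_inv flip: m_assoc[of b "inv\<^bsub>G\<^esub> b"])
    then have "word_val G u = (b \<otimes>\<^bsub>G\<^esub> y) \<otimes>\<^bsub>G\<^esub> x \<otimes>\<^bsub>G\<^esub> inv\<^bsub>G\<^esub> (b \<otimes>\<^bsub>G\<^esub> y)"
      using y x ab by (simp add: m_assoc inv_mult_group)
    then have "P u" unfolding P_def using uX y ab by (meson m_closed)
    from least[OF this] wu show False unfolding u_def by (metis Suc_n_not_le_n length_Cons length_append_singleton le_SucI)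
  qed
  have "word_val G (concat (replicate j w)) = y \<otimes>\<^bsub>G\<^esub> x [^]\<^bsub>G\<^esub> j \<otimes>\<^bsub>G\<^esub> inv\<^bsub>G\<^esub> y \<and>
      concat (replicate j w) \<in> lists (X \<times> UNIV)" for j
  proof (induction j)
    case (Suc j)
    have "word_val G (concat (replicate (Suc j) w)) = word_val G w \<otimes>\<^bsub>G\<^esub> word_val G (concat (replicate j w))"
      using word_val_append[OF XG wX, of "concat (replicate j w)"] Suc by simp
    also have "\<dots> = y \<otimes>\<^bsub>G\<^esub> (x \<otimes>\<^bsub>G\<^esub> x [^]\<^bsub>G\<^esub> j) \<otimes>\<^bsub>G\<^esub> inv\<^bsub>G\<^esub> y"
      using Suc y x by (simp add: m_assoc inv_solve_left')
    finally show ?case using Suc wX nat_pow_Suc2[OF x(1), of j] by auto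
  qed (use y in auto)
  from this[of k] have "y \<otimes>\<^bsub>G\<^esub> x [^]\<^bsub>G\<^esub> k \<otimes>\<^bsub>G\<^esub> inv\<^bsub>G\<^esub> y \<noteq> \<one>\<^bsub>G\<^esub>"
    using free[of "concat (replicate k w)"] reduced_concat_replicate[OF red ne cyc, of k] ne k
    by (metis concat_eq_Nil_conv in_set_replicate neq0_conv)
  then show ?thesis using y by auto
qed

section \<open>Discrete subgroups\<close>

lemma inv2_mult_continuous: "continuous_on UNIV (\<lambda>(A, B). inv2 A ** (B :: real^2^2))"
proof -
  have "(\<lambda>(A, B). inv2 A ** (B :: real^2^2)) = (\<lambda>p. \<chi> i j. inv2 (fst p) $ i $ 1 * snd p $ 1 $ j + inv2 (fst p) $ i $ 2 * snd p $ 2 $ j)"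
    by (auto simp: vec_eq_iff)
  moreover have *: "continuous_on UNIV (\<lambda>p::(real^2^2)\<times>(real^2^2). inv2 (fst p) $ i $ j)" for i j
    using exhaust_2[of i] exhaust_2[of j] by (elim disjE; simp; intro continuous_intros)
  ultimately show ?thesis
    by (simp only:) (intro continuous_on_vec_lambda continuous_on_add continuous_on_mult *; intro continuous_intros)
qed

lemma det_inv_closed: "closed {A :: real^2^2. det A = 1}"
  unfolding det_2 by (intro closed_Collect_eq continuous_intros)

text \<open>A discrete set may accumulate outside itself, so the group structure enters: near an
  accumulation point there are distinct \<open>A\<close>, \<open>A'\<close> whose quotient is close
  to the identity, which is isolated.\<close>

lemma discrete_subgroup_bounded_finite:
  assumes G: "discrete_subgroup \<Gamma>" and B: "bounded B"
  shows "finite (\<Union>\<Gamma> \<inter> B)"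
proof (rule ccontr)
  assume inf: "infinite (\<Union>\<Gamma> \<inter> B)"
  interpret PSL: group PSL2R by (rule group_PSL2R)
  have sub: "subgroup \<Gamma> PSL2R" and disc: "discrete (\<Union>\<Gamma>)" using G by (auto simp: discrete_subgroup_def)
  have det: "det A = 1" if "A \<in> \<Union>\<Gamma>" for A
    using that subgroup.mem_carrier[OF sub] in_PSL2R_iff by fastforce
  have quot: "inv2 A ** A' \<in> \<Union>\<Gamma>" if AA: "A \<in> \<Union>\<Gamma>" "A' \<in> \<Union>\<Gamma>" for A A'
  proof -
    obtain g g' where g: "g \<in> \<Gamma>" "A \<in> g" "g' \<in> \<Gamma>" "A' \<in> g'" using AA by auto
    have c: "g \<in> carrier PSL2R" "g' \<in> carrier PSL2R" using g subgroup.mem_carrier[OF sub] by auto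
    have A: "A = rep g \<or> A = - rep g" "A' = rep g' \<or> A' = - rep g'"
      using g rep_eq[OF c(1)] rep_eq[OF c(2)] by auto
    have i: "inv\<^bsub>PSL2R\<^esub> g \<in> \<Gamma>" "inv\<^bsub>PSL2R\<^esub> g \<in> carrier PSL2R"
      using g sub c by (auto simp: subgroup.m_inv_closed)
    let ?h = "inv\<^bsub>PSL2R\<^esub> g \<otimes>\<^bsub>PSL2R\<^esub> g'"
    have h: "?h \<in> \<Gamma>" "?h \<in> carrier PSL2R" using i g sub c by (auto simp: subgroup.m_closed)
    have "inv2 (- rep g) = - inv2 (rep g)" by (simp add: mat2_eq_iff)
    then have "inv2 A ** A' = rep ?h \<or> inv2 A ** A' = - rep ?h"
      using A rep_mult[OF i(2) c(2)] rep_inv[OF c(1)] by auto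
    then show ?thesis using h rep_eq[OF h(2)] by blast
  qed
  have "bounded (\<Union>\<Gamma> \<inter> B)" using B by (rule bounded_subset) auto
  then obtain l where l: "l islimpt (\<Union>\<Gamma> \<inter> B)"
    using inf bounded_infinite_imp_islimpt by blast
  have "\<Union>\<Gamma> \<inter> B \<subseteq> {A. det A = 1}" using det by auto
  \<comment> \<open>The accumulation point need not lie in the subgroup, but the determinant passes
    to the limit, so \<open>inv2 l\<close> still inverts it.\<close>
  from islimpt_subset[OF l this] have "l \<in> {A. det A = 1}"
    using det_inv_closed unfolding closed_limpt by blast
  then have dl: "det l = 1" by simp
  have "{mat 1, - mat 1} \<in> \<Gamma>" using subgroup.one_closed[OF sub] by simp
  then have "mat 1 \<in> \<Union>\<Gamma>" by blast
  then obtain e where e: "e > 0" "\<And>A. A \<in> \<Union>\<Gamma> \<Longrightarrow> dist A (mat 1) < e \<Longrightarrow> A = mat 1"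
    using disc unfolding discrete_def isolated_in_islimpt_iff islimpt_approachable by blast
  have "continuous (at (l, l)) (\<lambda>(A, B). inv2 A ** (B :: real^2^2))"
    using inv2_mult_continuous by (simp add: continuous_on_eq_continuous_at)
  then obtain d where d: "d > 0" "\<And>A A'. dist (A, A') (l, l) < d \<Longrightarrow> dist (inv2 A ** A') (inv2 l ** l) < e"
    using e(1) unfolding continuous_at_eps_delta by fastforce
  have infb: "infinite ((\<Union>\<Gamma> \<inter> B) \<inter> ball l (d/2))"
    using l d(1) unfolding islimpt_eq_infinite_ball by auto
  then obtain A A' where A: "A \<in> \<Union>\<Gamma>" "A' \<in> \<Union>\<Gamma>" "A \<noteq> A'" "dist A l < d/2" "dist A' l < d/2"
  proof -
    obtain A where A: "A \<in> (\<Union>\<Gamma> \<inter> B) \<inter> ball l (d/2)"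
      using infinite_imp_nonempty[OF infb] by blast
    obtain A' where A': "A' \<in> (\<Union>\<Gamma> \<inter> B) \<inter> ball l (d/2) - {A}"
      using infinite_imp_nonempty[OF infinite_remove[OF infb]] by blast
    show ?thesis by (rule that[of A A']) (use A A' in \<open>auto simp: dist_commute\<close>)
  qed
  have "dist (A, A') (l, l) < d"
    unfolding dist_Pair_Pair using A sqrt_sum_squares_le_sum[of "dist A l" "dist A' l"] by simp
  then have "inv2 A ** A' = mat 1"
    using d(2)[of A A'] dl e(2)[OF quot[OF A(1,2)]] by (simp add: inv2_mult)
  then have "A' = A"
    using det[OF A(1)] inv2_cancel_left(2)[of A A'] by (metis matrix_mul_rid)
  then show False using A by simp
qed

text \<open>\<open>Im_moebius_jac\<close> bounds |cz + d| by the two imaginary parts, and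
  \<open>cmod_moebius_jac\<close> then bounds |az + b|. As Im z is bounded below on
  \<open>C\<close>, this bounds the entries of both rows.\<close>

lemma bounded_moebius_compact:
  assumes "compact C" "C \<subseteq> HP"
  shows "bounded {A. det A = 1 \<and> (\<exists>z\<in>C. moebius A z \<in> C)}"
proof (cases "C = {}")
  case False
  obtain R where R: "\<And>z. z \<in> C \<Longrightarrow> cmod z \<le> R" using compact_imp_bounded[OF assms(1)] bounded_iff by blast
  have "continuous_on C Im" by (intro continuous_intros)
  then obtain z0 where z0: "z0 \<in> C" "\<And>z. z \<in> C \<Longrightarrow> Im z0 \<le> Im z"
    using continuous_attains_inf[OF assms(1) False] by blast
  define \<delta> where "\<delta> = Im z0"
  have \<delta>: "\<delta> > 0" using z0 assms(2) by (auto simp: \<delta>_def HP_def)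
  have R0: "R > 0" using R[OF z0(1)] \<delta> abs_Im_le_cmod[of z0] by (auto simp: \<delta>_def)
  define K where "K = R / \<delta>"
  have K: "K > 0" using R0 \<delta> by (simp add: K_def)
  define E where "E = sqrt (K + R\<^sup>2 * K)"
  have row: "\<bar>p\<bar> \<le> E / \<delta> \<and> \<bar>q\<bar> \<le> E + R * (E / \<delta>)"
    if h: "(p * Re z + q)\<^sup>2 + (p * Im z)\<^sup>2 \<le> K + R\<^sup>2 * K" and z: "z \<in> C" for p q z
  proof -
    have E2: "E \<ge> 0" by (simp add: E_def K R0 less_imp_le)
    have 1: "\<bar>p * Re z + q\<bar> \<le> E" "\<bar>p * Im z\<bar> \<le> E"
      unfolding E_def by (rule real_le_rsqrt, use h in \<open>simp add: add_increasing2 order.trans[OF _ h]\<close>)+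
    have "\<bar>p\<bar> * \<delta> \<le> \<bar>p * Im z\<bar>" unfolding abs_mult using z0(2)[OF z] \<delta>
      by (intro mult_left_mono) (auto simp: \<delta>_def)
    then have p: "\<bar>p\<bar> \<le> E / \<delta>" using 1 \<delta> by (simp add: field_simps)
    have "\<bar>p * Re z\<bar> \<le> (E / \<delta>) * R" unfolding abs_mult
      using p R[OF z] abs_Re_le_cmod[of z] E2 \<delta> by (intro mult_mono) auto
    then show ?thesis using p 1(1) by (auto simp: mult.commute)
  qed
  have bd: "\<bar>A$i$j\<bar> \<le> E / \<delta> + (E + R * (E / \<delta>))"
    if A: "det A = 1" "z \<in> C" "moebius A z \<in> C" for A z i j
  proof -
    have zH: "z \<in> HP" using A assms by auto
    have j: "jac A z = Im z / Im (moebius A z)"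
      using Im_moebius_jac[OF A(1) zH] moebius_in_HP[OF A(1) zH] by (simp add: HP_def field_simps)
    have "Im z \<le> R" using R[OF A(2)] abs_Im_le_cmod[of z] by linarith
    then have jK: "jac A z \<le> K" unfolding j K_def
      using z0(2)[OF A(3)] \<delta> zH by (intro frac_le) (auto simp: \<delta>_def HP_def)
    have "(cmod (moebius A z))\<^sup>2 \<le> R\<^sup>2" using R[OF A(3)] by (intro power_mono) auto
    then have "(cmod (moebius A z))\<^sup>2 * jac A z \<le> R\<^sup>2 * K"
      using jK jac_pos[OF A(1) zH] by (intro mult_mono) auto
    then have "(A$1$1 * Re z + A$1$2)\<^sup>2 + (A$1$1 * Im z)\<^sup>2 \<le> R\<^sup>2 * K"
      unfolding cmod_moebius_jac[OF A(1) zH] unfolding cmod_power2 by (simp add: power2_eq_square algebra_simps)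
    then have 1: "(A$1$1 * Re z + A$1$2)\<^sup>2 + (A$1$1 * Im z)\<^sup>2 \<le> K + R\<^sup>2 * K" using K by simp
    have "0 \<le> R\<^sup>2 * K" using K by simp
    then have 2: "(A$2$1 * Re z + A$2$2)\<^sup>2 + (A$2$1 * Im z)\<^sup>2 \<le> K + R\<^sup>2 * K"
      using jK unfolding jac_alt by linarith
    have "E / \<delta> \<ge> 0" "E + R * (E / \<delta>) \<ge> 0" using \<delta> R0 K by (auto simp: E_def)
    then show ?thesis
      using row[OF 1 A(2)] row[OF 2 A(2)] exhaust_2[of i] exhaust_2[of j] by auto
  qed
  define F where "F = E / \<delta> + (E + R * (E / \<delta>))"
  have "norm A \<le> 4 * F" if "det A = 1 \<and> (\<exists>z\<in>C. moebius A z \<in> C)" for A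
  proof -
    have "norm A \<le> norm (A$1) + norm (A$2)"
      using L2_set_le_sum[of UNIV "\<lambda>i. norm (A$i)"] unfolding norm_vec_def[of A] by (simp only: sum_2 norm_ge_zero simp_thms)
    also have "\<dots> \<le> \<bar>A$1$1\<bar> + \<bar>A$1$2\<bar> + (\<bar>A$2$1\<bar> + \<bar>A$2$2\<bar>)"
      using norm_le_l1_cart[of "A$1"] norm_le_l1_cart[of "A$2"] by (simp add: sum_2)
    also have "\<dots> \<le> 4 * F"
    proof -
      obtain z where "det A = 1" "z \<in> C" "moebius A z \<in> C" using \<open>det A = 1 \<and> _\<close> by blast
      from bd[OF this, of 1 1] bd[OF this, of 1 2] bd[OF this, of 2 1] bd[OF this, of 2 2]
      show ?thesis unfolding F_def[symmetric] by linarith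
    qed
    finally show ?thesis .
  qed
  then show ?thesis unfolding bounded_iff by blast
qed auto

lemma properly_discontinuous:
  assumes G: "discrete_subgroup \<Gamma>" and C: "compact C" "C \<subseteq> HP"
  shows "finite {g\<in>\<Gamma>. \<exists>z\<in>C. act g z \<in> C}"
proof -
  have c: "g \<in> carrier PSL2R" if "g \<in> \<Gamma>" for g
    using G that unfolding discrete_subgroup_def by (auto dest: subgroup.mem_carrier)
  have "rep ` {g\<in>\<Gamma>. \<exists>z\<in>C. act g z \<in> C} \<subseteq> \<Union>\<Gamma> \<inter> {A. det A = 1 \<and> (\<exists>z\<in>C. moebius A z \<in> C)}"
    using c rep_in by (auto simp: act_def)
  then have "finite (rep ` {g\<in>\<Gamma>. \<exists>z\<in>C. act g z \<in> C})"
    using discrete_subgroup_bounded_finite[OF G bounded_moebius_compact[OF C]] finite_subset by blast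
  moreover have "inj_on rep {g\<in>\<Gamma>. \<exists>z\<in>C. act g z \<in> C}"
  proof (rule inj_onI)
    fix g h assume "g \<in> {g\<in>\<Gamma>. \<exists>z\<in>C. act g z \<in> C}" "h \<in> {g\<in>\<Gamma>. \<exists>z\<in>C. act g z \<in> C}" "rep g = rep h"
    then show "g = h" using rep_eq[OF c[of g]] rep_eq[OF c[of h]] by auto
  qed
  ultimately show ?thesis by (rule finite_imageD)
qed

text \<open>The powers of an element fixing \<open>z\<close> also fix \<open>z\<close>, hence are
  finite in number by proper discontinuity, and a free group has no torsion.\<close>

lemma act_free:
  assumes G: "discrete_subgroup \<Gamma>" and F: "fg_free \<Gamma>" and g: "g \<in> \<Gamma>" and z: "z \<in> HP" "act g z = z"
  shows "g = \<one>\<^bsub>PSL2R\<^esub>"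
proof (rule ccontr)
  assume ne: "g \<noteq> \<one>\<^bsub>PSL2R\<^esub>"
  let ?G = "PSL2R\<lparr>carrier := \<Gamma>\<rparr>"
  have sub: "subgroup \<Gamma> PSL2R" using G by (simp add: discrete_subgroup_def)
  interpret PSL: group PSL2R by (rule group_PSL2R)
  interpret H: group ?G by (rule subgroup.subgroup_is_group[OF sub PSL.group_axioms])
  obtain X where X: "free_basis ?G X" using F unfolding fg_free_def by blast
  have c: "h \<in> carrier PSL2R" if "h \<in> \<Gamma>" for h using subgroup.mem_carrier[OF sub that] .
  have pw: "g [^]\<^bsub>?G\<^esub> k \<in> \<Gamma> \<and> act (g [^]\<^bsub>?G\<^esub> k) z = z" for k :: nat
  proof (induction k)
    case (Suc k)
    then show ?case using g z act_mult[OF c c z(1), of "g [^]\<^bsub>?G\<^esub> k" g] H.nat_pow_closed[of g "Suc k"] by simp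
  qed (use H.one_closed in auto)
  then have "range (\<lambda>k::nat. g [^]\<^bsub>?G\<^esub> k) \<subseteq> {h\<in>\<Gamma>. \<exists>w\<in>{z}. act h w \<in> {z}}" by auto
  then have "finite (range (\<lambda>k::nat. g [^]\<^bsub>?G\<^esub> k))"
    using properly_discontinuous[OF G, of "{z}"] z finite_subset by auto
  then have "\<not> inj (\<lambda>k::nat. g [^]\<^bsub>?G\<^esub> k)" using range_inj_infinite by blast
  then obtain k l :: nat where kl: "k < l" "g [^]\<^bsub>?G\<^esub> k = g [^]\<^bsub>?G\<^esub> l"
    unfolding inj_def by (metis linorder_neqE_nat)
  have "g [^]\<^bsub>?G\<^esub> l = g [^]\<^bsub>?G\<^esub> k \<otimes>\<^bsub>?G\<^esub> g [^]\<^bsub>?G\<^esub> (l - k)"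
    using kl(1) g by (subst H.nat_pow_mult) auto
  then have "g [^]\<^bsub>?G\<^esub> (l - k) = \<one>\<^bsub>?G\<^esub>"
    using kl(2) g H.l_cancel_one'[of "g [^]\<^bsub>?G\<^esub> k" "g [^]\<^bsub>?G\<^esub> (l - k)"] H.nat_pow_closed[of g]
    by (simp del: monoid.simps)
  moreover have "g [^]\<^bsub>?G\<^esub> (l - k) \<noteq> \<one>\<^bsub>?G\<^esub>"
    by (rule free_basis_torsion_free[OF H.group_axioms X]) (use g ne kl in auto)
  ultimately show False by blast
qed

section \<open>Tensors and pairings\<close>

lemma finite_idx [simp]: "finite (idx d)"
  unfolding idx_def using finite_lists_length_eq[of "UNIV :: 2 set" d] by simp

lemma card_idx: "card (idx d) = 2 ^ d"
  unfolding idx_def using card_lists_length_eq[of "UNIV :: 2 set" d] by simp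

text \<open>The distributive law as a factorization over the tensor slots; it evaluates pairings and
  matrix actions on pure tensors.\<close>

lemma sum_idx_prod:
  fixes f :: "nat \<Rightarrow> 2 \<Rightarrow> 'a::comm_semiring_1"
  shows "(\<Sum>l\<in>idx d. \<Prod>j<d. f j (l!j)) = (\<Prod>j<d. \<Sum>x\<in>UNIV. f j x)"
proof (induction d arbitrary: f)
  case 0
  then show ?case by (simp add: idx_def)
next
  case (Suc d)
  have *: "idx (Suc d) = (\<lambda>(x, l). x # l) ` (UNIV \<times> idx d)"
    by (auto simp: idx_def image_def length_Suc_conv)
  have "(\<Sum>l\<in>idx (Suc d). \<Prod>j<Suc d. f j (l!j)) = (\<Sum>(x, l)\<in>UNIV \<times> idx d. f 0 x * (\<Prod>j<d. f (Suc j) (l!j)))"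
    unfolding * by (subst sum.reindex) (auto simp: inj_on_def prod.lessThan_Suc_shift case_prod_beta simp del: prod.lessThan_Suc)
  also have "\<dots> = (\<Sum>x\<in>UNIV. f 0 x) * (\<Sum>l\<in>idx d. \<Prod>j<d. f (Suc j) (l!j))"
    by (simp add: sum_product sum.cartesian_product)
  also have "\<dots> = (\<Prod>j<Suc d. \<Sum>x\<in>UNIV. f j x)"
    using Suc.IH[of "\<lambda>j. f (Suc j)"] by (simp add: prod.lessThan_Suc_shift del: prod.lessThan_Suc)
  finally show ?case .
qed

lemma axis_nth_2 [simp]:
  "axis (1::2) (c::real) $ 1 = c" "axis (1::2) (c::real) $ 2 = 0"
  "axis (2::2) (c::real) $ 1 = 0" "axis (2::2) (c::real) $ 2 = c"
  by (simp_all add: axis_def)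

lemma sum_area_axis: "(\<Sum>x\<in>UNIV. area z (axis x 1) * v $ x) = area z v"
  by (simp add: sum_2 area_def)

text \<open>The negative of \<open>Bform d\<close> with the pure tensor of \<open>z 0\<close>, ...,
  \<open>z (d - 1)\<close> as first argument. Leaving that tensor unsymmetrized keeps its value on a
  monomial a plain sum over words.\<close>

definition pairing :: "nat \<Rightarrow> (nat \<Rightarrow> real^2) \<Rightarrow> tensor \<Rightarrow> real" where
  "pairing d z T = (\<Sum>l\<in>idx d. (\<Prod>j<d. area (z j) (axis (l!j) 1)) * T l)"

lemma pairing_sum:
  "pairing d z (\<lambda>k. \<Sum>i\<in>I. c i * T i k) = (\<Sum>i\<in>I. c i * pairing d z (T i))"
proof -
  have "pairing d z (\<lambda>k. \<Sum>i\<in>I. c i * T i k) =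
      (\<Sum>l\<in>idx d. \<Sum>i\<in>I. c i * ((\<Prod>j<d. area (z j) (axis (l!j) 1)) * T i l))"
    by (simp add: pairing_def sum_distrib_left mult.left_commute)
  then show ?thesis unfolding pairing_def sum_distrib_left by (simp add: sum.swap[of _ "idx d"])
qed

lemma pairing_add: "pairing d z (\<lambda>k. T k + U k) = pairing d z T + pairing d z U"
  by (simp add: pairing_def sum.distrib algebra_simps)

lemma pairing_scale: "pairing d z (\<lambda>k. c * T k) = c * pairing d z T"
  by (simp add: pairing_def sum_distrib_left algebra_simps)

lemma pairing_pure:
  assumes "length vs = d"
  shows "pairing d z (pure_tensor vs) = (\<Prod>j<d. area (z j) (vs!j))"
proof -
  have "pairing d z (pure_tensor vs) = (\<Sum>l\<in>idx d. \<Prod>j<d. area (z j) (axis (l!j) 1) * vs!j $ (l!j))"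
    unfolding pairing_def by (rule sum.cong) (auto simp: pure_tensor_def assms idx_def prod.distrib)
  also have "\<dots> = (\<Prod>j<d. \<Sum>x\<in>UNIV. area (z j) (axis x 1) * vs!j $ x)"
    by (rule sum_idx_prod)
  finally show ?thesis by (simp add: sum_area_axis)
qed

text \<open>Invariance holds slot by slot, because a matrix of determinant 1 preserves
  \<open>area\<close>.\<close>

lemma pairing_sigma_mat:
  assumes "det A = 1"
  shows "pairing d (\<lambda>j. A *v z j) (sigma_mat d A T) = pairing d z T"
proof -
  have "pairing d (\<lambda>j. A *v z j) (sigma_mat d A T) =
      (\<Sum>l\<in>idx d. \<Sum>l'\<in>idx d. (\<Prod>j<d. area (A *v z j) (axis (l!j) 1) * A $ (l!j) $ (l'!j)) * T l')"
    unfolding pairing_def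
    by (rule sum.cong) (auto simp: sigma_mat_def idx_def prod.distrib sum_distrib_left mult.assoc)
  also have "\<dots> = (\<Sum>l'\<in>idx d. (\<Sum>l\<in>idx d. \<Prod>j<d. area (A *v z j) (axis (l!j) 1) * A $ (l!j) $ (l'!j)) * T l')"
    by (subst sum.swap) (simp add: sum_distrib_right)
  also have "\<dots> = (\<Sum>l'\<in>idx d. (\<Prod>j<d. \<Sum>x\<in>UNIV. area (A *v z j) (axis x 1) * A $ x $ (l'!j)) * T l')"
    by (subst sum_idx_prod) simp
  also have "\<dots> = pairing d z T"
  proof -
    have "(\<Sum>x\<in>UNIV. area (A *v z j) (axis x 1) * A $ x $ y) = area (z j) (axis y 1)" for j y
    proof -
      have "A $ x $ y = (A *v axis y 1) $ x" for x
        using exhaust_2[of y] by auto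
      then show ?thesis by (simp only: sum_area_axis area_mult assms mult_1)
    qed
    then show ?thesis by (simp add: pairing_def)
  qed
  finally show ?thesis .
qed

lemma abs_area_axis_le: "\<bar>area v (axis i 1)\<bar> \<le> norm v"
  using exhaust_2[of i] component_le_norm_cart[of v 1] component_le_norm_cart[of v 2]
  by (auto simp: area_def)

text \<open>\<open>R\<close> only bounds the finitely many coordinates on \<open>C\<close>, so it
  can be fixed before the vectors \<open>z j\<close>, which will depend on the group
  element.\<close>

lemma compact_pairing_bound:
  assumes "compact C"
  obtains R where "R \<ge> 0" "\<And>T z. T \<in> C \<Longrightarrow> \<bar>pairing d z T\<bar> \<le> (\<Prod>j<d. norm (z j)) * R"
proof -
  have "continuous_on C (\<lambda>T. \<Sum>l\<in>idx d. \<bar>T l :: real\<bar>)"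
    by (intro continuous_intros continuous_on_subset[OF continuous_on_product_coordinates]) auto
  then have "bounded ((\<lambda>T. \<Sum>l\<in>idx d. \<bar>T l\<bar>) ` C)"
    using assms compact_continuous_image compact_imp_bounded by blast
  then obtain R where R: "\<And>T. T \<in> C \<Longrightarrow> \<bar>\<Sum>l\<in>idx d. \<bar>T l\<bar>\<bar> \<le> R" unfolding bounded_iff by auto
  show thesis
  proof (rule that[of "\<bar>R\<bar>"])
    fix T z assume "T \<in> C"
    have "\<bar>pairing d z T\<bar> \<le> (\<Sum>l\<in>idx d. (\<Prod>j<d. norm (z j)) * \<bar>T l\<bar>)"
      unfolding pairing_def
      by (rule order.trans[OF sum_abs], rule sum_mono)
        (auto simp: abs_mult abs_prod intro!: mult_right_mono prod_mono abs_area_axis_le)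
    also have "\<dots> \<le> (\<Prod>j<d. norm (z j)) * \<bar>R\<bar>"
      unfolding sum_distrib_left[symmetric] using R[OF \<open>T \<in> C\<close>]
      by (intro mult_left_mono prod_nonneg) auto
    finally show "\<bar>pairing d z T\<bar> \<le> (\<Prod>j<d. norm (z j)) * \<bar>R\<bar>" .
  qed simp
qed

section \<open>The representation on symmetric tensors\<close>

lemma sigma_mat_sum:
  "sigma_mat d A (\<lambda>k. \<Sum>i\<in>I. c i * T i k) = (\<lambda>k. \<Sum>i\<in>I. c i * sigma_mat d A (T i) k)"
proof
  fix k
  have "(\<Sum>l\<in>idx d. (\<Prod>j<d. A $ (k!j) $ (l!j)) * (\<Sum>i\<in>I. c i * T i l)) =
      (\<Sum>l\<in>idx d. \<Sum>i\<in>I. c i * ((\<Prod>j<d. A $ (k!j) $ (l!j)) * T i l))"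
    by (simp add: sum_distrib_left mult.left_commute)
  also have "\<dots> = (\<Sum>i\<in>I. c i * (\<Sum>l\<in>idx d. (\<Prod>j<d. A $ (k!j) $ (l!j)) * T i l))"
    by (subst sum.swap) (simp add: sum_distrib_left)
  finally show "sigma_mat d A (\<lambda>k. \<Sum>i\<in>I. c i * T i k) k = (\<Sum>i\<in>I. c i * sigma_mat d A (T i) k)"
    by (simp add: sigma_mat_def)
qed

lemma sigma_mat_scale: "sigma_mat d A (\<lambda>k. c * T k) = (\<lambda>k. c * sigma_mat d A T k)"
  by (rule ext) (simp add: sigma_mat_def sum_distrib_left mult.left_commute)

lemma sigma_mat_pure:
  assumes "length vs = d"
  shows "sigma_mat d A (pure_tensor vs) = pure_tensor (map ((*v) A) vs)"
proof
  fix k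
  show "sigma_mat d A (pure_tensor vs) k = pure_tensor (map ((*v) A) vs) k"
  proof (cases "length k = d")
    case True
    have "(\<Sum>l\<in>idx d. (\<Prod>j<d. A $ (k!j) $ (l!j)) * pure_tensor vs l) =
        (\<Sum>l\<in>idx d. \<Prod>j<d. A $ (k!j) $ (l!j) * vs!j $ (l!j))"
      by (rule sum.cong) (auto simp: pure_tensor_def assms idx_def prod.distrib)
    also have "\<dots> = (\<Prod>j<d. \<Sum>x\<in>UNIV. A $ (k!j) $ x * vs!j $ x)" by (rule sum_idx_prod)
    also have "\<dots> = (\<Prod>j<d. (map ((*v) A) vs ! j) $ (k!j))"
      using assms by (intro prod.cong) (auto simp: sum_2)
    finally show ?thesis using True assms by (simp add: sigma_mat_def pure_tensor_def)
  qed (use assms in \<open>simp add: sigma_mat_def pure_tensor_def\<close>)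
qed

section \<open>Monomials in two vectors as sums over words\<close>

abbreviation pick :: "real^2 \<Rightarrow> real^2 \<Rightarrow> 2 \<Rightarrow> real^2" where
  "pick v w \<equiv> \<lambda>j. if j = 1 then v else w"

abbreviation words :: "nat \<Rightarrow> nat \<Rightarrow> 2 list set" where
  "words d i \<equiv> {k \<in> idx d. count_list k 1 = i}"

lemma sym_mono_eq: "sym_mono d v w i = (\<lambda>l. \<Sum>k\<in>words d i. 1 * pure_tensor (map (pick v w) k) l)"
  by (simp add: sym_mono_def fun_eq_iff)

lemma sigma_mat_sym_mono: "sigma_mat d A (sym_mono d v w i) = sym_mono d (A *v v) (A *v w) i"
proof -
  have "sigma_mat d A (pure_tensor (map (pick v w) k)) = pure_tensor (map (pick (A *v v) (A *v w)) k)"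
    if "k \<in> words d i" for k
    using that by (subst sigma_mat_pure) (auto simp: idx_def comp_def if_distrib[of "(*v) A"])
  then show ?thesis unfolding sym_mono_eq sigma_mat_sum by (intro ext sum.cong) auto
qed

lemma pairing_sym_mono:
  "pairing d z (sym_mono d v w i) = (\<Sum>k\<in>words d i. \<Prod>j<d. area (z j) (pick v w (k!j)))"
  unfolding sym_mono_eq pairing_sum
  by (intro sum.cong) (auto simp: pairing_pure idx_def intro!: prod.cong)

lemma prod_if_count:
  fixes a b :: real and k :: "2 list"
  shows "(\<Prod>j<length k. if k!j = 1 then a else b) = a ^ count_list k 1 * b ^ (length k - count_list k 1)"
proof (induction k)
  case (Cons x k)
  have "count_list k 1 \<le> length k" by (rule count_le_length)
  then show ?case using Cons
    by (simp add: prod.lessThan_Suc_shift Suc_diff_le del: prod.lessThan_Suc)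
qed simp

lemma sym_mono_scaleR:
  assumes "i \<le> d"
  shows "sym_mono d (a *\<^sub>R v) (b *\<^sub>R w) i l = a ^ i * b ^ (d - i) * sym_mono d v w i l"
proof -
  have "pure_tensor (map (pick (a *\<^sub>R v) (b *\<^sub>R w)) k) l = a ^ i * b ^ (d - i) * pure_tensor (map (pick v w) k) l"
    if k: "k \<in> words d i" for k
  proof (cases "length l = d")
    case True
    have "(\<Prod>j<d. (map (pick (a *\<^sub>R v) (b *\<^sub>R w)) k ! j) $ (l!j)) =
        (\<Prod>j<d. (if k!j = 1 then a else b) * (map (pick v w) k ! j) $ (l!j))"
      using k by (intro prod.cong) (auto simp: idx_def)
    also have "\<dots> = (a ^ i * b ^ (d - i)) * (\<Prod>j<d. (map (pick v w) k ! j) $ (l!j))"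
      using prod_if_count[of k a b] k by (auto simp: prod.distrib idx_def)
    finally show ?thesis using True k by (simp add: pure_tensor_def idx_def)
  qed (use k in \<open>simp add: pure_tensor_def idx_def\<close>)
  then show ?thesis by (simp add: sym_mono_def sum_distrib_left)
qed

definition flip2 :: "2 \<Rightarrow> 2" where "flip2 x = (if x = 1 then 2 else 1)"

lemma flip2_simps [simp]: "flip2 (flip2 x) = x" "flip2 x = 1 \<longleftrightarrow> x \<noteq> 1" "flip2 1 = 2"
  using exhaust_2[of x] by (auto simp: flip2_def)

lemma count_map_flip2: "count_list (map flip2 k) 1 = length k - count_list k 1"
proof (induction k)
  case (Cons x k)
  have "count_list k 1 \<le> length k" by (rule count_le_length)
  then show ?case using Cons by (auto simp: Suc_diff_le)
qed simp

lemma map_flip2_words: "k \<in> words (2 * M) M \<Longrightarrow> map flip2 k \<in> words (2 * M) M"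
  by (auto simp: idx_def count_map_flip2)

text \<open>Complementing the letters permutes the words with equally many of each. This allows the
  endpoints of an axis to be relabelled.\<close>

lemma sym_mono_swap: "sym_mono (2 * M) w v M = sym_mono (2 * M) v w M"
proof
  fix l
  have *: "map (pick v w) (map flip2 k) = map (pick w v) k" for k
    using exhaust_2 by (auto simp: flip2_def)
  then show "sym_mono (2 * M) w v M l = sym_mono (2 * M) v w M l"
    unfolding sym_mono_def
    by (intro sum.reindex_bij_witness[where i = "map flip2" and j = "map flip2"])
      (use map_flip2_words[of _ M] in \<open>simp_all add: * comp_def del: map_map mem_Collect_eq, simp_all add: comp_def\<close>)
qed

lemma permute_words:
  assumes "p permutes {..<d}" "k \<in> words d i"
  shows "permute_list p k \<in> words d i"
proof -
  have "mset (permute_list p k) = mset k" using assms by (auto simp: idx_def)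
  then show ?thesis using assms(2) by (auto simp: idx_def simp flip: count_mset)
qed

text \<open>Rearranging the index is absorbed by rearranging the words in the same way, which
  preserves the letter counts.\<close>

lemma sym_mono_sym: "sym_mono d v w i \<in> sym_tensors d"
proof -
  have zero: "sym_mono d v w i k = 0" if "length k \<noteq> d" for k
    unfolding sym_mono_def using that by (intro sum.neutral) (auto simp: pure_tensor_def idx_def)
  have "sym_mono d v w i k = sym_mono d v w i l" if kl: "mset k = mset l" for k l
  proof (cases "length l = d")
    case True
    obtain p where p: "p permutes {..<length l}" "permute_list p l = k"
      using mset_eq_permutation[OF kl] by blast
    have p': "p permutes {..<d}" "inv_into UNIV p permutes {..<d}" using p True permutes_inv by auto
    have *: "pure_tensor (map (pick v w) (permute_list p q)) k = pure_tensor (map (pick v w) q) l"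
      if q: "q \<in> words d i" for q
    proof -
      have len: "length q = d" "length (permute_list p q) = d" using q by (auto simp: idx_def)
      have pj: "p j < d" if "j < d" for j using permutes_in_image[OF p'(1), of j] that by simp
      have "pure_tensor (map (pick v w) (permute_list p q)) k = (\<Prod>j<d. pick v w (q!(p j)) $ (l!(p j)))"
        using len p True p'(1) unfolding pure_tensor_def p(2)[symmetric]
        by (simp add: permute_list_nth)
      also have "\<dots> = (\<Prod>j<d. pick v w (q!j) $ (l!j))"
        using prod.permute[OF p'(1), of "\<lambda>j. pick v w (q!j) $ (l!j)"] by (simp add: comp_def)
      also have "\<dots> = pure_tensor (map (pick v w) q) l"
        using len True by (simp add: pure_tensor_def)
      finally show ?thesis .
    qed
    show ?thesis unfolding sym_mono_def
    proof (rule sum.reindex_bij_witness[where i = "permute_list p" and j = "permute_list (inv_into UNIV p)"])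
      fix q assume q: "q \<in> words d i"
      show "permute_list p q \<in> words d i" "permute_list (inv_into UNIV p) q \<in> words d i"
        using permute_words p' q by auto
      have len: "length q = d" using q by (simp add: idx_def)
      show inv: "permute_list p (permute_list (inv_into UNIV p) q) = q"
        using permute_list_compose[of p q "inv_into UNIV p"] p'(1) len permutes_inv_o(2)[OF p'(1)] by simp
      show "permute_list (inv_into UNIV p) (permute_list p q) = q"
        using permute_list_compose[of "inv_into UNIV p" q p] p'(2) len permutes_inv_o(1)[OF p'(1)] by simp
      show "pure_tensor (map (pick v w) (permute_list (inv_into UNIV p) q)) l = pure_tensor (map (pick v w) q) k"
        using *[OF permute_words[OF p'(2) q]] inv by simp
    qed
  next
    case False
    moreover have "length k = length l" using kl by (metis size_mset)
    ultimately show ?thesis using zero[of k] zero[of l] by metis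
  qed
  then show ?thesis using zero unfolding sym_tensors_def by blast
qed

lemma sym_tensors_sum:
  "(\<And>i. i \<in> I \<Longrightarrow> T i \<in> sym_tensors d) \<Longrightarrow> (\<lambda>k. \<Sum>i\<in>I. c i * T i k) \<in> sym_tensors d"
  unfolding sym_tensors_def mem_Collect_eq
proof (intro conjI allI impI)
  fix k :: "2 list" assume "\<And>i. i \<in> I \<Longrightarrow> (\<forall>k. length k \<noteq> d \<longrightarrow> T i k = 0) \<and> (\<forall>k l. mset k = mset l \<longrightarrow> T i k = T i l)"
    and "length k \<noteq> d"
  then show "(\<Sum>i\<in>I. c i * T i k) = 0" by (intro sum.neutral) simp
next
  fix k l :: "2 list" assume *: "\<And>i. i \<in> I \<Longrightarrow> (\<forall>k. length k \<noteq> d \<longrightarrow> T i k = 0) \<and> (\<forall>k l. mset k = mset l \<longrightarrow> T i k = T i l)"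
    and "mset k = mset l"
  then show "(\<Sum>i\<in>I. c i * T i k) = (\<Sum>i\<in>I. c i * T i l)" by (intro sum.cong refl) metis
qed

lemma area_commute: "area w v = - area v w"
  by (simp add: area_def)

text \<open>Since \<open>area v v = 0\<close>, a word pairs nontrivially only with its complement,
  where the value is \<open>area v w ^ M * (- area v w) ^ M\<close>. As \<open>M\<close> is odd, its
  sign cancels the one in \<open>Bform\<close>, so neutral vectors are spacelike.\<close>

lemma Bform_sym_mono:
  assumes "odd M"
  shows "Bform (2 * M) (sym_mono (2 * M) v w M) (sym_mono (2 * M) v w M) =
    real (card (words (2 * M) M)) * area v w ^ (2 * M)"
proof -
  let ?d = "2 * M" and ?W = "words (2 * M) M"
  let ?T = "sym_mono ?d v w M"
  have inner: "(\<Sum>k\<in>?W. \<Prod>j<?d. area (pick v w (k'!j)) (pick v w (k!j))) = - (area v w ^ (2 * M))"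
    if k': "k' \<in> ?W" for k'
  proof -
    have Z: "(\<Prod>j<?d. area (pick v w (k'!j)) (pick v w (k!j))) = 0" if k: "k \<in> ?W - {map flip2 k'}" for k
    proof -
      have len: "length k = ?d" "length k' = ?d" using k k' by (auto simp: idx_def)
      then obtain j where j: "j < ?d" "k!j \<noteq> flip2 (k'!j)"
        using k nth_equalityI[of k "map flip2 k'"] by auto
      then have "k!j = k'!j" using exhaust_2[of "k!j"] exhaust_2[of "k'!j"] by (auto simp: flip2_def)
      then have "area (pick v w (k'!j)) (pick v w (k!j)) = 0" by (simp add: area_def)
      then show ?thesis using j by (meson finite_lessThan lessThan_iff prod_zero)
    qed
    have "(\<Sum>k\<in>?W. \<Prod>j<?d. area (pick v w (k'!j)) (pick v w (k!j))) =
        (\<Prod>j<?d. area (pick v w (k'!j)) (pick v w (map flip2 k' !j))) +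
        (\<Sum>k\<in>?W - {map flip2 k'}. \<Prod>j<?d. area (pick v w (k'!j)) (pick v w (k!j)))"
      by (rule sum.remove) (use map_flip2_words[OF k'] in auto)
    also have "(\<Sum>k\<in>?W - {map flip2 k'}. \<Prod>j<?d. area (pick v w (k'!j)) (pick v w (k!j))) = 0"
      by (rule sum.neutral) (use Z in blast)
    also have "(\<Prod>j<?d. area (pick v w (k'!j)) (pick v w (map flip2 k' !j))) + 0 =
        (\<Prod>j<?d. area (pick v w (k'!j)) (pick v w (map flip2 k' !j)))" by simp
    also have "\<dots> = (\<Prod>j<length k'. if k'!j = 1 then area v w else - area v w)"
      using k' by (intro prod.cong) (auto simp: idx_def area_commute[of v w] area_def)
    also have "\<dots> = area v w ^ M * (- area v w) ^ M"
      using k' by (subst prod_if_count) (auto simp: idx_def)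
    also have "\<dots> = - (area v w ^ (2 * M))" using assms by (simp add: mult_2 power_add)
    finally show ?thesis .
  qed
  have "Bform ?d ?T ?T = - (\<Sum>k\<in>idx ?d. ?T k * pairing ?d (\<lambda>j. axis (k!j) 1) ?T)"
    by (simp add: Bform_def pairing_def sum_distrib_left algebra_simps)
  also have "\<dots> = - (\<Sum>k\<in>idx ?d. \<Sum>k'\<in>?W. (\<Prod>j<?d. area (pick v w (k'!j)) (axis (k!j) 1)) * ?T k)"
  proof -
    have "(\<Prod>j<?d. area (axis (k!j) 1) (pick v w (k'!j))) = (\<Prod>j<?d. area (pick v w (k'!j)) (axis (k!j) 1))" for k k'
      by (subst area_commute) (simp add: prod_uminus)
    then show ?thesis unfolding pairing_sym_mono by (simp add: sum_distrib_left mult.commute)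
  qed
  also have "\<dots> = - (\<Sum>k'\<in>?W. pairing ?d (\<lambda>j. pick v w (k'!j)) ?T)"
    by (subst sum.swap) (simp add: pairing_def)
  also have "\<dots> = real (card ?W) * area v w ^ (2 * M)"
    unfolding pairing_sym_mono by (simp add: inner)
  finally show ?thesis .
qed

lemma prod_lessThan_add:
  fixes f :: "nat \<Rightarrow> real"
  shows "(\<Prod>j<m + n. f j) = (\<Prod>j<m. f j) * (\<Prod>j<n. f (m + j))"
  by (induction n) (simp_all add: mult.assoc)

text \<open>The word with all letters \<open>1\<close> in its first half contributes \<open>p ^ M\<close>; each of the others
  contains a factor \<open>q\<close>.\<close>

lemma pairing_sym_mono_dominant:
  fixes v w x y :: "real^2"
  defines "p \<equiv> area v x * area w y" and "q \<equiv> area v y * area w x"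
  assumes q: "2 * 4 ^ M * \<bar>q\<bar> \<le> \<bar>p\<bar>"
  shows "\<bar>pairing (2 * M) (\<lambda>j. if j < M then v else w) (sym_mono (2 * M) x y M) - p ^ M\<bar> \<le> \<bar>p\<bar> ^ M / 2"
proof -
  let ?d = "2 * M" and ?W = "words (2 * M) M" and ?z = "\<lambda>j. if j < M then v else w"
  define \<epsilon> :: real where "\<epsilon> = 1 / (2 * 4 ^ M)"
  define t where "t k = (\<Prod>j<?d. area (?z j) (pick x y (k!j)))" for k
  have eps: "0 < \<epsilon>" "\<epsilon> \<le> 1" "\<bar>q\<bar> \<le> \<epsilon> * \<bar>p\<bar>"
  proof -
    have "(1::real) \<le> 2 * 4 ^ M" using one_le_power[of "4::real" M] by linarith
    then show "0 < \<epsilon>" "\<epsilon> \<le> 1" unfolding \<epsilon>_def by (auto simp: divide_le_eq)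
    show "\<bar>q\<bar> \<le> \<epsilon> * \<bar>p\<bar>" using q unfolding \<epsilon>_def by (simp add: field_simps)
  qed
  let ?k0 = "replicate M (1::2) @ replicate M 2"
  \<comment> \<open>\<open>c\<close> counts the letters 1 in the first half. There are
    \<open>M\<close> such letters in all, so the second half contains \<open>M - c\<close> of them,
    and the mismatches of the two halves combine to \<open>M - c\<close> factors
    \<open>q\<close>.\<close>
  have t: "t k = p ^ c * q ^ (M - c) \<and> c \<le> M \<and> (c = M \<longrightarrow> k = ?k0)"
    if k: "k \<in> ?W" and c: "c = count_list (take M k) 1" for k c
  proof -
    let ?u = "take M k" and ?u' = "drop M k"
    have len: "length ?u = M" "length ?u' = M" using k by (auto simp: idx_def)
    have kk: "k = ?u @ ?u'" by simp
    have c': "count_list ?u' 1 = M - c" "c \<le> M"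
    proof -
      have "count_list ?u 1 + count_list ?u' 1 = M"
        using k by (subst count_list_append[symmetric]) simp
      then show "count_list ?u' 1 = M - c" "c \<le> M" using c by auto
    qed
    have "t k = (\<Prod>j<M. area (?z j) (pick x y (k!j))) * (\<Prod>j<M. area (?z (M + j)) (pick x y (k!(M + j))))"
      unfolding t_def mult_2 by (rule prod_lessThan_add)
    also have "(\<Prod>j<M. area (?z j) (pick x y (k!j))) = (\<Prod>j<length ?u. if ?u!j = 1 then area v x else area v y)"
      using len by (intro prod.cong) auto
    also have "\<dots> = area v x ^ c * area v y ^ (M - c)" using prod_if_count[of ?u] len c by simp
    also have "(\<Prod>j<M. area (?z (M + j)) (pick x y (k!(M + j)))) = (\<Prod>j<length ?u'. if ?u'!j = 1 then area w x else area w y)"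
      using len by (intro prod.cong) auto
    also have "\<dots> = area w x ^ (M - c) * area w y ^ c"
      using prod_if_count[where k = ?u'] unfolding len c'(1) using c'(2) by simp
    finally have 1: "t k = p ^ c * q ^ (M - c)" by (simp add: p_def q_def power_mult_distrib)
    have "k = ?k0" if "c = M"
    proof -
      have "set ?u \<subseteq> {1}"
      proof
        fix b assume b: "b \<in> set ?u"
        show "b \<in> {1}"
        proof (rule ccontr)
          assume "b \<notin> {1}"
          then have "count_list ?u 1 < length ?u"
            using b by (metis (mono_tags, lifting) count_le_length count_list_eq_length_filter filter_True insertI1 length_filter_less linorder_not_less order_le_less)
          then show False using c that len by simp
        qed
      qed
      moreover have "set ?u' \<subseteq> {2}"
        using c' that count_list_0_iff[of ?u' 1] exhaust_2 by force
      ultimately have "?u = replicate M 1" "?u' = replicate M 2"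
        using len by (intro replicate_eqI; blast)+
      then show ?thesis using kk by metis
    qed
    then show ?thesis using 1 c' by simp
  qed
  have k0: "?k0 \<in> ?W" by (auto simp: idx_def count_list_eq_length_filter)
  have t0: "t ?k0 = p ^ M"
    using t[OF k0 refl] by (simp add: count_list_eq_length_filter)
  have small: "\<bar>t k\<bar> \<le> \<epsilon> * \<bar>p\<bar> ^ M" if k: "k \<in> ?W - {?k0}" for k
  proof -
    define c where "c = count_list (take M k) 1"
    have c: "t k = p ^ c * q ^ (M - c)" "c < M" using t[of k c] k c_def by auto
    have "\<bar>t k\<bar> = \<bar>p\<bar> ^ c * \<bar>q\<bar> ^ (M - c)" by (simp add: c abs_mult power_abs)
    also have "\<dots> \<le> \<bar>p\<bar> ^ c * (\<epsilon> * \<bar>p\<bar>) ^ (M - c)"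
      using eps by (intro mult_left_mono power_mono) auto
    also have "\<dots> = \<epsilon> ^ (M - c) * \<bar>p\<bar> ^ M"
      using c(2) by (simp add: power_mult_distrib flip: power_add)
    also have "\<dots> \<le> \<epsilon> * \<bar>p\<bar> ^ M"
      using power_decreasing[of 1 "M - c" \<epsilon>] eps c(2) by (intro mult_right_mono) auto
    finally show ?thesis .
  qed
  have fin: "finite ?W" by simp
  have "pairing ?d ?z (sym_mono ?d x y M) - p ^ M = (\<Sum>k\<in>?W - {?k0}. t k)"
    unfolding pairing_sym_mono t_def[symmetric] using sum.remove[OF fin k0, of t] t0 by simp
  then have "\<bar>pairing ?d ?z (sym_mono ?d x y M) - p ^ M\<bar> \<le> (\<Sum>k\<in>?W - {?k0}. \<bar>t k\<bar>)"
    by (simp only: sum_abs)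
  also have "\<dots> \<le> (\<Sum>k\<in>?W - {?k0}. \<epsilon> * \<bar>p\<bar> ^ M)"
    by (rule sum_mono) (rule small)
  \<comment> \<open>All 2^(2M) words are counted, a crude bound for the central binomial
    coefficient; this is the origin of 4^M in the thinness constant.\<close>
  also have "\<dots> \<le> 4 ^ M * (\<epsilon> * \<bar>p\<bar> ^ M)"
  proof -
    have "card (?W - {?k0}) \<le> card (idx ?d)" by (intro card_mono) auto
    then have "real (card (?W - {?k0})) \<le> real (2 ^ ?d)" unfolding card_idx by (simp only: of_nat_le_iff)
    also have "real (2 ^ ?d) = 4 ^ M" by (simp add: power_mult)
    finally have "real (card (?W - {?k0})) \<le> 4 ^ M" .
    then show ?thesis using eps by (simp add: mult_right_mono)
  qed
  also have "\<dots> = \<bar>p\<bar> ^ M / 2" by (simp add: \<epsilon>_def)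
  finally show ?thesis .
qed

section \<open>Neutral vectors\<close>

text \<open>For \<open>det B = 1\<close> this is the neutral vector of a translation along
  \<open>geod B\<close> in closed form: the columns are eigenvectors of \<open>area\<close> 1, so
  only the number of words remains of the normalization.\<close>

definition nvec :: "nat \<Rightarrow> real^2^2 \<Rightarrow> tensor" where
  "nvec n B = (\<lambda>k. real (card (words (4*n - 2) (2*n - 1))) powr (- 1/2) *
     sym_mono (4*n - 2) (column 1 B) (column 2 B) (2*n - 1) k)"

lemma odd_half_degree: "n \<ge> 1 \<Longrightarrow> odd (2*n - 1 :: nat)"
  by simp

lemma card_words_pos: "card (words (2 * M) M) > 0"
proof -
  have "replicate M 1 @ replicate M 2 \<in> words (2 * M) M"
    by (auto simp: idx_def count_list_eq_length_filter)
  moreover have "finite (words (2 * M) M)" by simp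
  ultimately show ?thesis using card_gt_0_iff by blast
qed

lemma nvec_sym: "nvec n B \<in> sym_tensors (4*n - 2)"
proof -
  have "(\<lambda>k. \<Sum>i\<in>{()}. c * T k) \<in> sym_tensors d" if "T \<in> sym_tensors d" for c T d
    using sym_tensors_sum[of "{()}" "\<lambda>_. T" d "\<lambda>_. c"] that by simp
  then show ?thesis using sym_mono_sym unfolding nvec_def by simp
qed

lemma nvec_mult: "nvec n (A ** B) = sigma_mat (4*n - 2) A (nvec n B)"
  by (simp add: nvec_def sigma_mat_scale sigma_mat_sym_mono column_mult)

lemma nvec_cong:
  assumes "n \<ge> 1" "column 1 B' = c *\<^sub>R column 1 B" "column 2 B' = d *\<^sub>R column 2 B" "c * d = 1"
  shows "nvec n B' = nvec n B"
proof -
  have "(c ^ (2*n - 1)) * d ^ (4*n - 2 - (2*n - 1)) = (c * d) ^ (2*n - 1)"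
  proof -
    have "4*n - 2 - (2*n - 1) = 2*n - 1" using assms(1) by simp
    then show ?thesis by (simp only: power_mult_distrib)
  qed
  then show ?thesis using assms by (simp add: nvec_def sym_mono_scaleR)
qed

lemma area_columns: "area (column 1 B) (column 2 B) = det B"
  by (simp add: area_def det_2 algebra_simps)

section \<open>Independence of the chosen eigenvectors\<close>

lemma vec2_expand:
  assumes "area x y = 1"
  shows "v = area v y *\<^sub>R x + area x v *\<^sub>R y"
proof -
  have *: "x$1 * y$2 - x$2 * y$1 = 1" using assms by (simp add: area_def)
  have "v$1 = v$1 * (x$1 * y$2 - x$2 * y$1)" "v$2 = v$2 * (x$1 * y$2 - x$2 * y$1)"
    unfolding * by simp_all
  then show ?thesis by (simp add: vec2_eq_iff area_def algebra_simps)
qed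

text \<open>\<open>neutral\<close> chooses its eigenvectors arbitrarily. The order of the moduli
  prevents an interchange of the eigenlines, so the choice amounts to scaling each vector.\<close>

lemma eigenframe_unique:
  assumes xy: "area x y = 1" and E: "E *v x = a *\<^sub>R x" "E *v y = d *\<^sub>R y" and ad: "\<bar>a\<bar> > \<bar>d\<bar>"
    and vw: "E *v v = \<kappa> *\<^sub>R v" "E *v w = \<mu> *\<^sub>R w" "\<bar>\<kappa>\<bar> > \<bar>\<mu>\<bar>" "area v w > 0"
  shows "\<exists>p q. v = p *\<^sub>R x \<and> w = q *\<^sub>R y \<and> p * q = area v w"
proof -
  have coord: "a * area u y = \<nu> * area u y \<and> d * area x u = \<nu> * area x u" if u: "E *v u = \<nu> *\<^sub>R u" for u \<nu>
  proof -
    have "E *v u = area u y *\<^sub>R (a *\<^sub>R x) + area x u *\<^sub>R (d *\<^sub>R y)"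
      by (subst vec2_expand[OF xy, of u]) (simp add: matrix_vector_right_distrib matrix_vector_mult_scaleR E)
    then have *: "\<nu> *\<^sub>R u = (a * area u y) *\<^sub>R x + (d * area x u) *\<^sub>R y" using u by (simp add: mult.commute)
    have lin: "area (b *\<^sub>R x + c *\<^sub>R y) y = b * area x y" "area x (b *\<^sub>R x + c *\<^sub>R y) = c * area x y" for b c
      by (simp_all add: area_def algebra_simps)
    have "area (\<nu> *\<^sub>R u) y = a * area u y" "area x (\<nu> *\<^sub>R u) = d * area x u"
      unfolding * lin xy by simp_all
    moreover have "area (\<nu> *\<^sub>R u) y = \<nu> * area u y" "area x (\<nu> *\<^sub>R u) = \<nu> * area x u"
      by (simp_all add: area_def algebra_simps)
    ultimately show ?thesis by metis
  qed
  define p q p' q' where "p = area v y" and "q = area x v" and "p' = area w y" and "q' = area x w"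
  have v: "v = p *\<^sub>R x + q *\<^sub>R y" and w: "w = p' *\<^sub>R x + q' *\<^sub>R y"
    unfolding p_def q_def p'_def q'_def by (rule vec2_expand[OF xy])+
  have ar: "area v w = p * q' - q * p'"
  proof -
    have "area v w = (p * q' - q * p') * area x y" unfolding v w by (simp add: area_def algebra_simps)
    then show ?thesis using xy by simp
  qed
  have c: "a * p = \<kappa> * p" "d * q = \<kappa> * q" "a * p' = \<mu> * p'" "d * q' = \<mu> * q'"
    using coord[OF vw(1)] coord[OF vw(2)] unfolding p_def q_def p'_def q'_def by auto
  have "p \<noteq> 0"
  proof
    assume "p = 0"
    then have "q \<noteq> 0" "p' \<noteq> 0" using ar vw(4) by auto
    then have "d = \<kappa>" "a = \<mu>" using c by auto
    then show False using ad vw(3) by simp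
  qed
  then have "a = \<kappa>" using c by simp
  then have "q = 0" using c ad by auto
  then have "q' \<noteq> 0" using ar vw(4) by auto
  then have "d = \<mu>" using c by simp
  then have "p' = 0" using c ad by auto
  then show ?thesis using v w \<open>q = 0\<close> ar by (intro exI[of _ p] exI[of _ q']) simp
qed

lemma translates_along_eigen:
  assumes "g \<in> carrier PSL2R" "det B = 1" "translates_along g B"
  shows "\<exists>\<kappa> \<mu>. rep g *v column 1 B = \<kappa> *\<^sub>R column 1 B \<and> rep g *v column 2 B = \<mu> *\<^sub>R column 2 B \<and> \<bar>\<kappa>\<bar> > \<bar>\<mu>\<bar>"
proof -
  obtain l where l: "l > 0" "\<And>t. act g (geod B t) = geod B (t + l)"
    using assms(3) unfolding translates_along_def by blast
  define E where "E = inv2 B ** (rep g ** B)"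
  have dE: "det E = 1" using assms by (simp add: E_def)
  have E: "moebius E (\<i> * of_real (exp t)) = \<i> * of_real (exp (t + l))" for t
  proof -
    have "moebius E (\<i> * of_real (exp t)) = moebius (inv2 B) (moebius (rep g) (moebius B (\<i> * of_real (exp t))))"
      unfolding E_def using assms by (simp add: moebius_mult moebius_in_HP)
    also have "\<dots> = moebius (inv2 B) (moebius B (\<i> * of_real (exp (t + l))))"
      using l(2)[of t] by (simp add: geod_def act_def)
    finally show ?thesis using assms by simp
  qed
  have eq: "E$1$2 = - E$2$1 * exp (2*t + l) \<and> E$1$1 = E$2$2 * exp l" for t
  proof -
    let ?z = "\<i> * complex_of_real (exp t)"
    have "of_real (E$1$1) * ?z + of_real (E$1$2) =
        \<i> * of_real (exp (t + l)) * (of_real (E$2$1) * ?z + of_real (E$2$2))"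
      using E[of t] moebius_denom_nz[OF dE, of ?z] unfolding moebius_def by (simp add: field_simps)
    then have "E$1$2 = - (exp (t + l) * (E$2$1 * exp t))" "E$1$1 * exp t = exp (t + l) * E$2$2"
      by (auto simp: complex_eq_iff)
    moreover have "exp (2*t + l) = exp (t + l) * exp t" "exp (t + l) = exp l * exp t" by (simp_all flip: exp_add add: add.commute)
    ultimately show ?thesis by simp
  qed
  \<comment> \<open>The first equation of \<open>eq\<close> holds for every \<open>t\<close>;
    comparing two times makes both off-diagonal entries vanish.\<close>
  have "E$2$1 * (exp (2 + l) - exp l) = 0" using eq[of 0] eq[of 1] by (simp add: algebra_simps)
  then have c: "E$2$1 = 0" by simp
  then have b: "E$1$2 = 0" using eq[of 0] by simp
  have nz: "E$2$2 \<noteq> 0" using dE b c by (auto simp: det_2)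
  have "rep g ** B = B ** E" unfolding E_def using assms by simp
  then have col: "rep g *v column j B = B *v column j E" for j by (metis column_mult)
  have "rep g *v column 1 B = E$1$1 *\<^sub>R column 1 B" "rep g *v column 2 B = E$2$2 *\<^sub>R column 2 B"
    unfolding col by (simp_all add: vec2_eq_iff b c)
  moreover have "\<bar>E$1$1\<bar> > \<bar>E$2$2\<bar>"
    using eq[of 0] nz l(1) by (simp add: abs_mult)
  ultimately show ?thesis by blast
qed

text \<open>Scaling the eigenvectors by \<open>p\<close> and \<open>q\<close> multiplies the
  monomial by the power 2n - 1 of \<open>p * q = area v w > 0\<close>, and the normalizing factor by
  the inverse of that power.\<close>

lemma neutral_translate:
  assumes n: "n \<ge> 1" and g: "g \<in> carrier PSL2R" "det B = 1" "translates_along g B"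
  shows "neutral n g = nvec n B"
proof -
  let ?M = "2*n - 1" and ?d = "4*n - 2"
  obtain a d where E: "rep g *v column 1 B = a *\<^sub>R column 1 B" "rep g *v column 2 B = d *\<^sub>R column 2 B" "\<bar>a\<bar> > \<bar>d\<bar>"
    using translates_along_eigen[OF g] by blast
  have ar: "area (column 1 B) (column 2 B) = 1" using g by (simp add: area_columns)
  have "eigen_frame g (column 1 B) (column 2 B)" unfolding eigen_frame_def using E ar by auto
  then have ex: "case (column 1 B, column 2 B) of (v1, v2) \<Rightarrow> eigen_frame g v1 v2" by simp
  obtain v w where vw: "(SOME (v1, v2). eigen_frame g v1 v2) = (v, w)" by fastforce
  have "eigen_frame g v w" using someI[of "\<lambda>(v1, v2). eigen_frame g v1 v2", OF ex] vw by simp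
  then obtain \<kappa> \<mu> where "\<bar>\<kappa>\<bar> > \<bar>\<mu>\<bar>" "rep g *v v = \<kappa> *\<^sub>R v" "rep g *v w = \<mu> *\<^sub>R w" and pos: "area v w > 0"
    unfolding eigen_frame_def by blast
  then obtain p q where pq: "v = p *\<^sub>R column 1 B" "w = q *\<^sub>R column 2 B" "p * q = area v w"
    using eigenframe_unique[OF ar E] by blast
  have d: "?d = 2 * ?M" using n by simp
  let ?C = "real (card (words ?d ?M))"
  have C: "?C > 0" using card_words_pos[of ?M] d by simp
  have "Bform ?d (sym_mono ?d v w ?M) (sym_mono ?d v w ?M) = ?C * area v w ^ ?d"
    using Bform_sym_mono[of ?M v w] odd_half_degree[OF n] d by simp
  then have "Bform ?d (sym_mono ?d v w ?M) (sym_mono ?d v w ?M) powr (-1/2) = ?C powr (-1/2) * (area v w ^ ?d) powr (-1/2)"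
    using C pos by (simp add: powr_mult)
  also have "(area v w ^ ?d) powr (-1/2) = area v w powr (real ?d * (-1/2))"
    using pos by (simp add: powr_powr flip: powr_realpow)
  also have "real ?d * (-1/2) = - real ?M"
  proof -
    have "real ?d = 2 * real ?M" by (simp only: d of_nat_mult of_nat_numeral)
    then show ?thesis by simp
  qed
  also have "area v w powr (- real ?M) = inverse (area v w ^ ?M)"
    using pos by (simp add: powr_minus powr_realpow)
  finally have N: "Bform ?d (sym_mono ?d v w ?M) (sym_mono ?d v w ?M) powr (-1/2) = ?C powr (-1/2) * inverse (area v w ^ ?M)" .
  have "sym_mono ?d v w ?M k = area v w ^ ?M * sym_mono ?d (column 1 B) (column 2 B) ?M k" for k
  proof -
    have "?d - ?M = ?M" using n by simp
    then have "p ^ ?M * q ^ (?d - ?M) = area v w ^ ?M" by (simp only: pq(3) flip: power_mult_distrib)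
    moreover have "?M \<le> ?d" using n by simp
    ultimately show ?thesis using sym_mono_scaleR[of ?M ?d p "column 1 B" q "column 2 B" k]
      unfolding pq(1,2)[symmetric] by simp
  qed
  then show ?thesis
    unfolding neutral_def vw Let_def prod.case nvec_def N using pos by (simp add: field_simps)
qed

section \<open>Directions at a point of a geodesic\<close>

lemma moebius_has_field_derivative:
  assumes "det A = 1" "z \<in> HP"
  shows "(moebius A has_field_derivative 1 / (of_real (A$2$1) * z + of_real (A$2$2))\<^sup>2) (at z)"
proof -
  have nz: "of_real (A$2$1) * z + of_real (A$2$2) \<noteq> (0::complex)" by (rule moebius_denom_nz[OF assms])
  have "complex_of_real (A$1$1 * A$2$2 - A$1$2 * A$2$1) = 1" using assms(1) by (simp add: det_2)
  then have *: "complex_of_real (A$1$1) * complex_of_real (A$2$2) - complex_of_real (A$1$2) * complex_of_real (A$2$1) = 1" by simp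
  have num: "of_real (A$1$1) * (of_real (A$2$1) * z + of_real (A$2$2)) - (of_real (A$1$1) * z + of_real (A$1$2)) * of_real (A$2$1) = (1::complex)"
    using * by (simp add: algebra_simps)
  have "((\<lambda>z. (of_real (A$1$1) * z + of_real (A$1$2)) / (of_real (A$2$1) * z + of_real (A$2$2))) has_field_derivative
     (of_real (A$1$1) * (of_real (A$2$1) * z + of_real (A$2$2)) - (of_real (A$1$1) * z + of_real (A$1$2)) * of_real (A$2$1)) /
       ((of_real (A$2$1) * z + of_real (A$2$2)) * (of_real (A$2$1) * z + of_real (A$2$2)))) (at z)"
    using nz by (auto intro!: derivative_eq_intros)
  then show ?thesis unfolding num moebius_def[abs_def] power2_eq_square .
qed

definition jgeod :: "real^2^2 \<Rightarrow> real \<Rightarrow> complex" where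
  "jgeod A t = of_real (A$2$1) * (\<i> * of_real (exp t)) + of_real (A$2$2)"

lemma jgeod_nz: "det A = 1 \<Longrightarrow> jgeod A t \<noteq> 0"
  unfolding jgeod_def by (rule moebius_denom_nz) auto

lemma vector_derivative_geod:
  assumes "det A = 1"
  shows "vector_derivative (geod A) (at t) = \<i> * of_real (exp t) / (jgeod A t)\<^sup>2"
proof -
  have "((\<lambda>t. \<i> * complex_of_real (exp t)) has_vector_derivative \<i> * of_real (exp t)) (at t)"
    by (auto intro!: derivative_eq_intros)
  from field_vector_diff_chain_at[OF this moebius_has_field_derivative[OF assms iexp_in_HP]]
  have "(geod A has_vector_derivative \<i> * of_real (exp t) * (1 / (jgeod A t)\<^sup>2)) (at t)"
    by (simp add: geod_def[abs_def] comp_def jgeod_def)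
  then show ?thesis by (simp add: vector_derivative_at)
qed

lemma pos_normal_geod: "det A = 1 \<Longrightarrow> pos_normal (geod A) t = of_real (exp t) / (jgeod A t)\<^sup>2"
  unfolding pos_normal_def by (simp add: vector_derivative_geod)

text \<open>Right multiplication by it is the geodesic flow for time \<open>t\<close>.\<close>

definition dg :: "real \<Rightarrow> real^2^2" where
  "dg t = mk2 (exp (t/2)) 0 0 (exp (- t/2))"

lemma det_dg [simp]: "det (dg t) = 1"
  by (simp add: dg_def flip: exp_add)

lemma geod_dg: "det A = 1 \<Longrightarrow> geod (A ** dg t) s = geod A (s + t)"
proof -
  have "moebius (dg t) (\<i> * of_real (exp s)) = \<i> * of_real (exp (s + t))"
    by (simp add: moebius_def dg_def exp_add exp_minus field_simps flip: of_real_mult exp_add)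
  then show "det A = 1 \<Longrightarrow> geod (A ** dg t) s = geod A (s + t)"
    unfolding geod_def by (simp add: moebius_mult)
qed

text \<open>For \<open>p^2 + q^2 = 1\<close> these matrices form the stabilizer of \<i>.\<close>

definition rot :: "real \<Rightarrow> real \<Rightarrow> real^2^2" where
  "rot p q = mk2 p (- q) q p"

text \<open>With both geodesics shifted to time 0, their matrices send \<i> to the same point and
  differ by an element of its stabilizer. Comparing tangents gives \<i> = cis \<theta> times the
  square of p + q\<i>, whence the double-angle formulas.\<close>

lemma at_angle_rotation:
  assumes A: "det A = 1" and at: "at_angle (geod A) s \<theta> B t"
  obtains p q where "B ** dg t = A ** dg s ** rot p q" "p\<^sup>2 + q\<^sup>2 = 1" "2 * p * q = cos \<theta>" "p\<^sup>2 - q\<^sup>2 = sin \<theta>"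
proof -
  have B: "det B = 1" and eq: "geod B t = geod A s"
    and ex: "\<exists>r>0. vector_derivative (geod B) (at t) = of_real r * cis \<theta> * pos_normal (geod A) s"
    using at unfolding at_angle_def by auto
  define E where "E = B ** dg t"
  define A0 where "A0 = A ** dg s"
  have d: "det E = 1" "det A0 = 1" using A B by (auto simp: E_def A0_def)
  define R where "R = inv2 A0 ** E"
  have dR: "det R = 1" using d by (simp add: R_def)
  have iHP: "\<i> \<in> HP" by (simp add: HP_def)
  have "moebius E \<i> = moebius A0 \<i>"
    using eq geod_dg[OF B, of t 0] geod_dg[OF A, of s 0] by (simp add: geod_def E_def A0_def)
  then have Ri: "moebius R \<i> = \<i>"
    unfolding R_def using d iHP moebius_mult[of "inv2 A0" E \<i>] by simp
  have "of_real (R$1$1) * \<i> + of_real (R$1$2) = \<i> * (of_real (R$2$1) * \<i> + of_real (R$2$2))"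
    using Ri moebius_denom_nz[OF dR iHP] unfolding moebius_def by (simp add: field_simps)
  then have R: "R$1$1 = R$2$2" "R$1$2 = - R$2$1" by (auto simp: complex_eq_iff)
  define p q where "p = R$1$1" and "q = R$2$1"
  have Rr: "R = rot p q" using R by (simp add: mat2_eq_iff rot_def p_def q_def)
  have pq: "p\<^sup>2 + q\<^sup>2 = 1" using dR by (simp add: Rr rot_def power2_eq_square)
  have EA: "E = A0 ** rot p q" unfolding Rr[symmetric] R_def using d by simp
  define jA where "jA = complex_of_real (A0$2$1) * \<i> + of_real (A0$2$2)"
  define jE where "jE = complex_of_real (E$2$1) * \<i> + of_real (E$2$2)"
  have jA0: "jA \<noteq> 0" unfolding jA_def by (rule moebius_denom_nz[OF d(2) iHP])
  have jEA: "jE = jA * Complex p q"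
    unfolding jE_def jA_def EA by (simp add: complex_eq_iff rot_def algebra_simps)
  have jdg: "(jgeod C u)\<^sup>2 = of_real (exp u) * (of_real ((C ** dg u)$2$1) * \<i> + of_real ((C ** dg u)$2$2))\<^sup>2" for C u
  proof -
    have e: "exp u = exp (u/2) * exp (u/2)" "exp (u/2) * exp (- u/2) = 1" by (simp_all flip: exp_add)
    have "jgeod C u = of_real (exp (u/2)) * (of_real ((C ** dg u)$2$1) * \<i> + of_real ((C ** dg u)$2$2))"
      using e by (simp add: jgeod_def dg_def complex_eq_iff)
    then show ?thesis unfolding e(1) by (simp add: power2_eq_square)
  qed
  have vB: "vector_derivative (geod B) (at t) = \<i> / jE\<^sup>2"
    unfolding vector_derivative_geod[OF B] jdg jE_def E_def by simp
  have pA: "pos_normal (geod A) s = 1 / jA\<^sup>2"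
    unfolding pos_normal_geod[OF A] jdg jA_def A0_def by simp
  obtain r where r: "r > 0" "\<i> / jE\<^sup>2 = of_real r * cis \<theta> * (1 / jA\<^sup>2)" using ex vB pA by auto
  have c0: "Complex p q \<noteq> 0" using pq by (auto simp: complex_eq_iff)
  have 1: "\<i> = of_real r * cis \<theta> * (Complex p q)\<^sup>2"
    using r(2) jA0 c0 unfolding jEA by (simp add: field_simps power_mult_distrib)
  have "cmod (Complex p q) = 1" using pq by (simp add: cmod_def)
  then have "cmod \<i> = r" using r(1) by (subst 1) (simp add: norm_mult norm_power)
  then have "r = 1" by simp
  with 1 have "cis (- \<theta>) * \<i> = cis (- \<theta>) * (cis \<theta> * (Complex p q)\<^sup>2)" by simp
  also have "\<dots> = (Complex p q)\<^sup>2" by (simp flip: mult.assoc add: cis_mult)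
  finally have "Re (cis (- \<theta>) * \<i>) = Re ((Complex p q)\<^sup>2)" "Im (cis (- \<theta>) * \<i>) = Im ((Complex p q)\<^sup>2)" by auto
  then have "sin \<theta> = p\<^sup>2 - q\<^sup>2" "cos \<theta> = 2 * p * q" by (auto simp: power2_eq_square)
  then show thesis using that[of p q] EA pq unfolding E_def A0_def by simp
qed

lemma at_angle_exists:
  assumes A: "det A = 1"
  shows "\<exists>B. at_angle (geod A) s \<theta> B 0"
proof -
  \<comment> \<open>The solution of \<i> = cis \<theta> times the square of cis \<psi>, the tangent
    condition found in \<open>at_angle_rotation\<close>.\<close>
  define \<psi> where "\<psi> = pi/4 - \<theta>/2"
  define B where "B = A ** dg s ** rot (cos \<psi>) (sin \<psi>)"
  have dr: "det (rot (cos \<psi>) (sin \<psi>)) = 1" by (simp add: rot_def power2_eq_square flip: power2_eq_square)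
  have B: "det B = 1" using A dr by (simp add: B_def)
  have iHP: "\<i> \<in> HP" by (simp add: HP_def)
  have nz: "complex_of_real (sin \<psi>) * \<i> + of_real (cos \<psi>) \<noteq> 0"
    using moebius_denom_nz[OF dr iHP] by (simp add: rot_def)
  have "moebius (rot (cos \<psi>) (sin \<psi>)) \<i> = \<i>"
    using nz by (simp add: moebius_def rot_def field_simps)
  then have "geod B 0 = geod (A ** dg s) 0"
    using A dr iHP by (simp add: B_def geod_def moebius_mult)
  then have eq: "geod B 0 = geod A s" using geod_dg[OF A, of s 0] by simp
  have j: "jgeod B 0 = jgeod (A ** dg s) 0 * cis \<psi>"
    unfolding jgeod_def B_def by (simp add: complex_eq_iff rot_def algebra_simps)
  have e: "exp s = exp (s/2) * exp (s/2)" "exp (s/2) * exp (- s/2) = 1" by (simp_all flip: exp_add)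
  have j2: "jgeod A s = of_real (exp (s/2)) * jgeod (A ** dg s) 0"
    using e by (simp add: jgeod_def dg_def complex_eq_iff)
  have "cis \<psi> ^ 2 = cis (pi/2 - \<theta>)" 
  proof -
    have "\<psi> + \<psi> = pi/2 - \<theta>" by (simp add: \<psi>_def)
    then show ?thesis by (simp only: power2_eq_square cis_mult)
  qed
  also have "\<dots> = \<i> / cis \<theta>" by (simp add: cis_divide[symmetric])
  finally have c: "cis \<psi> ^ 2 = \<i> / cis \<theta>" .
  have "vector_derivative (geod B) (at 0) = of_real 1 * cis \<theta> * pos_normal (geod A) s"
    unfolding vector_derivative_geod[OF B] pos_normal_geod[OF A] j j2 e(1) using jgeod_nz[of "A ** dg s" 0] A
    by (simp add: power_mult_distrib c power2_eq_square[of "complex_of_real (exp (s/2))"] field_simps)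
  then show ?thesis unfolding at_angle_def using B eq by (intro exI[of _ B]) (auto intro!: exI[of _ 1])
qed

lemma nvec_dg:
  assumes "n \<ge> 1"
  shows "nvec n (B ** dg t) = nvec n B"
  by (rule nvec_cong[OF assms, where c = "exp (t/2)" and d = "exp (- t/2)"])
    (simp_all add: vec2_eq_iff dg_def flip: exp_add)

text \<open>Sum and difference of the squares determine \<open>p\<close> and \<open>q\<close> up to
  signs, and the product relates the signs. So \<open>B\<close> is unique up to sign and time shift,
  neither of which affects \<open>nvec\<close>.\<close>

lemma at_angle_nvec_unique:
  assumes n: "n \<ge> 1" and A: "det A = 1" and B: "at_angle (geod A) s \<theta> B t" "at_angle (geod A) s \<theta> B' t'"
  shows "nvec n B = nvec n B'"
proof -
  obtain p q where 1: "B ** dg t = A ** dg s ** rot p q" "p\<^sup>2 + q\<^sup>2 = 1" "2 * p * q = cos \<theta>" "p\<^sup>2 - q\<^sup>2 = sin \<theta>"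
    using at_angle_rotation[OF A B(1)] by metis
  obtain p' q' where 2: "B' ** dg t' = A ** dg s ** rot p' q'" "p'\<^sup>2 + q'\<^sup>2 = 1" "2 * p' * q' = cos \<theta>" "p'\<^sup>2 - q'\<^sup>2 = sin \<theta>"
    using at_angle_rotation[OF A B(2)] by metis
  have "p\<^sup>2 = p'\<^sup>2" "q\<^sup>2 = q'\<^sup>2" using 1 2 by auto
  then have pq: "p = p' \<or> p = - p'" "q = q' \<or> q = - q'" by (auto simp: power2_eq_iff)
  then have "rot p q = rot p' q' \<or> rot p q = - rot p' q'"
    using 1(3) 2(3) by (auto simp: rot_def mat2_eq_iff)
  then have "B ** dg t = B' ** dg t' \<or> B ** dg t = - (B' ** dg t')" using 1(1) 2(1) by auto
  moreover have "nvec n (- C) = nvec n C" for C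
    by (rule nvec_cong[OF n, where c = "-1" and d = "-1"]) (simp_all add: vec2_eq_iff)
  ultimately have "nvec n (B ** dg t) = nvec n (B' ** dg t')" by metis
  then show ?thesis by (simp add: nvec_dg[OF n])
qed

text \<open>In the frame of \<open>A\<close> the two values are positive multiples of
  \<open>p * q\<close> and of its negative. The sign of cos \<theta> thus tells to which side the
  axis crosses; this is the form in which coherence of the angles is used.\<close>

lemma at_angle_bside:
  assumes A: "det A = 1" and at: "at_angle (geod A) s \<theta> B t"
  shows "sgn (bside A (column 1 B)) = sgn (cos \<theta>)" "sgn (bside A (column 2 B)) = - sgn (cos \<theta>)"
proof -
  obtain p q where 1: "B ** dg t = A ** dg s ** rot p q" "2 * p * q = cos \<theta>"
    using at_angle_rotation[OF A at] by metis
  have col: "column 1 (B ** dg t) = exp (t/2) *\<^sub>R column 1 B" "column 2 (B ** dg t) = exp (- t/2) *\<^sub>R column 2 B"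
    by (simp_all add: vec2_eq_iff dg_def)
  have bs: "bside A (column j (B ** dg t)) = bside (mat 1) (column j (dg s ** rot p q))" for j
  proof -
    have "column j (B ** dg t) = A *v column j (dg s ** rot p q)"
      unfolding 1(1) mat2_mult_assoc by (rule column_mult)
    then show ?thesis using bside_mult[OF A, of "mat 1" "column j (dg s ** rot p q)"] by simp
  qed
  have e: "exp (s/2) * exp (-s/2) = 1" by (simp flip: exp_add)
  have "(exp (t/2))\<^sup>2 * bside A (column 1 B) = p * q" "(exp (- t/2))\<^sup>2 * bside A (column 2 B) = - (p * q)"
    using bs[of 1] bs[of 2] e unfolding col bside_scaleR
    by (simp_all add: bside_def area_def dg_def rot_def algebra_simps)
  then have "bside A (column 1 B) = (p * q) / (exp (t/2))\<^sup>2" "bside A (column 2 B) = - (p * q) / (exp (- t/2))\<^sup>2"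
    by (simp_all add: field_simps)
  moreover have "sgn (p * q) = sgn (cos \<theta>)" using 1(2) by (simp add: sgn_mult flip: 1(2))
  ultimately show "sgn (bside A (column 1 B)) = sgn (cos \<theta>)" "sgn (bside A (column 2 B)) = - sgn (cos \<theta>)"
    by (simp_all add: sgn_mult sgn_divide)
qed

text \<open>The conjugate of \<open>dg 1\<close> by \<open>B\<close> shows that there is something
  to choose; by uniqueness of the axis up to flow and sign, every choice has the same neutral
  vector.\<close>

lemma strip_element_neutral:
  assumes n: "n \<ge> 1" and A: "det A = 1" and at: "at_angle (geod A) s \<theta> B t"
  shows "neutral n (SOME \<eta>. strip_element (geod A) s \<theta> \<eta>) = nvec n B"
proof -
  have B: "det B = 1" using at by (simp add: at_angle_def)
  define E where "E = B ** dg 1 ** inv2 B"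
  have dE: "det E = 1" using B by (simp add: E_def)
  define \<eta>0 where "\<eta>0 = {E, - E}"
  have c: "\<eta>0 \<in> carrier PSL2R" unfolding in_PSL2R_iff \<eta>0_def using dE by blast
  have r: "rep \<eta>0 = E \<or> rep \<eta>0 = - E" unfolding \<eta>0_def by (rule rep_pair[OF dE])
  have EB: "E ** B = B ** dg 1" unfolding E_def using B by (simp add: mat2_mult_assoc inv2_mult)
  have "act \<eta>0 (geod B u) = geod B (u + 1)" for u
    using act_geod[OF c B] r EB geod_dg[OF B, of 1 u] by auto
  then have tr: "translates_along \<eta>0 B" unfolding translates_along_def by (intro exI[of _ 1]) auto
  have Ec: "E *v column j B = B *v column j (dg 1)" for j
    using column_mult[of j E B] column_mult[of j B "dg 1"] EB by simp
  have E1: "E *v column 1 B = exp (1/2) *\<^sub>R column 1 B" "E *v column 2 B = exp (-1/2) *\<^sub>R column 2 B"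
    unfolding Ec by (simp_all add: vec2_eq_iff dg_def)
  have nz: "column 1 B \<noteq> 0" "column 2 B \<noteq> 0"
    using B area_columns[of B] unfolding area_def by (metis diff_self mult_zero_left mult_zero_right zero_index zero_neq_one)+
  have "(- E) *v v = - (E *v v)" for v by (simp add: vec2_eq_iff)
  then have "loxodromic \<eta>0"
    unfolding loxodromic_def using r E1 nz
    by (elim disjE) (rule exI[of _ "exp (1/2)"], rule exI[of _ "exp (-1/2)"], rule exI[of _ "column 1 B"], rule exI[of _ "column 2 B"], simp,
      rule exI[of _ "- exp (1/2)"], rule exI[of _ "- exp (-1/2)"], rule exI[of _ "column 1 B"], rule exI[of _ "column 2 B"], simp)
  then have "strip_element (geod A) s \<theta> \<eta>0" unfolding strip_element_def using c at tr by blast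
  then have "strip_element (geod A) s \<theta> (SOME \<eta>. strip_element (geod A) s \<theta> \<eta>)" by (rule someI)
  then obtain B' t' where "(SOME \<eta>. strip_element (geod A) s \<theta> \<eta>) \<in> carrier PSL2R"
      "at_angle (geod A) s \<theta> B' t'" "translates_along (SOME \<eta>. strip_element (geod A) s \<theta> \<eta>) B'"
    unfolding strip_element_def by blast
  then show ?thesis
    using neutral_translate[OF n, of _ B'] at_angle_nvec_unique[OF n A at, of B' t'] by (simp add: at_angle_def)
qed

text \<open>A Moebius map multiplies the tangents of both curves at their common point by the same
  complex number, its derivative.\<close>

lemma at_angle_mult:
  assumes G: "det G = 1" and A: "det A = 1" and at: "at_angle (geod A) s \<theta> B t"
  shows "at_angle (geod (G ** A)) s \<theta> (G ** B) t"
proof -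
  have B: "det B = 1" and eq: "geod B t = geod A s" using at by (auto simp: at_angle_def)
  obtain r where r: "r > 0" "vector_derivative (geod B) (at t) = of_real r * cis \<theta> * pos_normal (geod A) s"
    using at unfolding at_angle_def by auto
  have geq: "geod (G ** C) u = moebius G (geod C u)" if "det C = 1" for C u
    using moebius_geod[OF G that] by simp
  let ?D = "1 / (of_real (G$2$1) * geod A s + of_real (G$2$2))\<^sup>2 :: complex"
  have vd: "vector_derivative (geod (G ** C)) (at u) = ?D * vector_derivative (geod C) (at u)"
    if C: "det C = 1" "geod C u = geod A s" for C u
  proof -
    have "jgeod (G ** C) u = (of_real (G$2$1) * geod C u + of_real (G$2$2)) * jgeod C u"
      using jgeod_nz[OF C(1), of u] unfolding jgeod_def geod_def moebius_def
      by (simp add: field_simps)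
    then show ?thesis using C G by (simp add: vector_derivative_geod power_mult_distrib)
  qed
  have "vector_derivative (geod (G ** B)) (at t) = of_real r * cis \<theta> * pos_normal (geod (G ** A)) s"
    unfolding pos_normal_def vd[OF B eq] vd[OF A refl] using r(2) by (simp add: pos_normal_def)
  then show ?thesis unfolding at_angle_def using G A B r(1) geq eq by auto
qed

section \<open>Signed crossings\<close>

text \<open>At a point of \<open>geod A\<close> the gradient of \<open>side A\<close> is a positive
  multiple of the positive normal. Transversality thereby becomes a nonzero derivative, and the
  crossing sign the sign of this derivative.\<close>

lemma side_curve_derivative:
  assumes A: "det A = 1" and c: "(c has_vector_derivative w) (at \<tau>)" and cr: "c \<tau> = geod A r"
  obtains D where "((\<lambda>t. side A (c t)) has_real_derivative D) (at \<tau>)" "sgn D = sgn (pos_normal (geod A) r \<bullet> w)"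
proof -
  \<comment> \<open>The gradient of \<open>side A\<close> at \<open>c \<tau>\<close>, as a complex
    number.\<close>
  define G where "G = of_real (- 2 * A$2$1 * A$2$2) * c \<tau> + of_real (A$1$1 * A$2$2 + A$1$2 * A$2$1)"
  have Re: "((\<lambda>t. Re (c t)) has_real_derivative Re w) (at \<tau>)" "((\<lambda>t. Im (c t)) has_real_derivative Im w) (at \<tau>)"
    using c by (auto simp: has_vector_derivative_complex_iff)
  have D: "((\<lambda>t. side A (c t)) has_real_derivative G \<bullet> w) (at \<tau>)"
    unfolding side_def cmod_power2
    by (rule derivative_eq_intros Re refl)+ (simp add: G_def inner_complex_def algebra_simps)
  let ?j = "jgeod A r"
  have nz: "?j \<noteq> 0" by (rule jgeod_nz[OF A])
  have "complex_of_real (A$1$1 * A$2$2 - A$1$2 * A$2$1) = 1" using A by (simp add: det_2)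
  then have *: "complex_of_real (A$1$1) * complex_of_real (A$2$2) = 1 + complex_of_real (A$1$2) * complex_of_real (A$2$1)"
    by (simp add: algebra_simps)
  have "G * ?j = of_real (- 2 * A$2$1 * A$2$2) * (of_real (A$1$1) * (\<i> * of_real (exp r)) + of_real (A$1$2)) +
      of_real (A$1$1 * A$2$2 + A$1$2 * A$2$1) * ?j"
    using nz unfolding G_def cr geod_def moebius_def jgeod_def by (simp add: field_simps)
  also have "\<dots> = cnj ?j"
  proof -
    have 1: "A$1$1 * A$2$2 - A$1$2 * A$2$1 = 1" using A by (simp add: det_2)
    have "(A$1$1 * A$2$2 + A$1$2 * A$2$1) * A$2$2 - 2 * A$2$1 * A$2$2 * A$1$2 = (A$1$1 * A$2$2 - A$1$2 * A$2$1) * A$2$2"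
      "(A$1$1 * A$2$2 + A$1$2 * A$2$1) * (A$2$1 * exp r) - 2 * A$2$1 * A$2$2 * (A$1$1 * exp r) =
        (A$1$1 * A$2$2 - A$1$2 * A$2$1) * - (A$2$1 * exp r)"
      by (simp_all add: algebra_simps)
    then show ?thesis unfolding 1 by (simp add: complex_eq_iff jgeod_def)
  qed
  finally have "G = cnj ?j / ?j" using nz by (simp add: field_simps)
  also have "\<dots> = of_real ((cmod ?j)\<^sup>2 / exp r) * pos_normal (geod A) r"
  proof -
    have "of_real ((cmod ?j)\<^sup>2 / exp r) * pos_normal (geod A) r = of_real ((cmod ?j)\<^sup>2) / ?j\<^sup>2"
      unfolding pos_normal_geod[OF A] by simp
    also have "\<dots> = cnj ?j / ?j"
      using nz unfolding complex_norm_square by (simp add: power2_eq_square)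
    finally show ?thesis by simp
  qed
  finally have G: "G = ((cmod ?j)\<^sup>2 / exp r) *\<^sub>R pos_normal (geod A) r" by (simp add: scaleR_conv_of_real)
  have "sgn (G \<bullet> w) = sgn (pos_normal (geod A) r \<bullet> w)"
    unfolding G inner_scaleR_left sgn_mult using nz by simp
  then show thesis using that D by blast
qed

lemma deriv_nonzero_sign:
  fixes f :: "real \<Rightarrow> real"
  assumes "(f has_real_derivative D) (at x)" "D \<noteq> 0" "f x = 0"
  obtains d where "d > 0" "\<And>h. 0 < h \<Longrightarrow> h < d \<Longrightarrow> sgn (f (x + h)) = sgn D \<and> sgn (f (x - h)) = - sgn D"
proof (cases "D > 0")
  case True
  obtain d1 d2 where "d1 > 0" "\<forall>h>0. h < d1 \<longrightarrow> f x < f (x + h)" "d2 > 0" "\<forall>h>0. h < d2 \<longrightarrow> f (x - h) < f x"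
    using DERIV_pos_inc_right[OF assms(1) True] DERIV_pos_inc_left[OF assms(1) True] by blast
  then show thesis using that[of "min d1 d2"] True assms(3) by simp
next
  case False
  then have D: "D < 0" using assms(2) by simp
  obtain d1 d2 where "d1 > 0" "\<forall>h>0. h < d1 \<longrightarrow> f x > f (x + h)" "d2 > 0" "\<forall>h>0. h < d2 \<longrightarrow> f (x - h) > f x"
    using DERIV_neg_dec_right[OF assms(1) D] DERIV_neg_dec_left[OF assms(1) D] by blast
  then show thesis using that[of "min d1 d2"] D assms(3) by simp
qed

lemma sgn_eq_no_zero:
  fixes f :: "real \<Rightarrow> real"
  assumes "continuous_on {a..b} f" "a \<le> b" "\<And>t. t \<in> {a..b} \<Longrightarrow> f t \<noteq> 0"
  shows "sgn (f a) = sgn (f b)"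
proof (rule ccontr)
  assume "sgn (f a) \<noteq> sgn (f b)"
  moreover have "f a \<noteq> 0" "f b \<noteq> 0" using assms by auto
  ultimately consider "f a \<le> 0" "0 \<le> f b" | "f b \<le> 0" "0 \<le> f a" by (auto simp: sgn_if split: if_splits)
  then obtain t where "t \<in> {a..b}" "f t = 0"
    using IVT'[of f a 0 b] IVT2'[of f b 0 a] assms(1,2) by cases auto
  then show False using assms(3) by blast
qed

text \<open>Zeros with nonzero derivative are isolated, hence finite in number on a compact
  interval, and \<open>f\<close> changes sign at each of them; the sum telescopes.\<close>

lemma sum_sgn_zeros:
  fixes f D :: "real \<Rightarrow> real"
  assumes "continuous_on {a..b} f" "a \<le> b" "f a \<noteq> 0" "f b \<noteq> 0"
    and "\<And>t. t \<in> {a..b} \<Longrightarrow> f t = 0 \<Longrightarrow> (f has_real_derivative D t) (at t) \<and> D t \<noteq> 0"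
  shows "finite {t\<in>{a..b}. f t = 0} \<and> (\<Sum>t | t \<in> {a..b} \<and> f t = 0. sgn (D t)) = (sgn (f b) - sgn (f a)) / 2"
proof -
  define Z where "Z a = {t\<in>{a..b}. f t = 0}" for a
  have fin: "finite (Z a)"
  proof (rule ccontr)
    assume inf: "infinite (Z a)"
    have "closed ({a..b} \<inter> f -` {0})" using assms(1) by (intro continuous_closed_preimage) auto
    moreover have "Z a = {a..b} \<inter> f -` {0}" by (auto simp: Z_def)
    ultimately have cl: "closed (Z a)" by simp
    have "bounded (Z a)" by (rule bounded_subset[of "{a..b}"]) (auto simp: Z_def)
    then obtain x where x: "x islimpt Z a" using bounded_infinite_imp_islimpt inf by blast
    then have "x \<in> Z a" using cl closed_limpt by blast
    then obtain d where d: "d > 0" "\<And>h. 0 < h \<Longrightarrow> h < d \<Longrightarrow> sgn (f (x + h)) = sgn (D x) \<and> sgn (f (x - h)) = - sgn (D x)"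
        and Dx: "D x \<noteq> 0"
    proof -
      have *: "(f has_real_derivative D x) (at x)" "D x \<noteq> 0" "f x = 0"
        using assms(5)[of x] \<open>x \<in> Z a\<close> by (auto simp: Z_def)
      show thesis using deriv_nonzero_sign[OF *] *(2) that by blast
    qed
    obtain y where y: "y \<in> Z a" "y \<noteq> x" "dist y x < d" using x d(1) unfolding islimpt_approachable by blast
    then have "f y = 0" by (simp add: Z_def)
    moreover have "f y \<noteq> 0"
      using d(2)[of "\<bar>y - x\<bar>"] y Dx by (cases "y > x") (auto simp: dist_real_def sgn_0_0)
    ultimately show False by simp
  qed
  have "card (Z a) = k \<Longrightarrow> continuous_on {a..b} f \<Longrightarrow> a \<le> b \<Longrightarrow> f a \<noteq> 0 \<Longrightarrow> finite (Z a) \<Longrightarrow>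
     (\<And>t. t \<in> {a..b} \<Longrightarrow> f t = 0 \<Longrightarrow> (f has_real_derivative D t) (at t) \<and> D t \<noteq> 0) \<Longrightarrow>
     (\<Sum>t\<in>Z a. sgn (D t)) = (sgn (f b) - sgn (f a)) / 2" for k
  proof (induction k arbitrary: a)
    case 0
    then have "Z a = {}" by simp
    then have "f t \<noteq> 0" if "t \<in> {a..b}" for t using that by (auto simp: Z_def)
    then show ?case using sgn_eq_no_zero[of a b f] 0 \<open>Z a = {}\<close> by simp
  next
    case (Suc k)
    define t0 where "t0 = Min (Z a)"
    have ne: "Z a \<noteq> {}" using Suc.prems(1) by auto
    have t0: "t0 \<in> Z a" and least: "\<And>t. t \<in> Z a \<Longrightarrow> t0 \<le> t"
      unfolding t0_def using Suc.prems(5) ne by auto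
    then have t: "t0 \<in> {a..b}" "f t0 = 0" by (auto simp: Z_def)
    have lt: "a < t0" "t0 < b" using t Suc.prems(4) assms(4) by (metis atLeastAtMost_iff order_le_less)+
    obtain d where d: "d > 0" "\<And>h. 0 < h \<Longrightarrow> h < d \<Longrightarrow> sgn (f (t0 + h)) = sgn (D t0) \<and> sgn (f (t0 - h)) = - sgn (D t0)"
      using Suc.prems(6)[OF t] deriv_nonzero_sign[of f "D t0" t0] t(2) by metis
    have D0: "D t0 \<noteq> 0" using Suc.prems(6)[OF t] by simp
    \<comment> \<open>So small that on both sides of the first zero the sign of \<open>f\<close> is
      dictated by the derivative; the interval that starts at \<open>t0 + h\<close> then misses
      exactly this zero.\<close>
    define h where "h = min d (min (b - t0) (t0 - a)) / 2"
    have h: "0 < h" "h < d" "t0 + h < b" "a < t0 - h"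
    proof -
      have "min d (min (b - t0) (t0 - a)) > 0" using d lt by simp
      moreover have "min d (min (b - t0) (t0 - a)) \<le> d" "min d (min (b - t0) (t0 - a)) \<le> b - t0"
        "min d (min (b - t0) (t0 - a)) \<le> t0 - a" by auto
      ultimately show "0 < h" "h < d" "t0 + h < b" "a < t0 - h" unfolding h_def by linarith+
    qed
    define a' where "a' = t0 + h"
    have sub: "{a'..b} \<subseteq> {a..b}" using h lt unfolding a'_def by auto
    have "Z a \<subseteq> insert t0 (Z a')"
    proof
      fix u assume u: "u \<in> Z a"
      show "u \<in> insert t0 (Z a')"
      proof (cases "u = t0")
        case False
        then have "u > t0" using least[OF u] by simp
        moreover have "\<not> u < a'" using d(2)[of "u - t0"] h u \<open>u > t0\<close> D0 unfolding a'_def Z_def by (auto simp: sgn_0_0)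
        ultimately show ?thesis using u unfolding Z_def by auto
      qed simp
    qed
    moreover have "insert t0 (Z a') \<subseteq> Z a" using t sub by (auto simp: Z_def)
    ultimately have Za': "Z a = insert t0 (Z a')" by blast
    have nin: "t0 \<notin> Z a'" using h by (auto simp: Z_def a'_def)
    have fa': "sgn (f a') = sgn (D t0)" using d(2)[OF h(1,2)] by (simp add: a'_def)
    have fin': "finite (Z a')" using Suc.prems(5) Za' by simp
    have "(\<Sum>t\<in>Z a'. sgn (D t)) = (sgn (f b) - sgn (f a')) / 2"
    proof (rule Suc.IH)
      show "card (Z a') = k" using Suc.prems(1) Za' nin fin' by simp
      show "continuous_on {a'..b} f" using continuous_on_subset[OF Suc.prems(2) sub] .
      show "a' \<le> b" using h by (simp add: a'_def)
      show "f a' \<noteq> 0" using fa' D0 by (auto simp: sgn_0_0)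
    qed (use fin' sub Suc.prems(6) in auto)
    moreover have "sgn (f a) = sgn (f (t0 - h))"
    proof (rule sgn_eq_no_zero[of a "t0 - h" f])
      show "continuous_on {a..t0 - h} f" by (rule continuous_on_subset[OF Suc.prems(2)]) (use h lt in auto)
      show "f u \<noteq> 0" if "u \<in> {a..t0 - h}" for u
        using least[of u] that h lt unfolding Z_def by force
    qed (use h in simp)
    ultimately show ?case using Za' nin fin' fa' d(2)[OF h(1,2)] by (simp add: field_simps)
  qed
  from this[OF refl assms(1-3) fin assms(5)] fin show ?thesis by (simp add: Z_def)
qed

section \<open>Lifts of the arcs\<close>

lemma same_sign_connected:
  fixes f :: "'a::topological_space \<Rightarrow> real"
  assumes "connected S" "continuous_on S f" "\<And>x. x \<in> S \<Longrightarrow> f x \<noteq> 0" "x \<in> S" "y \<in> S"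
  shows "f x * f y > 0"
proof (rule ccontr)
  assume "\<not> f x * f y > 0"
  then have *: "f x \<le> 0 \<and> 0 \<le> f y \<or> f y \<le> 0 \<and> 0 \<le> f x" by (auto simp: zero_less_mult_iff)
  have "connected (f ` S)" using assms by (simp add: connected_continuous_image)
  then have "0 \<in> f ` S"
    using * assms(4,5) connectedD_interval[of "f ` S" "f x" "f y" 0] connectedD_interval[of "f ` S" "f y" "f x" 0]
    by (meson imageI)
  then show False using assms(3) by auto
qed

lemma continuous_on_geod: "det A = 1 \<Longrightarrow> continuous_on S (geod A)"
  unfolding geod_def[abs_def]
  by (rule continuous_on_compose2[OF continuous_on_moebius]) (auto intro!: continuous_intros)

lemma connected_range_geod: "det A = 1 \<Longrightarrow> connected (range (geod A))"
  using connected_continuous_image[OF continuous_on_geod connected_UNIV] .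

locale arc_system =
  fixes \<Gamma> :: "psl set" and m :: nat and a :: "nat \<Rightarrow> real^2^2"
  assumes discrete: "discrete_subgroup \<Gamma>" and free: "fg_free \<Gamma>" and cutting: "cutting_arcs \<Gamma> m a"
begin

text \<open>Lifts are indexed by pairs, with \<open>lm\<close> supplying a matrix;
  \<open>lifts_disjoint\<close> shows that no geodesic is listed twice.\<close>

definition lifts :: "(nat \<times> psl) set" where
  "lifts = {..<m} \<times> \<Gamma>"

definition lm :: "nat \<times> psl \<Rightarrow> real^2^2" where
  "lm L = rep (snd L) ** a (fst L)"

definition Y :: "complex set" where
  "Y = {z \<in> HP. \<forall>L\<in>lifts. side (lm L) z \<noteq> 0}"

definition sep :: "complex \<Rightarrow> complex \<Rightarrow> (nat \<times> psl) set" where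
  "sep x y = {L \<in> lifts. side (lm L) x * side (lm L) y < 0}"

definition tr :: "psl \<Rightarrow> nat \<times> psl \<Rightarrow> nat \<times> psl" where
  "tr h L = (fst L, h \<otimes>\<^bsub>PSL2R\<^esub> snd L)"

sublocale PSL: group PSL2R by (rule group_PSL2R)

lemma subgroup_\<Gamma>: "subgroup \<Gamma> PSL2R"
  using discrete by (simp add: discrete_subgroup_def)

lemma \<Gamma>_carrier [simp]: "g \<in> \<Gamma> \<Longrightarrow> g \<in> carrier PSL2R"
  using subgroup.mem_carrier[OF subgroup_\<Gamma>] .

lemma \<Gamma>_closed [simp]: "g \<in> \<Gamma> \<Longrightarrow> h \<in> \<Gamma> \<Longrightarrow> g \<otimes>\<^bsub>PSL2R\<^esub> h \<in> \<Gamma>" "g \<in> \<Gamma> \<Longrightarrow> inv\<^bsub>PSL2R\<^esub> g \<in> \<Gamma>"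
  "{mat 1, - mat 1} \<in> \<Gamma>"
  using subgroup.m_closed[OF subgroup_\<Gamma>] subgroup.m_inv_closed[OF subgroup_\<Gamma>] subgroup.one_closed[OF subgroup_\<Gamma>]
  by auto

lemma PSL2R_l_one [simp]: "g \<in> carrier PSL2R \<Longrightarrow> {mat 1, - mat 1} \<otimes>\<^bsub>PSL2R\<^esub> g = g"
  using PSL.l_one by simp

lemma det_a [simp]: "i < m \<Longrightarrow> det (a i) = 1"
  using cutting by (simp add: cutting_arcs_def)

lemma det_lm [simp]: "L \<in> lifts \<Longrightarrow> det (lm L) = 1"
  by (auto simp: lifts_def lm_def)

lemma lift_curve_eq: "(i, g) \<in> lifts \<Longrightarrow> lift_curve a i g = geod (lm (i, g))"
  by (auto simp: lifts_def lm_def lift_curve_def fun_eq_iff act_geod)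

lemma tr_lifts [simp]: "h \<in> \<Gamma> \<Longrightarrow> L \<in> lifts \<Longrightarrow> tr h L \<in> lifts"
  by (auto simp: lifts_def tr_def)

lemma lm_tr: "h \<in> \<Gamma> \<Longrightarrow> L \<in> lifts \<Longrightarrow> lm (tr h L) = rep h ** lm L \<or> lm (tr h L) = - (rep h ** lm L)"
  using rep_mult[of h "snd L"] by (auto simp: lifts_def tr_def lm_def mat2_mult_assoc)

lemma tr_inv [simp]: "h \<in> \<Gamma> \<Longrightarrow> L \<in> lifts \<Longrightarrow> tr (inv\<^bsub>PSL2R\<^esub> h) (tr h L) = L"
  "h \<in> \<Gamma> \<Longrightarrow> L \<in> lifts \<Longrightarrow> tr h (tr (inv\<^bsub>PSL2R\<^esub> h) L) = L"
  by (auto simp: lifts_def tr_def PSL.m_assoc[symmetric])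

lemma sgn_side_tr:
  "h \<in> \<Gamma> \<Longrightarrow> L \<in> lifts \<Longrightarrow> z \<in> HP \<Longrightarrow> sgn (side (lm (tr h L)) (act h z)) = sgn (side (lm L) z)"
  using sgn_side_act[of h "lm L" z] lm_tr[of h L] by auto

lemma bside_tr:
  "h \<in> \<Gamma> \<Longrightarrow> L \<in> lifts \<Longrightarrow> bside (lm (tr h L)) (rep h *v v) = bside (lm L) v"
  using bside_mult[of "rep h" "lm L" v] lm_tr[of h L] by auto

section \<open>Orbits, disjointness and local finiteness of the lifts\<close>

lemma proj_eq_iff:
  assumes "z \<in> HP"
  shows "proj \<Gamma> z = proj \<Gamma> w \<longleftrightarrow> (\<exists>g\<in>\<Gamma>. w = act g z)"
proof
  assume "proj \<Gamma> z = proj \<Gamma> w"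
  moreover have "w \<in> proj \<Gamma> w" unfolding proj_def by (rule image_eqI[of _ _ "{mat 1, - mat 1}"]) auto
  ultimately show "\<exists>g\<in>\<Gamma>. w = act g z" unfolding proj_def by auto
next
  assume "\<exists>g\<in>\<Gamma>. w = act g z"
  then obtain g where g: "g \<in> \<Gamma>" "w = act g z" by blast
  show "proj \<Gamma> z = proj \<Gamma> w"
  proof
    show "proj \<Gamma> z \<subseteq> proj \<Gamma> w"
    proof
      fix u assume "u \<in> proj \<Gamma> z"
      then obtain h where h: "h \<in> \<Gamma>" "u = act h z" unfolding proj_def by auto
      have "u = act (h \<otimes>\<^bsub>PSL2R\<^esub> inv\<^bsub>PSL2R\<^esub> g) w"
        using g h assms by (simp add: act_mult act_inv)
      then show "u \<in> proj \<Gamma> w" unfolding proj_def using g h by auto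
    qed
    show "proj \<Gamma> w \<subseteq> proj \<Gamma> z"
    proof
      fix u assume "u \<in> proj \<Gamma> w"
      then obtain h where h: "h \<in> \<Gamma>" "u = act h w" unfolding proj_def by auto
      have "u = act (h \<otimes>\<^bsub>PSL2R\<^esub> g) z"
        using g h assms by (simp add: act_mult)
      then show "u \<in> proj \<Gamma> z" unfolding proj_def using g h by auto
    qed
  qed
qed

lemma act_eq_imp:
  assumes "g \<in> \<Gamma>" "h \<in> \<Gamma>" "z \<in> HP" "act g z = act h z"
  shows "g = h"
proof -
  have "act (inv\<^bsub>PSL2R\<^esub> h \<otimes>\<^bsub>PSL2R\<^esub> g) z = z"
    using assms by (simp add: act_mult act_inv)
  then have "inv\<^bsub>PSL2R\<^esub> h \<otimes>\<^bsub>PSL2R\<^esub> g = \<one>\<^bsub>PSL2R\<^esub>"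
    using act_free[OF discrete free _ assms(3), of "inv\<^bsub>PSL2R\<^esub> h \<otimes>\<^bsub>PSL2R\<^esub> g"] assms(1,2) by simp
  then show ?thesis using assms PSL.inv_solve_left'[of "\<one>\<^bsub>PSL2R\<^esub>" h g] PSL.r_one[of h] by (simp del: PSL2R_one)
qed

text \<open>A common point projects to both arcs, so the arcs coincide; then the embedding
  identifies the parameters, and freeness of the action identifies the group elements.\<close>

lemma lifts_disjoint:
  assumes L: "L \<in> lifts" "L' \<in> lifts" and eq: "geod (lm L) s = geod (lm L') t"
  shows "L = L'"
proof -
  obtain i g j h where ij: "L = (i, g)" "L' = (j, h)" "i < m" "j < m" "g \<in> \<Gamma>" "h \<in> \<Gamma>"
    using L by (auto simp: lifts_def)
  have e: "act g (geod (a i) s) = act h (geod (a j) t)"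
    using eq ij by (simp add: lm_def act_geod)
  have H: "geod (a i) s \<in> HP" "geod (a j) t \<in> HP" using ij by auto
  have p: "proj \<Gamma> (geod (a i) s) = proj \<Gamma> (geod (a j) t)"
    using proj_eq_iff[OF H(1), of "act g (geod (a i) s)"] proj_eq_iff[OF H(2), of "act h (geod (a j) t)"] ij e by metis
  then have "arc_image \<Gamma> a i \<inter> arc_image \<Gamma> a j \<noteq> {}"
    unfolding arc_image_def by blast
  then have 1: "i = j" using cutting ij(3,4) unfolding cutting_arcs_def by blast
  have "embedding_map euclideanreal (surface \<Gamma>) (\<lambda>t. proj \<Gamma> (geod (a i) t))"
    using cutting ij(3) unfolding cutting_arcs_def by blast
  then have "inj (\<lambda>t. proj \<Gamma> (geod (a i) t))"
    unfolding embedding_map_def by (metis homeomorphic_imp_injective_map topspace_euclidean)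
  then have "s = t" using p 1 by (simp add: inj_def)
  then have "g = h" using act_eq_imp[OF ij(5,6) H(1)] e 1 by simp
  then show ?thesis using ij 1 by simp
qed

lemma topspace_surface: "topspace (surface \<Gamma>) = proj \<Gamma> ` HP"
proof
  have "{z \<in> HP. proj \<Gamma> z \<in> proj \<Gamma> ` HP} = HP" by auto
  then have "openin (surface \<Gamma>) (proj \<Gamma> ` HP)" using open_HP by (simp add: openin_surface)
  then show "proj \<Gamma> ` HP \<subseteq> topspace (surface \<Gamma>)" by (rule openin_subset)
  show "topspace (surface \<Gamma>) \<subseteq> proj \<Gamma> ` HP"
    using openin_topspace[of "surface \<Gamma>"] unfolding openin_surface by blast
qed

lemma continuous_map_proj: "continuous_map (top_of_set HP) (surface \<Gamma>) (proj \<Gamma>)"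
proof -
  show ?thesis
    unfolding continuous_map_def topspace_surface
  proof (intro conjI allI impI)
    fix U assume "openin (surface \<Gamma>) U"
    then have "open {z \<in> HP. proj \<Gamma> z \<in> U}" by (simp add: openin_surface)
    then show "openin (top_of_set HP) {x \<in> topspace (top_of_set HP). proj \<Gamma> x \<in> U}"
      using open_HP by (simp add: openin_open_eq)
  qed auto
qed

text \<open>By properness of the arc, the parameters of its points lying over \<open>C\<close> form
  a compact set \<open>T\<close>. A translate of the arc by \<open>g\<close> meets \<open>C\<close>
  only if \<open>g\<close> moves some point of the compact set \<open>D\<close> into
  \<open>D\<close>.\<close>

lemma lifts_locally_finite:
  assumes C: "compact C" "C \<subseteq> HP"
  shows "finite {L \<in> lifts. \<exists>t. geod (lm L) t \<in> C}"
proof -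
  have "finite {g \<in> \<Gamma>. \<exists>t. geod (lm (i, g)) t \<in> C}" if i: "i < m" for i
  proof -
    define T where "T = {t. proj \<Gamma> (geod (a i) t) \<in> proj \<Gamma> ` C}"
    have "compactin (surface \<Gamma>) (proj \<Gamma> ` C)"
      by (rule image_compactin[OF _ continuous_map_proj]) (use C in \<open>simp add: compactin_subtopology\<close>)
    moreover have "proper_map euclideanreal (surface \<Gamma>) (\<lambda>t. proj \<Gamma> (geod (a i) t))"
      using cutting i unfolding cutting_arcs_def by blast
    ultimately have "compactin euclideanreal {t \<in> topspace euclideanreal. proj \<Gamma> (geod (a i) t) \<in> proj \<Gamma> ` C}"
      using compactin_proper_map_preimage by blast
    then have T: "compact T" by (simp add: T_def)
    define D where "D = C \<union> geod (a i) ` T"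
    have D: "compact D" "D \<subseteq> HP"
      unfolding D_def using C T i by (auto intro!: compact_Un compact_continuous_image continuous_on_geod)
    have "{g \<in> \<Gamma>. \<exists>t. geod (lm (i, g)) t \<in> C} \<subseteq> {g \<in> \<Gamma>. \<exists>z\<in>D. act g z \<in> D}"
    proof
      fix g assume "g \<in> {g \<in> \<Gamma>. \<exists>t. geod (lm (i, g)) t \<in> C}"
      then obtain t where g: "g \<in> \<Gamma>" "geod (lm (i, g)) t \<in> C" by blast
      then have gt: "act g (geod (a i) t) \<in> C" using i by (simp add: lm_def act_geod)
      have "proj \<Gamma> (geod (a i) t) = proj \<Gamma> (act g (geod (a i) t))"
        using proj_eq_iff[of "geod (a i) t"] i g by auto
      then have "t \<in> T" unfolding T_def using gt by blast
      then show "g \<in> {g \<in> \<Gamma>. \<exists>z\<in>D. act g z \<in> D}" using g gt unfolding D_def by blast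
    qed
    then show ?thesis using properly_discontinuous[OF discrete D] finite_subset by blast
  qed
  then have "finite (\<Union>i<m. Pair i ` {g \<in> \<Gamma>. \<exists>t. geod (lm (i, g)) t \<in> C})" by auto
  moreover have "{L \<in> lifts. \<exists>t. geod (lm L) t \<in> C} \<subseteq> (\<Union>i<m. Pair i ` {g \<in> \<Gamma>. \<exists>t. geod (lm (i, g)) t \<in> C})"
    unfolding lifts_def by auto
  ultimately show ?thesis by (rule finite_subset[rotated])
qed

lemma lifts_locally_finite':
  assumes "compact C" "C \<subseteq> HP"
  shows "finite {L \<in> lifts. \<exists>z\<in>C. side (lm L) z = 0}"
proof -
  have "{L \<in> lifts. \<exists>z\<in>C. side (lm L) z = 0} \<subseteq> {L \<in> lifts. \<exists>t. geod (lm L) t \<in> C}"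
    using side_eq_0_iff assms(2) by fastforce
  then show ?thesis using lifts_locally_finite[OF assms] finite_subset by blast
qed

text \<open>One disk serves all lifts at once: only the finitely many lifts meeting a fixed closed
  disk about \<open>z\<close> require shrinking.\<close>

lemma HP_neighbourhood:
  assumes z: "z \<in> HP"
  obtains e where "e > 0" "ball z e \<subseteq> HP"
    "\<And>L w. L \<in> lifts \<Longrightarrow> side (lm L) z \<noteq> 0 \<Longrightarrow> w \<in> ball z e \<Longrightarrow> side (lm L) w * side (lm L) z > 0"
proof -
  obtain r where r: "r > 0" "cball z r \<subseteq> HP" using open_HP z open_contains_cball by blast
  define F where "F = {L \<in> lifts. side (lm L) z \<noteq> 0 \<and> (\<exists>w\<in>cball z r. side (lm L) w = 0)}"
  have "finite F"
    by (rule finite_subset[OF _ lifts_locally_finite'[OF compact_cball r(2)]]) (auto simp: F_def)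
  then have "open (\<Inter>L\<in>F. {w. side (lm L) w \<noteq> 0})"
    by (intro open_INT) (auto intro!: open_Collect_neq continuous_intros)
  moreover have "z \<in> (\<Inter>L\<in>F. {w. side (lm L) w \<noteq> 0})" by (auto simp: F_def)
  ultimately obtain e where e: "e > 0" "ball z e \<subseteq> (\<Inter>L\<in>F. {w. side (lm L) w \<noteq> 0})"
    using open_contains_ball by blast
  define d where "d = min e r"
  have d: "d > 0" "ball z d \<subseteq> ball z e" "ball z d \<subseteq> cball z r" using e r by (auto simp: d_def)
  show thesis
  proof (rule that[OF d(1)])
    show "ball z d \<subseteq> HP" using d r by blast
    fix L w assume L: "L \<in> lifts" "side (lm L) z \<noteq> 0" and w: "w \<in> ball z d"
    have nz: "side (lm L) u \<noteq> 0" if u: "u \<in> ball z d" for u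
    proof
      assume 0: "side (lm L) u = 0"
      then have "L \<in> F" using L u d(3) by (auto simp: F_def)
      then show False using e(2) d(2) u 0 by blast
    qed
    show "side (lm L) w * side (lm L) z > 0"
      by (rule same_sign_connected[of "ball z d" "side (lm L)"])
        (use nz w d(1) in \<open>auto intro!: continuous_intros\<close>)
  qed
qed

lemma Y_subset: "Y \<subseteq> HP"
  by (auto simp: Y_def)

lemma Y_eq: "Y = HP - all_lifts \<Gamma> m a"
proof -
  have "z \<in> all_lifts \<Gamma> m a \<longleftrightarrow> (\<exists>L\<in>lifts. side (lm L) z = 0)" if "z \<in> HP" for z
  proof -
    have "z \<in> all_lifts \<Gamma> m a \<longleftrightarrow> (\<exists>L\<in>lifts. z \<in> range (lift_curve a (fst L) (snd L)))"
      unfolding all_lifts_def lifts_def by auto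
    also have "\<dots> \<longleftrightarrow> (\<exists>L\<in>lifts. z \<in> range (geod (lm L)))" using lift_curve_eq by auto
    finally show ?thesis using side_eq_0_iff[OF det_lm that] by blast
  qed
  then show ?thesis unfolding Y_def by auto
qed

lemma act_Y: "h \<in> \<Gamma> \<Longrightarrow> z \<in> Y \<Longrightarrow> act h z \<in> Y"
proof -
  assume h: "h \<in> \<Gamma>" and z: "z \<in> Y"
  have "side (lm L) (act h z) \<noteq> 0" if L: "L \<in> lifts" for L
  proof -
    let ?L = "tr (inv\<^bsub>PSL2R\<^esub> h) L"
    have L': "?L \<in> lifts" using h L by simp
    have "side (lm ?L) z \<noteq> 0" "z \<in> HP" using z L' by (auto simp: Y_def)
    then have "sgn (side (lm (tr h ?L)) (act h z)) \<noteq> 0" using sgn_side_tr[OF h L'] by (simp add: sgn_0_0)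
    then show ?thesis using h L by (simp add: sgn_0_0)
  qed
  then show ?thesis using z h by (auto simp: Y_def)
qed

lemma closed_segment_HP: "x \<in> HP \<Longrightarrow> y \<in> HP \<Longrightarrow> closed_segment x y \<subseteq> HP"
  using closed_segment_subset[of x HP y] convex_halfspace_Im_gt[of 0] by (simp add: HP_def)

text \<open>A separating lift meets the Euclidean segment from \<open>x\<close> to \<open>y\<close>,
  a compact subset of the half plane.\<close>

lemma finite_sep:
  assumes "x \<in> HP" "y \<in> HP"
  shows "finite (sep x y)"
proof -
  have "sep x y \<subseteq> {L \<in> lifts. \<exists>z\<in>closed_segment x y. side (lm L) z = 0}"
  proof
    fix L assume L: "L \<in> sep x y"
    have "\<exists>z\<in>closed_segment x y. side (lm L) z = 0"
    proof (rule ccontr)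
      assume "\<not> ?thesis"
      then have "side (lm L) x * side (lm L) y > 0"
        by (intro same_sign_connected[of "closed_segment x y" "side (lm L)"]) (auto intro!: continuous_intros)
      then show False using L by (simp add: sep_def)
    qed
    then show "L \<in> {L \<in> lifts. \<exists>z\<in>closed_segment x y. side (lm L) z = 0}" using L by (simp add: sep_def)
  qed
  then show ?thesis using lifts_locally_finite'[OF compact_segment closed_segment_HP[OF assms]] finite_subset by blast
qed

lemma sep_tr:
  assumes h: "h \<in> \<Gamma>" and x: "x \<in> HP" "y \<in> HP"
  shows "sep (act h x) (act h y) = tr h ` sep x y"
proof -
  have mem: "tr h L \<in> sep (act h x) (act h y) \<longleftrightarrow> L \<in> sep x y" if L: "L \<in> lifts" for L
  proof -
    have "side (lm (tr h L)) (act h x) * side (lm (tr h L)) (act h y) < 0 \<longleftrightarrow> side (lm L) x * side (lm L) y < 0"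
    proof -
      have "sgn (side (lm (tr h L)) (act h x) * side (lm (tr h L)) (act h y)) = sgn (side (lm L) x * side (lm L) y)"
        using sgn_side_tr[OF h L x(1)] sgn_side_tr[OF h L x(2)] by (simp add: sgn_mult)
      then show ?thesis by (metis sgn_less)
    qed
    then show ?thesis using L h by (simp add: sep_def)
  qed
  show ?thesis
  proof
    show "sep (act h x) (act h y) \<subseteq> tr h ` sep x y"
    proof
      fix L assume L: "L \<in> sep (act h x) (act h y)"
      then have L': "L \<in> lifts" by (simp add: sep_def)
      have "L = tr h (tr (inv\<^bsub>PSL2R\<^esub> h) L)" using h L' by simp
      moreover have "tr (inv\<^bsub>PSL2R\<^esub> h) L \<in> sep x y"
        using mem[of "tr (inv\<^bsub>PSL2R\<^esub> h) L"] h L L' by simp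
      ultimately show "L \<in> tr h ` sep x y" by blast
    qed
    show "tr h ` sep x y \<subseteq> sep (act h x) (act h y)"
    proof
      fix L assume "L \<in> tr h ` sep x y"
      then obtain L' where L': "L = tr h L'" "L' \<in> sep x y" by blast
      then show "L \<in> sep (act h x) (act h y)" using mem[of L'] by (simp add: sep_def)
    qed
  qed
qed

lemma inj_tr: "h \<in> \<Gamma> \<Longrightarrow> inj_on (tr h) lifts"
  by (metis inj_on_inverseI tr_inv(1))

section \<open>The cocycle as a sum over separating lifts\<close>

text \<open>A path-free form of the cocycle: the sign is the total one with which a path from
  \<open>x\<close> to \<open>y\<close> crosses \<open>L\<close>, positive if \<open>y\<close> lies
  on the right.\<close>

definition ssum :: "nat \<Rightarrow> (nat \<times> psl \<Rightarrow> real^2^2) \<Rightarrow> complex \<Rightarrow> complex \<Rightarrow> tensor" where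
  "ssum n B x y = (\<lambda>k. \<Sum>L\<in>sep x y. sgn (side (lm L) y) * nvec n (B L) k)"

text \<open>The coefficient is 0 unless \<open>L\<close> separates. Over a common index set the
  coefficients are differences of signs, which makes additivity in the endpoints immediate.\<close>

lemma ssum_superset:
  assumes "x \<in> Y" "y \<in> Y" "finite F" "sep x y \<subseteq> F" "F \<subseteq> lifts"
  shows "ssum n B x y = (\<lambda>k. \<Sum>L\<in>F. (sgn (side (lm L) y) - sgn (side (lm L) x)) / 2 * nvec n (B L) k)"
proof
  fix k
  have nz: "side (lm L) x \<noteq> 0" "side (lm L) y \<noteq> 0" if "L \<in> lifts" for L using that assms by (auto simp: Y_def)
  have "(\<Sum>L\<in>F. (sgn (side (lm L) y) - sgn (side (lm L) x)) / 2 * nvec n (B L) k) =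
      (\<Sum>L\<in>sep x y. (sgn (side (lm L) y) - sgn (side (lm L) x)) / 2 * nvec n (B L) k)"
  proof (rule sum.mono_neutral_right[OF assms(3,4)], intro ballI)
    fix L assume "L \<in> F - sep x y"
    then have "L \<in> lifts" "\<not> side (lm L) x * side (lm L) y < 0" using assms(5) by (auto simp: sep_def)
    then have "sgn (side (lm L) y) = sgn (side (lm L) x)"
      using nz[of L] by (auto simp: sgn_if mult_less_0_iff)
    then show "(sgn (side (lm L) y) - sgn (side (lm L) x)) / 2 * nvec n (B L) k = 0" by simp
  qed
  also have "\<dots> = ssum n B x y k"
    unfolding ssum_def
  proof (rule sum.cong[OF refl])
    fix L assume "L \<in> sep x y"
    then have "sgn (side (lm L) x) = - sgn (side (lm L) y)"
      by (auto simp: sep_def sgn_if mult_less_0_iff)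
    then show "(sgn (side (lm L) y) - sgn (side (lm L) x)) / 2 * nvec n (B L) k = sgn (side (lm L) y) * nvec n (B L) k"
      by simp
  qed
  finally show "ssum n B x y k = (\<Sum>L\<in>F. (sgn (side (lm L) y) - sgn (side (lm L) x)) / 2 * nvec n (B L) k)" by simp
qed

lemma ssum_add:
  assumes "x \<in> Y" "y \<in> Y" "z \<in> Y"
  shows "ssum n B x z = (\<lambda>k. ssum n B x y k + ssum n B y z k)"
proof -
  define F where "F = sep x y \<union> sep y z \<union> sep x z"
  have F: "finite F" "F \<subseteq> lifts" using assms Y_subset finite_sep by (auto simp: F_def sep_def)
  have "ssum n B x z = (\<lambda>k. \<Sum>L\<in>F. (sgn (side (lm L) z) - sgn (side (lm L) x)) / 2 * nvec n (B L) k)"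
    "ssum n B x y = (\<lambda>k. \<Sum>L\<in>F. (sgn (side (lm L) y) - sgn (side (lm L) x)) / 2 * nvec n (B L) k)"
    "ssum n B y z = (\<lambda>k. \<Sum>L\<in>F. (sgn (side (lm L) z) - sgn (side (lm L) y)) / 2 * nvec n (B L) k)"
    using assms F by (intro ssum_superset; auto simp: F_def)+
  then show ?thesis by (simp add: distrib_right add_divide_distrib diff_divide_distrib left_diff_distrib flip: sum.distrib)
qed

text \<open>\<open>B\<close> selects one matrix for the axis at each lift and need not be
  equivariant; by \<open>nvec_tr\<close> the neutral vectors are.\<close>

definition axes :: "(nat \<Rightarrow> real) \<Rightarrow> (nat \<Rightarrow> real) \<Rightarrow> (nat \<times> psl \<Rightarrow> real^2^2) \<Rightarrow> bool" where
  "axes s \<theta> B \<longleftrightarrow> (\<forall>L\<in>lifts. at_angle (geod (lm L)) (s (fst L)) (\<theta> (fst L)) (B L) 0)"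

lemma axes_exist: "\<exists>B. axes s \<theta> B"
  unfolding axes_def using at_angle_exists det_lm by (intro bchoice ballI) blast

lemma axes_tr:
  assumes "axes s \<theta> B" "h \<in> \<Gamma>" "L \<in> lifts"
  shows "at_angle (geod (lm (tr h L))) (s (fst L)) (\<theta> (fst L)) (rep h ** B L) 0"
proof -
  have "at_angle (geod (rep h ** lm L)) (s (fst L)) (\<theta> (fst L)) (rep h ** B L) 0"
    using assms by (intro at_angle_mult) (auto simp: axes_def)
  moreover have "geod (lm (tr h L)) = geod (rep h ** lm L)"
    using lm_tr[OF assms(2,3)] by (auto simp: fun_eq_iff)
  ultimately show ?thesis by simp
qed

lemma nvec_tr:
  assumes n: "n \<ge> 1" and B: "axes s \<theta> B" and h: "h \<in> \<Gamma>" "L \<in> lifts"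
  shows "nvec n (B (tr h L)) = sigma_mat (4*n - 2) (rep h) (nvec n (B L))"
proof -
  have "at_angle (geod (lm (tr h L))) (s (fst L)) (\<theta> (fst L)) (B (tr h L)) 0"
    using B h tr_lifts[OF h] unfolding axes_def by (metis tr_def fst_conv)
  then have "nvec n (B (tr h L)) = nvec n (rep h ** B L)"
    using at_angle_nvec_unique[OF n det_lm[OF tr_lifts[OF h]] _ axes_tr[OF B h]] by blast
  then show ?thesis by (simp add: nvec_mult)
qed

lemma ssum_tr:
  assumes n: "n \<ge> 1" and B: "axes s \<theta> B" and h: "h \<in> \<Gamma>" and x: "x \<in> HP" "y \<in> HP"
  shows "ssum n B (act h x) (act h y) = sigma (4*n - 2) h (ssum n B x y)"
proof -
  have "ssum n B (act h x) (act h y) = (\<lambda>k. \<Sum>L\<in>sep x y. sgn (side (lm (tr h L)) (act h y)) * nvec n (B (tr h L)) k)"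
    unfolding ssum_def sep_tr[OF h x]
    by (subst sum.reindex) (auto intro!: inj_on_subset[OF inj_tr[OF h]] simp: sep_def)
  also have "\<dots> = (\<lambda>k. \<Sum>L\<in>sep x y. sgn (side (lm L) y) * sigma_mat (4*n - 2) (rep h) (nvec n (B L)) k)"
    using sgn_side_tr[OF h _ x(2)] nvec_tr[OF n B h] by (intro ext sum.cong) (auto simp: sep_def)
  finally show ?thesis unfolding sigma_def ssum_def by (simp add: sigma_mat_sum[abs_def] fun_eq_iff)
qed

text \<open>Crossing signs are the signs of the derivative of the side function along the path.
  Grouping the crossings by lifts, \<open>sum_sgn_zeros\<close> evaluates each group from the two
  endpoints alone.\<close>

lemma strip_sum_eq:
  assumes n: "n \<ge> 1" and B: "axes s \<theta> B" and c: "transverse_path \<Gamma> m a x y c" and x: "x \<in> Y" "y \<in> Y"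
  shows "strip_sum n \<Gamma> m a s \<theta> c = ssum n B x y"
proof -
  have pc: "path c" "path_image c \<subseteq> HP" "c 0 = x" "c 1 = y"
    and tv: "\<And>t i g r. (t, i, g, r) \<in> crossings \<Gamma> m a c \<Longrightarrow> c differentiable (at t) \<and>
        pos_normal (lift_curve a i g) r \<bullet> vector_derivative c (at t) \<noteq> 0"
    using c unfolding transverse_path_def pathstart_def pathfinish_def by blast+
  have cc: "continuous_on {0..1} c" and cHP: "\<And>t. t \<in> {0..1} \<Longrightarrow> c t \<in> HP"
    using pc unfolding path_def path_image_def by auto
  define f where "f L t = side (lm L) (c t)" for L t
  define D where "D L t = deriv (f L) t" for L t
  define Z where "Z L = {t \<in> {0..1}. f L t = 0}" for L
  have cross: "t \<in> Z L \<and> L \<in> lifts" if "(t, fst L, snd L, r) \<in> crossings \<Gamma> m a c" for t L r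
  proof -
    have L: "L \<in> lifts" "t \<in> {0..1}" "c t = lift_curve a (fst L) (snd L) r"
      using that unfolding crossings_def lifts_def by (auto simp: mem_Times_iff)
    then have "c t = geod (lm L) r" using lift_curve_eq[of "fst L" "snd L"] by simp
    then show ?thesis using L by (simp add: Z_def f_def)
  qed
  have cross': "\<exists>r. (t, fst L, snd L, r) \<in> crossings \<Gamma> m a c" if "L \<in> lifts" "t \<in> Z L" for L t
  proof -
    have "c t \<in> range (geod (lm L))"
      using that side_eq_0_iff[OF det_lm[OF that(1)] cHP[of t]] by (simp add: Z_def f_def)
    then obtain r where "c t = geod (lm L) r" by blast
    then have "c t = lift_curve a (fst L) (snd L) r" using lift_curve_eq[of "fst L" "snd L"] that by simp
    then show ?thesis using that unfolding crossings_def lifts_def Z_def by (auto simp: mem_Times_iff)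
  qed
  have der: "(f L has_real_derivative D L t) (at t) \<and> sgn (D L t) = crossing_sign c (lift_curve a (fst L) (snd L)) t r \<and> D L t \<noteq> 0"
    if cr: "(t, fst L, snd L, r) \<in> crossings \<Gamma> m a c" for t L r
  proof -
    have L: "L \<in> lifts" using cross[OF cr] by blast
    have ct: "c t = geod (lm L) r" using cr lift_curve_eq[of "fst L" "snd L"] L unfolding crossings_def by auto
    have "(c has_vector_derivative vector_derivative c (at t)) (at t)"
      using tv[OF cr] vector_derivative_works by blast
    from side_curve_derivative[OF det_lm[OF L] this ct]
    obtain D' where D': "(f L has_real_derivative D') (at t)"
        "sgn D' = sgn (pos_normal (geod (lm L)) r \<bullet> vector_derivative c (at t))"
      unfolding f_def by blast
    have "D L t = D'" unfolding D_def using DERIV_imp_deriv[OF D'(1)] .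
    moreover have "pos_normal (lift_curve a (fst L) (snd L)) r \<bullet> vector_derivative c (at t) \<noteq> 0"
      using tv[OF cr] by blast
    ultimately show ?thesis using D' lift_curve_eq[of "fst L" "snd L"] L
      by (auto simp: crossing_sign_def sgn_0_0)
  qed
  have fL: "finite (Z L) \<and> (\<Sum>t\<in>Z L. sgn (D L t)) = (sgn (side (lm L) y) - sgn (side (lm L) x)) / 2"
    if L: "L \<in> lifts" for L
  proof -
    have "finite {t\<in>{0..1}. f L t = 0} \<and> (\<Sum>t | t \<in> {0..1} \<and> f L t = 0. sgn (D L t)) = (sgn (f L 1) - sgn (f L 0)) / 2"
    proof (rule sum_sgn_zeros)
      show "continuous_on {0..1} (f L)" unfolding f_def by (intro continuous_intros cc)
      show "f L 0 \<noteq> 0" "f L 1 \<noteq> 0" using x L pc by (auto simp: f_def Y_def)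
      fix t assume "t \<in> {0..1}" "f L t = 0"
      then obtain r where "(t, fst L, snd L, r) \<in> crossings \<Gamma> m a c" using cross'[OF L, of t] by (auto simp: Z_def)
      from der[OF this] show "(f L has_real_derivative D L t) (at t) \<and> D L t \<noteq> 0" by blast
    qed simp
    then show ?thesis using pc by (simp add: Z_def f_def)
  qed
  define F where "F = {L \<in> lifts. Z L \<noteq> {}}"
  have "compact (c ` {0..1})" by (rule compact_continuous_image[OF cc]) simp
  moreover have "c ` {0..1} \<subseteq> HP" using cHP by blast
  ultimately have "finite {L \<in> lifts. \<exists>z\<in>c ` {0..1}. side (lm L) z = 0}" by (rule lifts_locally_finite')
  then have F: "finite F" by (rule finite_subset[rotated]) (auto simp: F_def Z_def f_def)
  have sepF: "sep x y \<subseteq> F"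
  proof
    fix L assume L: "L \<in> sep x y"
    then have Ll: "L \<in> lifts" by (simp add: sep_def)
    have "sgn (side (lm L) y) \<noteq> sgn (side (lm L) x)" using L by (auto simp: sep_def sgn_if mult_less_0_iff)
    then show "L \<in> F" using fL[OF Ll] Ll by (auto simp: F_def)
  qed
  \<comment> \<open>The parameter of the crossing point on its lift is dropped, being determined by
    the time and the lift.\<close>
  define \<phi> where "\<phi> = (\<lambda>(t::real, i::nat, g::psl, r::real). ((i, g), t))"
  have bij: "bij_betw \<phi> (crossings \<Gamma> m a c) (Sigma F Z)"
  proof (rule bij_betwI')
    fix p q assume p: "p \<in> crossings \<Gamma> m a c" "q \<in> crossings \<Gamma> m a c"
    obtain t i g r t' i' g' r' where pq: "p = (t, i, g, r)" "q = (t', i', g', r')" by (metis prod_cases4)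
    show "\<phi> p = \<phi> q \<longleftrightarrow> p = q"
    proof
      assume "\<phi> p = \<phi> q"
      then have e: "i = i'" "g = g'" "t = t'" using pq by (auto simp: \<phi>_def)
      have L: "(i, g) \<in> lifts" using p(1) pq by (auto simp: crossings_def lifts_def)
      have "geod (lm (i, g)) r = geod (lm (i, g)) r'"
        using p pq e lift_curve_eq[OF L] by (auto simp: crossings_def)
      then have "r = r'" using geod_inj[OF det_lm[OF L]] by blast
      then show "p = q" using pq e by simp
    qed simp
  next
    fix p assume p: "p \<in> crossings \<Gamma> m a c"
    obtain t i g r where pq: "p = (t, i, g, r)" by (metis prod_cases4)
    then show "\<phi> p \<in> Sigma F Z" using cross[of t "(i, g)" r] p by (auto simp: \<phi>_def F_def)
  next
    fix q assume "q \<in> Sigma F Z"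
    then obtain L t where q: "q = (L, t)" "L \<in> lifts" "t \<in> Z L" by (auto simp: F_def)
    then obtain r where "(t, fst L, snd L, r) \<in> crossings \<Gamma> m a c" using cross' by blast
    then show "\<exists>p\<in>crossings \<Gamma> m a c. q = \<phi> p" using q by (intro bexI) (auto simp: \<phi>_def)
  qed
  show ?thesis
  proof
    fix k
    have "strip_sum n \<Gamma> m a s \<theta> c k = (\<Sum>p\<in>crossings \<Gamma> m a c. (\<lambda>(L, t). sgn (D L t) * nvec n (B L) k) (\<phi> p))"
      unfolding strip_sum_def
    proof (rule sum.cong[OF refl])
      fix p assume p: "p \<in> crossings \<Gamma> m a c"
      obtain t i g r where pq: "p = (t, i, g, r)" by (metis prod_cases4)
      have cr: "(t, fst (i, g), snd (i, g), r) \<in> crossings \<Gamma> m a c" using p pq by simp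
      have L: "(i, g) \<in> lifts" using cross[OF cr] by blast
      have "at_angle (geod (lm (i, g))) (s i) (\<theta> i) (B (i, g)) 0"
        using B L unfolding axes_def by fastforce
      then have "neutral n (SOME \<eta>. strip_element (lift_curve a i g) (s i) (\<theta> i) \<eta>) = nvec n (B (i, g))"
        unfolding lift_curve_eq[OF L] using strip_element_neutral[OF n det_lm[OF L]] by blast
      then show "(case p of (t, i, g, r) \<Rightarrow> crossing_sign c (lift_curve a i g) t r * neutral n (SOME \<eta>. strip_element (lift_curve a i g) (s i) (\<theta> i) \<eta>) k) =
          (\<lambda>(L, t). sgn (D L t) * nvec n (B L) k) (\<phi> p)"
        using der[OF cr] pq by (simp add: \<phi>_def)
    qed
    also have "\<dots> = (\<Sum>(L, t)\<in>Sigma F Z. sgn (D L t) * nvec n (B L) k)"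
      by (rule sum.reindex_bij_betw[OF bij])
    also have "\<dots> = (\<Sum>L\<in>F. \<Sum>t\<in>Z L. sgn (D L t) * nvec n (B L) k)"
      using F fL by (subst sum.Sigma) (auto simp: F_def)
    also have "\<dots> = (\<Sum>L\<in>F. (sgn (side (lm L) y) - sgn (side (lm L) x)) / 2 * nvec n (B L) k)"
      using fL by (intro sum.cong) (auto simp: F_def simp flip: sum_distrib_right)
    also have "\<dots> = ssum n B x y k"
      using ssum_superset[OF x F sepF, of n B] by (simp add: F_def)
    finally show "strip_sum n \<Gamma> m a s \<theta> c k = ssum n B x y k" .
  qed
qed

lemma ssum_sym: "ssum n B x y \<in> sym_tensors (4*n - 2)"
  unfolding ssum_def by (rule sym_tensors_sum) (rule nvec_sym)

lemma ssum_cocycle: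
  assumes n: "n \<ge> 1" and B: "axes s \<theta> B" and x: "x \<in> Y" and g: "g \<in> \<Gamma>" "h \<in> \<Gamma>"
  shows "ssum n B x (act (g \<otimes>\<^bsub>PSL2R\<^esub> h) x) =
    (\<lambda>k. sigma (4*n - 2) g (ssum n B x (act h x)) k + ssum n B x (act g x) k)"
proof -
  have H: "x \<in> HP" "act h x \<in> HP" "act g x \<in> Y" "act g (act h x) \<in> Y"
    using x g act_Y Y_subset by auto
  have "act (g \<otimes>\<^bsub>PSL2R\<^esub> h) x = act g (act h x)" using g H by (simp add: act_mult)
  then show ?thesis
    using ssum_add[OF x H(3,4), of n B] ssum_tr[OF n B g(1) H(1,2)] by (simp add: add.commute)
qed

end

section \<open>Complementary regions\<close>

text \<open>The geodesic segment from \<open>x\<close> to \<open>y\<close>, parametrized so that \<open>(|z|\<^sup>2, Re z)\<close>, and hence every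
  side function, is affine in \<open>t\<close>.\<close>

definition kp :: "complex \<Rightarrow> complex \<Rightarrow> real \<Rightarrow> complex" where
  "kp x y t = Complex ((1 - t) * Re x + t * Re y)
     (sqrt ((1 - t) * (cmod x)\<^sup>2 + t * (cmod y)\<^sup>2 - ((1 - t) * Re x + t * Re y)\<^sup>2))"

lemma kp_disc:
  "(1 - t) * (cmod x)\<^sup>2 + t * (cmod y)\<^sup>2 - ((1 - t) * Re x + t * Re y)\<^sup>2 =
    (1 - t) * (Im x)\<^sup>2 + t * (Im y)\<^sup>2 + t * (1 - t) * (Re x - Re y)\<^sup>2"
  unfolding cmod_power2 by (simp add: power2_eq_square algebra_simps)

lemma kp_disc_pos:
  assumes "x \<in> HP" "y \<in> HP" "0 \<le> t" "t \<le> 1"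
  shows "(1 - t) * (Im x)\<^sup>2 + t * (Im y)\<^sup>2 + t * (1 - t) * (Re x - Re y)\<^sup>2 > 0"
proof (cases "t = 0")
  case False
  then have "t * (Im y)\<^sup>2 > 0" using assms by (simp add: HP_def)
  moreover have "(1 - t) * (Im x)\<^sup>2 \<ge> 0" "t * (1 - t) * (Re x - Re y)\<^sup>2 \<ge> 0" using assms by auto
  ultimately show ?thesis by linarith
qed (use assms in \<open>simp add: HP_def\<close>)

lemma kp_in_HP: "x \<in> HP \<Longrightarrow> y \<in> HP \<Longrightarrow> 0 \<le> t \<Longrightarrow> t \<le> 1 \<Longrightarrow> kp x y t \<in> HP"
  unfolding kp_def HP_def kp_disc using kp_disc_pos[of x y t] by (simp add: HP_def)

lemma cmod_kp:
  assumes "x \<in> HP" "y \<in> HP" "0 \<le> t" "t \<le> 1"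
  shows "(cmod (kp x y t))\<^sup>2 = (1 - t) * (cmod x)\<^sup>2 + t * (cmod y)\<^sup>2"
  using kp_disc_pos[OF assms] unfolding kp_def cmod_power2[of "Complex _ _"] complex.sel
  by (simp add: kp_disc) (simp add: kp_disc[symmetric])

lemma side_kp:
  assumes "x \<in> HP" "y \<in> HP" "0 \<le> t" "t \<le> 1"
  shows "side A (kp x y t) = (1 - t) * side A x + t * side A y"
  unfolding side_def cmod_kp[OF assms] by (simp add: kp_def algebra_simps)

lemma kp_0: "x \<in> HP \<Longrightarrow> kp x y 0 = x"
  by (simp add: kp_def complex_eq_iff cmod_power2 HP_def)

lemma kp_1: "y \<in> HP \<Longrightarrow> kp x y 1 = y"
  by (simp add: kp_def complex_eq_iff cmod_power2 HP_def)

lemma continuous_on_kp: "continuous_on S (kp x y)"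
  unfolding kp_def by (intro continuous_intros)

context arc_system
begin

text \<open>Complementary regions are described by signs rather than as connected components, so
  that equivariance becomes a statement on signs; connectedness is
  \<open>connected_rg\<close>.\<close>

definition rg :: "complex \<Rightarrow> complex set" where
  "rg z = {w \<in> HP. \<forall>L\<in>lifts. side (lm L) z * side (lm L) w > 0}"

lemma rg_sub_Y: "rg z \<subseteq> Y"
  by (auto simp: rg_def Y_def)

lemma rg_refl: "z \<in> Y \<Longrightarrow> z \<in> rg z"
  by (auto simp: rg_def Y_def zero_less_mult_iff linorder_neq_iff)

lemma rg_iff_sgn:
  "z \<in> Y \<Longrightarrow> w \<in> rg z \<longleftrightarrow> w \<in> HP \<and> (\<forall>L\<in>lifts. sgn (side (lm L) w) = sgn (side (lm L) z))"
proof -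
  assume z: "z \<in> Y"
  have "side (lm L) z * side (lm L) w > 0 \<longleftrightarrow> sgn (side (lm L) w) = sgn (side (lm L) z)" if "L \<in> lifts" for L
    using z that by (auto simp: Y_def sgn_if zero_less_mult_iff linorder_neq_iff split: if_splits)
  then show ?thesis unfolding rg_def by auto
qed

lemma rg_eq: "z \<in> Y \<Longrightarrow> w \<in> rg z \<Longrightarrow> rg w = rg z"
proof -
  assume z: "z \<in> Y" and w: "w \<in> rg z"
  then have wY: "w \<in> Y" using rg_sub_Y by blast
  have "\<forall>L\<in>lifts. sgn (side (lm L) w) = sgn (side (lm L) z)" using w rg_iff_sgn[OF z] by blast
  then have "u \<in> rg w \<longleftrightarrow> u \<in> rg z" for u unfolding rg_iff_sgn[OF z] rg_iff_sgn[OF wY] by auto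
  then show ?thesis by blast
qed

lemma rg_sym: "z \<in> Y \<Longrightarrow> w \<in> rg z \<Longrightarrow> z \<in> rg w"
  using rg_eq rg_refl by blast

lemma rg_act:
  assumes "z \<in> Y" "w \<in> rg z" "g \<in> \<Gamma>"
  shows "act g w \<in> rg (act g z)"
proof -
  have H: "w \<in> HP" "z \<in> HP" "act g z \<in> Y" using assms rg_sub_Y Y_subset act_Y by auto
  have "sgn (side (lm L) (act g w)) = sgn (side (lm L) (act g z))" if L: "L \<in> lifts" for L
  proof -
    let ?L = "tr (inv\<^bsub>PSL2R\<^esub> g) L"
    have L': "?L \<in> lifts" "tr g ?L = L" using assms L by auto
    show ?thesis
      using sgn_side_tr[OF assms(3) L'(1), of w] sgn_side_tr[OF assms(3) L'(1), of z] H assms(2) L'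
      unfolding rg_iff_sgn[OF assms(1)] by simp
  qed
  then show ?thesis unfolding rg_iff_sgn[OF H(3)] using H assms by auto
qed

lemma open_rg: "z \<in> Y \<Longrightarrow> open (rg z)"
proof (subst open_subopen, rule ballI)
  fix w assume z: "z \<in> Y" and w: "w \<in> rg z"
  then have wY: "w \<in> Y" using rg_sub_Y by blast
  then obtain e where e: "e > 0" "ball w e \<subseteq> HP"
      "\<And>L u. L \<in> lifts \<Longrightarrow> side (lm L) w \<noteq> 0 \<Longrightarrow> u \<in> ball w e \<Longrightarrow> side (lm L) u * side (lm L) w > 0"
    using HP_neighbourhood[of w] Y_subset by blast
  have "ball w e \<subseteq> rg w"
    unfolding rg_def using e wY by (auto simp: Y_def mult.commute)
  then show "\<exists>T. open T \<and> w \<in> T \<and> T \<subseteq> rg z" using e(1) rg_eq[OF z w] by (intro exI[of _ "ball w e"]) auto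
qed

text \<open>Side functions are affine along \<open>kp\<close>, so the segment from \<open>z\<close>
  to any point of the region stays inside.\<close>

lemma connected_rg: "z \<in> Y \<Longrightarrow> connected (rg z)"
proof -
  assume z: "z \<in> Y"
  have sub: "kp z w t \<in> rg z" if w: "w \<in> rg z" and t: "t \<in> {0..1}" for w t
  proof -
    have H: "z \<in> HP" "w \<in> HP" using z w rg_sub_Y Y_subset by auto
    have "side (lm L) z * side (lm L) (kp z w t) > 0" if L: "L \<in> lifts" for L
    proof -
      have 1: "side (lm L) z * side (lm L) z > 0" "side (lm L) z * side (lm L) w > 0"
        using rg_refl[OF z] w L by (auto simp: rg_def)
      have "side (lm L) z * side (lm L) (kp z w t) = (1 - t) * (side (lm L) z * side (lm L) z) + t * (side (lm L) z * side (lm L) w)"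
      proof -
        have e: "side (lm L) (kp z w t) = (1 - t) * side (lm L) z + t * side (lm L) w"
          using side_kp[OF H] t by simp
        show ?thesis unfolding e by (simp add: algebra_simps)
      qed
      moreover have "(1 - t) * (side (lm L) z * side (lm L) z) + t * (side (lm L) z * side (lm L) w) > 0"
        using 1 t by (cases "t = 0") (auto intro!: add_nonneg_pos)
      ultimately show ?thesis by simp
    qed
    then show ?thesis using kp_in_HP[OF H] t by (auto simp: rg_def)
  qed
  have "rg z = (\<Union>w\<in>rg z. kp z w ` {0..1})"
  proof
    show "rg z \<subseteq> (\<Union>w\<in>rg z. kp z w ` {0..1})"
    proof
      fix w assume w: "w \<in> rg z"
      then have "w \<in> HP" using rg_sub_Y Y_subset by blast
      then have "w = kp z w 1" using kp_1[of w z] by simp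
      then show "w \<in> (\<Union>w\<in>rg z. kp z w ` {0..1})" using w by fastforce
    qed
  qed (use sub in blast)
  moreover have "connected (\<Union>w\<in>rg z. kp z w ` {0..1})"
  proof (rule connected_Union)
    fix S assume "S \<in> (\<lambda>w. kp z w ` {0..1}) ` rg z"
    then show "connected S" by (auto intro!: connected_continuous_image continuous_on_kp)
  next
    have "z \<in> HP" using z Y_subset by blast
    then have "z \<in> kp z w ` {0..1}" for w by (metis kp_0 atLeastAtMost_iff image_eqI order_refl zero_le_one)
    then show "\<Inter>((\<lambda>w. kp z w ` {0..1}) ` rg z) \<noteq> {}" by blast
  qed
  ultimately show ?thesis by simp
qed

text \<open>The quotient map followed by the homeomorphism onto the disk. It is open because the
  preimage of the image of \<open>U\<close> in the surface is the union of the translates of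
  \<open>U\<close>.\<close>

lemma disk_projection:
  obtains p :: "complex \<Rightarrow> complex" where "continuous_on Y p" "p ` Y = ball 0 1"
    "\<And>U. open U \<Longrightarrow> U \<subseteq> Y \<Longrightarrow> open (p ` U)"
    "\<And>z w. z \<in> Y \<Longrightarrow> w \<in> Y \<Longrightarrow> p z = p w \<longleftrightarrow> (\<exists>g\<in>\<Gamma>. w = act g z)"
proof -
  let ?Q = "topspace (surface \<Gamma>) - (\<Union>i<m. arc_image \<Gamma> a i)"
  let ?SQ = "subtopology (surface \<Gamma>) ?Q"
  obtain f f' where f: "homeomorphic_maps ?SQ (top_of_set (ball (0::complex) 1)) f f'"
    using cutting unfolding cutting_arcs_def homeomorphic_space_def by blast
  then have hf: "homeomorphic_map ?SQ (top_of_set (ball (0::complex) 1)) f"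
    by (rule homeomorphic_maps_imp_map)
  have arcs: "proj \<Gamma> z \<in> (\<Union>i<m. arc_image \<Gamma> a i) \<longleftrightarrow> z \<in> all_lifts \<Gamma> m a" if z: "z \<in> HP" for z
  proof
    assume "proj \<Gamma> z \<in> (\<Union>i<m. arc_image \<Gamma> a i)"
    then obtain i t where it: "i < m" "proj \<Gamma> (geod (a i) t) = proj \<Gamma> z" unfolding arc_image_def by force
    then obtain g where "g \<in> \<Gamma>" "z = act g (geod (a i) t)" using proj_eq_iff[of "geod (a i) t" z] by auto
    then show "z \<in> all_lifts \<Gamma> m a" using it unfolding all_lifts_def lift_curve_def by blast
  next
    assume "z \<in> all_lifts \<Gamma> m a"
    then obtain i g t where it: "i < m" "g \<in> \<Gamma>" "z = act g (geod (a i) t)"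
      unfolding all_lifts_def lift_curve_def by blast
    then have "proj \<Gamma> (geod (a i) t) = proj \<Gamma> z" using proj_eq_iff[of "geod (a i) t" z] by auto
    then show "proj \<Gamma> z \<in> (\<Union>i<m. arc_image \<Gamma> a i)" using it(1) unfolding arc_image_def
      by (metis UN_I imageI lessThan_iff rangeI)
  qed
  have projY: "proj \<Gamma> ` Y = ?Q"
    unfolding topspace_surface Y_eq using arcs by auto
  define p where "p z = f (proj \<Gamma> z)" for z
  have tsQ: "topspace ?SQ = ?Q" by auto
  show thesis
  proof (rule that[of p])
    have "continuous_map (top_of_set Y) (surface \<Gamma>) (proj \<Gamma>)"
      using continuous_map_from_subtopology_mono[OF continuous_map_proj Y_subset] .
    then have "continuous_map (top_of_set Y) ?SQ (proj \<Gamma>)"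
      using projY by (auto simp: continuous_map_in_subtopology)
    moreover have "continuous_map ?SQ (top_of_set (ball (0::complex) 1)) f"
      using f by (simp add: homeomorphic_maps_def)
    ultimately have "continuous_map (top_of_set Y) (top_of_set (ball (0::complex) 1)) (f \<circ> proj \<Gamma>)"
      by (rule continuous_map_compose)
    then show "continuous_on Y p"
      by (simp add: continuous_map_in_subtopology p_def[abs_def] comp_def)
    have "f ` ?Q = ball 0 1"
      using homeomorphic_imp_surjective_map[OF hf] tsQ by simp
    then show "p ` Y = ball 0 1" unfolding p_def projY[symmetric] by (simp add: image_image)
    show "open (p ` U)" if U: "open U" "U \<subseteq> Y" for U
    proof -
      have "{z \<in> HP. proj \<Gamma> z \<in> proj \<Gamma> ` U} = (\<Union>g\<in>\<Gamma>. act g ` U)"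
      proof (intro subset_antisym subsetI)
        fix z assume "z \<in> {z \<in> HP. proj \<Gamma> z \<in> proj \<Gamma> ` U}"
        then obtain u where "u \<in> U" "proj \<Gamma> u = proj \<Gamma> z" by force
        then show "z \<in> (\<Union>g\<in>\<Gamma>. act g ` U)" using proj_eq_iff[of u z] U Y_subset by blast
      next
        fix z assume "z \<in> (\<Union>g\<in>\<Gamma>. act g ` U)"
        then obtain g u where g: "g \<in> \<Gamma>" "u \<in> U" "z = act g u" by blast
        then have "u \<in> HP" using U Y_subset by blast
        then show "z \<in> {z \<in> HP. proj \<Gamma> z \<in> proj \<Gamma> ` U}"
          using g proj_eq_iff[of u z] by auto
      qed
      moreover have "open (\<Union>g\<in>\<Gamma>. act g ` U)"
        using U Y_subset by (intro open_UN ballI open_act_image) auto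
      ultimately have "openin (surface \<Gamma>) (proj \<Gamma> ` U)"
        unfolding openin_surface using U Y_subset by auto
      then have "openin ?SQ (proj \<Gamma> ` U)"
        using U projY by (auto simp: openin_subtopology_alt intro!: image_eqI[of _ _ "proj \<Gamma> ` U"])
      then have "openin (top_of_set (ball (0::complex) 1)) (f ` proj \<Gamma> ` U)"
        using homeomorphic_imp_open_map[OF hf] by (simp add: open_map_def)
      then show ?thesis using openin_open_trans[OF _ open_ball] by (simp add: p_def image_image)
    qed
    show "p z = p w \<longleftrightarrow> (\<exists>g\<in>\<Gamma>. w = act g z)" if z: "z \<in> Y" "w \<in> Y" for z w
    proof -
      have "inj_on f ?Q" using homeomorphic_imp_injective_map[OF hf] tsQ by simp
      moreover have "proj \<Gamma> z \<in> ?Q" "proj \<Gamma> w \<in> ?Q" using z projY by auto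
      ultimately have "p z = p w \<longleftrightarrow> proj \<Gamma> z = proj \<Gamma> w" unfolding p_def by (simp add: inj_on_eq_iff)
      then show ?thesis using proj_eq_iff[of z w] z Y_subset by auto
    qed
  qed
qed

text \<open>Otherwise the image of the region of \<open>z\<close> and that of all regions outside
  its orbit would be disjoint nonempty open sets covering the connected disk.\<close>

lemma regions_transitive:
  assumes z: "z \<in> Y" and w: "w \<in> Y"
  shows "\<exists>g\<in>\<Gamma>. w \<in> rg (act g z)"
proof (rule ccontr)
  assume no: "\<not> (\<exists>g\<in>\<Gamma>. w \<in> rg (act g z))"
  obtain p :: "complex \<Rightarrow> complex" where p: "continuous_on Y p" "p ` Y = ball 0 1"
    "\<And>U. open U \<Longrightarrow> U \<subseteq> Y \<Longrightarrow> open (p ` U)"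
    "\<And>z w. z \<in> Y \<Longrightarrow> w \<in> Y \<Longrightarrow> p z = p w \<longleftrightarrow> (\<exists>g\<in>\<Gamma>. w = act g z)"
    using disk_projection by blast
  define W where "W = {w \<in> Y. \<forall>g\<in>\<Gamma>. w \<notin> rg (act g z)}"
  have "W = (\<Union>w\<in>W. rg w)"
  proof (intro subset_antisym subsetI)
    fix u assume "u \<in> (\<Union>w\<in>W. rg w)"
    then obtain v where v: "v \<in> W" "u \<in> rg v" by blast
    then have vY: "v \<in> Y" by (simp add: W_def)
    have "u \<notin> rg (act g z)" if g: "g \<in> \<Gamma>" for g
    proof
      assume "u \<in> rg (act g z)"
      then have "rg u = rg (act g z)" using rg_eq act_Y[OF g z] by blast
      then have "v \<in> rg (act g z)" using rg_sym[OF vY v(2)] by simp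
      then show False using v(1) g by (simp add: W_def)
    qed
    then show "u \<in> W" using v rg_sub_Y by (auto simp: W_def)
  qed (use rg_refl in \<open>auto simp: W_def\<close>)
  moreover have "open (\<Union>w\<in>W. rg w)" by (intro open_UN ballI open_rg) (simp add: W_def)
  ultimately have oW: "open W" by simp
  have o: "open (p ` rg z)" "open (p ` W)"
    using p(3)[OF open_rg[OF z] rg_sub_Y] p(3)[OF oW] by (auto simp: W_def)
  have dis: "p ` rg z \<inter> p ` W = {}"
  proof (rule ccontr)
    assume "p ` rg z \<inter> p ` W \<noteq> {}"
    then obtain u v where uv: "u \<in> rg z" "v \<in> W" "p u = p v" by force
    then have "u \<in> Y" "v \<in> Y" using rg_sub_Y by (auto simp: W_def)
    then obtain g where "g \<in> \<Gamma>" "v = act g u" using p(4) uv by blast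
    then show False using rg_act[OF z uv(1)] uv(2) by (auto simp: W_def)
  qed
  have cov: "ball 0 1 \<subseteq> p ` rg z \<union> p ` W"
  proof
    fix y :: complex assume "y \<in> ball 0 1"
    then obtain u where u: "u \<in> Y" "y = p u" using p(2) by blast
    show "y \<in> p ` rg z \<union> p ` W"
    proof (cases "u \<in> W")
      case False
      then obtain g where g: "g \<in> \<Gamma>" "u \<in> rg (act g z)" using u by (auto simp: W_def)
      have zH: "z \<in> HP" using z Y_subset by blast
      have "act (inv\<^bsub>PSL2R\<^esub> g) u \<in> rg z"
        using rg_act[OF act_Y[OF g(1) z] g(2), of "inv\<^bsub>PSL2R\<^esub> g"] g zH by (simp add: act_inv)
      moreover have "p (act (inv\<^bsub>PSL2R\<^esub> g) u) = p u"
        using p(4)[OF u(1), of "act (inv\<^bsub>PSL2R\<^esub> g) u"] g act_Y[of "inv\<^bsub>PSL2R\<^esub> g"] u by auto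
      ultimately show ?thesis using u by (metis UnI1 image_eqI)
    qed (use u in blast)
  qed
  have "connected (ball (0::complex) 1)" by simp
  moreover have "p ` rg z \<inter> ball 0 1 \<noteq> {}" using rg_refl[OF z] z p(2) by blast
  moreover have "p ` W \<inter> ball 0 1 \<noteq> {}"
  proof -
    have "w \<in> W" using w no by (simp add: W_def)
    then show ?thesis using w p(2) by blast
  qed
  ultimately show False using connectedD[of "ball (0::complex) 1" "p ` rg z" "p ` W"] o dis cov by auto
qed

text \<open>Proper discontinuity leaves finitely many elements to be avoided, and by freeness each
  of them moves \<open>z\<close> a positive distance.\<close>

lemma wandering_neighbourhood:
  assumes z: "z \<in> HP" and e: "e > 0" "ball z e \<subseteq> HP"
  obtains d where "0 < d" "d \<le> e"
    "\<And>g u. g \<in> \<Gamma> \<Longrightarrow> u \<in> ball z d \<Longrightarrow> act g u \<in> ball z d \<Longrightarrow> g = {mat 1, - mat 1}"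
proof -
  have cb: "cball z (e/2) \<subseteq> HP" using e by (auto simp: subset_iff dist_commute)
  define F where "F = {g \<in> \<Gamma>. \<exists>u\<in>cball z (e/2). act g u \<in> cball z (e/2)} - {{mat 1, - mat 1}}"
  have F: "finite F" using properly_discontinuous[OF discrete compact_cball cb] by (simp add: F_def)
  have "\<exists>d>0. \<forall>u\<in>ball z d. act g u \<notin> ball z d" if g: "g \<in> F" for g
  proof -
    have g': "g \<in> \<Gamma>" "g \<noteq> {mat 1, - mat 1}" using g by (auto simp: F_def)
    define \<delta> where "\<delta> = dist (act g z) z"
    have \<delta>: "\<delta> > 0" using act_free[OF discrete free g'(1) z] g'(2) by (auto simp: \<delta>_def)
    have "continuous (at z) (act g)"
      using continuous_on_act[of g] g' z open_HP by (simp add: continuous_on_eq_continuous_at)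
    then obtain d where d: "d > 0" "\<And>u. dist u z < d \<Longrightarrow> dist (act g u) (act g z) < \<delta>/2"
      using \<delta> unfolding continuous_at_eps_delta by (meson half_gt_zero)
    have "act g u \<notin> ball z (min d (\<delta>/2))" if u: "u \<in> ball z (min d (\<delta>/2))" for u
    proof
      assume "act g u \<in> ball z (min d (\<delta>/2))"
      then have "dist (act g u) z < \<delta>/2" by (simp add: dist_commute)
      moreover have "dist (act g u) (act g z) < \<delta>/2" using d(2)[of u] u by (simp add: dist_commute)
      ultimately show False using dist_triangle2[of "act g z" z "act g u"] unfolding \<delta>_def by (simp add: dist_commute)
    qed
    then show ?thesis using d(1) \<delta> by (intro exI[of _ "min d (\<delta>/2)"]) auto
  qed
  then obtain D where D: "\<And>g. g \<in> F \<Longrightarrow> D g > 0" "\<And>g u. g \<in> F \<Longrightarrow> u \<in> ball z (D g) \<Longrightarrow> act g u \<notin> ball z (D g)"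
    by metis
  define d where "d = Min (insert (e/2) (D ` F))"
  have fin: "finite (insert (e/2) (D ` F))" using F by simp
  have d: "d > 0" "d \<le> e/2" "\<And>g. g \<in> F \<Longrightarrow> d \<le> D g"
  proof -
    show "d > 0" unfolding d_def using fin D(1) e(1) by (subst Min_gr_iff) auto
    show "d \<le> e/2" unfolding d_def by (rule Min_le[OF fin]) simp
    show "d \<le> D g" if "g \<in> F" for g unfolding d_def by (rule Min_le[OF fin]) (use that in simp)
  qed
  show thesis
  proof (rule that[of d])
    fix g u assume g: "g \<in> \<Gamma>" "u \<in> ball z d" "act g u \<in> ball z d"
    show "g = {mat 1, - mat 1}"
    proof (rule ccontr)
      assume "g \<noteq> {mat 1, - mat 1}"
      then have "g \<in> F" unfolding F_def using g d(2) by (auto intro!: bexI[of _ u])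
      then show False using D(2)[of g u] d(3)[of g] g by auto
    qed
  qed (use d e in auto)
qed

text \<open>The region of \<open>x\<close> covers a disk, so it has a section; comparing it with the identity shows that
  the projection is injective on the region.\<close>

lemma region_stabilizer:
  assumes x: "x \<in> Y" and g: "g \<in> \<Gamma>" "act g x \<in> rg x"
  shows "g = {mat 1, - mat 1}"
proof -
  obtain p :: "complex \<Rightarrow> complex" where p: "continuous_on Y p" "p ` Y = ball 0 1"
    "\<And>U. open U \<Longrightarrow> U \<subseteq> Y \<Longrightarrow> open (p ` U)"
    "\<And>z w. z \<in> Y \<Longrightarrow> w \<in> Y \<Longrightarrow> p z = p w \<longleftrightarrow> (\<exists>g\<in>\<Gamma>. w = act g z)"
    using disk_projection by blast
  define D where "D = rg x"
  have DY: "D \<subseteq> Y" and DH: "D \<subseteq> HP" and oD: "open D" using rg_sub_Y Y_subset open_rg[OF x] by (auto simp: D_def)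
  have xD: "x \<in> D" using rg_refl[OF x] by (simp add: D_def)
  have Deq: "rg u = D" if "u \<in> D" for u using rg_eq[OF x] that by (simp add: D_def)
  have stab: "act h v \<in> D" if "h \<in> \<Gamma>" "u \<in> D" "v \<in> D" "act h u \<in> D" for h u v
  proof -
    have "v \<in> rg u" using Deq that by simp
    then have "act h v \<in> rg (act h u)" using rg_act[of u v h] that DY by blast
    then show ?thesis using Deq that by simp
  qed
  have cont: "continuous_on D p" using continuous_on_subset[OF p(1) DY] .
  have surj: "p ` D = ball 0 1"
  proof
    show "p ` D \<subseteq> ball 0 1" using p(2) DY by blast
    show "ball 0 1 \<subseteq> p ` D"
    proof
      fix y :: complex assume "y \<in> ball 0 1"
      then obtain u where u: "u \<in> Y" "y = p u" using p(2) by blast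
      obtain k where k: "k \<in> \<Gamma>" "u \<in> rg (act k x)" using regions_transitive[OF x u(1)] by blast
      have "act (inv\<^bsub>PSL2R\<^esub> k) u \<in> D"
        using rg_act[OF act_Y[OF k(1) x] k(2), of "inv\<^bsub>PSL2R\<^esub> k"] k x Y_subset by (auto simp: act_inv D_def subset_iff)
      moreover have "p (act (inv\<^bsub>PSL2R\<^esub> k) u) = p u"
        using p(4)[OF u(1), of "act (inv\<^bsub>PSL2R\<^esub> k) u"] k act_Y[of "inv\<^bsub>PSL2R\<^esub> k"] u by auto
      ultimately show "y \<in> p ` D" using u by (metis image_eqI)
    qed
  qed
  have cov: "covering_space D p (ball 0 1)"
  proof (rule covering_spaceI[OF cont surj])
    fix y :: complex assume "y \<in> ball 0 1"
    then obtain z where z: "z \<in> D" "y = p z" using surj by blast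
    obtain e where e: "e > 0" "ball z e \<subseteq> D" using oD z open_contains_ball by blast
    obtain d where d: "0 < d" "d \<le> e"
        "\<And>g u. g \<in> \<Gamma> \<Longrightarrow> u \<in> ball z d \<Longrightarrow> act g u \<in> ball z d \<Longrightarrow> g = {mat 1, - mat 1}"
      using wandering_neighbourhood[of z e] e z DH by blast
    define V where "V = ball z d"
    have V: "open V" "V \<subseteq> D" "z \<in> V" using d e by (auto simp: V_def)
    \<comment> \<open>The sheets over the image of \<open>V\<close>: its translates by the elements
      that keep \<open>z\<close>, and hence all of \<open>D\<close>, inside
      \<open>D\<close>.\<close>
    define v where "v = (\<lambda>h. act h ` V) ` {h \<in> \<Gamma>. act h z \<in> D}"
    have sub: "act h ` V \<subseteq> D" if "h \<in> \<Gamma>" "act h z \<in> D" for h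
      using stab[OF that(1) z(1) _ that(2)] V by blast
    have op: "open (p ` U)" if "open U" "U \<subseteq> D" for U using p(3)[of U] that DY by blast
    show "\<exists>T. y \<in> T \<and> openin (top_of_set (ball 0 1)) T \<and> (\<exists>v. \<Union>v = D \<inter> p -` T \<and> (\<forall>u\<in>v. openin (top_of_set D) u) \<and> pairwise disjnt v \<and> (\<forall>u\<in>v. \<exists>q. homeomorphism u T p q))"
    proof (intro exI[of _ "p ` V"] conjI exI[of _ v] ballI)
      show "y \<in> p ` V" using z V by blast
      show "openin (top_of_set (ball 0 1)) (p ` V)"
        using op[OF V(1,2)] surj V by (intro open_subset) auto
      show "\<Union>v = D \<inter> p -` (p ` V)"
      proof (intro subset_antisym subsetI)
        fix u assume "u \<in> \<Union>v"
        then obtain h w where h: "h \<in> \<Gamma>" "act h z \<in> D" "w \<in> V" "u = act h w" unfolding v_def by blast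
        have u: "u \<in> D" using sub[OF h(1,2)] h by blast
        moreover have "p w = p u" using p(4)[of w u] h u V DY by blast
        ultimately show "u \<in> D \<inter> p -` (p ` V)" using h(3) by (metis IntI image_eqI vimageI2)
      next
        fix u assume u: "u \<in> D \<inter> p -` (p ` V)"
        then obtain w where w: "w \<in> V" "p w = p u" by force
        then obtain h where h: "h \<in> \<Gamma>" "u = act h w" using p(4)[of w u] u V DY by blast
        then have "act h z \<in> D" using stab[OF h(1), of w z] w V z u by blast
        then show "u \<in> \<Union>v" unfolding v_def using h w by blast
      qed
      show "openin (top_of_set D) u" if "u \<in> v" for u
        using that sub V DH unfolding v_def by (auto intro!: open_subset open_act_image)
      show "pairwise disjnt v"
      proof (rule pairwiseI)
        fix u u' assume u: "u \<in> v" "u' \<in> v" "u \<noteq> u'"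
        then obtain h h' where h: "h \<in> \<Gamma>" "u = act h ` V" "h' \<in> \<Gamma>" "u' = act h' ` V" unfolding v_def by blast
        show "disjnt u u'"
        proof (rule ccontr)
          assume "\<not> disjnt u u'"
          then obtain w w' where w: "w \<in> V" "w' \<in> V" "act h w = act h' w'" using h unfolding disjnt_def by blast
          then have wH: "w \<in> HP" "w' \<in> HP" using V DH by auto
          have "act (inv\<^bsub>PSL2R\<^esub> h' \<otimes>\<^bsub>PSL2R\<^esub> h) w = w'"
            using w(3) wH h by (simp add: act_mult act_inv)
          then have "inv\<^bsub>PSL2R\<^esub> h' \<otimes>\<^bsub>PSL2R\<^esub> h = {mat 1, - mat 1}"
            using d(3)[of "inv\<^bsub>PSL2R\<^esub> h' \<otimes>\<^bsub>PSL2R\<^esub> h" w] w h unfolding V_def by simp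
          then have "w' = w" using w(3) \<open>act (_ \<otimes>\<^bsub>PSL2R\<^esub> _) w = w'\<close> by simp
          then have "h = h'" using act_eq_imp[OF h(1,3) wH(1)] w(3) by simp
          then have "u = u'" using h by simp
          then show False using u by simp
        qed
      qed
      show "\<exists>q. homeomorphism u (p ` V) p q" if u: "u \<in> v" for u
      proof -
        obtain h where h: "h \<in> \<Gamma>" "act h z \<in> D" "u = act h ` V" using u unfolding v_def by blast
        have uD: "u \<subseteq> D" using sub h by blast
        have ou: "open u" using h V DH by (auto intro!: open_act_image)
        have pu: "p (act h w) = p w" if w: "w \<in> V" for w
        proof -
          have "w \<in> Y" "act h w \<in> Y" using w h(3) uD V(2) DY by auto
          then show ?thesis using p(4)[of w "act h w"] h(1) by auto
        qed
        have inj: "inj_on p u"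
        proof (rule inj_onI)
          fix b b' assume b: "b \<in> u" "b' \<in> u" "p b = p b'"
          then obtain w w' where w: "w \<in> V" "w' \<in> V" "b = act h w" "b' = act h w'" using h by blast
          then have "p w = p w'" using pu b by simp
          then obtain k where k: "k \<in> \<Gamma>" "w' = act k w" using p(4)[of w w'] w V DY by blast
          then have "k = {mat 1, - mat 1}" using d(3)[of k w] w unfolding V_def by simp
          then show "b = b'" using k w by simp
        qed
        have im: "p ` u = p ` V" using pu h by (auto simp: image_image)
        have oo: "openin (top_of_set (p ` V)) (p ` U)" if "openin (top_of_set u) U" for U
        proof -
          have "open U" "U \<subseteq> u" using that ou by (auto simp: openin_open_eq)
          moreover have "p ` U \<subseteq> p ` V" unfolding im[symmetric] using \<open>U \<subseteq> u\<close> by (rule image_mono)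
          ultimately show ?thesis using op[of U] uD by (intro open_subset) auto
        qed
        obtain q where "homeomorphism u (p ` V) p q"
          using homeomorphism_injective_open_map[OF continuous_on_subset[OF cont uD] im inj oo] by blast
        then show ?thesis by blast
      qed
    qed
  qed
  \<comment> \<open>A section, obtained by lifting the identity of the simply connected
    disk.\<close>
  obtain s where s: "continuous_on (ball 0 1) s" "s \<in> ball 0 1 \<rightarrow> D" "\<And>y. y \<in> ball 0 1 \<Longrightarrow> p (s y) = y"
  proof (rule covering_space_lift[OF cov])
    show "simply_connected (ball (0::complex) 1)" by (intro convex_imp_simply_connected convex_ball)
    show "locally path_connected (ball (0::complex) 1)" by (intro convex_imp_locally_path_connected convex_ball)
    show "continuous_on (ball (0::complex) 1) (\<lambda>y. y)" by simp
  qed auto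
  have px: "p x \<in> ball 0 1" using surj xD by blast
  then have sx: "s (p x) \<in> D" "p (s (p x)) = p x" using s by auto
  then obtain k where k: "k \<in> \<Gamma>" "x = act k (s (p x))" using p(4)[of "s (p x)" x] xD DY by blast
  have kD: "act k v \<in> D" if "v \<in> D" for v using stab[OF k(1) sx(1) that] k xD by simp
  have gx: "act g x \<in> D" using g by (simp add: D_def)
  \<comment> \<open>The identity and the map that sends \<open>z\<close> to
    \<open>act k (s (p z))\<close> are lifts of \<open>p\<close> on the connected region which agree
    at \<open>x\<close>. So \<open>act g x\<close>, which has the same projection as
    \<open>x\<close>, equals \<open>x\<close>.\<close>
  have "act g x = act k (s (p (act g x)))"
  proof (rule covering_space_lift_unique[OF cov, where ?g1.0 = "\<lambda>z. z" and ?g2.0 = "\<lambda>z. act k (s (p z))" and f = p and T = D and a = x])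
    have "continuous_on D (\<lambda>z. s (p z))"
      by (rule continuous_on_compose2[OF s(1) cont]) (use surj in auto)
    then show "continuous_on D (\<lambda>z. act k (s (p z)))"
      by (rule continuous_on_compose2[OF continuous_on_act[of k], rotated]) (use k s surj DH in auto)
    show "connected D" unfolding D_def by (rule connected_rg[OF x])
    show "p z = p (act k (s (p z)))" if z: "z \<in> D" for z
    proof -
      have pz: "p z \<in> ball 0 1" using surj z by blast
      then have "s (p z) \<in> D" using s by auto
      then have "p (s (p z)) = p (act k (s (p z)))" using p(4)[of "s (p z)" "act k (s (p z))"] kD k DY by blast
      then show ?thesis using s(3)[OF pz] by simp
    qed
  qed (use k(2) cont surj s kD xD gx in auto)
  also have "p (act g x) = p x" using p(4)[OF x act_Y[OF g(1) x]] g(1) by metis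
  also have "act k (s (p x)) = x" using k by simp
  finally show ?thesis using act_free[OF discrete free g(1)] x Y_subset by auto
qed

end

section \<open>Counting group elements by separating lifts\<close>

context arc_system
begin

text \<open>The region of \<open>z\<close> is the one adjacent to the lift \<open>L\<close> on the side \<open>\<sigma>\<close>.\<close>

definition adj :: "nat \<times> psl \<Rightarrow> real \<Rightarrow> complex \<Rightarrow> bool" where
  "adj L \<sigma> z \<longleftrightarrow> z \<in> Y \<and> sgn (side (lm L) z) = \<sigma> \<and>
     (\<forall>L'\<in>lifts. L' \<noteq> L \<longrightarrow> (\<forall>t. side (lm L') z * side (lm L') (geod (lm L) t) > 0))"

text \<open>For other lifts the sign is the one they have on \<open>L\<close>, and for
  \<open>L\<close> itself it is \<sigma>; together these determine the region.\<close>

lemma adj_region: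
  assumes "adj L \<sigma> z" "adj L \<sigma> w"
  shows "w \<in> rg z"
proof -
  have z: "z \<in> Y" and w: "w \<in> Y" using assms by (auto simp: adj_def)
  have "sgn (side (lm L') w) = sgn (side (lm L') z)" if L': "L' \<in> lifts" for L'
  proof (cases "L' = L")
    case False
    then have "side (lm L') z * side (lm L') (geod (lm L) 0) > 0" "side (lm L') w * side (lm L') (geod (lm L) 0) > 0"
      using assms L' unfolding adj_def by blast+
    then show ?thesis by (auto simp: sgn_if zero_less_mult_iff)
  qed (use assms in \<open>simp add: adj_def\<close>)
  then show ?thesis using rg_iff_sgn[OF z] w Y_subset by blast
qed

lemma adj_rg: "adj L \<sigma> z \<Longrightarrow> L \<in> lifts \<Longrightarrow> w \<in> rg z \<Longrightarrow> adj L \<sigma> w"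
proof -
  assume a: "adj L \<sigma> z" and L: "L \<in> lifts" and w: "w \<in> rg z"
  have z: "z \<in> Y" using a by (simp add: adj_def)
  have s: "sgn (side (lm L') w) = sgn (side (lm L') z)" if "L' \<in> lifts" for L' using w that rg_iff_sgn[OF z] by blast
  have "side (lm L') w * side (lm L') (geod (lm L) t) > 0" if "L' \<in> lifts" "L' \<noteq> L" for L' t
  proof -
    have "side (lm L') z * side (lm L') (geod (lm L) t) > 0" using a that unfolding adj_def by blast
    then have "sgn (side (lm L') w * side (lm L') (geod (lm L) t)) > 0"
      unfolding sgn_mult s[OF that(1)] by (simp add: sgn_mult[symmetric])
    then show ?thesis by (simp add: sgn_greater)
  qed
  moreover have "w \<in> Y" using w rg_sub_Y by blast
  ultimately show ?thesis using a s[OF L] unfolding adj_def by auto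
qed

lemma adj_tr:
  assumes a: "adj L \<sigma> z" and L: "L \<in> lifts" and h: "h \<in> \<Gamma>"
  shows "adj (tr h L) \<sigma> (act h z)"
proof -
  have z: "z \<in> Y" "z \<in> HP" using a Y_subset by (auto simp: adj_def)
  have geo: "geod (lm (tr h L)) t = act h (geod (lm L) t)" for t
    using lm_tr[OF h L] act_geod[of h "lm L" t] h L by auto
  have "side (lm L') (act h z) * side (lm L') (geod (lm (tr h L)) t) > 0" if L': "L' \<in> lifts" "L' \<noteq> tr h L" for L' t
  proof -
    let ?L = "tr (inv\<^bsub>PSL2R\<^esub> h) L'"
    have l: "?L \<in> lifts" "tr h ?L = L'" "?L \<noteq> L" using L' h by auto
    have "side (lm ?L) z * side (lm ?L) (geod (lm L) t) > 0" using a l unfolding adj_def by blast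
    then have "sgn (side (lm ?L) z * side (lm ?L) (geod (lm L) t)) > 0" by simp
    then have "sgn (side (lm L') (act h z) * side (lm L') (act h (geod (lm L) t))) > 0"
      using sgn_side_tr[OF h l(1) z(2)] sgn_side_tr[OF h l(1), of "geod (lm L) t"] L l(2) by (simp add: sgn_mult)
    then show ?thesis unfolding geo by (simp add: sgn_greater)
  qed
  then show ?thesis unfolding adj_def using act_Y[OF h z(1)] sgn_side_tr[OF h L z(2)] a by (auto simp: adj_def)
qed

lemma lift_same_side:
  assumes "L \<in> lifts" "L' \<in> lifts" "L' \<noteq> L"
  shows "side (lm L') (geod (lm L) t) * side (lm L') (geod (lm L) t') > 0"
proof (rule same_sign_connected[of "range (geod (lm L))" "side (lm L')"])
  show "connected (range (geod (lm L)))" using assms by (simp add: connected_range_geod)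
  show "continuous_on (range (geod (lm L))) (side (lm L'))" by (intro continuous_intros)
  fix x assume "x \<in> range (geod (lm L))"
  then obtain u where x: "x = geod (lm L) u" by blast
  show "side (lm L') x \<noteq> 0"
  proof
    assume "side (lm L') x = 0"
    then have "x \<in> range (geod (lm L'))" using side_eq_0_iff[of "lm L'" x] assms x by simp
    then show False using lifts_disjoint[OF assms(1,2)] x assms(3) by auto
  qed
qed auto

lemma adj_exists:
  assumes L: "L \<in> lifts" and \<sigma>: "\<sigma> = 1 \<or> \<sigma> = -1"
  shows "\<exists>z. adj L \<sigma> z"
proof -
  define q where "q = geod (lm L) 0"
  have q: "q \<in> HP" using L by (simp add: q_def)
  obtain e where e: "e > 0" "ball q e \<subseteq> HP"
    "\<And>L' w. L' \<in> lifts \<Longrightarrow> side (lm L') q \<noteq> 0 \<Longrightarrow> w \<in> ball q e \<Longrightarrow> side (lm L') w * side (lm L') q > 0"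
    using HP_neighbourhood[OF q] by blast
  \<comment> \<open>In the frame of \<open>lm L\<close> this is \<i> displaced horizontally towards
    the side \<sigma>.\<close>
  define w where "w \<delta> = moebius (lm L) (Complex (\<sigma> * \<delta>) 1)" for \<delta>
  have H: "Complex (\<sigma> * \<delta>) 1 \<in> HP" for \<delta> by (simp add: HP_def)
  have "continuous_on UNIV w"
    unfolding w_def by (rule continuous_on_compose2[OF continuous_on_moebius])
      (use L in \<open>auto intro!: continuous_intros simp: HP_def\<close>)
  then have "continuous (at 0) w" by (simp add: continuous_on_eq_continuous_at)
  moreover have w0: "w 0 = q" by (simp add: w_def q_def geod_def i_complex_of_real complex_eq_iff) (simp add: Complex_eq)
  ultimately obtain d where d: "d > 0" "\<And>\<delta>. dist \<delta> 0 < d \<Longrightarrow> dist (w \<delta>) q < e"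
    using e(1) unfolding continuous_at_eps_delta w0 by blast
  define z where "z = w (d/2)"
  have zb: "z \<in> ball q e" using d(2)[of "d/2"] d(1) by (simp add: z_def dist_commute)
  then have zH: "z \<in> HP" using e by blast
  have eq: "side (lm L) z = Re (Complex (\<sigma> * (d/2)) 1) * jac (inv2 (lm L)) z"
    using side_eq_Re[OF det_lm[OF L] zH] moebius_inv2(1)[OF det_lm[OF L] H, of "d/2"]
    unfolding z_def w_def by (simp only:)
  then have sg: "sgn (side (lm L) z) = \<sigma>"
    using jac_pos[of "inv2 (lm L)" z] L zH d(1) \<sigma> unfolding eq by (auto simp: sgn_mult)
  have oth: "side (lm L') z * side (lm L') (geod (lm L) t) > 0" if L': "L' \<in> lifts" "L' \<noteq> L" for L' t
  proof -
    have 1: "side (lm L') q * side (lm L') (geod (lm L) t) > 0"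
      unfolding q_def by (rule lift_same_side[OF L L'])
    then have "side (lm L') q \<noteq> 0" by auto
    then have "side (lm L') z * side (lm L') q > 0" using e(3) L' zb by blast
    then show ?thesis using 1 by (auto simp: zero_less_mult_iff)
  qed
  have "side (lm L') z \<noteq> 0" if "L' \<in> lifts" for L'
    using oth[OF that, of 0] sg \<sigma> by (cases "L' = L") (auto simp: sgn_0_0)
  then have "z \<in> Y" using zH by (auto simp: Y_def)
  then show ?thesis unfolding adj_def using sg oth by blast
qed

text \<open>Lifts are ordered by the parameter \<tau> at which they meet the segment
  \<open>kp y y'\<close>. The first one borders the region of \<open>y\<close>; every other one is
  met beyond it and, being disjoint from it, stays beyond it.\<close>

lemma first_crossing:
  assumes y: "y \<in> Y" "y' \<in> Y" and ne: "sep y y' \<noteq> {}"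
  obtains L where "L \<in> sep y y'" "adj L (sgn (side (lm L) y)) y"
    "\<And>w. adj L (- sgn (side (lm L) y)) w \<Longrightarrow> sep w y' = sep y y' - {L}"
    "\<And>L'. L' \<in> sep y y' \<Longrightarrow> L' \<noteq> L \<Longrightarrow> \<exists>t. sgn (side (lm L) (geod (lm L') t)) = - sgn (side (lm L) y)"
proof -
  have H: "y \<in> HP" "y' \<in> HP" using y Y_subset by auto
  define \<tau> where "\<tau> L = side (lm L) y / (side (lm L) y - side (lm L) y')" for L
  have fin: "finite (sep y y')" by (rule finite_sep[OF H])
  obtain L where L: "L \<in> sep y y'" and least: "\<And>L'. L' \<in> sep y y' \<Longrightarrow> \<tau> L \<le> \<tau> L'"
    using ex_min_if_finite[of "\<tau> ` sep y y'"] fin ne by (metis (mono_tags, lifting) arg_min_if_finite(1) arg_min_least)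
  have Ll: "L \<in> lifts" using L by (simp add: sep_def)
  have \<tau>: "0 < \<tau> L' \<and> \<tau> L' < 1 \<and> (1 - \<tau> L') * side (lm L') y + \<tau> L' * side (lm L') y' = 0"
    if "L' \<in> sep y y'" for L'
  proof -
    define b c where "b = side (lm L') y" and "c = side (lm L') y'"
    have bc: "b * c < 0" using that by (simp add: sep_def b_def c_def)
    then have nz: "b - c \<noteq> 0" by (auto simp: mult_less_0_iff)
    have "0 < b / (b - c)" "b / (b - c) < 1"
      using bc by (auto simp: mult_less_0_iff zero_less_divide_iff divide_less_eq)
    moreover have "(1 - b / (b - c)) * b + b / (b - c) * c = 0"
      using nz by (simp add: field_simps)
    ultimately show ?thesis by (simp add: \<tau>_def b_def c_def)
  qed
  have zero: "kp y y' (\<tau> L') \<in> range (geod (lm L'))" if "L' \<in> sep y y'" for L'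
    using \<tau>[OF that] side_kp[OF H, of "\<tau> L'" "lm L'"] side_eq_0_iff[of "lm L'" "kp y y' (\<tau> L')"] kp_in_HP[OF H, of "\<tau> L'"] that
    by (simp add: sep_def)
  obtain u where u: "kp y y' (\<tau> L) = geod (lm L) u" using zero[OF L] by blast
  have oth: "side (lm L') y * side (lm L') (geod (lm L) t) > 0" if L': "L' \<in> lifts" "L' \<noteq> L" for L' t
  proof -
    define b c where "b = side (lm L') y" and "c = side (lm L') y'"
    have q: "side (lm L') (geod (lm L) u) = (1 - \<tau> L) * b + \<tau> L * c"
      using side_kp[OF H, of "\<tau> L" "lm L'"] \<tau>[OF L] by (simp add: u[symmetric] b_def c_def)
    have ss: "side (lm L') (geod (lm L) u) * side (lm L') (geod (lm L) t) > 0"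
      by (rule lift_same_side[OF Ll L'])
    have bnz: "b \<noteq> 0" "c \<noteq> 0" using y L' by (auto simp: Y_def b_def c_def)
    have "b * ((1 - \<tau> L) * b + \<tau> L * c) > 0"
    proof (cases "b * c < 0")
      case False
      then have "b * c > 0" using bnz by (simp add: linorder_not_less order_le_less)
      then have "\<tau> L * (b * c) > 0" using \<tau>[OF L] by simp
      moreover have "(1 - \<tau> L) * (b * b) \<ge> 0" using \<tau>[OF L] by simp
      ultimately have "(1 - \<tau> L) * (b * b) + \<tau> L * (b * c) > 0" by linarith
      then show ?thesis by (simp add: algebra_simps)
    next
      case True
      then have L's: "L' \<in> sep y y'" using L' by (simp add: sep_def b_def c_def)
      have "(1 - \<tau> L) * b + \<tau> L * c \<noteq> 0" using ss q by auto
      moreover have z': "(1 - \<tau> L') * b + \<tau> L' * c = 0" using \<tau>[OF L's] by (simp add: b_def c_def)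
      ultimately have lt: "\<tau> L < \<tau> L'" using least[OF L's] by (cases "\<tau> L = \<tau> L'") auto
      \<comment> \<open>Subtracting the vanishing value at \<open>\<tau> L'\<close> leaves
        \<open>\<tau> L' - \<tau> L\<close> times a positive number.\<close>
      have "b * ((1 - \<tau> L) * b + \<tau> L * c) = b * ((1 - \<tau> L) * b + \<tau> L * c) - b * ((1 - \<tau> L') * b + \<tau> L' * c)"
        unfolding z' by simp
      also have "\<dots> = (\<tau> L' - \<tau> L) * (b * b - b * c)" by (simp add: algebra_simps)
      also have "\<dots> > 0" using lt True by (intro mult_pos_pos) (auto intro: order.strict_trans2[OF _ zero_le_square])
      finally show ?thesis .
    qed
    then have "b * side (lm L') (geod (lm L) u) > 0" using q by simp
    then show ?thesis using ss unfolding b_def by (auto simp: zero_less_mult_iff)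
  qed
  show thesis
  proof (rule that[OF L])
    show "adj L (sgn (side (lm L) y)) y" unfolding adj_def using y oth by blast
  next
    fix w assume w: "adj L (- sgn (side (lm L) y)) w"
    have wY: "w \<in> Y" using w by (simp add: adj_def)
    have "L' \<in> sep w y' \<longleftrightarrow> L' \<in> sep y y'" if L': "L' \<in> lifts" "L' \<noteq> L" for L'
    proof -
      have "side (lm L') w * side (lm L') (geod (lm L) u) > 0" using w L' unfolding adj_def by blast
      then have "side (lm L') w * side (lm L') y > 0" using oth[OF L', of u] by (auto simp: zero_less_mult_iff)
      then show ?thesis using L' by (auto simp: sep_def mult_less_0_iff zero_less_mult_iff)
    qed
    moreover have "L \<notin> sep w y'"
      using w L by (auto simp: adj_def sep_def sgn_if mult_less_0_iff split: if_splits)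
    moreover have "sep w y' \<subseteq> lifts" "sep y y' \<subseteq> lifts" by (auto simp: sep_def)
    ultimately show "sep w y' = sep y y' - {L}" by blast
  next
    fix L' assume L': "L' \<in> sep y y'" "L' \<noteq> L"
    then have L'l: "L' \<in> lifts" by (simp add: sep_def)
    obtain t where t: "kp y y' (\<tau> L') = geod (lm L') t" using zero[OF L'(1)] by blast
    define b c where "b = side (lm L) y" and "c = side (lm L) y'"
    have bc: "b * c < 0" using L by (simp add: sep_def b_def c_def)
    have val: "side (lm L) (geod (lm L') t) = (1 - \<tau> L') * b + \<tau> L' * c"
      using side_kp[OF H, of "\<tau> L'" "lm L"] \<tau>[OF L'(1)] by (simp add: t[symmetric] b_def c_def)
    have z: "(1 - \<tau> L) * b + \<tau> L * c = 0" using \<tau>[OF L] by (simp add: b_def c_def)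
    have "\<tau> L' \<noteq> \<tau> L"
    proof
      assume "\<tau> L' = \<tau> L"
      then have "geod (lm L') t = geod (lm L) u" using t u by simp
      then show False using lifts_disjoint[OF L'l Ll] L'(2) by blast
    qed
    then have lt: "\<tau> L < \<tau> L'" using least[OF L'(1)] by simp
    have "b * side (lm L) (geod (lm L') t) = b * ((1 - \<tau> L') * b + \<tau> L' * c) - b * ((1 - \<tau> L) * b + \<tau> L * c)"
      unfolding z val by simp
    also have "\<dots> = (\<tau> L' - \<tau> L) * (b * c - b * b)" by (simp add: algebra_simps)
    also have "\<dots> < 0"
    proof (rule mult_pos_neg)
      have "0 \<le> b * b" by simp
      then show "b * c - b * b < 0" using bc by linarith
    qed (use lt in simp)
    finally have "sgn (side (lm L) (geod (lm L') t)) = - sgn b"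
      by (auto simp: mult_less_0_iff)
    then show "\<exists>t. sgn (side (lm L) (geod (lm L') t)) = - sgn (side (lm L) y)" unfolding b_def by blast
  qed
qed

lemma region_unique:
  assumes x: "x \<in> Y" and g: "g \<in> \<Gamma>" "h \<in> \<Gamma>" and r: "act h x \<in> rg (act g x)"
  shows "h = g"
proof -
  have xH: "x \<in> HP" using x Y_subset by blast
  have "act (inv\<^bsub>PSL2R\<^esub> g) (act h x) \<in> rg (act (inv\<^bsub>PSL2R\<^esub> g) (act g x))"
    using rg_act[OF act_Y[OF g(1) x] r, of "inv\<^bsub>PSL2R\<^esub> g"] g by simp
  then have "act (inv\<^bsub>PSL2R\<^esub> g \<otimes>\<^bsub>PSL2R\<^esub> h) x \<in> rg x"
    using g xH by (simp add: act_mult act_inv)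
  then have "inv\<^bsub>PSL2R\<^esub> g \<otimes>\<^bsub>PSL2R\<^esub> h = \<one>\<^bsub>PSL2R\<^esub>"
    using region_stabilizer[OF x, of "inv\<^bsub>PSL2R\<^esub> g \<otimes>\<^bsub>PSL2R\<^esub> h"] g by simp
  then show ?thesis using g PSL.inv_solve_left'[of "\<one>\<^bsub>PSL2R\<^esub>" g h] PSL.r_one[of g] by (simp del: PSL2R_one)
qed

text \<open>By simple transitivity a region is named by the group element that moves
  \<open>x\<close> into it. \<open>k i \<sigma>\<close> names the region on the side \<sigma> of the
  lift of arc \<open>i\<close> with trivial group element, and left multiplication by
  \<open>h\<close> names the one beside \<open>(i, h)\<close>.\<close>

definition side_elements :: "complex \<Rightarrow> (nat \<Rightarrow> real \<Rightarrow> psl) \<Rightarrow> bool" where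
  "side_elements x k \<longleftrightarrow> (\<forall>i \<sigma>. i < m \<longrightarrow> \<sigma> = 1 \<or> \<sigma> = -1 \<longrightarrow> k i \<sigma> \<in> \<Gamma>) \<and>
     (\<forall>i h \<sigma>. (i, h) \<in> lifts \<longrightarrow> \<sigma> = 1 \<or> \<sigma> = -1 \<longrightarrow> adj (i, h) \<sigma> (act (h \<otimes>\<^bsub>PSL2R\<^esub> k i \<sigma>) x))"

lemma side_elements_exist:
  assumes x: "x \<in> Y"
  shows "\<exists>k. side_elements x k"
proof -
  have "\<exists>g. g \<in> \<Gamma> \<and> adj (i, {mat 1, - mat 1}) \<sigma> (act g x)" if i: "i < m" and \<sigma>: "\<sigma> = 1 \<or> \<sigma> = -1" for i \<sigma>
  proof -
    have L: "(i, {mat 1, - mat 1}) \<in> lifts" using i by (simp add: lifts_def)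
    obtain w where w: "adj (i, {mat 1, - mat 1}) \<sigma> w" using adj_exists[OF L \<sigma>] by blast
    then have "w \<in> Y" by (simp add: adj_def)
    then obtain g where g: "g \<in> \<Gamma>" "w \<in> rg (act g x)" using regions_transitive[OF x] by blast
    then have "act g x \<in> rg w" using rg_sym act_Y x by blast
    then show ?thesis using g adj_rg[OF w L] by blast
  qed
  then obtain k where k: "\<And>i \<sigma>. i < m \<Longrightarrow> \<sigma> = 1 \<or> \<sigma> = -1 \<Longrightarrow> k i \<sigma> \<in> \<Gamma> \<and> adj (i, {mat 1, - mat 1}) \<sigma> (act (k i \<sigma>) x)"
    by metis
  show ?thesis
    unfolding side_elements_def
  proof (intro exI[of _ k] conjI allI impI)
    fix i h \<sigma> assume L: "(i, h) \<in> lifts" and \<sigma>: "\<sigma> = (1::real) \<or> \<sigma> = -1"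
    then have ih: "i < m" "h \<in> \<Gamma>" by (auto simp: lifts_def)
    have L1: "(i, {mat 1, - mat 1}) \<in> lifts" using ih by (simp add: lifts_def)
    have "adj (tr h (i, {mat 1, - mat 1})) \<sigma> (act h (act (k i \<sigma>) x))"
      using adj_tr[OF _ L1 ih(2)] k[OF ih(1) \<sigma>] by blast
    moreover have "tr h (i, {mat 1, - mat 1}) = (i, h)"
      using PSL.r_one[of h] ih by (simp add: tr_def)
    ultimately show "adj (i, h) \<sigma> (act (h \<otimes>\<^bsub>PSL2R\<^esub> k i \<sigma>) x)"
      using ih k[OF ih(1) \<sigma>] x Y_subset by (auto simp: act_mult subset_iff)
  qed (use k in blast)
qed

text \<open>If \<open>(i, h)\<close> borders the region of \<open>act g x\<close>, uniqueness of
  names gives that \<open>g\<close> is \<open>h\<close> times \<open>k i \<sigma>\<close>. So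
  \<open>(i, h)\<close> is the translate by \<open>g\<close> of the lift of arc \<open>i\<close>
  with group element inverse to \<open>k i \<sigma>\<close>.\<close>

lemma first_lift_finite:
  assumes x: "x \<in> Y"
  obtains LS where "finite LS" "LS \<subseteq> lifts"
    "\<And>g L \<sigma>. g \<in> \<Gamma> \<Longrightarrow> L \<in> lifts \<Longrightarrow> \<sigma> = 1 \<or> \<sigma> = -1 \<Longrightarrow> adj L \<sigma> (act g x) \<Longrightarrow> L \<in> tr g ` LS"
proof -
  obtain k where se: "side_elements x k" using side_elements_exist[OF x] by blast
  have k: "\<And>i \<sigma>. i < m \<Longrightarrow> \<sigma> = 1 \<or> \<sigma> = -1 \<Longrightarrow> k i \<sigma> \<in> \<Gamma>"
    "\<And>i h \<sigma>. (i, h) \<in> lifts \<Longrightarrow> \<sigma> = 1 \<or> \<sigma> = -1 \<Longrightarrow> adj (i, h) \<sigma> (act (h \<otimes>\<^bsub>PSL2R\<^esub> k i \<sigma>) x)"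
    using se unfolding side_elements_def by blast+
  define LS where "LS = (\<lambda>(i, \<sigma>). (i, inv\<^bsub>PSL2R\<^esub> (k i \<sigma>))) ` ({..<m} \<times> {1, -1::real})"
  show thesis
  proof (rule that[of LS])
    show "finite LS" by (simp add: LS_def)
    show "LS \<subseteq> lifts" using k(1) by (auto simp: LS_def lifts_def)
    fix g L \<sigma> assume g: "g \<in> \<Gamma>" and L: "L \<in> lifts" and \<sigma>: "\<sigma> = (1::real) \<or> \<sigma> = -1" and a: "adj L \<sigma> (act g x)"
    obtain i h where ih: "L = (i, h)" "i < m" "h \<in> \<Gamma>" using L by (auto simp: lifts_def)
    have "act (h \<otimes>\<^bsub>PSL2R\<^esub> k i \<sigma>) x \<in> rg (act g x)"
      using adj_region[OF a] k(2)[of i h \<sigma>] L ih \<sigma> by blast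
    then have "h \<otimes>\<^bsub>PSL2R\<^esub> k i \<sigma> = g" using region_unique[OF x g, of "h \<otimes>\<^bsub>PSL2R\<^esub> k i \<sigma>"] ih k(1)[OF ih(2) \<sigma>] by simp
    then have "h = g \<otimes>\<^bsub>PSL2R\<^esub> inv\<^bsub>PSL2R\<^esub> (k i \<sigma>)"
      using ih k(1)[OF ih(2) \<sigma>] by (metis PSL.inv_solve_right \<Gamma>_carrier g)
    then have "L = tr g (i, inv\<^bsub>PSL2R\<^esub> (k i \<sigma>))" using ih by (simp add: tr_def)
    moreover have "(i, inv\<^bsub>PSL2R\<^esub> (k i \<sigma>)) \<in> LS"
      unfolding LS_def using ih \<sigma> by (intro image_eqI[of _ _ "(i, \<sigma>)"]) auto
    ultimately show "L \<in> tr g ` LS" by (metis image_eqI)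
  qed
qed

text \<open>Crossing the first separating lift \<open>(i, h)\<close> replaces
  \<open>k i \<sigma>\<close> by \<open>k i (- \<sigma>)\<close> behind \<open>h\<close>, which is
  right multiplication by an element of the finite set \<open>T\<close>. So \<gamma> is a product of
  as many elements of \<open>T\<close> as there are separating lifts.\<close>

lemma finite_sep_bounded:
  assumes x: "x \<in> Y"
  shows "finite {\<gamma> \<in> \<Gamma>. card (sep x (act \<gamma> x)) \<le> r}"
proof -
  obtain k where se: "side_elements x k" using side_elements_exist[OF x] by blast
  have k: "\<And>i \<sigma>. i < m \<Longrightarrow> \<sigma> = 1 \<or> \<sigma> = -1 \<Longrightarrow> k i \<sigma> \<in> \<Gamma>"
    "\<And>i h \<sigma>. (i, h) \<in> lifts \<Longrightarrow> \<sigma> = 1 \<or> \<sigma> = -1 \<Longrightarrow> adj (i, h) \<sigma> (act (h \<otimes>\<^bsub>PSL2R\<^esub> k i \<sigma>) x)"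
    using se unfolding side_elements_def by blast+
  define T where "T = (\<lambda>(i, \<sigma>). inv\<^bsub>PSL2R\<^esub> (k i \<sigma>) \<otimes>\<^bsub>PSL2R\<^esub> k i (- \<sigma>)) ` ({..<m} \<times> {1, -1::real})"
  have T: "finite T" "T \<subseteq> \<Gamma>" using k(1) by (auto simp: T_def)
  \<comment> \<open>\<open>W r\<close> consists of the products of exactly \<open>r\<close> elements
    of \<open>T\<close>.\<close>
  define W where "W = rec_nat {{mat 1, - mat 1}} (\<lambda>_ S. (\<lambda>(t, w). t \<otimes>\<^bsub>PSL2R\<^esub> w) ` (T \<times> S))"
  have W0: "W 0 = {{mat 1, - mat 1}}" and WS: "\<And>r. W (Suc r) = (\<lambda>(t, w). t \<otimes>\<^bsub>PSL2R\<^esub> w) ` (T \<times> W r)"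
    by (simp_all add: W_def)
  have W: "finite (W r) \<and> W r \<subseteq> \<Gamma>" for r
  proof (induction r)
    case (Suc r)
    then have "t \<otimes>\<^bsub>PSL2R\<^esub> w \<in> \<Gamma>" if "t \<in> T" "w \<in> W r" for t w
      using that T by (meson \<Gamma>_closed(1) subsetD)
    then show ?case using Suc T by (auto simp: WS)
  qed (simp add: W0)
  \<comment> \<open>The starting region is arbitrary, since each induction step moves it across one
    lift.\<close>
  have main: "\<gamma> \<in> (\<lambda>w. g \<otimes>\<^bsub>PSL2R\<^esub> w) ` W r" if "g \<in> \<Gamma>" "\<gamma> \<in> \<Gamma>" "card (sep (act g x) (act \<gamma> x)) = r" for g \<gamma> r
    using that
  proof (induction r arbitrary: g)
    case 0
    have Yg: "act g x \<in> Y" "act \<gamma> x \<in> Y" using 0 x act_Y by auto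
    then have "finite (sep (act g x) (act \<gamma> x))" using finite_sep Y_subset by blast
    then have "sep (act g x) (act \<gamma> x) = {}" using 0 by simp
    then have "side (lm L) (act g x) * side (lm L) (act \<gamma> x) > 0" if L: "L \<in> lifts" for L
    proof -
      have "\<not> side (lm L) (act g x) * side (lm L) (act \<gamma> x) < 0" using \<open>sep _ _ = {}\<close> L unfolding sep_def by blast
      moreover have "side (lm L) (act g x) * side (lm L) (act \<gamma> x) \<noteq> 0" using Yg L by (auto simp: Y_def)
      ultimately show ?thesis by linarith
    qed
    then have "act \<gamma> x \<in> rg (act g x)" using Yg Y_subset by (auto simp: rg_def)
    then have "\<gamma> = g" using region_unique[OF x] 0 by blast
    then show ?case using 0 PSL.r_one[of g] by (auto simp: W0)
  next
    case (Suc r)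
    have Yg: "act g x \<in> Y" "act \<gamma> x \<in> Y" using Suc.prems x act_Y by auto
    then have fin: "finite (sep (act g x) (act \<gamma> x))" using finite_sep Y_subset by blast
    have ne: "sep (act g x) (act \<gamma> x) \<noteq> {}" using Suc.prems by auto
    obtain L where L: "L \<in> sep (act g x) (act \<gamma> x)" "adj L (sgn (side (lm L) (act g x))) (act g x)"
      "\<And>w. adj L (- sgn (side (lm L) (act g x))) w \<Longrightarrow> sep w (act \<gamma> x) = sep (act g x) (act \<gamma> x) - {L}"
      using first_crossing[OF Yg ne] by metis
    define \<sigma> where "\<sigma> = sgn (side (lm L) (act g x))"
    have Ll: "L \<in> lifts" using L by (simp add: sep_def)
    then obtain i h where ih: "L = (i, h)" "i < m" "h \<in> \<Gamma>" by (auto simp: lifts_def)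
    have \<sigma>: "\<sigma> = 1 \<or> \<sigma> = -1" "- \<sigma> = 1 \<or> - \<sigma> = -1" using Yg(1) Ll by (auto simp: \<sigma>_def Y_def sgn_if)
    have kk: "k i \<sigma> \<in> \<Gamma>" "k i (- \<sigma>) \<in> \<Gamma>" using k(1) ih \<sigma> by auto
    have "act (h \<otimes>\<^bsub>PSL2R\<^esub> k i \<sigma>) x \<in> rg (act g x)"
      using adj_region[OF L(2)] k(2)[of i h \<sigma>] Ll ih \<sigma> unfolding \<sigma>_def by blast
    then have g: "g = h \<otimes>\<^bsub>PSL2R\<^esub> k i \<sigma>"
      using region_unique[OF x Suc.prems(1), of "h \<otimes>\<^bsub>PSL2R\<^esub> k i \<sigma>"] ih kk by simp
    define g' where "g' = h \<otimes>\<^bsub>PSL2R\<^esub> k i (- \<sigma>)"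
    have g': "g' \<in> \<Gamma>" using ih kk by (simp add: g'_def)
    have "adj L (- \<sigma>) (act g' x)" unfolding g'_def ih(1) using k(2)[of i h "- \<sigma>"] Ll ih \<sigma> by blast
    then have "sep (act g' x) (act \<gamma> x) = sep (act g x) (act \<gamma> x) - {L}" using L(3) by (simp add: \<sigma>_def)
    then have "card (sep (act g' x) (act \<gamma> x)) = r" using Suc.prems(3) L(1) fin by simp
    then obtain w where w: "w \<in> W r" "\<gamma> = g' \<otimes>\<^bsub>PSL2R\<^esub> w" using Suc.IH[OF g' Suc.prems(2)] by blast
    then have wG: "w \<in> \<Gamma>" using W by blast
    define t where "t = inv\<^bsub>PSL2R\<^esub> (k i \<sigma>) \<otimes>\<^bsub>PSL2R\<^esub> k i (- \<sigma>)"
    have tT: "t \<in> T" unfolding t_def T_def using ih \<sigma> by (intro image_eqI[of _ _ "(i, \<sigma>)"]) auto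
    have "g \<otimes>\<^bsub>PSL2R\<^esub> t = g'"
    proof -
      have "g \<otimes>\<^bsub>PSL2R\<^esub> t = h \<otimes>\<^bsub>PSL2R\<^esub> ((k i \<sigma> \<otimes>\<^bsub>PSL2R\<^esub> inv\<^bsub>PSL2R\<^esub> (k i \<sigma>)) \<otimes>\<^bsub>PSL2R\<^esub> k i (- \<sigma>))"
        using ih kk unfolding g t_def by (simp only: PSL.m_assoc \<Gamma>_carrier \<Gamma>_closed)
      then show ?thesis using kk unfolding g'_def by simp
    qed
    then have "\<gamma> = g \<otimes>\<^bsub>PSL2R\<^esub> (t \<otimes>\<^bsub>PSL2R\<^esub> w)"
    proof -
      have "g \<in> carrier PSL2R" "t \<in> carrier PSL2R" "w \<in> carrier PSL2R" using Suc.prems(1) tT T(2) wG by auto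
      then show ?thesis using w(2) \<open>g \<otimes>\<^bsub>PSL2R\<^esub> t = g'\<close> by (simp add: PSL.m_assoc[symmetric])
    qed
    then show ?case unfolding WS using tT w by (intro image_eqI[of _ _ "t \<otimes>\<^bsub>PSL2R\<^esub> w"]) auto
  qed
  have "{\<gamma> \<in> \<Gamma>. card (sep x (act \<gamma> x)) \<le> r} \<subseteq> (\<Union>j\<le>r. W j)"
  proof
    fix \<gamma> assume \<gamma>: "\<gamma> \<in> {\<gamma> \<in> \<Gamma>. card (sep x (act \<gamma> x)) \<le> r}"
    then have "\<gamma> \<in> (\<lambda>w. {mat 1, - mat 1} \<otimes>\<^bsub>PSL2R\<^esub> w) ` W (card (sep x (act \<gamma> x)))"
      using main[of "{mat 1, - mat 1}" \<gamma>] by simp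
    then obtain w where "w \<in> W (card (sep x (act \<gamma> x)))" "\<gamma> = {mat 1, - mat 1} \<otimes>\<^bsub>PSL2R\<^esub> w" by blast
    moreover from this have "w \<in> \<Gamma>" using W by blast
    ultimately have "\<gamma> \<in> W (card (sep x (act \<gamma> x)))" by simp
    then show "\<gamma> \<in> (\<Union>j\<le>r. W j)" using \<gamma> by blast
  qed
  moreover have "finite (\<Union>j\<le>r. W j)" using W by blast
  ultimately show ?thesis by (rule finite_subset)
qed

end

section \<open>Convex sets in the Klein model\<close>

lemma jac_iexp: "jac A (\<i> * of_real (exp t)) = (A$2$1)\<^sup>2 * exp (2*t) + (A$2$2)\<^sup>2"
  by (simp add: jac_alt power_mult_distrib exp_double)

lemma cmod_iexp: "(cmod (\<i> * of_real (exp t)))\<^sup>2 = exp (2*t)"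
  by (simp add: norm_mult exp_double)

lemma Re_geod:
  assumes "det A = 1"
  shows "Re (geod A t) * ((A$2$1)\<^sup>2 * exp (2*t) + (A$2$2)\<^sup>2) = A$1$1 * A$2$1 * exp (2*t) + A$1$2 * A$2$2"
  using Re_moebius_jac[OF assms iexp_in_HP, of t] unfolding jac_iexp cmod_iexp by (simp add: geod_def)

lemma cmod_geod:
  assumes "det A = 1"
  shows "(cmod (geod A t))\<^sup>2 * ((A$2$1)\<^sup>2 * exp (2*t) + (A$2$2)\<^sup>2) = (A$1$1)\<^sup>2 * exp (2*t) + (A$1$2)\<^sup>2"
  using cmod_moebius_jac[OF assms iexp_in_HP, of t] unfolding jac_iexp cmod_iexp by (simp add: geod_def)

lemma hyp_convex_param:
  assumes X: "hyp_convex X" and A: "det A = 1" and z: "geod A r \<in> X" "geod A t \<in> X"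
    and s: "r \<le> s \<and> s \<le> t \<or> t \<le> s \<and> s \<le> r"
  shows "geod A s \<in> X"
  using assms unfolding hyp_convex_def by blast

text \<open>\<open>f\<close> serves as a coordinate along the geodesic, so the order of three points
  on it is visible without their parameters.\<close>

lemma hyp_convex_monotone:
  fixes f :: "complex \<Rightarrow> real"
  assumes X: "hyp_convex X" and A: "det A = 1" and mono: "strict_mono (\<lambda>s. f (geod A s))"
    and z: "z \<in> X" "w \<in> X" and y: "y \<in> HP"
    and on: "side A z = 0" "side A w = 0" "side A y = 0"
    and btw: "f z \<le> f y \<and> f y \<le> f w \<or> f w \<le> f y \<and> f y \<le> f z"
  shows "y \<in> X"
proof -
  have "z \<in> HP" "w \<in> HP" using X z by (auto simp: hyp_convex_def)
  then obtain r t s where "z = geod A r" "w = geod A t" "y = geod A s"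
    using side_eq_0_iff[OF A] on y by blast
  then show ?thesis
    using hyp_convex_param[OF X A, of r t s] z btw strict_mono_less_eq[OF mono] by auto
qed

text \<open>\<open>kp z w\<close> has to be recognized as part of some \<open>geod A\<close>. The
  matrix of the geodesic through both points is therefore written down, for a vertical line and for
  a half circle.\<close>

lemma hyp_convex_kp:
  assumes X: "hyp_convex X" and zw: "z \<in> X" "w \<in> X" and t: "0 \<le> t" "t \<le> 1"
  shows "kp z w t \<in> X"
proof -
  have H: "z \<in> HP" "w \<in> HP" using X zw by (auto simp: hyp_convex_def)
  define y where "y = kp z w t"
  have yH: "y \<in> HP" unfolding y_def by (rule kp_in_HP[OF H t])
  have Rey: "Re y = (1 - t) * Re z + t * Re w" by (simp add: y_def kp_def)
  have btw: "b \<le> c \<Longrightarrow> b \<le> (1 - t) * b + t * c \<and> (1 - t) * b + t * c \<le> c" for b c :: real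
  proof -
    assume "b \<le> c"
    then have "t * (c - b) \<ge> 0" "(1 - t) * (c - b) \<ge> 0" using t by auto
    then show "b \<le> (1 - t) * b + t * c \<and> (1 - t) * b + t * c \<le> c" by (simp add: algebra_simps)
  qed
  have btw': "b \<le> (1 - t) * b + t * c \<and> (1 - t) * b + t * c \<le> c \<or> c \<le> (1 - t) * b + t * c \<and> (1 - t) * b + t * c \<le> b" for b c :: real
  proof (cases "b \<le> c")
    case False
    then have "t * (b - c) \<ge> 0" "(1 - t) * (b - c) \<ge> 0" using t by auto
    then show ?thesis by (simp add: algebra_simps)
  qed (use btw in blast)
  have "y \<in> X"
  proof (cases "Re z = Re w")
    case True
    define A where "A = mk2 1 (Re z) 0 1"
    have A: "det A = 1" by (simp add: A_def)
    have Reyz: "Re y = Re z" using True by (simp add: Rey algebra_simps)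
    have g: "geod A s = \<i> * of_real (exp s) + of_real (Re z)" for s by (simp add: geod_def moebius_def A_def)
    have on: "side A u = 0 \<longleftrightarrow> Re u = Re z" for u by (simp add: side_def A_def)
    have Im2: "(Im y)\<^sup>2 = (1 - t) * (Im z)\<^sup>2 + t * (Im w)\<^sup>2"
    proof -
      have "Im y = sqrt ((1 - t) * (Im z)\<^sup>2 + t * (Im w)\<^sup>2)"
        unfolding y_def kp_def kp_disc using True by simp
      moreover have "(1 - t) * (Im z)\<^sup>2 + t * (Im w)\<^sup>2 \<ge> 0" using t by simp
      ultimately show ?thesis by simp
    qed
    have "Im z > 0" "Im w > 0" "Im y > 0" using H yH by (auto simp: HP_def)
    then have "Im z \<le> Im y \<and> Im y \<le> Im w \<or> Im w \<le> Im y \<and> Im y \<le> Im z"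
      using btw'[of "(Im z)\<^sup>2" "(Im w)\<^sup>2"] unfolding Im2[symmetric]
      by (auto simp: power2_le_iff_abs_le abs_if)
    then show ?thesis
      by (intro hyp_convex_monotone[OF X A _ zw yH, of Im]) (auto simp: g on strict_mono_def True Reyz)
  next
    case False
    \<comment> \<open>The half circle has the equation |v|^2 - b Re v + c = 0. Its ends
      \<open>u1\<close>, \<open>u2\<close> are the roots of u^2 - b u + c, real and distinct because
      \<open>z\<close> lies on the circle above the real axis.\<close>
    define b where "b = ((cmod z)\<^sup>2 - (cmod w)\<^sup>2) / (Re z - Re w)"
    define c where "c = b * Re z - (cmod z)\<^sup>2"
    have zc: "(cmod z)\<^sup>2 - b * Re z + c = 0" by (simp add: c_def)
    have wc: "(cmod w)\<^sup>2 - b * Re w + c = 0"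
    proof -
      have "b * (Re z - Re w) = (cmod z)\<^sup>2 - (cmod w)\<^sup>2" using False by (simp add: b_def)
      then show ?thesis unfolding c_def by (simp add: algebra_simps)
    qed
    have "b\<^sup>2 - 4 * c = (b - 2 * Re z)\<^sup>2 + 4 * (Im z)\<^sup>2"
      unfolding c_def cmod_power2 by (simp add: power2_eq_square algebra_simps)
    moreover have "(Im z)\<^sup>2 > 0" using H by (simp add: HP_def)
    ultimately have disc: "b\<^sup>2 - 4 * c > 0" by (simp add: add_nonneg_pos)
    define \<delta> where "\<delta> = sqrt (b\<^sup>2 - 4 * c)"
    have \<delta>: "\<delta> > 0" "\<delta>\<^sup>2 = b\<^sup>2 - 4 * c" using disc by (auto simp: \<delta>_def)
    define u1 u2 where "u1 = (b - \<delta>) / 2" and "u2 = (b + \<delta>) / 2"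
    have u: "u1 < u2" "u1 + u2 = b" "u1 * u2 = c"
      using \<delta> by (auto simp: u1_def u2_def field_simps power2_eq_square)
    \<comment> \<open>This gives the matrix \<open>A\<close> below determinant 1. It sends 0 to
      \<open>u1\<close> and \<infinity> to \<open>u2\<close>, so the real part increases along its
      geodesic.\<close>
    define k where "k = 1 / sqrt (u2 - u1)"
    have k: "k > 0" "k * k * (u2 - u1) = 1" using u(1) by (auto simp: k_def)
    define A where "A = mk2 (k * u2) (k * u1) k k"
    have A: "det A = 1" using k(2) by (simp add: A_def algebra_simps)
    have "side A v = - (k * k) * ((cmod v)\<^sup>2 - b * Re v + c)" for v
      unfolding side_def A_def u(2)[symmetric] u(3)[symmetric] by (simp add: algebra_simps)
    then have on: "side A z = 0" "side A w = 0" using zc wc by simp_all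
    have "side A y = 0" unfolding y_def side_kp[OF H t] using on by simp
    moreover have "strict_mono (\<lambda>s. Re (geod A s))"
    proof (rule strict_monoI)
      fix s s' :: real assume "s < s'"
      have R: "Re (geod A v) = u2 - (u2 - u1) / (exp (2 * v) + 1)" for v
      proof -
        have "Re (geod A v) * (k * k * (exp (2 * v) + 1)) = k * k * (u2 * exp (2 * v) + u1)"
          using Re_geod[OF A, of v] by (simp add: A_def power2_eq_square algebra_simps)
        then have "Re (geod A v) * (exp (2 * v) + 1) = u2 * exp (2 * v) + u1" using k(1) by simp
        moreover have "exp (2 * v) + 1 > 0" by (simp add: add_pos_pos)
        ultimately show ?thesis by (simp add: field_simps)
      qed
      have "(u2 - u1) / (exp (2 * s') + 1) < (u2 - u1) / (exp (2 * s) + 1)"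
        using u(1) \<open>s < s'\<close> by (intro divide_strict_left_mono) (auto simp: add_pos_pos)
      then show "Re (geod A s) < Re (geod A s')" unfolding R by simp
    qed
    ultimately show ?thesis
      using btw'[of "Re z" "Re w"] on
      by (intro hyp_convex_monotone[OF X A _ zw yH, of Re]) (auto simp: Rey)
  qed
  then show ?thesis by (simp add: y_def)
qed

text \<open>An affine picture of the Klein model: the half plane becomes the region above a
  parabola, geodesics become chords, and side functions become affine.\<close>

definition klein :: "complex \<Rightarrow> complex" where
  "klein z = Complex (Re z) ((cmod z)\<^sup>2)"

lemma continuous_on_klein: "continuous_on S klein"
  unfolding klein_def by (intro continuous_intros)

lemma klein_inj: "z \<in> HP \<Longrightarrow> w \<in> HP \<Longrightarrow> klein z = klein w \<Longrightarrow> z = w"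
  by (auto simp: klein_def HP_def complex_eq_iff cmod_power2)

lemma klein_convex:
  assumes "hyp_convex X"
  shows "convex (klein ` X)"
proof (rule convexI)
  fix p q :: complex and u v :: real
  assume p: "p \<in> klein ` X" "q \<in> klein ` X" and uv: "0 \<le> u" "0 \<le> v" "u + v = 1"
  obtain z w where zw: "z \<in> X" "w \<in> X" "p = klein z" "q = klein w" using p by blast
  have H: "z \<in> HP" "w \<in> HP" using assms zw by (auto simp: hyp_convex_def)
  have u: "u = 1 - v" "v \<le> 1" using uv by auto
  have "u *\<^sub>R p + v *\<^sub>R q = klein (kp z w v)"
    unfolding klein_def cmod_kp[OF H uv(2) u(2)] zw u(1) by (simp add: kp_def complex_eq_iff klein_def)
  moreover have "kp z w v \<in> X" using hyp_convex_kp[OF assms zw(1,2) uv(2) u(2)] .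
  ultimately show "u *\<^sub>R p + v *\<^sub>R q \<in> klein ` X" by blast
qed

text \<open>A set without interior lies in a hyperplane; otherwise \<open>p\<close> is separated
  from the interior, which has the same closure as \<open>C\<close>.\<close>

lemma convex_support:
  fixes C :: "'a::euclidean_space set"
  assumes C: "convex C" and p: "p \<in> closure C" "p \<notin> interior C"
  obtains a where "a \<noteq> 0" "\<And>x. x \<in> closure C \<Longrightarrow> a \<bullet> p \<le> a \<bullet> x"
proof (cases "interior C = {}")
  case True
  then obtain a b where ab: "a \<noteq> 0" "C \<subseteq> {x. a \<bullet> x = b}"
    using empty_interior_subset_hyperplane[OF C] by blast
  have "closure C \<subseteq> {x. a \<bullet> x = b}" using ab(2) by (intro closure_minimal closed_hyperplane)
  then have "a \<bullet> x = b" if "x \<in> closure C" for x using that by blast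
  then show thesis using that[OF ab(1)] p by simp
next
  case False
  obtain a b where ab: "a \<noteq> 0" "a \<bullet> p \<le> b" "\<forall>x\<in>interior C. a \<bullet> x \<ge> b"
    using separating_hyperplane_sets[of "{p}" "interior C"] C p False by (auto simp: convex_interior)
  have "closure (interior C) \<subseteq> {x. a \<bullet> x \<ge> b}"
    using ab(3) by (intro closure_minimal closed_halfspace_ge) auto
  then have "a \<bullet> x \<ge> b" if "x \<in> closure C" for x
    using that convex_closure_interior[OF C False] by auto
  then show thesis using that[OF ab(1)] ab(2) by force
qed

text \<open>A supporting line of the Klein image at a point of \<open>geod A\<close> must contain this geodesic.\<close>

lemma hyp_convex_one_side:
  assumes X: "hyp_convex X" and A: "det A = 1" and fr: "range (geod A) \<subseteq> frontier X"
  shows "(\<forall>z\<in>X. side A z \<le> 0) \<or> (\<forall>z\<in>X. side A z \<ge> 0)"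
proof -
  define C where "C = klein ` X"
  have C: "convex C" unfolding C_def by (rule klein_convex[OF X])
  have XH: "X \<subseteq> HP" using X by (simp add: hyp_convex_def)
  have cl: "klein (geod A s) \<in> closure C" for s
  proof -
    have "klein ` closure X \<subseteq> closure C"
      unfolding C_def by (rule image_closure_subset) (auto simp: continuous_on_klein closure_subset)
    moreover have "geod A s \<in> closure X" using fr by (auto simp: frontier_def)
    ultimately show ?thesis by blast
  qed
  define p where "p = klein (geod A 0)"
  have "p \<notin> interior C"
  proof
    assume p: "p \<in> interior C"
    define U where "U = HP \<inter> klein -` interior C"
    have "open U" unfolding U_def by (rule continuous_open_preimage[OF continuous_on_klein open_HP]) simp
    moreover have "U \<subseteq> X"
    proof
      fix u assume u: "u \<in> U"
      then have "klein u \<in> C" using interior_subset by (auto simp: U_def)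
      then obtain x where "x \<in> X" "klein x = klein u" by (auto simp: C_def)
      then show "u \<in> X" using klein_inj[of x u] u XH by (auto simp: U_def)
    qed
    moreover have "geod A 0 \<in> U" using p A by (simp add: U_def p_def)
    ultimately have "geod A 0 \<in> interior X" by (meson interiorI)
    then show False using fr by (auto simp: frontier_def)
  qed
  then obtain v where v: "v \<noteq> 0" "\<And>x. x \<in> closure C \<Longrightarrow> v \<bullet> p \<le> v \<bullet> x"
    using convex_support[OF C, of p] cl[of 0] unfolding p_def by blast
  define a1 a2 c where "a1 = Re v" and "a2 = Im v" and "c = v \<bullet> p"
  have vk: "v \<bullet> klein z = a1 * Re z + a2 * (cmod z)\<^sup>2" for z
    by (simp add: klein_def inner_complex_def a1_def a2_def)
  \<comment> \<open>The supporting linear form, homogenized on the symmetric square and evaluated at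
    squares of vectors.\<close>
  define Q where "Q x1 x2 = a2 * x1\<^sup>2 + a1 * (x1 * x2) - c * x2\<^sup>2" for x1 x2
  define x1 x2 y1 y2 where "x1 = A$1$1" and "x2 = A$2$1" and "y1 = A$1$2" and "y2 = A$2$2"
  have det: "x1 * y2 - x2 * y1 = 1" using A by (simp add: det_2 x1_def x2_def y1_def y2_def mult.commute)
  have h: "(v \<bullet> klein (geod A s) - c) * (x2\<^sup>2 * exp (2 * s) + y2\<^sup>2) = Q x1 x2 * exp (2 * s) + Q y1 y2" for s
  proof -
    have "(v \<bullet> klein (geod A s) - c) * (x2\<^sup>2 * exp (2 * s) + y2\<^sup>2) =
        a1 * (Re (geod A s) * (x2\<^sup>2 * exp (2 * s) + y2\<^sup>2)) + a2 * ((cmod (geod A s))\<^sup>2 * (x2\<^sup>2 * exp (2 * s) + y2\<^sup>2))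
        - c * (x2\<^sup>2 * exp (2 * s) + y2\<^sup>2)"
      unfolding vk by (simp add: algebra_simps)
    also have "\<dots> = Q x1 x2 * exp (2 * s) + Q y1 y2"
      using Re_geod[OF A, of s] cmod_geod[OF A, of s] unfolding Q_def x1_def x2_def y1_def y2_def
      by (simp add: algebra_simps)
    finally show ?thesis .
  qed
  have j: "x2\<^sup>2 * exp (2 * s) + y2\<^sup>2 \<ge> 0" for s by simp
  have "v \<bullet> klein (geod A 0) = c" by (simp add: c_def p_def)
  then have 0: "Q x1 x2 + Q y1 y2 = 0" using h[of 0] by simp
  have ge: "Q x1 x2 * exp (2 * s) + Q y1 y2 \<ge> 0" for s
    using v(2)[OF cl[of s]] j[of s] unfolding h[symmetric] c_def by simp
  \<comment> \<open>The values at the two ends are opposite, so nonnegativity both before and after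
    time 0 forces them to vanish.\<close>
  have "Q x1 x2 * (exp 2 - 1) \<ge> 0" "Q x1 x2 * (exp (-2) - 1) \<ge> 0"
    using ge[of 1] ge[of "-1"] 0 by (simp_all add: algebra_simps)
  moreover have "exp 2 - 1 > (0::real)" "exp (-2) - 1 < (0::real)" by simp_all
  ultimately have Qx: "Q x1 x2 = 0" unfolding zero_le_mult_iff by linarith
  then have Qy: "Q y1 y2 = 0" using 0 by simp
  \<comment> \<open>The polar form of \<open>Q\<close> at the two columns. It determines a quadratic
    form vanishing at both of them, so \<open>Q\<close> is \<kappa> times the form defining
    \<open>side A\<close>.\<close>
  define \<kappa> where "\<kappa> = 2 * a2 * x1 * y1 + a1 * (x1 * y2 + x2 * y1) - 2 * c * x2 * y2"
  have "a2 * (x1 * y2 - x2 * y1)\<^sup>2 = y2\<^sup>2 * Q x1 x2 + x2\<^sup>2 * Q y1 y2 - x2 * y2 * \<kappa>"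
    "- c * (x1 * y2 - x2 * y1)\<^sup>2 = y1\<^sup>2 * Q x1 x2 + x1\<^sup>2 * Q y1 y2 - x1 * y1 * \<kappa>"
    "a1 * (x1 * y2 - x2 * y1)\<^sup>2 = - 2 * y1 * y2 * Q x1 x2 - 2 * x1 * x2 * Q y1 y2 + (x1 * y2 + x2 * y1) * \<kappa>"
    unfolding Q_def \<kappa>_def by (simp_all add: power2_eq_square algebra_simps)
  then have co: "a2 = - x2 * y2 * \<kappa>" "- c = - x1 * y1 * \<kappa>" "a1 = (x1 * y2 + x2 * y1) * \<kappa>"
    unfolding det Qx Qy by simp_all
  have "v \<bullet> klein z - c = \<kappa> * side A z" for z
  proof -
    have "v \<bullet> klein z - c = a1 * Re z + a2 * (cmod z)\<^sup>2 + (- c)" by (simp add: vk)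
    also have "\<dots> = \<kappa> * side A z"
      unfolding co side_def x1_def x2_def y1_def y2_def by (simp add: algebra_simps)
    finally show ?thesis .
  qed
  moreover have "v \<bullet> klein z - c \<ge> 0" if "z \<in> X" for z
    using v(2)[of "klein z"] closure_subset[of C] that by (auto simp: C_def c_def)
  ultimately have "\<kappa> * side A z \<ge> 0" if "z \<in> X" for z using that by metis
  moreover have "\<kappa> \<noteq> 0"
  proof
    assume "\<kappa> = 0"
    then have "a1 = 0" "a2 = 0" using co by auto
    then show False using v(1) by (simp add: a1_def a2_def complex_eq_iff)
  qed
  ultimately show ?thesis by (cases "\<kappa> > 0") (auto simp: zero_le_mult_iff)
qed

section \<open>Geodesics with given endpoints\<close>

lemma geod_times_denominator:
  assumes "det A = 1"
  shows "geod A t * (of_real (A$2$1) * (\<i> * of_real (exp t)) + of_real (A$2$2)) = of_real (A$1$1) * (\<i> * of_real (exp t)) + of_real (A$1$2)"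
  using moebius_denom_nz[OF assms iexp_in_HP, of t] unfolding geod_def moebius_def by simp

lemma exp_at_bot_of_real: "((\<lambda>t. \<i> * complex_of_real (exp t)) \<longlongrightarrow> 0) at_bot"
  using tendsto_mult[OF tendsto_const tendsto_of_real[OF exp_at_bot]] by simp

lemma exp_at_top_of_real: "((\<lambda>t. complex_of_real (exp (- t))) \<longlongrightarrow> 0) at_top"
proof -
  have "((\<lambda>t::real. exp (- t)) \<longlongrightarrow> 0) at_top"
    by (rule filterlim_compose[OF exp_at_bot filterlim_uminus_at_bot_at_top])
  then show ?thesis using tendsto_of_real[of "\<lambda>t. exp (- t)" 0] by simp
qed

text \<open>The ends of \<open>geod A\<close> are the images of 0 and \<infinity>, that is, the
  columns of \<open>A\<close>. Vanishing of \<open>area\<close> expresses equality in the projective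
  line uniformly for finite and infinite ends.\<close>

lemma tends_at_bot_endpoint:
  assumes A: "det A = 1" and t: "tends_rp1 (geod A) \<xi> at_bot"
  shows "area (column 2 A) (hom_coord \<xi>) = 0"
proof (cases \<xi>)
  case (Fin x)
  then have "(geod A \<longlongrightarrow> of_real x) at_bot" using t by simp
  then have "((\<lambda>t. geod A t * (of_real (A$2$1) * (\<i> * of_real (exp t)) + of_real (A$2$2))) \<longlongrightarrow> of_real x * (of_real (A$2$1) * 0 + of_real (A$2$2))) at_bot"
    by (intro tendsto_intros exp_at_bot_of_real)
  moreover have "((\<lambda>t. of_real (A$1$1) * (\<i> * of_real (exp t)) + of_real (A$1$2)) \<longlongrightarrow> of_real (A$1$1) * 0 + complex_of_real (A$1$2)) at_bot"
    by (intro tendsto_intros exp_at_bot_of_real)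
  ultimately have "complex_of_real x * (of_real (A$2$1) * 0 + of_real (A$2$2)) = of_real (A$1$1) * 0 + of_real (A$1$2)"
    unfolding geod_times_denominator[OF A] using tendsto_unique[OF trivial_limit_at_bot_linorder] by blast
  then have "complex_of_real (x * A$2$2) = of_real (A$1$2)" by simp
  then have "x * A$2$2 = A$1$2" by (simp only: of_real_eq_iff)
  then show ?thesis using Fin by (simp add: area_def mult.commute)
next
  case Infty
  have "A$2$2 = 0"
  proof (rule ccontr)
    assume nz: "A$2$2 \<noteq> 0"
    have "((\<lambda>t. (of_real (A$1$1) * (\<i> * of_real (exp t)) + of_real (A$1$2)) / (of_real (A$2$1) * (\<i> * of_real (exp t)) + of_real (A$2$2)))
        \<longlongrightarrow> (of_real (A$1$1) * 0 + of_real (A$1$2)) / (of_real (A$2$1) * 0 + complex_of_real (A$2$2))) at_bot"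
      by (intro tendsto_intros exp_at_bot_of_real) (use nz in simp)
    then have "(geod A \<longlongrightarrow> (of_real (A$1$1) * 0 + of_real (A$1$2)) / (of_real (A$2$1) * 0 + complex_of_real (A$2$2))) at_bot"
      by (simp add: geod_def[abs_def] moebius_def)
    then show False using t Infty not_tendsto_and_filterlim_at_infinity[OF trivial_limit_at_bot_linorder] by auto
  qed
  then show ?thesis using Infty by (simp add: area_def)
qed

lemma tends_at_top_endpoint:
  assumes A: "det A = 1" and t: "tends_rp1 (geod A) \<xi> at_top"
  shows "area (column 1 A) (hom_coord \<xi>) = 0"
proof -
  \<comment> \<open>Numerator and denominator are rescaled by e^(-t), so that both converge at
    \<infinity>.\<close>
  define N where "N t = of_real (A$1$1) * \<i> + of_real (A$1$2) * complex_of_real (exp (- t))" for t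
  define D where "D t = of_real (A$2$1) * \<i> + of_real (A$2$2) * complex_of_real (exp (- t))" for t
  have limN: "(N \<longlongrightarrow> of_real (A$1$1) * \<i> + of_real (A$1$2) * 0) at_top"
    unfolding N_def by (intro tendsto_intros exp_at_top_of_real)
  have limD: "(D \<longlongrightarrow> of_real (A$2$1) * \<i> + of_real (A$2$2) * 0) at_top"
    unfolding D_def by (intro tendsto_intros exp_at_top_of_real)
  have e: "complex_of_real (exp t) * of_real (exp (- t)) = 1" for t
    by (simp flip: of_real_mult exp_add)
  have NN: "N t = (of_real (A$1$1) * (\<i> * of_real (exp t)) + of_real (A$1$2)) * of_real (exp (- t))" for t
    using e[of t] by (simp add: N_def algebra_simps)
  have DD: "D t = (of_real (A$2$1) * (\<i> * of_real (exp t)) + of_real (A$2$2)) * of_real (exp (- t))" for t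
    using e[of t] by (simp add: D_def algebra_simps)
  have eq: "geod A t * D t = N t" for t
    unfolding NN DD using geod_times_denominator[OF A, of t] by (simp add: mult.assoc[symmetric])
  show ?thesis
  proof (cases \<xi>)
    case (Fin x)
    then have "(geod A \<longlongrightarrow> of_real x) at_top" using t by simp
    then have "((\<lambda>t. geod A t * D t) \<longlongrightarrow> of_real x * (of_real (A$2$1) * \<i> + of_real (A$2$2) * 0)) at_top"
      by (intro tendsto_mult limD)
    then have "of_real x * (of_real (A$2$1) * \<i> + of_real (A$2$2) * 0) = of_real (A$1$1) * \<i> + complex_of_real (A$1$2) * 0"
      unfolding eq using limN tendsto_unique[OF trivial_limit_at_top_linorder] by blast
    then have "x * A$2$1 = A$1$1" by (simp add: complex_eq_iff)
    then show ?thesis using Fin by (simp add: area_def mult.commute)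
  next
    case Infty
    have "A$2$1 = 0"
    proof (rule ccontr)
      assume nz: "A$2$1 \<noteq> 0"
      have "((\<lambda>t. N t / D t) \<longlongrightarrow> (of_real (A$1$1) * \<i> + of_real (A$1$2) * 0) / (of_real (A$2$1) * \<i> + of_real (A$2$2) * 0)) at_top"
        by (intro tendsto_divide limN limD) (use nz in simp)
      moreover have "N t / D t = geod A t" for t
      proof -
        have "D t \<noteq> 0" unfolding DD using moebius_denom_nz[OF A iexp_in_HP, of t] by simp
        then show ?thesis using eq[of t] by (simp add: field_simps)
      qed
      ultimately show False using t Infty not_tendsto_and_filterlim_at_infinity[OF trivial_limit_at_top_linorder] by auto
    qed
    then show ?thesis using Infty by (simp add: area_def)
  qed
qed

lemma area_0_parallel:
  assumes "area u h = 0" "area v h = 0" "h \<noteq> 0" "v \<noteq> 0"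
  shows "\<exists>c. u = c *\<^sub>R v"
proof -
  have u: "u$1 * h$2 = u$2 * h$1" and v: "v$1 * h$2 = v$2 * h$1" using assms by (auto simp: area_def)
  show ?thesis
  proof (cases "h$1 = 0")
    case True
    then have "h$2 \<noteq> 0" using assms(3) by (simp add: vec2_eq_iff)
    then have "u$1 = 0" "v$1 = 0" using u v True by auto
    then have "v$2 \<noteq> 0" using assms(4) by (simp add: vec2_eq_iff)
    then show ?thesis using \<open>u$1 = 0\<close> \<open>v$1 = 0\<close> by (intro exI[of _ "u$2 / v$2"]) (simp add: vec2_eq_iff)
  next
    case False
    then have u2: "u$2 = u$1 * h$2 / h$1" and v2: "v$2 = v$1 * h$2 / h$1" using u v by (auto simp: field_simps)
    then have "v$1 \<noteq> 0" using assms(4) by (auto simp: vec2_eq_iff)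
    then show ?thesis using u2 v2 by (intro exI[of _ "u$1 / v$1"]) (simp add: vec2_eq_iff)
  qed
qed

lemma hom_coord_nz: "hom_coord \<xi> \<noteq> 0"
  by (cases \<xi>) (auto simp: vec2_eq_iff)

text \<open>Matrices with the same ends have proportional columns with reciprocal factors, hence the
  same side function and the same range; the union in \<open>geod_line\<close> is a single
  geodesic.\<close>

lemma geod_line_matrix:
  assumes ne: "geod_line \<xi> \<eta> \<noteq> {}"
  obtains A where "det A = 1" "area (column 2 A) (hom_coord \<xi>) = 0" "area (column 1 A) (hom_coord \<eta>) = 0"
    "geod_line \<xi> \<eta> = range (geod A)"
proof -
  obtain A where A: "det A = 1" "tends_rp1 (geod A) \<xi> at_bot" "tends_rp1 (geod A) \<eta> at_top"
    using ne unfolding geod_line_def by blast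
  note ends = tends_at_bot_endpoint[OF A(1,2)] tends_at_top_endpoint[OF A(1,3)]
  have nz: "column 1 A \<noteq> 0 \<and> column 2 A \<noteq> 0" if "det A = 1" for A :: "real^2^2"
    using that area_columns[of A] unfolding area_def by (metis diff_self mult_zero_left mult_zero_right zero_index zero_neq_one)
  have "range (geod B) = range (geod A)"
    if B: "det B = 1" "tends_rp1 (geod B) \<xi> at_bot" "tends_rp1 (geod B) \<eta> at_top" for B
  proof -
    obtain c d where cd: "column 1 B = c *\<^sub>R column 1 A" "column 2 B = d *\<^sub>R column 2 A"
      using area_0_parallel[OF tends_at_top_endpoint[OF B(1,3)] ends(2) hom_coord_nz]
        area_0_parallel[OF tends_at_bot_endpoint[OF B(1,2)] ends(1) hom_coord_nz] nz[OF A(1)] by blast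
    then have e: "B$1$1 = c * A$1$1" "B$2$1 = c * A$2$1" "B$1$2 = d * A$1$2" "B$2$2 = d * A$2$2"
      by (auto simp: vec2_eq_iff)
    then have "c * d * det A = det B" by (simp add: det_2 algebra_simps)
    then have cd1: "c * d = 1" using A B by simp
    have "side B z = c * d * side A z" for z unfolding side_def e by (simp add: algebra_simps)
    then have s: "side B z = side A z" for z using cd1 by simp
    have "z \<in> range (geod B) \<longleftrightarrow> z \<in> range (geod A)" if "z \<in> HP" for z
      using side_eq_0_iff[OF A(1) that] side_eq_0_iff[OF B(1) that] s by simp
    moreover have "range (geod B) \<subseteq> HP" "range (geod A) \<subseteq> HP" using A B by auto
    ultimately show ?thesis by blast
  qed
  then have "geod_line \<xi> \<eta> \<subseteq> range (geod A)" unfolding geod_line_def by blast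
  moreover have "range (geod A) \<subseteq> geod_line \<xi> \<eta>" unfolding geod_line_def using A by blast
  ultimately have "geod_line \<xi> \<eta> = range (geod A)" by blast
  then show thesis using that[OF A(1)] ends by blast
qed

section \<open>Thin quadrilaterals\<close>

lemma abs_det_product_le:
  fixes a1 a2 a3 a4 b1 b2 b3 b4 :: real
  assumes nn: "a1 \<ge> 0" "a2 \<ge> 0" "a3 \<ge> 0" "a4 \<ge> 0" "b1 \<ge> 0" "b2 \<ge> 0" "b3 \<ge> 0" "b4 \<ge> 0"
  shows "\<bar>(a1 * b2 - b1 * a2) * (a3 * b4 - b3 * a4)\<bar> \<le> a1*a4*b2*b3 + b1*b4*a2*a3 + a1*b4*b2*a3 + b1*a4*a2*b3"
proof -
  have "(a1 * b2 - b1 * a2) * (a3 * b4 - b3 * a4) = a1*b4*b2*a3 - a1*a4*b2*b3 - b1*b4*a2*a3 + b1*a4*a2*b3"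
    by (simp add: algebra_simps)
  moreover have "a1*a4*b2*b3 \<ge> 0" "b1*b4*a2*a3 \<ge> 0" "a1*b4*b2*a3 \<ge> 0" "b1*a4*a2*b3 \<ge> 0"
    using nn by simp_all
  ultimately show ?thesis by linarith
qed

text \<open>Four of the 16 products on the right carry the monomials of the determinant product on
  the left, two with coefficient \<open>pq * rs\<close> and two with \<open>pr * qs\<close>, which
  \<open>EF\<close> compares. The other twelve are nonnegative.\<close>

lemma bilinear_product_ge:
  fixes a1 a2 a3 a4 b1 b2 b3 b4 qs pq rs pr :: real
  assumes nn: "a1 \<ge> 0" "a2 \<ge> 0" "a3 \<ge> 0" "a4 \<ge> 0" "b1 \<ge> 0" "b2 \<ge> 0" "b3 \<ge> 0" "b4 \<ge> 0"
    and pos: "qs \<ge> 0" "pq \<ge> 0" "rs \<ge> 0" "pr \<ge> 0" and EF: "pq * rs \<le> pr * qs"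
  shows "pq * rs * \<bar>(a1 * b2 - b1 * a2) * (a3 * b4 - b3 * a4)\<bar> \<le>
    (a1*a4*qs + a1*b4*pq + b1*a4*rs + b1*b4*pr) * (a2*a3*qs + a2*b3*pq + b2*a3*rs + b2*b3*pr)"
proof -
  have n4: "a1*a4*b2*b3 \<ge> 0" "b1*b4*a2*a3 \<ge> 0" using nn by simp_all
  have "pq * rs * \<bar>(a1 * b2 - b1 * a2) * (a3 * b4 - b3 * a4)\<bar> \<le>
      pq * rs * (a1*a4*b2*b3 + b1*b4*a2*a3 + a1*b4*b2*a3 + b1*a4*a2*b3)"
    using abs_det_product_le[OF nn] pos by (intro mult_left_mono) auto
  also have "\<dots> \<le> (pr * qs) * (a1*a4*b2*b3 + b1*b4*a2*a3) + (pq * rs) * (a1*b4*b2*a3 + b1*a4*a2*b3)"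
  proof -
    have "pq * rs * (a1*a4*b2*b3 + b1*b4*a2*a3) \<le> (pr * qs) * (a1*a4*b2*b3 + b1*b4*a2*a3)"
      using EF n4 by (intro mult_right_mono) auto
    then show ?thesis by (simp add: distrib_left)
  qed
  also have "\<dots> \<le> (a1*a4*qs + a1*b4*pq + b1*a4*rs + b1*b4*pr) * (a2*a3*qs + a2*b3*pq + b2*a3*rs + b2*b3*pr)"
  proof -
    have "0 \<le> (a1*a4*qs) * (a2*a3*qs) + (a1*a4*qs) * (a2*b3*pq) + (a1*a4*qs) * (b2*a3*rs)
        + (a1*b4*pq) * (a2*a3*qs) + (a1*b4*pq) * (a2*b3*pq) + (a1*b4*pq) * (b2*b3*pr)
        + (b1*a4*rs) * (a2*a3*qs) + (b1*a4*rs) * (b2*a3*rs) + (b1*a4*rs) * (b2*b3*pr)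
        + (b1*b4*pr) * (a2*b3*pq) + (b1*b4*pr) * (b2*a3*rs) + (b1*b4*pr) * (b2*b3*pr)"
      using nn pos by (intro add_nonneg_nonneg mult_nonneg_nonneg)
    then show ?thesis by (simp add: algebra_simps)
  qed
  finally show ?thesis .
qed

text \<open>Four vectors in general position, listed in increasing cyclic order and with signs chosen such
  that they lie in an open half plane.\<close>

locale quad =
  fixes P Q R S :: "real^2"
  assumes pos: "area Q P > 0" "area R P > 0" "area S P > 0" "area R Q > 0" "area S Q > 0" "area S R > 0"
begin

text \<open>Up to sign the cone of \<open>Q\<close> and \<open>R\<close>, i.e. the closed boundary
  interval between them. In \<open>far\<close>, the interval from \<open>S\<close> on to
  \<open>P\<close> ends at \<open>- P\<close>, since the signs of the four vectors were fixed within
  a half plane.\<close>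

definition near :: "real^2 \<Rightarrow> bool" where
  "near v \<longleftrightarrow> (\<exists>\<sigma> a b. (\<sigma> = 1 \<or> \<sigma> = -1) \<and> a \<ge> 0 \<and> b \<ge> 0 \<and> v = \<sigma> *\<^sub>R (a *\<^sub>R Q + b *\<^sub>R R))"

definition far :: "real^2 \<Rightarrow> bool" where
  "far v \<longleftrightarrow> (\<exists>\<sigma> a b. (\<sigma> = 1 \<or> \<sigma> = -1) \<and> a \<ge> 0 \<and> b \<ge> 0 \<and> v = \<sigma> *\<^sub>R (a *\<^sub>R S - b *\<^sub>R P))"

lemma expand:
  assumes "area x y \<noteq> 0"
  shows "v = (area v y / area x y) *\<^sub>R x + (area x v / area x y) *\<^sub>R y"
proof -
  have "area x y *\<^sub>R v = area v y *\<^sub>R x + area x v *\<^sub>R y"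
    by (simp add: vec2_eq_iff area_def algebra_simps)
  then have "v = (1 / area x y) *\<^sub>R (area v y *\<^sub>R x + area x v *\<^sub>R y)"
    using assms by (metis (no_types, lifting) divide_inverse_commute inverse_eq_divide mult.right_neutral nonzero_divide_eq_eq scaleR_one scaleR_scaleR)
  then show ?thesis by (simp add: scaleR_add_right)
qed

lemma same_sign_cases: "(a::real) * b \<ge> 0 \<Longrightarrow> (\<exists>\<sigma> a' b'. (\<sigma> = 1 \<or> \<sigma> = -1) \<and> a' \<ge> 0 \<and> b' \<ge> 0 \<and> a = \<sigma> * a' \<and> b = \<sigma> * b')"
proof -
  assume "a * b \<ge> 0"
  then consider "a \<ge> 0" "b \<ge> 0" | "a \<le> 0" "b \<le> 0" by (auto simp: zero_le_mult_iff)
  then show ?thesis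
  proof cases
    case 1
    then show ?thesis by (intro exI[of _ 1] exI[of _ a] exI[of _ b]) simp
  next
    case 2
    then show ?thesis by (intro exI[of _ "-1"] exI[of _ "-a"] exI[of _ "-b"]) simp
  qed
qed

text \<open>The hypotheses exclude the open interval from \<open>P\<close> to \<open>Q\<close> and
  the one from \<open>R\<close> to \<open>S\<close>.\<close>

lemma near_or_far:
  assumes "area v P * area v Q \<ge> 0" "area v R * area v S \<ge> 0"
  shows "near v \<or> far v"
proof (cases "area R v * area v Q \<ge> 0")
  case True
  define a b where "a = area R v / area R Q" and "b = area v Q / area R Q"
  have v: "v = b *\<^sub>R R + a *\<^sub>R Q"
    using expand[of R Q v] pos by (simp add: a_def b_def)
  have "a * b \<ge> 0" using True by (simp add: a_def b_def)
  then obtain \<sigma> a' b' where "\<sigma> = 1 \<or> \<sigma> = -1" "a' \<ge> 0" "b' \<ge> 0" "a = \<sigma> * a'" "b = \<sigma> * b'"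
    using same_sign_cases by blast
  then have "near v" unfolding near_def v
    by (intro exI[of _ \<sigma>] exI[of _ a'] exI[of _ b']) (simp add: scaleR_add_right add.commute)
  then show ?thesis by simp
next
  case False
  then have n: "area v R * area v Q > 0" by (simp add: area_commute[of v R])
  define a b where "a = area v P / area S P" and "b = area v S / area S P"
  have v: "v = a *\<^sub>R S - b *\<^sub>R P"
    using expand[of S P v] pos by (simp add: a_def b_def area_commute[of v S])
  have "area v P * area v S \<ge> 0"
    using n assms by (auto simp: zero_less_mult_iff zero_le_mult_iff)
  then have "a * b \<ge> 0" by (simp add: a_def b_def)
  then obtain \<sigma> a' b' where "\<sigma> = 1 \<or> \<sigma> = -1" "a' \<ge> 0" "b' \<ge> 0" "a = \<sigma> * a'" "b = \<sigma> * b'"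
    using same_sign_cases by blast
  then have "far v" unfolding far_def v
    by (intro exI[of _ \<sigma>] exI[of _ a'] exI[of _ b']) (simp add: scaleR_diff_right)
  then show ?thesis by simp
qed

text \<open>Expanding the vectors along the generators of the two cones reduces the inequality to
  the four corners \<open>P\<close>, \<open>Q\<close>, \<open>R\<close>, \<open>S\<close>. There
  hypothesis \<open>c\<close> bounds their cross ratio minus 1, by the identity
  \<open>pl\<close>.\<close>

lemma contraction:
  assumes v: "near v" "near v'" and w: "far w" "far w'"
    and c: "(c - 1) * (area S P * area R Q) \<le> area Q P * area S R"
  shows "(c - 1) * \<bar>area v v' * area w w'\<bar> \<le> \<bar>area v w' * area v' w\<bar>"
proof -
  obtain s1 a1 b1 where 1: "s1 = 1 \<or> s1 = -1" "a1 \<ge> 0" "b1 \<ge> 0" "v = s1 *\<^sub>R (a1 *\<^sub>R Q + b1 *\<^sub>R R)"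
    using v(1) unfolding near_def by blast
  obtain s2 a2 b2 where 2: "s2 = 1 \<or> s2 = -1" "a2 \<ge> 0" "b2 \<ge> 0" "v' = s2 *\<^sub>R (a2 *\<^sub>R Q + b2 *\<^sub>R R)"
    using v(2) unfolding near_def by blast
  obtain s3 a3 b3 where 3: "s3 = 1 \<or> s3 = -1" "a3 \<ge> 0" "b3 \<ge> 0" "w = s3 *\<^sub>R (a3 *\<^sub>R S - b3 *\<^sub>R P)"
    using w(1) unfolding far_def by blast
  obtain s4 a4 b4 where 4: "s4 = 1 \<or> s4 = -1" "a4 \<ge> 0" "b4 \<ge> 0" "w' = s4 *\<^sub>R (a4 *\<^sub>R S - b4 *\<^sub>R P)"
    using w(2) unfolding far_def by blast
  have s: "\<bar>s1\<bar> = 1" "\<bar>s2\<bar> = 1" "\<bar>s3\<bar> = 1" "\<bar>s4\<bar> = 1" using 1 2 3 4 by auto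
  have vv: "area v v' = - (s1 * s2 * ((a1 * b2 - b1 * a2) * area R Q))"
    unfolding 1(4) 2(4) by (simp add: area_def algebra_simps)
  have ww: "area w w' = - (s3 * s4 * ((a3 * b4 - b3 * a4) * area S P))"
    unfolding 3(4) 4(4) by (simp add: area_def algebra_simps)
  have vw: "area v w' = - (s1 * s4 * (a1*a4*area S Q + a1*b4*area Q P + b1*a4*area S R + b1*b4*area R P))"
    unfolding 1(4) 4(4) by (simp add: area_def algebra_simps)
  have v'w: "area v' w = - (s2 * s3 * (a2*a3*area S Q + a2*b3*area Q P + b2*a3*area S R + b2*b3*area R P))"
    unfolding 2(4) 3(4) by (simp add: area_def algebra_simps)
  have pl: "area R P * area S Q = area Q P * area S R + area S P * area R Q"
    by (simp add: area_def algebra_simps)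
  have EF: "area Q P * area S R \<le> area R P * area S Q" unfolding pl using pos by simp
  have "\<bar>area v v' * area w w'\<bar> = \<bar>(a1 * b2 - b1 * a2) * (a3 * b4 - b3 * a4)\<bar> * (area S P * area R Q)"
    unfolding vv ww using s pos by (simp add: abs_mult)
  then have "(c - 1) * \<bar>area v v' * area w w'\<bar> =
      ((c - 1) * (area S P * area R Q)) * \<bar>(a1 * b2 - b1 * a2) * (a3 * b4 - b3 * a4)\<bar>"
    by simp
  also have "\<dots> \<le> area Q P * area S R * \<bar>(a1 * b2 - b1 * a2) * (a3 * b4 - b3 * a4)\<bar>"
    using c by (intro mult_right_mono) auto
  also have "\<dots> \<le> (a1*a4*area S Q + a1*b4*area Q P + b1*a4*area S R + b1*b4*area R P) *
      (a2*a3*area S Q + a2*b3*area Q P + b2*a3*area S R + b2*b3*area R P)"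
    using bilinear_product_ge[OF 1(2) 2(2) 3(2) 4(2) 1(3) 2(3) 3(3) 4(3), of "area S Q" "area Q P" "area S R" "area R P"]
      pos EF by simp
  also have "\<dots> \<le> \<bar>area v w' * area v' w\<bar>"
    unfolding vw v'w using s by (simp add: abs_mult) (simp flip: abs_mult)
  finally show ?thesis .
qed

lemma strictly_between:
  assumes xy: "area y x > 0" and e: "area e x * area e y < 0"
  shows "\<exists>\<sigma> p q. (\<sigma> = 1 \<or> \<sigma> = -1) \<and> p > 0 \<and> q > 0 \<and> e = \<sigma> *\<^sub>R (p *\<^sub>R x + q *\<^sub>R y)"
proof -
  define q p where "q = area e x / area y x" and "p = area y e / area y x"
  have ev: "e = q *\<^sub>R y + p *\<^sub>R x"
    using expand[of y x e] xy by (simp add: p_def q_def)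
  have "p * q > 0"
  proof -
    have "area y e * area e x > 0" using e by (simp add: area_commute[of e y] mult.commute)
    then show ?thesis using xy by (simp add: p_def q_def zero_less_mult_iff zero_less_divide_iff divide_less_0_iff)
  qed
  then consider "p > 0" "q > 0" | "- p > 0" "- q > 0" by (auto simp: zero_less_mult_iff)
  then show ?thesis
  proof cases
    case 1
    then show ?thesis using ev by (intro exI[of _ 1] exI[of _ p] exI[of _ q]) (simp add: add.commute)
  next
    case 2
    then show ?thesis using ev by (intro exI[of _ "-1"] exI[of _ "-p"] exI[of _ "-q"]) (simp add: scaleR_add_right)
  qed
qed

text \<open>With \<open>e\<close> and \<open>f\<close> expanded in their intervals, \<open>x\<close>
  and \<open>y\<close> have positive coefficients throughout. The factor \<open>area e f\<close>
  compensates the arbitrary signs of \<open>e\<close> and \<open>f\<close>.\<close>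

lemma crossing_sides:
  assumes e: "area e P * area e Q < 0" and f: "area f R * area f S < 0" and v: "v \<noteq> 0"
  shows "near v \<Longrightarrow> area e f * (area v f * area e v) < 0" "far v \<Longrightarrow> area e f * (area v f * area e v) > 0"
proof -
  obtain s p q where E: "s = 1 \<or> s = -1" "p > 0" "q > 0" "e = s *\<^sub>R (p *\<^sub>R P + q *\<^sub>R Q)"
    using strictly_between[OF pos(1) e] by blast
  obtain s' r t where F: "s' = 1 \<or> s' = -1" "r > 0" "t > 0" "f = s' *\<^sub>R (r *\<^sub>R R + t *\<^sub>R S)"
    using strictly_between[OF pos(6) f] by blast
  have s2: "s * s = 1" "s' * s' = 1" using E F by auto
  have comb: "k * a + l * b > 0" if "k > 0" "l > 0" "a \<ge> 0" "b \<ge> 0" "a > 0 \<or> b > 0" for k l a b :: real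
  proof -
    have "k * a \<ge> 0" "l * b \<ge> 0" "k * a > 0 \<or> l * b > 0" using that by auto
    then show ?thesis by linarith
  qed
  define ef where "ef = p*r*area R P + p*t*area S P + q*r*area R Q + q*t*area S Q"
  have ef: "area e f = - (s * s') * ef" unfolding E(4) F(4) ef_def by (simp add: area_def algebra_simps)
  have efp: "ef > 0" unfolding ef_def using E F pos by (intro add_pos_pos mult_pos_pos)
  { assume "near v"
    then obtain \<sigma> a b where V: "\<sigma> = 1 \<or> \<sigma> = -1" "a \<ge> 0" "b \<ge> 0" "v = \<sigma> *\<^sub>R (a *\<^sub>R Q + b *\<^sub>R R)"
      unfolding near_def by blast
    have ab: "a > 0 \<or> b > 0" using V v by (cases "a = 0"; cases "b = 0") auto
    define x y where "x = (r * area R Q + t * area S Q) * a + (t * area S R) * b" and "y = (p * area Q P) * a + (p * area R P + q * area R Q) * b"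
    have "area v f = - (\<sigma> * s') * x" "area e v = - (s * \<sigma>) * y"
      unfolding V(4) E(4) F(4) x_def y_def by (simp_all add: area_def algebra_simps)
    then have "area e f * (area v f * area e v) = - ((s * s) * (s' * s') * (\<sigma> * \<sigma>) * (ef * (x * y)))"
      unfolding ef by (simp add: algebra_simps)
    also have "\<dots> = - (ef * (x * y))" using s2 V(1) by auto
    finally have 1: "area e f * (area v f * area e v) = - (ef * (x * y))" .
    have "x > 0" "y > 0" unfolding x_def y_def using E F pos
      by (intro comb[OF _ _ V(2,3) ab] add_pos_pos mult_pos_pos; simp)+
    then show "area e f * (area v f * area e v) < 0" using efp unfolding 1 by simp }
  { assume "far v"
    then obtain \<sigma> a b where V: "\<sigma> = 1 \<or> \<sigma> = -1" "a \<ge> 0" "b \<ge> 0" "v = \<sigma> *\<^sub>R (a *\<^sub>R S - b *\<^sub>R P)"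
      unfolding far_def by blast
    have ab: "a > 0 \<or> b > 0" using V v by (cases "a = 0"; cases "b = 0") auto
    define x y where "x = (r * area S R) * a + (r * area R P + t * area S P) * b" and "y = (p * area S P + q * area S Q) * a + (q * area Q P) * b"
    have "area v f = (\<sigma> * s') * x" "area e v = - (s * \<sigma>) * y"
      unfolding V(4) E(4) F(4) x_def y_def by (simp_all add: area_def algebra_simps)
    then have "area e f * (area v f * area e v) = (s * s) * (s' * s') * (\<sigma> * \<sigma>) * (ef * (x * y))"
      unfolding ef by (simp add: algebra_simps)
    also have "\<dots> = ef * (x * y)" using s2 V(1) by auto
    finally have 1: "area e f * (area v f * area e v) = ef * (x * y)" .
    have "x > 0" "y > 0" unfolding x_def y_def using E F pos
      by (intro comb[OF _ _ V(2,3) ab] add_pos_pos mult_pos_pos; simp)+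
    then show "area e f * (area v f * area e v) > 0" using efp unfolding 1 by simp }
qed

end

text \<open>Each vector occurs twice in \<open>cyc\<close>, so its sign is free. The last three are
  oriented relative to the first, and the cyclic conditions then make the remaining areas
  positive.\<close>

lemma quad_signs:
  assumes c1: "cyc z1 z2 z3" "cyc z1 z2 z4" "cyc z1 z3 z4"
  defines "h \<equiv> hom_coord"
  obtains s2 s3 s4 where "s2 = 1 \<or> s2 = -1" "s3 = 1 \<or> s3 = -1" "s4 = 1 \<or> s4 = (-1::real)"
    "quad (h z1) (s2 *\<^sub>R h z2) (s3 *\<^sub>R h z3) (s4 *\<^sub>R h z4)"
proof -
  define A where "A u v = area (h u) (h v)" for u v
  have com: "A u v = - A v u" for u v unfolding A_def by (rule area_commute)
  have c: "A z1 z2 * A z2 z3 * A z3 z1 > 0" "A z1 z2 * A z2 z4 * A z4 z1 > 0" "A z1 z3 * A z3 z4 * A z4 z1 > 0"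
    using c1 by (auto simp: cyc_def A_def h_def)
  have nz: "A z2 z1 \<noteq> 0" "A z3 z1 \<noteq> 0" "A z4 z1 \<noteq> 0"
    using c com[of z1 z2] by auto
  define s2 s3 s4 where "s2 = sgn (A z2 z1)" and "s3 = sgn (A z3 z1)" and "s4 = sgn (A z4 z1)"
  have ss: "s2 = 1 \<or> s2 = -1" "s3 = 1 \<or> s3 = -1" "s4 = 1 \<or> s4 = -1"
    using nz by (auto simp: s2_def s3_def s4_def sgn_if)
  have p1: "s2 * A z2 z1 > 0" "s3 * A z3 z1 > 0" "s4 * A z4 z1 > 0"
    using nz by (auto simp: s2_def s3_def s4_def sgn_if)
  have tri: "s * s' * A v u > 0"
    if "A z1 u * A u v * A v z1 > 0" "s * A u z1 > 0" "s' * A v z1 > 0" for u v s s'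
  proof -
    have eq: "A z1 u * A u v * A v z1 = A u z1 * A v u * A v z1" unfolding com[of z1 u] com[of u v] by simp
    have *: "A u z1 * A v u * A v z1 > 0" using that(1) unfolding eq .
    have "(s * A u z1) * (s' * A v z1) > 0" using that(2,3) by simp
    then have "((s * A u z1) * (s' * A v z1)) * (A u z1 * A v u * A v z1) > 0" using * by simp
    then have "(s * s' * A v u) * ((A u z1)\<^sup>2 * (A v z1)\<^sup>2) > 0" by (simp add: power2_eq_square algebra_simps)
    then show ?thesis by (metis mult_nonpos_nonneg not_less zero_le_mult_iff zero_le_power2)
  qed
  have ar: "area (s *\<^sub>R h u) (s' *\<^sub>R h v) = s * s' * A u v" for s s' u v
    by (simp add: area_def A_def algebra_simps)
  have "quad (h z1) (s2 *\<^sub>R h z2) (s3 *\<^sub>R h z3) (s4 *\<^sub>R h z4)"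
  proof
    show "0 < area (s2 *\<^sub>R h z2) (h z1)" "0 < area (s3 *\<^sub>R h z3) (h z1)" "0 < area (s4 *\<^sub>R h z4) (h z1)"
      using p1 ar[of _ _ 1 z1] by simp_all
    show "0 < area (s3 *\<^sub>R h z3) (s2 *\<^sub>R h z2)" "0 < area (s4 *\<^sub>R h z4) (s2 *\<^sub>R h z2)" "0 < area (s4 *\<^sub>R h z4) (s3 *\<^sub>R h z3)"
      unfolding ar using tri[OF c(1) p1(1,2)] tri[OF c(2) p1(1,3)] tri[OF c(3) p1(2,3)] by (simp_all add: mult.commute)
  qed
  then show thesis using that ss by blast
qed

section \<open>Geodesics in the convex core\<close>

lemma hyp_convex_core_cover: "hyp_convex (core_cover \<Gamma>)"
proof -
  define F where "F = {X. hyp_convex X \<and> (\<Union>\<xi>\<in>limit_set \<Gamma>. \<Union>\<eta>\<in>limit_set \<Gamma>. geod_line \<xi> \<eta>) \<subseteq> X}"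
  have core: "core_cover \<Gamma> = \<Inter>F" by (simp add: core_cover_def hull_def F_def)
  have "geod_line \<xi> \<eta> \<subseteq> HP" for \<xi> \<eta> unfolding geod_line_def by auto
  then have "HP \<in> F" unfolding F_def hyp_convex_def by auto
  then have sub: "core_cover \<Gamma> \<subseteq> HP" unfolding core by blast
  have "geod A s \<in> X" if X: "X \<in> F" and h: "det A = 1" "r \<le> s" "s \<le> t" "geod A r \<in> core_cover \<Gamma>" "geod A t \<in> core_cover \<Gamma>"
    for A r s t X
  proof -
    have "geod A r \<in> X" "geod A t \<in> X" "hyp_convex X" using X h(4,5) unfolding core by (auto simp: F_def)
    then show ?thesis using h(1-3) unfolding hyp_convex_def by blast
  qed
  then show ?thesis unfolding hyp_convex_def using sub core by auto
qed

text \<open>The statement is the limit at the two ends. In place of limits, values u = e^(2t) are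
  chosen at which one of the two terms prevails.\<close>

lemma bside_le_0_of_geod:
  assumes B: "det B = 1" and le: "\<And>t. side A (geod B t) \<le> 0"
  shows "bside A (column 1 B) \<le> 0" "bside A (column 2 B) \<le> 0"
proof -
  define b1 b2 where "b1 = bside A (column 1 B)" and "b2 = bside A (column 2 B)"
  have E: "u * b1 + b2 \<le> 0" if u: "u > 0" for u
  proof -
    obtain r where "r > 0" "side A (geod B (ln u / 2)) = r * (exp (2 * (ln u / 2)) * b1 + b2)"
      using side_geod_pos[OF B] unfolding b1_def b2_def by metis
    then have "r * (u * b1 + b2) \<le> 0" "r > 0" using le[of "ln u / 2"] u by simp_all
    then show ?thesis by (simp add: mult_le_0_iff)
  qed
  show "bside A (column 1 B) \<le> 0"
  proof (rule ccontr)
    assume "\<not> ?thesis"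
    then have b: "b1 > 0" by (simp add: b1_def)
    have "((\<bar>b2\<bar> + 1) / b1) * b1 + b2 \<le> 0" by (rule E) (use b in \<open>simp add: add_nonneg_pos\<close>)
    then show False using b by simp
  qed
  show "bside A (column 2 B) \<le> 0"
  proof (rule ccontr)
    assume "\<not> ?thesis"
    then have b: "b2 > 0" by (simp add: b2_def)
    define u where "u = b2 / (2 * (\<bar>b1\<bar> + 1))"
    have d: "2 * (\<bar>b1\<bar> + 1) > 0" by simp
    have u: "u > 0" using b d by (simp add: u_def)
    have "u * (2 * (\<bar>b1\<bar> + 1)) = b2" using d by (simp add: u_def)
    then have "2 * (u * \<bar>b1\<bar>) + 2 * u = b2" by (simp add: algebra_simps)
    moreover have "- (u * \<bar>b1\<bar>) \<le> u * b1" using u by (simp add: abs_if)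
    moreover have "u * \<bar>b1\<bar> \<ge> 0" using u by simp
    ultimately show False using E[OF u] u by linarith
  qed
qed

lemma column_nz: "det (B :: real^2^2) = 1 \<Longrightarrow> column 1 B \<noteq> 0 \<and> column 2 B \<noteq> 0"
  using area_columns[of B] unfolding area_def by (metis diff_self mult_zero_left mult_zero_right zero_index zero_neq_one)

lemma bside_endpoints:
  assumes A: "det A = 1" and h: "area (column 2 A) hx = 0" "area (column 1 A) hy = 0" "hx \<noteq> 0" "hy \<noteq> 0"
    and xy: "x = \<sigma> *\<^sub>R hx" "y = \<tau> *\<^sub>R hy" "\<sigma> \<noteq> 0" "\<tau> \<noteq> 0" "area y x > 0"
  shows "\<exists>\<kappa> d e. \<kappa> > 0 \<and> (\<forall>v. bside A v = - \<kappa> * (area v x * area v y)) \<and>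
    column 2 A = d *\<^sub>R x \<and> column 1 A = e *\<^sub>R y \<and> d \<noteq> 0 \<and> e \<noteq> 0"
proof -
  have nz: "x \<noteq> 0" "y \<noteq> 0" using xy h by auto
  have "area (column 2 A) x = 0" "area (column 1 A) y = 0" using h unfolding xy by (auto simp: area_def algebra_simps)
  moreover have "area x x = 0" "area y y = 0" by (simp_all add: area_def)
  ultimately obtain d e where de: "column 2 A = d *\<^sub>R x" "column 1 A = e *\<^sub>R y"
    using area_0_parallel[of "column 2 A" x x] area_0_parallel[of "column 1 A" y y] nz by blast
  have "1 = d * e * area y x"
    using area_columns[of A] A unfolding de by (simp add: area_def algebra_simps)
  then have de0: "d * e > 0" using xy(5) by (metis zero_less_mult_pos2 zero_less_one)
  have "bside A v = - (d * e) * (area v x * area v y)" for v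
    unfolding bside_def de by (simp add: area_def algebra_simps)
  moreover have "d \<noteq> 0" "e \<noteq> 0" using de0 by auto
  ultimately show ?thesis using de0 de by (intro exI[of _ "d * e"] exI[of _ d] exI[of _ e]) simp
qed

lemma mult_neg_cancel_pos: "(x::real) > 0 \<Longrightarrow> x * y < 0 \<Longrightarrow> y < 0" "(y::real) > 0 \<Longrightarrow> x * y < 0 \<Longrightarrow> x < 0"
  by (auto simp: mult_less_0_iff)

context quad
begin

lemma between_disjoint:
  "area e P * area e Q < 0 \<Longrightarrow> area e R * area e S > 0"
proof -
  assume "area e P * area e Q < 0"
  then obtain s p q where E: "s = 1 \<or> s = -1" "p > 0" "q > 0" "e = s *\<^sub>R (p *\<^sub>R P + q *\<^sub>R Q)"
    using strictly_between[OF pos(1)] by blast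
  have "area e R = - s * (p * area R P + q * area R Q)" "area e S = - s * (p * area S P + q * area S Q)"
    unfolding E(4) by (simp_all add: area_def algebra_simps)
  then have "area e R * area e S = (s * s) * ((p * area R P + q * area R Q) * (p * area S P + q * area S Q))" by simp
  moreover have "p * area R P + q * area R Q > 0" "p * area S P + q * area S Q > 0"
    using E pos by (auto intro!: add_pos_pos)
  ultimately show ?thesis using E(1) by auto
qed

text \<open>A geodesic crossing both boundary geodesics has one end between \<open>P\<close> and
  \<open>Q\<close> and, as the intervals are disjoint, the other between \<open>R\<close> and
  \<open>S\<close>. The sign \<tau> records which is which.\<close>

lemma crossing_dichotomy:
  assumes A: "det A = 1"
    and b: "(area (column 1 A) P * area (column 1 A) Q) * (area (column 2 A) P * area (column 2 A) Q) < 0"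
      "(area (column 1 A) R * area (column 1 A) S) * (area (column 2 A) R * area (column 2 A) S) < 0"
  shows "\<exists>\<tau>. (\<tau> = 1 \<or> \<tau> = (-1::real)) \<and>
    (\<forall>v. v \<noteq> 0 \<longrightarrow> (near v \<longrightarrow> sgn (bside A v) = - \<tau>) \<and> (far v \<longrightarrow> sgn (bside A v) = \<tau>))"
proof -
  let ?e = "column 1 A" and ?f = "column 2 A"
  have ef: "area ?e ?f = 1" using A by (simp add: area_columns)
  then have fe: "area ?f ?e = -1" by (simp add: area_commute[of ?f ?e])
  consider "area ?e P * area ?e Q < 0" | "area ?f P * area ?f Q < 0" using b(1) mult_less_0_iff by blast
  then show ?thesis
  proof cases
    case 1
    then have "area ?e R * area ?e S > 0" by (rule between_disjoint)
    then have f: "area ?f R * area ?f S < 0" using b(2) mult_neg_cancel_pos(1) by blast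
    have "sgn (bside A v) = - 1" if "v \<noteq> 0" "near v" for v
      using crossing_sides(1)[OF 1 f that] ef by (simp add: bside_def)
    moreover have "sgn (bside A v) = 1" if "v \<noteq> 0" "far v" for v
      using crossing_sides(2)[OF 1 f that] ef by (simp add: bside_def)
    ultimately show ?thesis by (intro exI[of _ 1]) simp
  next
    case 2
    then have "area ?f R * area ?f S > 0" by (rule between_disjoint)
    then have f: "area ?e R * area ?e S < 0" using b(2) mult_neg_cancel_pos(2) by blast
    have flip: "area v ?e * area ?f v = bside A v" for v
      unfolding bside_def by (simp add: area_commute[of v ?e] area_commute[of ?f v])
    have "sgn (bside A v) = 1" if "v \<noteq> 0" "near v" for v
      using crossing_sides(1)[OF 2 f that] fe flip[of v] by simp
    moreover have "sgn (bside A v) = - 1" if "v \<noteq> 0" "far v" for v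
      using crossing_sides(2)[OF 2 f that] fe flip[of v] by simp
    ultimately show ?thesis by (intro exI[of _ "-1"]) simp
  qed
qed

end

section \<open>From thinness along K to an inequality at every lift\<close>

lemma cyc_rotate: "cyc x y z \<longleftrightarrow> cyc y z x"
  by (simp add: cyc_def mult.commute mult.left_commute)

context arc_system
begin

definition good :: "real^2 \<Rightarrow> bool" where
  "good v \<longleftrightarrow> (\<exists>B. det B = 1 \<and> range (geod B) \<subseteq> core_cover \<Gamma> \<and> (v = column 1 B \<or> v = column 2 B))"

text \<open>Thinness as seen from one lift, with \<open>v\<close>, \<open>v'\<close> on one side and
  \<open>w\<close>, \<open>w'\<close> on the other. Each vector occurs once in either product, so
  the inequality concerns boundary points only.\<close>

definition contr :: "real \<Rightarrow> real^2^2 \<Rightarrow> bool" where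
  "contr c A \<longleftrightarrow> (\<forall>v. good v \<longrightarrow> bside A v \<noteq> 0) \<and>
     (\<forall>v v' w w'. good v \<and> good v' \<and> good w \<and> good w' \<and> bside A v * bside A v' > 0 \<and>
        bside A w * bside A w' > 0 \<and> bside A v * bside A w < 0 \<longrightarrow>
        (c - 1) * \<bar>area v v' * area w w'\<bar> \<le> \<bar>area v w' * area v' w\<bar>)"

lemma good_nz: "good v \<Longrightarrow> v \<noteq> 0"
proof -
  assume "good v"
  then obtain B where "det B = 1" "v = column 1 B \<or> v = column 2 B" unfolding good_def by auto
  then show ?thesis using column_nz[of B] by auto
qed

text \<open>The invariance is read off from the tiling by translates of \<open>K\<close>.\<close>

lemma core_cover_act:
  assumes F: "fundamental_domain \<Gamma> (core_cover \<Gamma>) K" and g: "g \<in> \<Gamma>" and z: "z \<in> core_cover \<Gamma>"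
  shows "act g z \<in> core_cover \<Gamma>"
proof -
  have cov: "(\<Union>g\<in>\<Gamma>. act g ` K) = core_cover \<Gamma>" and K: "K \<subseteq> core_cover \<Gamma>"
    using F by (auto simp: fundamental_domain_def)
  obtain h k where h: "h \<in> \<Gamma>" "k \<in> K" "z = act h k" using z unfolding cov[symmetric] by blast
  have "k \<in> HP" using h K hyp_convex_core_cover[of \<Gamma>] by (auto simp: hyp_convex_def)
  then have "act g z = act (g \<otimes>\<^bsub>PSL2R\<^esub> h) k" using g h by (simp add: act_mult)
  moreover have "act (g \<otimes>\<^bsub>PSL2R\<^esub> h) k \<in> (\<Union>g\<in>\<Gamma>. act g ` K)"
    using g h by (intro UN_I[of "g \<otimes>\<^bsub>PSL2R\<^esub> h"]) auto
  ultimately show ?thesis using cov by simp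
qed

lemma good_act:
  assumes F: "fundamental_domain \<Gamma> (core_cover \<Gamma>) K" and g: "g \<in> \<Gamma>" and v: "good v"
  shows "good (rep g *v v)"
proof -
  obtain B where B: "det B = 1" "range (geod B) \<subseteq> core_cover \<Gamma>" "v = column 1 B \<or> v = column 2 B"
    using v unfolding good_def by blast
  have "geod (rep g ** B) t \<in> core_cover \<Gamma>" for t
    using core_cover_act[OF F g, of "geod B t"] B act_geod[of g B t] g by auto
  then show ?thesis unfolding good_def using B g
    by (intro exI[of _ "rep g ** B"]) (auto simp: column_mult)
qed

lemma core_domain_contraction:
  assumes cd: "core_domain \<Gamma> m a K N bm bp" and th: "thin c N bm bp" and c0: "c \<ge> 0" and i: "i < m"
  shows "\<exists>g\<in>\<Gamma>. contr c (lm (i, g))"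
proof -
  define X where "X = core_cover \<Gamma>"
  have Xc: "hyp_convex X" unfolding X_def by (rule hyp_convex_core_cover)
  obtain L where L: "\<forall>i<m. L i True \<noteq> L i False \<and>
           (\<forall>e. (\<exists>g\<in>\<Gamma>. L i e = range (lift_curve a i g)) \<and>
              (\<exists>k<N. L i e \<inter> geod_line (bm k) (bp k) \<noteq> {} \<and>
                 L i e \<inter> geod_line (bm (Suc k mod N)) (bp (Suc k mod N)) \<noteq> {}))"
    using cd unfolding core_domain_def by (elim conjE exE) blast
  obtain g where g: "g \<in> \<Gamma>" "L i True = range (lift_curve a i g)" using L i by blast
  obtain k where k: "k < N" "L i True \<inter> geod_line (bm k) (bp k) \<noteq> {}"
    "L i True \<inter> geod_line (bm (Suc k mod N)) (bp (Suc k mod N)) \<noteq> {}" using L i by blast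
  define k' where "k' = Suc k mod N"
  have k': "k' < N" using k by (simp add: k'_def)
  have gl: "geod_line (bm j) (bp j) \<in> components (HP \<inter> frontier X)" if "j < N" for j
    using cd that unfolding core_domain_def X_def by blast
  have cr: "cross_ratio (bm k') (bp k') (bm k) (bp k) > c" using th k(1) unfolding thin_def k'_def by blast
  have co: "\<And>i j l. i < j \<Longrightarrow> j < l \<Longrightarrow> l < 2 * N \<Longrightarrow> cyc (endpoint bm bp i) (endpoint bm bp j) (endpoint bm bp l)"
  proof -
    have "cyclically_ordered N bm bp" using cd by (simp add: core_domain_def)
    then show "\<And>i j l. i < j \<Longrightarrow> j < l \<Longrightarrow> l < 2 * N \<Longrightarrow> cyc (endpoint bm bp i) (endpoint bm bp j) (endpoint bm bp l)"
      unfolding cyclically_ordered_def by simp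
  qed
  have ep: "endpoint bm bp (2 * j) = bm j" "endpoint bm bp (Suc (2 * j)) = bp j" for j
    by (auto simp: endpoint_def)
  \<comment> \<open>For \<open>N = 1\<close> the two geodesics would coincide and their cross ratio
    would be 0, which does not exceed \<open>c\<close>.\<close>
  have N2: "N \<ge> 2"
  proof (rule ccontr)
    assume "\<not> N \<ge> 2"
    then have "N = 1" "k = 0" using k(1) by linarith+
    then have "k' = k" by (simp add: k'_def)
    then have "cross_ratio (bm k') (bp k') (bm k) (bp k) = 0" by (simp add: cross_ratio_def area_def)
    then show False using cr c0 by simp
  qed
  have "cyc (bm k) (bp k) (bm k') \<and> cyc (bm k) (bp k) (bp k') \<and> cyc (bm k) (bm k') (bp k')"
  proof (cases "Suc k < N")
    case True
    then have "k' = Suc k" by (simp add: k'_def)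
    then show ?thesis
      using co[of "2 * k" "Suc (2 * k)" "2 * Suc k"] co[of "2 * k" "Suc (2 * k)" "Suc (2 * Suc k)"]
        co[of "2 * k" "2 * Suc k" "Suc (2 * Suc k)"] True unfolding ep by simp
  next
    case False
    \<comment> \<open>The last geodesic is followed by the one of index 0; rotating the triples
      restores increasing indices.\<close>
    then have e: "Suc k = N" using k(1) by simp
    then have k0: "k' = 0" by (simp add: k'_def)
    have lt: "0 < 2 * k" "Suc 0 < 2 * k" "Suc (2 * k) < 2 * N" "2 * k < 2 * N" using e N2 by linarith+
    have "cyc (bm 0) (bm k) (bp k)" using co[of 0 "2 * k" "Suc (2 * k)"] lt ep(1)[of 0] ep[of k] by simp
    moreover have "cyc (bp 0) (bm k) (bp k)" using co[of "Suc 0" "2 * k" "Suc (2 * k)"] lt ep(2)[of 0] ep[of k] by simp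
    moreover have "cyc (bm 0) (bp 0) (bm k)" using co[of 0 "Suc 0" "2 * k"] lt ep[of 0] ep(1)[of k] by simp
    ultimately show ?thesis unfolding k0 using cyc_rotate by blast
  qed
  then have cy: "cyc (bm k) (bp k) (bm k')" "cyc (bm k) (bp k) (bp k')" "cyc (bm k) (bm k') (bp k')" by auto
  obtain s2 s3 s4 where s: "s2 = 1 \<or> s2 = -1" "s3 = 1 \<or> s3 = -1" "s4 = 1 \<or> s4 = (-1::real)"
    and qd: "quad (hom_coord (bm k)) (s2 *\<^sub>R hom_coord (bp k)) (s3 *\<^sub>R hom_coord (bm k')) (s4 *\<^sub>R hom_coord (bp k'))"
    using quad_signs[OF cy] by blast
  define P Q R S where "P = hom_coord (bm k)" and "Q = s2 *\<^sub>R hom_coord (bp k)"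
    and "R = s3 *\<^sub>R hom_coord (bm k')" and "S = s4 *\<^sub>R hom_coord (bp k')"
  interpret quad P Q R S using qd by (simp add: P_def Q_def R_def S_def)
  \<comment> \<open>The signs cancel in the cross ratio, and the relation between the three products
    of areas turns its lower bound \<open>c\<close> into \<open>c - 1\<close>.\<close>
  have cratio: "(c - 1) * (area S P * area R Q) \<le> area Q P * area S R"
  proof -
    have "cross_ratio (bm k') (bp k') (bm k) (bp k) = (area R P / area S P) * (area S Q / area R Q)"
      unfolding cross_ratio_def P_def Q_def R_def S_def using s by (auto simp: area_def algebra_simps divide_simps)
    then have "c < (area R P * area S Q) / (area S P * area R Q)" using cr by simp
    moreover have "area S P * area R Q > 0" using pos by simp
    ultimately have "c * (area S P * area R Q) < area R P * area S Q" by (simp only: pos_less_divide_eq)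
    moreover have "area R P * area S Q = area Q P * area S R + area S P * area R Q"
      by (simp add: area_def algebra_simps)
    ultimately show ?thesis by (simp add: algebra_simps)
  qed
  have s0: "s2 \<noteq> 0" "s3 \<noteq> 0" "s4 \<noteq> 0" using s by auto
  obtain A1 where A1: "det A1 = 1" "area (column 2 A1) (hom_coord (bm k)) = 0" "area (column 1 A1) (hom_coord (bp k)) = 0"
    "geod_line (bm k) (bp k) = range (geod A1)"
    using geod_line_matrix[OF in_components_nonempty[OF gl[OF k(1)]]] by blast
  obtain A2 where A2: "det A2 = 1" "area (column 2 A2) (hom_coord (bm k')) = 0" "area (column 1 A2) (hom_coord (bp k')) = 0"
    "geod_line (bm k') (bp k') = range (geod A2)"
    using geod_line_matrix[OF in_components_nonempty[OF gl[OF k']]] by blast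
  have fr: "range (geod A1) \<subseteq> frontier X" "range (geod A2) \<subseteq> frontier X"
    using in_components_subset[OF gl[OF k(1)]] in_components_subset[OF gl[OF k']] A1(4) A2(4) by auto
  have P1: "P = 1 *\<^sub>R hom_coord (bm k)" by (simp add: P_def)
  obtain \<kappa>1 d1 e1 where b1': "\<kappa>1 > 0 \<and> (\<forall>v. bside A1 v = - \<kappa>1 * (area v P * area v Q)) \<and>
      column 2 A1 = d1 *\<^sub>R P \<and> column 1 A1 = e1 *\<^sub>R Q \<and> d1 \<noteq> 0 \<and> e1 \<noteq> 0"
    using bside_endpoints[OF A1(1,2,3) hom_coord_nz hom_coord_nz P1 Q_def one_neq_zero s0(1) pos(1)]
    by iprover
  have b1: "\<kappa>1 > 0" "\<And>v. bside A1 v = - \<kappa>1 * (area v P * area v Q)"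
    "column 2 A1 = d1 *\<^sub>R P" "column 1 A1 = e1 *\<^sub>R Q" "d1 \<noteq> 0" "e1 \<noteq> 0"
    using b1' by simp_all
  obtain \<kappa>2 d2 e2 where b2': "\<kappa>2 > 0 \<and> (\<forall>v. bside A2 v = - \<kappa>2 * (area v R * area v S)) \<and>
      column 2 A2 = d2 *\<^sub>R R \<and> column 1 A2 = e2 *\<^sub>R S \<and> d2 \<noteq> 0 \<and> e2 \<noteq> 0"
    using bside_endpoints[OF A2(1,2,3) hom_coord_nz hom_coord_nz R_def S_def s0(2,3) pos(6)]
    by iprover
  have b2: "\<kappa>2 > 0" "\<And>v. bside A2 v = - \<kappa>2 * (area v R * area v S)"
    "column 2 A2 = d2 *\<^sub>R R" "column 1 A2 = e2 *\<^sub>R S" "d2 \<noteq> 0" "e2 \<noteq> 0"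
    using b2' by simp_all
  have neg_geod: "side A (geod B t) < 0" if B: "det B = 1" and neg: "bside A (column 1 B) < 0" "bside A (column 2 B) < 0" for A B t
  proof -
    obtain r where "r > 0" "side A (geod B t) = r * (exp (2*t) * bside A (column 1 B) + bside A (column 2 B))"
      using side_geod_pos[OF B] by metis
    moreover have "exp (2*t) * bside A (column 1 B) + bside A (column 2 B) < 0"
      using neg by (intro add_neg_neg mult_pos_neg) auto
    ultimately show ?thesis by (simp add: mult_pos_neg)
  qed
  \<comment> \<open>Each of the two boundary geodesics lies to the left of the other. This decides
    the alternative in \<open>hyp_convex_one_side\<close>: the core lies to the left of
    both.\<close>
  have A1neg: "side A1 (geod A2 t) < 0" for t
  proof (rule neg_geod[OF A2(1)])
    have "area R P * area R Q > 0" "area S P * area S Q > 0" using pos by auto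
    then have "bside A1 R < 0" "bside A1 S < 0" unfolding b1(2) using b1(1) by simp_all
    then show "bside A1 (column 1 A2) < 0" "bside A1 (column 2 A2) < 0"
      unfolding b2(3,4) bside_scaleR using b2(5,6) by (simp_all add: mult_pos_neg)
  qed
  have A2neg: "side A2 (geod A1 t) < 0" for t
  proof (rule neg_geod[OF A1(1)])
    have "area P R * area P S > 0" "area Q R * area Q S > 0"
      using pos unfolding area_commute[of P R] area_commute[of P S] area_commute[of Q R] area_commute[of Q S] by simp_all
    then have "bside A2 P < 0" "bside A2 Q < 0" unfolding b2(2) using b2(1) by simp_all
    then show "bside A2 (column 1 A1) < 0" "bside A2 (column 2 A1) < 0"
      unfolding b1(3,4) bside_scaleR using b1(5,6) by (simp_all add: mult_pos_neg)
  qed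
  have one: "\<forall>z\<in>X. side A z \<le> 0"
    if A: "det A = 1" "range (geod A) \<subseteq> frontier X" and B: "range (geod B) \<subseteq> frontier X" "side A (geod B 0) < 0" for A B
  proof (rule ccontr)
    assume "\<not> ?thesis"
    then have "\<forall>z\<in>X. side A z \<ge> 0" using hyp_convex_one_side[OF Xc A] by blast
    then have "closure X \<subseteq> {z. 0 \<le> side A z}"
      by (intro closure_minimal closed_Collect_le) (auto intro!: continuous_intros)
    moreover have "geod B 0 \<in> closure X" using B(1) by (auto simp: frontier_def)
    ultimately show False using B(2) by auto
  qed
  have X1: "\<forall>z\<in>X. side A1 z \<le> 0" and X2: "\<forall>z\<in>X. side A2 z \<le> 0"
    using one[OF A1(1) fr(1,2) A1neg] one[OF A2(1) fr(2,1) A2neg] by auto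
  have nf: "near v \<or> far v" if v: "good v" for v
  proof -
    obtain B where B: "det B = 1" "range (geod B) \<subseteq> X" "v = column 1 B \<or> v = column 2 B"
      using v unfolding good_def X_def by blast
    have "geod B t \<in> X" for t using B(2) by (simp add: range_subsetD)
    then have le: "side A1 (geod B t) \<le> 0" "side A2 (geod B t) \<le> 0" for t using X1 X2 by simp_all
    have "bside A1 v \<le> 0" "bside A2 v \<le> 0"
      using bside_le_0_of_geod[OF B(1) le(1)] bside_le_0_of_geod[OF B(1) le(2)] B(3) by auto
    then have "area v P * area v Q \<ge> 0" "area v R * area v S \<ge> 0"
      unfolding b1(2) b2(2) using b1(1) b2(1) by (auto simp: zero_le_mult_iff mult_le_0_iff)
    then show ?thesis by (rule near_or_far)
  qed
  define A where "A = lm (i, g)"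
  have il: "(i, g) \<in> lifts" using i g by (simp add: lifts_def)
  have A: "det A = 1" unfolding A_def by (rule det_lm[OF il])
  have Lr: "L i True = range (geod A)" using g(2) lift_curve_eq[OF il] by (simp add: A_def)
  obtain t where t: "geod A t \<in> range (geod A1)" using k(2) Lr A1(4) by auto
  obtain t' where t': "geod A t' \<in> range (geod A2)" using k(3) Lr A2(4) unfolding k'_def by auto
  \<comment> \<open>A lift that meets a boundary geodesic and also has a point off it crosses it, so
    its ends lie strictly on different sides.\<close>
  have opp: "bside A' (column 1 A) * bside A' (column 2 A) < 0"
    if "side A' (geod A t) = 0" "side A' (geod A t') < 0" for A' t t'
  proof -
    define \<beta>1 \<beta>2 where "\<beta>1 = bside A' (column 1 A)" and "\<beta>2 = bside A' (column 2 A)"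
    obtain r where r: "r > 0" "side A' (geod A t) = r * (exp (2*t) * \<beta>1 + \<beta>2)"
      using side_geod_pos[OF A] unfolding \<beta>1_def \<beta>2_def by metis
    obtain r' where r': "r' > 0" "side A' (geod A t') = r' * (exp (2*t') * \<beta>1 + \<beta>2)"
      using side_geod_pos[OF A] unfolding \<beta>1_def \<beta>2_def by metis
    have eq: "\<beta>2 = - (exp (2*t) * \<beta>1)" using that(1) r by simp
    have "\<beta>1 \<noteq> 0" using that(2) r' eq by auto
    then have "\<beta>1 * \<beta>1 > 0" by (auto simp: zero_less_mult_iff linorder_neq_iff)
    then have "exp (2*t) * (\<beta>1 * \<beta>1) > 0" by simp
    then show ?thesis unfolding \<beta>1_def[symmetric] \<beta>2_def[symmetric] eq by (simp add: mult.commute mult.left_commute)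
  qed
  have "bside A1 (column 1 A) * bside A1 (column 2 A) < 0"
    by (rule opp[of A1 t t']) (use t t' A1neg A1(1) in auto)
  moreover have "bside A2 (column 1 A) * bside A2 (column 2 A) < 0"
    by (rule opp[of A2 t' t]) (use t t' A2neg A2(1) in auto)
  ultimately have "(\<kappa>1 * \<kappa>1) * ((area (column 1 A) P * area (column 1 A) Q) * (area (column 2 A) P * area (column 2 A) Q)) < 0"
      "(\<kappa>2 * \<kappa>2) * ((area (column 1 A) R * area (column 1 A) S) * (area (column 2 A) R * area (column 2 A) S)) < 0"
    unfolding b1(2) b2(2) by (simp_all only: minus_mult_minus mult_minus_left mult_minus_right minus_minus mult.assoc mult.left_commute)
  note prods = this
  have bb: "(area (column 1 A) P * area (column 1 A) Q) * (area (column 2 A) P * area (column 2 A) Q) < 0"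
      "(area (column 1 A) R * area (column 1 A) S) * (area (column 2 A) R * area (column 2 A) S) < 0"
    by (rule mult_neg_cancel_pos(1)[OF _ prods(1)], use b1(1) in simp,
      rule mult_neg_cancel_pos(1)[OF _ prods(2)], use b2(1) in simp)
  obtain \<tau> where \<tau>': "(\<tau> = 1 \<or> \<tau> = (-1::real)) \<and>
      (\<forall>v. v \<noteq> 0 \<longrightarrow> (near v \<longrightarrow> sgn (bside A v) = - \<tau>) \<and> (far v \<longrightarrow> sgn (bside A v) = \<tau>))"
    using crossing_dichotomy[OF A bb] by iprover
  have \<tau>: "\<tau> = 1 \<or> \<tau> = (-1::real)" "\<And>v. v \<noteq> 0 \<Longrightarrow> near v \<Longrightarrow> sgn (bside A v) = - \<tau>"
    "\<And>v. v \<noteq> 0 \<Longrightarrow> far v \<Longrightarrow> sgn (bside A v) = \<tau>"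
    using \<tau>' by simp_all
  have sg: "near v \<and> sgn (bside A v) = - \<tau> \<or> far v \<and> sgn (bside A v) = \<tau>" if "good v" for v
    using nf[OF that] \<tau>(2,3) good_nz[OF that] by blast
  have "contr c A"
    unfolding contr_def
  proof (intro conjI allI impI)
    fix v assume "good v"
    then show "bside A v \<noteq> 0" using sg[of v] \<tau>(1) by (auto simp: sgn_0_0)
  next
    fix v v' w w'
    assume h: "good v \<and> good v' \<and> good w \<and> good w' \<and> bside A v * bside A v' > 0 \<and>
        bside A w * bside A w' > 0 \<and> bside A v * bside A w < 0"
    then have e: "sgn (bside A v) = sgn (bside A v')" "sgn (bside A w) = sgn (bside A w')" "sgn (bside A v) = - sgn (bside A w)"
      by (auto simp: sgn_if zero_less_mult_iff mult_less_0_iff)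
    show "(c - 1) * \<bar>area v v' * area w w'\<bar> \<le> \<bar>area v w' * area v' w\<bar>"
    proof (cases "sgn (bside A v) = - \<tau>")
      case True
      then have "near v" "near v'" "far w" "far w'"
        using sg[of v] sg[of v'] sg[of w] sg[of w'] h e \<tau>(1) by auto
      then show ?thesis using contraction cratio by blast
    next
      case False
      then have "far v" "far v'" "near w" "near w'"
        using sg[of v] sg[of v'] sg[of w] sg[of w'] h e \<tau>(1) by auto
      then have "(c - 1) * \<bar>area w w' * area v v'\<bar> \<le> \<bar>area w v' * area w' v\<bar>" using contraction cratio by blast
      then show ?thesis by (simp add: area_commute[of w v'] area_commute[of w' v] mult.commute)
    qed
  qed
  then show ?thesis using g(1) A_def by blast
qed

text \<open>The inequality is known at one lift of each arc; \<open>good\<close>,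
  \<open>bside\<close> and \<open>area\<close> are invariant under the group, which carries it to
  all translates.\<close>

lemma lifts_contraction:
  assumes cd: "core_domain \<Gamma> m a K N bm bp" and th: "thin c N bm bp" and c0: "c \<ge> 0" and L: "L \<in> lifts"
  shows "contr c (lm L)"
proof -
  have F: "fundamental_domain \<Gamma> (core_cover \<Gamma>) K" using cd by (simp add: core_domain_def)
  obtain i g where ig: "L = (i, g)" "i < m" "g \<in> \<Gamma>" using L by (auto simp: lifts_def)
  obtain g0 where g0: "g0 \<in> \<Gamma>" "contr c (lm (i, g0))" using core_domain_contraction[OF cd th c0 ig(2)] by blast
  define h where "h = g0 \<otimes>\<^bsub>PSL2R\<^esub> inv\<^bsub>PSL2R\<^esub> g"
  have h: "h \<in> \<Gamma>" using ig g0 by (simp add: h_def)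
  have r1: "g0 \<otimes>\<^bsub>PSL2R\<^esub> {mat 1, - mat 1} = g0" using PSL.r_one[of g0] g0 by simp
  have tr: "tr h L = (i, g0)" using ig g0 r1 by (simp add: tr_def h_def PSL.m_assoc)
  have bs: "bside (lm (i, g0)) (rep h *v v) = bside (lm L) v" for v using bside_tr[OF h L, of v] tr by simp
  have ar: "area (rep h *v v) (rep h *v w) = area v w" for v w using h by (simp add: area_mult)
  have gd: "good (rep h *v v)" if "good v" for v using good_act[OF F h that] .
  show ?thesis
    unfolding contr_def
  proof (intro conjI allI impI)
    fix v assume "good v"
    then show "bside (lm L) v \<noteq> 0" using g0(2) gd bs unfolding contr_def by metis
  next
    fix v v' w w'
    assume "good v \<and> good v' \<and> good w \<and> good w' \<and> bside (lm L) v * bside (lm L) v' > 0 \<and>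
        bside (lm L) w * bside (lm L) w' > 0 \<and> bside (lm L) v * bside (lm L) w < 0"
    then have "good (rep h *v v) \<and> good (rep h *v v') \<and> good (rep h *v w) \<and> good (rep h *v w') \<and>
        bside (lm (i, g0)) (rep h *v v) * bside (lm (i, g0)) (rep h *v v') > 0 \<and>
        bside (lm (i, g0)) (rep h *v w) * bside (lm (i, g0)) (rep h *v w') > 0 \<and>
        bside (lm (i, g0)) (rep h *v v) * bside (lm (i, g0)) (rep h *v w) < 0"
      unfolding bs using gd by simp
    then have "(c - 1) * \<bar>area (rep h *v v) (rep h *v v') * area (rep h *v w) (rep h *v w')\<bar> \<le>
        \<bar>area (rep h *v v) (rep h *v w') * area (rep h *v v') (rep h *v w)\<bar>"
      by (rule conjunct2[OF g0(2)[unfolded contr_def], rule_format])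
    then show "(c - 1) * \<bar>area v v' * area w w'\<bar> \<le> \<bar>area v w' * area v' w\<bar>" unfolding ar .
  qed
qed

text \<open>\<open>strip_data\<close> only speaks of the axis through the waist on
  \<open>a i\<close> itself, up to projection. The axis at another lift is moved back to it, and
  invariance of the core removes the projection.\<close>

lemma axes_in_core:
  assumes F: "fundamental_domain \<Gamma> (core_cover \<Gamma>) K" and sd: "strip_data \<Gamma> m a s \<theta>"
    and B: "axes s \<theta> B" and L: "L \<in> lifts"
  shows "range (geod (B L)) \<subseteq> core_cover \<Gamma>"
proof -
  obtain i g where ig: "L = (i, g)" "i < m" "g \<in> \<Gamma>" using L by (auto simp: lifts_def)
  have at: "at_angle (geod (lm L)) (s i) (\<theta> i) (B L) 0" using B L ig unfolding axes_def by fastforce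
  then have dB: "det (B L) = 1" by (simp add: at_angle_def)
  define B' where "B' = inv2 (rep g) ** B L"
  have "at_angle (geod (inv2 (rep g) ** lm L)) (s i) (\<theta> i) B' 0"
    unfolding B'_def by (rule at_angle_mult[OF _ det_lm[OF L] at]) (use ig in simp)
  moreover have "inv2 (rep g) ** lm L = a i" using ig by (simp add: lm_def)
  ultimately have "at_angle (geod (a i)) (s i) (\<theta> i) B' 0" by simp
  then have sub: "proj \<Gamma> ` range (geod B') \<subseteq> Core \<Gamma>" using sd ig unfolding strip_data_def by blast
  have dB': "det B' = 1" using dB ig by (simp add: B'_def)
  show ?thesis
  proof
    fix z assume "z \<in> range (geod (B L))"
    then obtain t where t: "z = geod (B L) t" by blast
    have "proj \<Gamma> (geod B' t) \<in> proj \<Gamma> ` core_cover \<Gamma>" using sub unfolding Core_def by blast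
    then obtain x where x: "x \<in> core_cover \<Gamma>" "proj \<Gamma> x = proj \<Gamma> (geod B' t)" by force
    then have "x \<in> HP" using hyp_convex_core_cover[of \<Gamma>] by (auto simp: hyp_convex_def)
    then obtain h where "h \<in> \<Gamma>" "geod B' t = act h x" using proj_eq_iff x(2) by blast
    then have "geod B' t \<in> core_cover \<Gamma>" using core_cover_act[OF F] x(1) by simp
    moreover have "act g (geod B' t) = z"
      using act_geod[of g B' t] ig dB' t unfolding B'_def by simp
    ultimately show "z \<in> core_cover \<Gamma>" using core_cover_act[OF F ig(3)] by metis
  qed
qed

end

section \<open>Endpoints of the axes and separating lifts\<close>

lemma geod_from_0_to_end:
  assumes B: "det B = 1" and v: "v = column 1 B \<or> v = column 2 B"
  obtains B' where "det B' = 1" "column 1 B' = v" "geod B' 0 = geod B 0"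
proof (cases "v = column 1 B")
  case True
  then show thesis using that[of B] B by simp
next
  case False
  then have v: "v = column 2 B" using v by simp
  \<comment> \<open>Fixes \<i> and reverses the imaginary axis, interchanging the columns up to
    sign.\<close>
  define J where "J = mk2 0 (-1) 1 0"
  have J: "det J = 1" by (simp add: J_def)
  have "moebius J (\<i> * of_real (exp 0)) = \<i> * of_real (exp 0)"
    by (simp add: moebius_def J_def)
  then have "geod (B ** J) 0 = geod B 0"
    unfolding geod_def using moebius_mult[OF B J iexp_in_HP, of 0] by simp
  moreover have "column 1 (B ** J) = v" by (simp add: v J_def vec2_eq_iff)
  ultimately show thesis using that[of "B ** J"] B J by simp
qed

text \<open>\<open>area u w\<close> vanishes only for parallel vectors, which lie on the same side.
  On the compact set of unit vectors not on the side of \<open>u\<close> it is therefore bounded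
  away from 0.\<close>

lemma area_bound:
  assumes u: "bside A u \<noteq> 0"
  shows "\<exists>\<kappa>\<ge>0. \<forall>w. bside A u * bside A w \<le> 0 \<longrightarrow> norm u * norm w \<le> \<kappa> * \<bar>area u w\<bar>"
proof -
  define K where "K = {w. norm w = 1 \<and> bside A u * bside A w \<le> 0}"
  have cont: "continuous_on UNIV (\<lambda>w. bside A u * bside A w)"
    unfolding bside_def area_def by (intro continuous_intros)
  have K: "compact K"
  proof -
    have "K = sphere 0 1 \<inter> {w. bside A u * bside A w \<le> 0}" by (auto simp: K_def)
    moreover have "closed {w. bside A u * bside A w \<le> 0}"
      using cont by (intro closed_Collect_le) auto
    ultimately show ?thesis by (simp add: compact_Int_closed)
  qed
  have nz: "area u w \<noteq> 0" if "w \<in> K" for w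
  proof
    assume 0: "area u w = 0"
    have "w \<noteq> 0" "u \<noteq> 0" using that u by (auto simp: K_def bside_def area_def)
    moreover have "area w u = 0" "area u u = 0" using 0 area_commute[of w u] by (simp, simp add: area_def)
    ultimately obtain d where d: "w = d *\<^sub>R u" using area_0_parallel[of w u u] by blast
    then have "d \<noteq> 0" using \<open>w \<noteq> 0\<close> by auto
    have "bside A u * bside A w = d\<^sup>2 * (bside A u)\<^sup>2" unfolding d bside_scaleR by (simp add: power2_eq_square)
    moreover have "d\<^sup>2 * (bside A u)\<^sup>2 > 0" using \<open>d \<noteq> 0\<close> u by simp
    ultimately show False using that by (simp add: K_def)
  qed
  obtain \<delta> where \<delta>: "\<delta> > 0" "\<And>w. w \<in> K \<Longrightarrow> \<delta> \<le> \<bar>area u w\<bar>"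
  proof (cases "K = {}")
    case True
    then show thesis using that[of 1] by simp
  next
    case False
    have "continuous_on K (\<lambda>w. \<bar>area u w\<bar>)" unfolding area_def by (intro continuous_intros)
    then obtain w0 where "w0 \<in> K" "\<And>w. w \<in> K \<Longrightarrow> \<bar>area u w0\<bar> \<le> \<bar>area u w\<bar>"
      using continuous_attains_inf[OF K False] by blast
    then show thesis using that[of "\<bar>area u w0\<bar>"] nz by auto
  qed
  have "norm u * norm w \<le> (norm u / \<delta>) * \<bar>area u w\<bar>" if w: "bside A u * bside A w \<le> 0" for w
  proof (cases "w = 0")
    case False
    define w0 where "w0 = (1 / norm w) *\<^sub>R w"
    have ww: "w = norm w *\<^sub>R w0" using False by (simp add: w0_def)
    have eq: "bside A u * bside A w0 = (1 / norm w)\<^sup>2 * (bside A u * bside A w)"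
      unfolding w0_def bside_scaleR by simp
    have "bside A u * bside A w0 \<le> 0" unfolding eq by (rule mult_nonneg_nonpos[OF zero_le_power2 w])
    moreover have "norm w0 = 1" using False by (simp add: w0_def)
    ultimately have "\<delta> \<le> \<bar>area u w0\<bar>" using \<delta>(2) by (simp add: K_def)
    moreover have "\<bar>area u w\<bar> = norm w * \<bar>area u w0\<bar>"
    proof -
      have "area u w = norm w * area u w0" by (subst ww) (simp add: area_def algebra_simps)
      then show ?thesis by (simp add: abs_mult)
    qed
    ultimately have "norm w * \<delta> \<le> \<bar>area u w\<bar>" by (simp add: mult_left_mono)
    then have "norm w \<le> \<bar>area u w\<bar> / \<delta>" using \<delta>(1) by (simp add: pos_le_divide_eq)
    then have "norm u * norm w \<le> norm u * (\<bar>area u w\<bar> / \<delta>)" by (rule mult_left_mono) simp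
    then show ?thesis by simp
  qed (use \<delta>(1) in simp)
  then show ?thesis using \<delta>(1) by (intro exI[of _ "norm u / \<delta>"]) auto
qed

context arc_system
begin

text \<open>The ray leaves \<open>L1\<close> to one side and stays there, while \<open>L\<close>
  lies on the other side; so the ray never meets \<open>L\<close>.\<close>

lemma ray_stays_on_side:
  assumes L: "L1 \<in> lifts" "L \<in> lifts" "L \<noteq> L1"
    and B: "det B = 1" "geod B 0 = geod (lm L1) s0"
    and nz: "bside (lm L1) (column 1 B) \<noteq> 0" "bside (lm L) (column 1 B) \<noteq> 0"
    and opp: "sgn (side (lm L1) (geod (lm L) t0)) = - sgn (bside (lm L1) (column 1 B))"
  shows "sgn (bside (lm L) (column 1 B)) = sgn (side (lm L) (geod B 0))"
proof (rule ccontr)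
  assume ne: "sgn (bside (lm L) (column 1 B)) \<noteq> sgn (side (lm L) (geod B 0))"
  define b1 b2 \<beta>1 \<beta>2 where "b1 = bside (lm L) (column 1 B)" and "b2 = bside (lm L) (column 2 B)"
    and "\<beta>1 = bside (lm L1) (column 1 B)" and "\<beta>2 = bside (lm L1) (column 2 B)"
  obtain r where r: "r > 0" "side (lm L) (geod B 0) = r * (exp (2 * 0) * b1 + b2)"
    using side_geod_pos[OF B(1)] unfolding b1_def b2_def by metis
  obtain r1 where r1: "r1 > 0" "side (lm L1) (geod B 0) = r1 * (exp (2 * 0) * \<beta>1 + \<beta>2)"
    using side_geod_pos[OF B(1)] unfolding \<beta>1_def \<beta>2_def by metis
  have "side (lm L) (geod (lm L1) s0) \<noteq> 0" using lift_same_side[OF L, of s0 s0] by auto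
  then have s0: "side (lm L) (geod B 0) \<noteq> 0" using B by simp
  have "side (lm L1) (geod B 0) = 0" using B L by simp
  then have \<beta>: "\<beta>2 = - \<beta>1" using r1 by simp
  have b1nz: "b1 \<noteq> 0" using nz by (simp add: b1_def)
  have "sgn b1 \<noteq> sgn (b1 + b2)" "b1 + b2 \<noteq> 0" using ne r s0 by (auto simp: sgn_mult b1_def)
  then have op: "b1 * (b1 + b2) < 0" using b1nz by (auto simp: sgn_if mult_less_0_iff split: if_splits)
  \<comment> \<open>The value of e^(2t) at which the geodesic would meet \<open>L\<close>; u > 1
    says that this happens on the ray.\<close>
  define u where "u = - b2 / b1"
  have u1: "u > 1"
  proof (cases "b1 > 0")
    case True
    then have "b1 + b2 < 0" using op by (simp add: mult_less_0_iff)
    then show ?thesis unfolding u_def using True by (subst pos_less_divide_eq) auto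
  next
    case False
    then have "b1 < 0" using b1nz by simp
    moreover from this have "b1 + b2 > 0" using op by (simp add: mult_less_0_iff)
    ultimately show ?thesis unfolding u_def by (subst neg_less_divide_eq) auto
  qed
  have ub: "u * b1 + b2 = 0" using b1nz by (simp add: u_def)
  define t where "t = ln u / 2"
  have et: "exp (2 * t) = u" using u1 by (simp add: t_def)
  obtain r' where r': "r' > 0" "side (lm L) (geod B t) = r' * (exp (2 * t) * b1 + b2)"
    using side_geod_pos[OF B(1)] unfolding b1_def b2_def by metis
  then have "side (lm L) (geod B t) = 0" using ub et by simp
  then obtain t' where t': "geod B t = geod (lm L) t'"
    using side_eq_0_iff[OF det_lm[OF L(2)] geod_in_HP[OF B(1)]] by blast
  obtain r'' where r'': "r'' > 0" "side (lm L1) (geod B t) = r'' * (exp (2 * t) * \<beta>1 + \<beta>2)"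
    using side_geod_pos[OF B(1)] unfolding \<beta>1_def \<beta>2_def by metis
  have "side (lm L1) (geod B t) = (r'' * (u - 1)) * \<beta>1" using r''(2) unfolding et \<beta> by (simp add: algebra_simps)
  then have "sgn (side (lm L1) (geod (lm L) t')) = sgn \<beta>1"
    unfolding t'[symmetric] using r''(1) u1 by (simp add: sgn_mult)
  moreover have "side (lm L1) (geod (lm L) t') * side (lm L1) (geod (lm L) t0) > 0"
    by (rule lift_same_side[OF L(2,1)]) (use L in simp)
  then have "sgn (side (lm L1) (geod (lm L) t')) = sgn (side (lm L1) (geod (lm L) t0))"
    by (auto simp: sgn_if zero_less_mult_iff)
  ultimately have "sgn \<beta>1 = - sgn \<beta>1" using opp by (simp add: \<beta>1_def)
  then show False using nz by (simp add: \<beta>1_def sgn_0_0)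
qed

text \<open>The end is taken on the side of \<open>y\<close> at the first lift. Every other
  separating lift lies beyond the first one, so the ray to this end does not meet it and ends on the
  side of its starting point, which is that of \<open>y\<close>.\<close>

lemma first_axis_endpoint:
  assumes y: "y \<in> Y" "y' \<in> Y" and ne: "sep y y' \<noteq> {}" and B: "axes s \<theta> B"
    and cos: "\<And>i. i < m \<Longrightarrow> cos (\<theta> i) \<noteq> 0"
    and core: "\<And>L. L \<in> lifts \<Longrightarrow> range (geod (B L)) \<subseteq> core_cover \<Gamma>"
    and con: "\<And>L. L \<in> lifts \<Longrightarrow> contr c (lm L)"
  obtains L v where "L \<in> sep y y'" "adj L (sgn (side (lm L) y)) y" "v = column 1 (B L) \<or> v = column 2 (B L)"
    "\<And>L'. L' \<in> sep y y' \<Longrightarrow> sgn (bside (lm L') v) = sgn (side (lm L') y)"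
proof -
  obtain L where L: "L \<in> sep y y'" "adj L (sgn (side (lm L) y)) y"
    "\<And>L'. L' \<in> sep y y' \<Longrightarrow> L' \<noteq> L \<Longrightarrow> \<exists>t. sgn (side (lm L) (geod (lm L') t)) = - sgn (side (lm L) y)"
    using first_crossing[OF y ne] by metis
  have Ll: "L \<in> lifts" and syL: "side (lm L) y \<noteq> 0" using L(1) by (auto simp: sep_def)
  have i: "fst L < m" using Ll by (auto simp: lifts_def)
  have at: "at_angle (geod (lm L)) (s (fst L)) (\<theta> (fst L)) (B L) 0" using B Ll by (simp add: axes_def)
  have dB: "det (B L) = 1" and g0: "geod (B L) 0 = geod (lm L) (s (fst L))" using at by (auto simp: at_angle_def)
  note bs = at_angle_bside[OF det_lm[OF Ll] at]
  have c: "sgn (cos (\<theta> (fst L))) = 1 \<or> sgn (cos (\<theta> (fst L))) = -1" using cos[OF i] by (auto simp: sgn_if)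
  have "sgn (side (lm L) y) = 1 \<or> sgn (side (lm L) y) = -1" using syL by (auto simp: sgn_if)
  then obtain v where v: "v = column 1 (B L) \<or> v = column 2 (B L)" "sgn (bside (lm L) v) = sgn (side (lm L) y)"
  proof -
    assume h: "sgn (side (lm L) y) = 1 \<or> sgn (side (lm L) y) = -1"
    show thesis
    proof (cases "sgn (cos (\<theta> (fst L))) = sgn (side (lm L) y)")
      case True
      then show thesis using that[of "column 1 (B L)"] bs(1) by simp
    next
      case False
      then have "- sgn (cos (\<theta> (fst L))) = sgn (side (lm L) y)" using c h by auto
      then show thesis using that[of "column 2 (B L)"] bs(2) by simp
    qed
  qed
  obtain B' where B': "det B' = 1" "column 1 B' = v" "geod B' 0 = geod (B L) 0"
    using geod_from_0_to_end[OF dB v(1)] by blast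
  have gv: "good v" unfolding good_def using v(1) dB core[OF Ll] by blast
  show thesis
  proof (rule that[OF L(1,2) v(1)])
    fix L' assume L': "L' \<in> sep y y'"
    show "sgn (bside (lm L') v) = sgn (side (lm L') y)"
    proof (cases "L' = L")
      case False
      have L'l: "L' \<in> lifts" using L' by (simp add: sep_def)
      obtain t where t: "sgn (side (lm L) (geod (lm L') t)) = - sgn (side (lm L) y)" using L(3)[OF L' False] by blast
      have "bside (lm L') v \<noteq> 0" using con[OF L'l] gv unfolding contr_def by blast
      moreover have "bside (lm L) v \<noteq> 0" using v(2) syL by (auto simp: sgn_if split: if_splits)
      ultimately have "sgn (bside (lm L') (column 1 B')) = sgn (side (lm L') (geod B' 0))"
        using ray_stays_on_side[OF Ll L'l False B'(1), of "s (fst L)" t] B' g0 t v(2) by simp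
      moreover have "side (lm L') y * side (lm L') (geod (lm L) (s (fst L))) > 0"
        using L(2) L'l False unfolding adj_def by blast
      ultimately show ?thesis using B' g0 by (auto simp: sgn_if zero_less_mult_iff)
    qed (use v in simp)
  qed
qed

end

section \<open>Properness\<close>

text \<open>As \<beta> = p - q with |q| at most |p| / 2, the numbers \<beta> and \<open>p\<close>
  have the same sign and comparable size; since \<open>M\<close> is odd, \<open>p ^ M\<close> keeps
  this sign.\<close>

lemma pairing_sym_mono_lower_bound:
  fixes v w x y :: "real^2"
  defines "\<beta> \<equiv> area v w * area x y"
  assumes M: "odd M" and q: "2 * 4 ^ M * \<bar>area v y * area w x\<bar> \<le> \<bar>area v x * area w y\<bar>"
  shows "(\<bar>\<beta>\<bar> / 2) ^ M / 2 \<le> sgn \<beta> * pairing (2 * M) (\<lambda>j. if j < M then v else w) (sym_mono (2 * M) x y M)"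
proof -
  define p q where "p = area v x * area w y" and "q = area v y * area w x"
  define T where "T = pairing (2 * M) (\<lambda>j. if j < M then v else w) (sym_mono (2 * M) x y M)"
  have \<beta>: "\<beta> = p - q" unfolding \<beta>_def p_def q_def by (simp add: area_def algebra_simps)
  have T: "\<bar>T - p ^ M\<bar> \<le> \<bar>p\<bar> ^ M / 2" unfolding T_def p_def by (rule pairing_sym_mono_dominant[OF assms(3)])
  have "2 * \<bar>q\<bar> \<le> 2 * 4 ^ M * \<bar>q\<bar>" using one_le_power[of "4::real" M] by (intro mult_right_mono) auto
  then have qp: "2 * \<bar>q\<bar> \<le> \<bar>p\<bar>" using assms(3) unfolding p_def q_def by linarith
  have le: "\<bar>\<beta>\<bar> / 2 \<le> \<bar>p\<bar>" using qp abs_triangle_ineq4[of p q] unfolding \<beta> by simp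
  have sg: "sgn \<beta> = sgn p" unfolding \<beta> using qp by (auto simp: sgn_if)
  have "sgn p * p ^ M = \<bar>p\<bar> ^ M"
  proof -
    have "sgn p ^ M = sgn p" using M odd_pos[OF M] by (auto simp: sgn_if)
    moreover have "(sgn p * p) ^ M = \<bar>p\<bar> ^ M" by (simp add: sgn_mult_self_eq abs_sgn mult.commute)
    ultimately show ?thesis by (simp add: power_mult_distrib)
  qed
  then have pM: "sgn \<beta> * p ^ M = \<bar>p\<bar> ^ M" using sg by simp
  have "\<bar>sgn \<beta> * (T - p ^ M)\<bar> \<le> \<bar>p\<bar> ^ M / 2"
  proof -
    have "\<bar>sgn \<beta> * (T - p ^ M)\<bar> \<le> 1 * \<bar>T - p ^ M\<bar>" unfolding abs_mult by (intro mult_right_mono) (auto simp: sgn_if)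
    then show ?thesis using T by simp
  qed
  then have "sgn \<beta> * T - sgn \<beta> * p ^ M \<ge> - (\<bar>p\<bar> ^ M / 2)" unfolding right_diff_distrib abs_le_iff by linarith
  then have "sgn \<beta> * T \<ge> \<bar>p\<bar> ^ M / 2" unfolding pM by (simp add: field_simps)
  moreover have "(\<bar>\<beta>\<bar> / 2) ^ M \<le> \<bar>p\<bar> ^ M" using le by (intro power_mono) auto
  ultimately show ?thesis unfolding T_def by simp
qed

lemma prod_norm_half: "(\<Prod>j<2 * M. norm (if j < M then v else w :: real^2)) = (norm v * norm w) ^ M"
proof -
  have "(\<Prod>j<M + M. norm (if j < M then v else w)) = norm v ^ M * norm w ^ M"
    by (subst prod_lessThan_add) simp
  then show ?thesis by (simp add: mult_2 power_mult_distrib)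
qed

context arc_system
begin

text \<open>Every summand has the sign of \<open>\<epsilon> * area v w\<close> and exceeds a bound
  independent of the lift, so nothing cancels.\<close>

lemma ssum_pairing_lower_bound:
  assumes n: "n \<ge> 1" and B: "axes s \<theta> B" and c: "c = 1 + 2 * 4 ^ (2*n - 1)"
    and \<epsilon>: "\<epsilon> = 1 \<or> \<epsilon> = (-1::real)" "\<And>i. i < m \<Longrightarrow> sgn (cos (\<theta> i)) = \<epsilon>"
    and core: "\<And>L. L \<in> lifts \<Longrightarrow> range (geod (B L)) \<subseteq> core_cover \<Gamma>"
    and con: "\<And>L. L \<in> lifts \<Longrightarrow> contr c (lm L)"
    and g: "good v" "good w"
    and v: "\<And>L. L \<in> sep x y \<Longrightarrow> sgn (bside (lm L) v) = sgn (side (lm L) x)"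
    and w: "\<And>L. L \<in> sep x y \<Longrightarrow> sgn (bside (lm L) w) = sgn (side (lm L) y)"
  shows "real (card (sep x y)) * (real (card (words (4*n - 2) (2*n - 1))) powr (-1/2) * ((\<bar>area v w\<bar> / 2) ^ (2*n - 1) / 2)) \<le>
     \<bar>pairing (4*n - 2) (\<lambda>j. if j < 2*n - 1 then v else w) (ssum n B x y)\<bar>"
proof -
  define M d where "M = 2*n - 1" and "d = 4*n - 2"
  have d: "d = 2 * M" and M: "odd M" using n by (auto simp: d_def M_def)
  define C where "C = real (card (words d M)) powr (-1/2)"
  have C: "C > 0"
  proof -
    have "real (card (words d M)) > 0" unfolding d using card_words_pos by (simp only: of_nat_0_less_iff)
    then show ?thesis unfolding C_def by (metis powr_gt_zero less_irrefl)
  qed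
  define z where "z = (\<lambda>j::nat. if j < M then v else w)"
  define \<alpha> where "\<alpha> = area v w"
  define b where "b = (\<bar>\<alpha>\<bar> / 2) ^ M / 2"
  have summand: "C * b \<le> \<epsilon> * sgn \<alpha> * (sgn (side (lm L) y) * pairing d z (nvec n (B L)))" if L: "L \<in> sep x y" for L
  proof -
    have Ll: "L \<in> lifts" and xy: "side (lm L) x * side (lm L) y < 0" using L by (auto simp: sep_def)
    have i: "fst L < m" using Ll by (auto simp: lifts_def)
    define x1 x2 where "x1 = column 1 (B L)" and "x2 = column 2 (B L)"
    have at: "at_angle (geod (lm L)) (s (fst L)) (\<theta> (fst L)) (B L) 0" using B Ll by (simp add: axes_def)
    have dB: "det (B L) = 1" using at by (simp add: at_angle_def)
    have b12: "sgn (bside (lm L) x1) = \<epsilon>" "sgn (bside (lm L) x2) = - \<epsilon>"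
      using at_angle_bside[OF det_lm[OF Ll] at] \<epsilon>(2)[OF i] by (auto simp: x1_def x2_def)
    have g12: "good x1" "good x2" unfolding good_def x1_def x2_def using dB core[OF Ll] by blast+
    have ar: "area x1 x2 = 1" using dB by (simp add: x1_def x2_def area_columns)
    define \<tau> where "\<tau> = sgn (side (lm L) y)"
    have \<tau>: "\<tau> = 1 \<or> \<tau> = -1" "sgn (side (lm L) x) = - \<tau>" using xy by (auto simp: \<tau>_def sgn_if mult_less_0_iff)
    have vw: "sgn (bside (lm L) v) = - \<tau>" "sgn (bside (lm L) w) = \<tau>" using v[OF L] w[OF L] \<tau> by (auto simp: \<tau>_def)
    have prod: "sgn a = 1 \<or> sgn a = -1 \<Longrightarrow> sgn a' = sgn a \<Longrightarrow> a * a' > 0"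
      "sgn a = 1 \<or> sgn a = -1 \<Longrightarrow> sgn a' = - sgn a \<Longrightarrow> a * a' < 0" for a a' :: real
      by (auto simp: sgn_if mult_less_0_iff zero_less_mult_iff split: if_splits)
    have cc: "(c - 1) * \<bar>area v v' * area w w'\<bar> \<le> \<bar>area v w' * area v' w\<bar>"
      if "good v'" "good w'" "sgn (bside (lm L) v') = - \<tau>" "sgn (bside (lm L) w') = \<tau>" for v' w'
    proof (rule conjunct2[OF con[OF Ll, unfolded contr_def], rule_format])
      show "good v \<and> good v' \<and> good w \<and> good w' \<and> 0 < bside (lm L) v * bside (lm L) v' \<and>
          0 < bside (lm L) w * bside (lm L) w' \<and> bside (lm L) v * bside (lm L) w < 0"
        using g that vw \<tau> by (auto intro!: prod)
    qed
    have c1: "c - 1 = 2 * 4 ^ M" by (simp add: c M_def)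
    \<comment> \<open>\<open>\<epsilon> * \<tau>\<close> is 1 if the axis runs from the side of
      \<open>v\<close> to that of \<open>w\<close>. Otherwise its ends are interchanged, which
      reverses the sign of the dominant product; the crossing sign compensates this.\<close>
    have low: "b \<le> (\<epsilon> * \<tau>) * (sgn \<alpha> * pairing (2 * M) z (sym_mono (2 * M) x1 x2 M))"
    proof (cases "\<tau> = \<epsilon>")
      case True
      have "2 * 4 ^ M * \<bar>area v x2 * area w x1\<bar> \<le> \<bar>area v x1 * area w x2\<bar>"
        using cc[OF g12(2,1)] b12 True unfolding c1 by (simp add: area_commute[of x2 w])
      from pairing_sym_mono_lower_bound[OF M this] have "b \<le> sgn \<alpha> * pairing (2 * M) z (sym_mono (2 * M) x1 x2 M)"
        unfolding ar by (simp add: b_def \<alpha>_def z_def)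
      moreover have "\<epsilon> * \<tau> = 1" using True \<epsilon>(1) by auto
      ultimately show ?thesis by simp
    next
      case False
      then have t: "\<tau> = - \<epsilon>" using \<tau>(1) \<epsilon>(1) by auto
      have "2 * 4 ^ M * \<bar>area v x1 * area w x2\<bar> \<le> \<bar>area v x2 * area w x1\<bar>"
        using cc[OF g12] b12 t unfolding c1 by (simp add: area_commute[of x1 w])
      moreover have "area x2 x1 = - 1" using ar by (simp add: area_commute[of x2 x1])
      ultimately have "b \<le> - sgn \<alpha> * pairing (2 * M) z (sym_mono (2 * M) x2 x1 M)"
        using pairing_sym_mono_lower_bound[OF M, of v x1 w x2] by (simp add: b_def \<alpha>_def z_def sgn_minus)
      moreover have "\<epsilon> * \<tau> = -1" using t \<epsilon>(1) by auto
      ultimately show ?thesis by (simp add: sym_mono_swap)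
    qed
    have "pairing d z (nvec n (B L)) = C * pairing (2 * M) z (sym_mono (2 * M) x1 x2 M)"
      unfolding nvec_def d_def[symmetric] M_def[symmetric] pairing_scale C_def[symmetric] x1_def x2_def by (simp add: d)
    then have eq: "\<epsilon> * sgn \<alpha> * (sgn (side (lm L) y) * pairing d z (nvec n (B L))) =
        C * ((\<epsilon> * \<tau>) * (sgn \<alpha> * pairing (2 * M) z (sym_mono (2 * M) x1 x2 M)))"
      by (simp add: \<tau>_def algebra_simps)
    show ?thesis unfolding eq using low C by (intro mult_left_mono) auto
  qed
  have "real (card (sep x y)) * (C * b) = (\<Sum>L\<in>sep x y. C * b)" by simp
  also have "\<dots> \<le> (\<Sum>L\<in>sep x y. \<epsilon> * sgn \<alpha> * (sgn (side (lm L) y) * pairing d z (nvec n (B L))))"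
    by (rule sum_mono) (rule summand)
  also have "\<dots> = \<epsilon> * sgn \<alpha> * pairing d z (ssum n B x y)"
    unfolding ssum_def pairing_sum by (simp add: sum_distrib_left)
  also have "\<dots> \<le> \<bar>pairing d z (ssum n B x y)\<bar>"
    using \<epsilon>(1) by (auto simp: sgn_if)
  finally show ?thesis by (simp add: C_def b_def \<alpha>_def z_def d_def M_def)
qed

text \<open>\<open>R\<close>, \<open>LS\<close> and \<kappa> are fixed before the group element.
  Upper and lower bound of the pairing then both scale with \<open>\<alpha> ^ M\<close>, and their
  quotient bounds the number of separating lifts.\<close>

lemma affine_action_proper:
  assumes n: "n \<ge> 1" and B: "axes s \<theta> B" and c: "c = 1 + 2 * 4 ^ (2*n - 1)"
    and F: "fundamental_domain \<Gamma> (core_cover \<Gamma>) K"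
    and \<epsilon>: "\<epsilon> = 1 \<or> \<epsilon> = (-1::real)" "\<And>i. i < m \<Longrightarrow> sgn (cos (\<theta> i)) = \<epsilon>"
    and core: "\<And>L. L \<in> lifts \<Longrightarrow> range (geod (B L)) \<subseteq> core_cover \<Gamma>"
    and con: "\<And>L. L \<in> lifts \<Longrightarrow> contr c (lm L)"
    and x: "x \<in> Y" and u: "\<And>g. g \<in> \<Gamma> \<Longrightarrow> u g = ssum n B x (act g x)" and C: "compact C"
  shows "finite {g \<in> \<Gamma>. affine_act n u g ` C \<inter> C \<noteq> {}}"
proof -
  define M d where "M = 2*n - 1" and "d = 4*n - 2"
  have d: "d = 2 * M" and M: "odd M" using n by (auto simp: d_def M_def)
  define C0 where "C0 = real (card (words d M)) powr (-1/2)"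
  have C0: "C0 > 0"
  proof -
    have "real (card (words d M)) > 0" unfolding d using card_words_pos by (simp only: of_nat_0_less_iff)
    then show ?thesis unfolding C0_def by (metis powr_gt_zero less_irrefl)
  qed
  have xH: "x \<in> HP" using x Y_subset by blast
  have cosnz: "cos (\<theta> i) \<noteq> 0" if "i < m" for i using \<epsilon>(2)[OF that] \<epsilon>(1) by auto
  obtain R where R: "R \<ge> 0" "\<And>T z. T \<in> C \<Longrightarrow> \<bar>pairing d z T\<bar> \<le> (\<Prod>j<d. norm (z j)) * R"
    using compact_pairing_bound[OF C, of d] by blast
  obtain LS where LS: "finite LS" "LS \<subseteq> lifts"
    "\<And>g L \<sigma>. g \<in> \<Gamma> \<Longrightarrow> L \<in> lifts \<Longrightarrow> \<sigma> = 1 \<or> \<sigma> = -1 \<Longrightarrow> adj L \<sigma> (act g x) \<Longrightarrow> L \<in> tr g ` LS"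
    using first_lift_finite[OF x] by metis
  have tr1: "tr {mat 1, - mat 1} L = L" if "L \<in> lifts" for L using that by (auto simp: tr_def lifts_def)
  have LS1: "L \<in> LS" if "L \<in> lifts" "\<sigma> = 1 \<or> \<sigma> = -1" "adj L \<sigma> x" for L \<sigma>
    using LS(3)[of "{mat 1, - mat 1}" L \<sigma>] that tr1 LS(2) by auto
  have gcol: "good (column 1 (B L)) \<and> good (column 2 (B L))" if L: "L \<in> lifts" for L
  proof -
    have "det (B L) = 1" using B L by (auto simp: axes_def at_angle_def)
    then show ?thesis unfolding good_def using core[OF L] by blast
  qed
  have "\<exists>\<kappa>\<ge>0. \<forall>v w. (v = column 1 (B L) \<or> v = column 2 (B L)) \<longrightarrow> bside (lm L) v * bside (lm L) w \<le> 0 \<longrightarrow>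
      norm v * norm w \<le> \<kappa> * \<bar>area v w\<bar>" if L: "L \<in> lifts" for L
  proof -
    have nz: "bside (lm L) (column 1 (B L)) \<noteq> 0" "bside (lm L) (column 2 (B L)) \<noteq> 0"
      using gcol[OF L] con[OF L] unfolding contr_def by blast+
    obtain \<kappa>1 where k1: "\<kappa>1 \<ge> 0" "\<And>w. bside (lm L) (column 1 (B L)) * bside (lm L) w \<le> 0 \<Longrightarrow>
        norm (column 1 (B L)) * norm w \<le> \<kappa>1 * \<bar>area (column 1 (B L)) w\<bar>" using area_bound[OF nz(1)] by blast
    obtain \<kappa>2 where k2: "\<kappa>2 \<ge> 0" "\<And>w. bside (lm L) (column 2 (B L)) * bside (lm L) w \<le> 0 \<Longrightarrow>
        norm (column 2 (B L)) * norm w \<le> \<kappa>2 * \<bar>area (column 2 (B L)) w\<bar>" using area_bound[OF nz(2)] by blast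
    have "norm v * norm w \<le> (\<kappa>1 + \<kappa>2) * \<bar>area v w\<bar>"
      if h: "v = column 1 (B L) \<or> v = column 2 (B L)" "bside (lm L) v * bside (lm L) w \<le> 0" for v w
    proof -
      have "0 \<le> \<kappa>1 * \<bar>area v w\<bar>" "0 \<le> \<kappa>2 * \<bar>area v w\<bar>" using k1 k2 by auto
      moreover have "norm v * norm w \<le> \<kappa>1 * \<bar>area v w\<bar> \<or> norm v * norm w \<le> \<kappa>2 * \<bar>area v w\<bar>"
        using h k1(2)[of w] k2(2)[of w] by auto
      ultimately show ?thesis unfolding distrib_right by linarith
    qed
    then show ?thesis using k1(1) k2(1) by (intro exI[of _ "\<kappa>1 + \<kappa>2"]) auto
  qed
  then obtain \<kappa>' where \<kappa>': "\<And>L. L \<in> lifts \<Longrightarrow> \<kappa>' L \<ge> 0"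
    "\<And>L v w. L \<in> lifts \<Longrightarrow> v = column 1 (B L) \<or> v = column 2 (B L) \<Longrightarrow> bside (lm L) v * bside (lm L) w \<le> 0 \<Longrightarrow>
      norm v * norm w \<le> \<kappa>' L * \<bar>area v w\<bar>" by metis
  \<comment> \<open>Summing over the finite set \<open>LS\<close> yields one constant for all lifts
    that can occur first or, after translation, last.\<close>
  define \<kappa> where "\<kappa> = (\<Sum>L\<in>LS. \<kappa>' L)"
  have \<kappa>: "norm v * norm w \<le> \<kappa> * \<bar>area v w\<bar>"
    if "L \<in> LS" "v = column 1 (B L) \<or> v = column 2 (B L)" "bside (lm L) v * bside (lm L) w \<le> 0" for L v w
  proof -
    have L: "L \<in> lifts" using that LS by blast
    have "\<kappa>' L \<le> \<kappa>" unfolding \<kappa>_def using that(1) LS \<kappa>'(1) by (intro member_le_sum) auto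
    then have "\<kappa>' L * \<bar>area v w\<bar> \<le> \<kappa> * \<bar>area v w\<bar>" by (intro mult_right_mono) auto
    then show ?thesis using \<kappa>'(2)[OF L that(2,3)] by linarith
  qed
  have sepsym: "sep y y' = sep y' y" for y y' by (auto simp: sep_def mult.commute)
  have main: "real (card (sep x (act g x))) \<le> 4 * R * (2 * \<kappa>) ^ M / C0"
    if g: "g \<in> \<Gamma>" and ne: "affine_act n u g ` C \<inter> C \<noteq> {}" and sne: "sep x (act g x) \<noteq> {}" for g
  proof -
    define gi where "gi = inv\<^bsub>PSL2R\<^esub> g"
    have gi: "gi \<in> \<Gamma>" using g by (simp add: gi_def)
    have Yg: "act g x \<in> Y" "act gi x \<in> Y" using act_Y g gi x by auto
    have ggx: "act g (act gi x) = x" unfolding gi_def using g xH by (simp add: act_inv)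
    have giH: "act gi x \<in> HP" using Yg Y_subset by blast
    obtain L1 v where v: "L1 \<in> sep x (act g x)" "adj L1 (sgn (side (lm L1) x)) x"
        "v = column 1 (B L1) \<or> v = column 2 (B L1)"
        "\<And>L'. L' \<in> sep x (act g x) \<Longrightarrow> sgn (bside (lm L') v) = sgn (side (lm L') x)"
      using first_axis_endpoint[OF x Yg(1) sne B cosnz core con] by metis
    \<comment> \<open>The last lift before \<open>act g x\<close> is the first one seen from there.
      Moved back by \<open>g\<close>, it is the first from \<open>x\<close> towards
      \<open>act gi x\<close>, hence in \<open>LS\<close>.\<close>
    have seq: "sep x (act g x) = tr g ` sep x (act gi x)"
      using sep_tr[OF g xH giH] ggx sepsym by metis
    then have sne': "sep x (act gi x) \<noteq> {}" using sne by auto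
    obtain L2 w' where w': "L2 \<in> sep x (act gi x)" "adj L2 (sgn (side (lm L2) x)) x"
        "w' = column 1 (B L2) \<or> w' = column 2 (B L2)"
        "\<And>L'. L' \<in> sep x (act gi x) \<Longrightarrow> sgn (bside (lm L') w') = sgn (side (lm L') x)"
      using first_axis_endpoint[OF x Yg(2) sne' B cosnz core con] by metis
    have Ll: "L1 \<in> lifts" "L2 \<in> lifts" using v(1) w'(1) by (auto simp: sep_def)
    have sg1: "sgn (side (lm L) x) = 1 \<or> sgn (side (lm L) x) = -1" if "L \<in> lifts" for L
      using x that by (auto simp: Y_def sgn_if)
    have LSm: "L1 \<in> LS" "L2 \<in> LS" using LS1[OF Ll(1) sg1 v(2)] LS1[OF Ll(2) sg1 w'(2)] Ll by auto
    define w where "w = rep g *v w'"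
    \<comment> \<open>Pairing the image of a point of \<open>C\<close> under the linear part of
      \<open>g\<close> with \<open>v\<close>, \<open>w\<close> amounts to pairing the point itself
      with \<open>v'\<close>, \<open>w'\<close>, so these need a norm bound as well.\<close>
    define v' where "v' = inv2 (rep g) *v v"
    have vv: "v = rep g *v v'" unfolding v'_def using g by simp
    have area_eq: "area v' w' = area v w" unfolding vv w_def using g by (simp add: area_mult)
    have good: "good v" "good w"
      using gcol[OF Ll(1)] v(3) gcol[OF Ll(2)] w'(3) good_act[OF F g, of w'] by (auto simp: w_def)
    have w: "sgn (bside (lm L) w) = sgn (side (lm L) (act g x))" if L: "L \<in> sep x (act g x)" for L
    proof -
      obtain L0 where L0: "L0 \<in> sep x (act gi x)" "L = tr g L0" using L seq by blast
      have L0l: "L0 \<in> lifts" using L0 by (simp add: sep_def)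
      show ?thesis using w'(4)[OF L0(1)] bside_tr[OF g L0l, of w'] sgn_side_tr[OF g L0l xH] L0(2) by (simp add: w_def)
    qed
    have opp: "sgn a = - sgn b \<Longrightarrow> a * b \<le> 0" for a b :: real
      by (auto simp: sgn_if mult_le_0_iff split: if_splits)
    have sgo: "sgn (side (lm L) (act g x)) = - sgn (side (lm L) x)" if "L \<in> sep x (act g x)" for L
      using that by (auto simp: sep_def sgn_if mult_less_0_iff)
    have n1: "norm v * norm w \<le> \<kappa> * \<bar>area v w\<bar>"
      by (rule \<kappa>[OF LSm(1) v(3)], rule opp) (use v(4)[OF v(1)] w[OF v(1)] sgo[OF v(1)] in simp)
    have n2: "norm v' * norm w' \<le> \<kappa> * \<bar>area v w\<bar>"
    proof -
      have t2: "tr g L2 \<in> sep x (act g x)" using w'(1) seq by blast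
      have "sgn (bside (lm L2) v') = sgn (bside (lm (tr g L2)) v)"
        using bside_tr[OF g Ll(2), of v'] vv by simp
      also have "\<dots> = - sgn (side (lm (tr g L2)) (act g x))" using v(4)[OF t2] sgo[OF t2] by simp
      also have "\<dots> = - sgn (side (lm L2) x)" using sgn_side_tr[OF g Ll(2) xH] by simp
      finally have "sgn (bside (lm L2) w') = - sgn (bside (lm L2) v')" using w'(4)[OF w'(1)] by simp
      then have "norm w' * norm v' \<le> \<kappa> * \<bar>area w' v'\<bar>" using \<kappa>[OF LSm(2) w'(3)] opp by blast
      then show ?thesis using area_eq by (simp add: area_commute[of w' v'] mult.commute)
    qed
    define \<alpha> where "\<alpha> = \<bar>area v w\<bar>"
    have \<alpha>: "\<alpha> > 0"
    proof -
      have "norm v * norm w > 0" using good_nz good by simp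
      then have "\<kappa> * \<bar>area v w\<bar> > 0" using n1 by linarith
      then have "area v w \<noteq> 0" by auto
      then show ?thesis by (simp add: \<alpha>_def)
    qed
    define z z' where "z = (\<lambda>j::nat. if j < M then v else w)" and "z' = (\<lambda>j::nat. if j < M then v' else w')"
    have zz: "z = (\<lambda>j. rep g *v z' j)" by (auto simp: z_def z'_def vv w_def)
    obtain p where p: "p \<in> C" "affine_act n u g p \<in> C" using ne by auto
    have "pairing d z (affine_act n u g p) = pairing d z (sigma_mat d (rep g) p) + pairing d z (u g)"
      unfolding affine_act_def sigma_def d_def[symmetric] pairing_add by simp
    moreover have "pairing d z (sigma_mat d (rep g) p) = pairing d z' p"
      unfolding zz using g by (intro pairing_sigma_mat) simp
    ultimately have "\<bar>pairing d z (u g)\<bar> \<le> \<bar>pairing d z (affine_act n u g p)\<bar> + \<bar>pairing d z' p\<bar>" by linarith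
    also have "\<dots> \<le> (norm v * norm w) ^ M * R + (norm v' * norm w') ^ M * R"
      using R(2)[OF p(2), of z] R(2)[OF p(1), of z'] unfolding z_def z'_def d prod_norm_half by linarith
    also have "\<dots> \<le> (\<kappa> * \<alpha>) ^ M * R + (\<kappa> * \<alpha>) ^ M * R"
      using n1 n2 R(1) unfolding \<alpha>_def by (intro add_mono mult_right_mono power_mono) auto
    finally have up: "\<bar>pairing d z (u g)\<bar> \<le> 2 * R * (\<kappa> * \<alpha>) ^ M" by simp
    have "real (card (sep x (act g x))) * (C0 * ((\<alpha> / 2) ^ M / 2)) \<le> \<bar>pairing d z (u g)\<bar>"
      using ssum_pairing_lower_bound[OF n B c \<epsilon> core con good v(4) w] u[OF g]
      by (simp add: C0_def \<alpha>_def z_def d_def M_def)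
    then have le: "real (card (sep x (act g x))) * (C0 * ((\<alpha> / 2) ^ M / 2)) \<le> 2 * R * (\<kappa> * \<alpha>) ^ M" using up by linarith
    \<comment> \<open>Written so that the power of \<alpha>, the only factor depending on
      \<open>g\<close>, cancels.\<close>
    have eq: "2 * R * (\<kappa> * \<alpha>) ^ M = (4 * R * (2 * \<kappa>) ^ M / C0) * (C0 * ((\<alpha> / 2) ^ M / 2))"
    proof -
      have "(2 * \<kappa>) ^ M * (\<alpha> / 2) ^ M = (2 * \<kappa> * (\<alpha> / 2)) ^ M" by (simp only: power_mult_distrib)
      also have "2 * \<kappa> * (\<alpha> / 2) = \<kappa> * \<alpha>" by simp
      finally have "(\<kappa> * \<alpha>) ^ M = (2 * \<kappa>) ^ M * (\<alpha> / 2) ^ M" by simp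
      then show ?thesis using C0 by simp
    qed
    have "C0 * ((\<alpha> / 2) ^ M / 2) > 0" using C0 \<alpha> by simp
    then show ?thesis using le unfolding eq by (simp only: mult_le_cancel_right_pos)
  qed
  define r where "r = nat \<lceil>4 * R * (2 * \<kappa>) ^ M / C0\<rceil>"
  have "{g \<in> \<Gamma>. affine_act n u g ` C \<inter> C \<noteq> {}} \<subseteq> {g \<in> \<Gamma>. card (sep x (act g x)) \<le> r}"
  proof
    fix g assume g: "g \<in> {g \<in> \<Gamma>. affine_act n u g ` C \<inter> C \<noteq> {}}"
    show "g \<in> {g \<in> \<Gamma>. card (sep x (act g x)) \<le> r}"
    proof (cases "sep x (act g x) = {}")
      case False
      then have "real (card (sep x (act g x))) \<le> 4 * R * (2 * \<kappa>) ^ M / C0" using main g by blast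
      then have "card (sep x (act g x)) \<le> r" unfolding r_def by linarith
      then show ?thesis using g by simp
    qed (use g in simp)
  qed
  then show ?thesis using finite_sep_bounded[OF x, of r] finite_subset by blast
qed

lemma higher_strip_deformation_proper:
  assumes n: "n \<ge> 1" and cd: "core_domain \<Gamma> m a K N bm bp" and th: "thin (1 + 2 * 4 ^ (2*n - 1)) N bm bp"
    and sd: "strip_data \<Gamma> m a s \<theta>" and co: "coherent_angles m \<theta>"
    and hs: "higher_strip_deformation n \<Gamma> m a s \<theta> u"
  shows "proper_affine_deformation n \<Gamma> u"
proof -
  define c :: real where "c = 1 + 2 * 4 ^ (2*n - 1)"
  have c0: "c \<ge> 0" by (simp add: c_def)
  have F: "fundamental_domain \<Gamma> (core_cover \<Gamma>) K" using cd by (simp add: core_domain_def)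
  obtain B where B: "axes s \<theta> B" using axes_exist by blast
  obtain x p where x: "x \<in> HP - all_lifts \<Gamma> m a" and p: "\<forall>g\<in>\<Gamma>. transverse_path \<Gamma> m a x (act g x) (p g) \<and>
      u g = strip_sum n \<Gamma> m a s \<theta> (p g)"
    using hs unfolding higher_strip_deformation_def by blast
  have xY: "x \<in> Y" using x Y_eq by simp
  have u: "u g = ssum n B x (act g x)" if g: "g \<in> \<Gamma>" for g
    using strip_sum_eq[OF n B _ xY act_Y[OF g xY]] p g by metis
  obtain \<epsilon> where \<epsilon>: "\<epsilon> = 1 \<or> \<epsilon> = (-1::real)" "\<And>i. i < m \<Longrightarrow> sgn (cos (\<theta> i)) = \<epsilon>"
  proof (cases "\<forall>i<m. cos (\<theta> i) > 0")
    case True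
    then show thesis using that[of 1] by simp
  next
    case False
    then have "\<forall>i<m. cos (\<theta> i) < 0" using co by (auto simp: coherent_angles_def)
    then show thesis using that[of "-1"] by simp
  qed
  have core: "range (geod (B L)) \<subseteq> core_cover \<Gamma>" if "L \<in> lifts" for L by (rule axes_in_core[OF F sd B that])
  have con: "contr c (lm L)" if "L \<in> lifts" for L
    using lifts_contraction[OF cd _ c0 that] th by (simp add: c_def)
  show ?thesis
    unfolding proper_affine_deformation_def
  proof (intro conjI ballI allI impI)
    show "u g \<in> sym_tensors (4*n - 2)" if "g \<in> \<Gamma>" for g using u[OF that] ssum_sym by simp
    show "u (g \<otimes>\<^bsub>PSL2R\<^esub> h) = affine_act n u g (u h)" if g: "g \<in> \<Gamma>" "h \<in> \<Gamma>" for g h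
      using ssum_cocycle[OF n B xY g] u[OF g(1)] u[OF g(2)] u[OF \<Gamma>_closed(1)[OF g]]
      unfolding affine_act_def by simp
    show "finite {g \<in> \<Gamma>. affine_act n u g ` C \<inter> C \<noteq> {}}"
      if "compact C \<and> C \<subseteq> sym_tensors (4*n - 2)" for C
      using affine_action_proper[OF n B c_def F \<epsilon> core con xY u] that by blast
  qed
qed

end

theorem proposition4p6:
  fixes n :: nat
  assumes "n \<ge> 1"
  shows "\<exists>c_n :: real. \<forall>(\<Gamma> :: psl set) (m :: nat) (a :: nat \<Rightarrow> real^2^2) (K :: complex set)
      (N :: nat) (bm :: nat \<Rightarrow> rp1) (bp :: nat \<Rightarrow> rp1) (s :: nat \<Rightarrow> real) (\<theta> :: nat \<Rightarrow> real).
    discrete_subgroup \<Gamma> \<and> fg_free \<Gamma> \<and> \<not> compact_space (surface \<Gamma>) \<and> convex_cocompact \<Gamma> \<and>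
    cutting_arcs \<Gamma> m a \<and> core_domain \<Gamma> m a K N bm bp \<and>
    strip_data \<Gamma> m a s \<theta> \<and> coherent_angles m \<theta> \<and>
    thin c_n N bm bp \<longrightarrow>
    (\<forall>u. higher_strip_deformation n \<Gamma> m a s \<theta> u \<longrightarrow> proper_affine_deformation n \<Gamma> u)"
proof (intro exI[of _ "1 + 2 * 4 ^ (2*n - 1)"] allI impI)
  fix \<Gamma> :: "psl set" and m N :: nat and a :: "nat \<Rightarrow> real^2^2" and K :: "complex set"
    and bm bp :: "nat \<Rightarrow> rp1" and s \<theta> :: "nat \<Rightarrow> real" and u :: "psl \<Rightarrow> tensor"
  assume h: "discrete_subgroup \<Gamma> \<and> fg_free \<Gamma> \<and> \<not> compact_space (surface \<Gamma>) \<and> convex_cocompact \<Gamma> \<and>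
    cutting_arcs \<Gamma> m a \<and> core_domain \<Gamma> m a K N bm bp \<and>
    strip_data \<Gamma> m a s \<theta> \<and> coherent_angles m \<theta> \<and> thin (1 + 2 * 4 ^ (2*n - 1)) N bm bp"
    and u: "higher_strip_deformation n \<Gamma> m a s \<theta> u"
  interpret arc_system \<Gamma> m a using h by unfold_locales auto
  show "proper_affine_deformation n \<Gamma> u"
    using higher_strip_deformation_proper[OF assms] h u by blast
qed

end
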